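(* Let $Y\subset\mathrm{Gr}(2,5)$ be the quintic del Pezzo fourfold, i.e. the linear section of $\mathrm{Gr}(2,5)\subset\mathbb{P}^9$ by $p_{12}-p_{03}=p_{13}-p_{24}=0$. Let $\mathbf{H}_2(Y)$ be the Hilbert scheme of conics in $Y$ and let $\mathbf{D}(Y)$ be the locus of double lines in $\mathbf{H}_2(Y)$. Then $\mathbf{D}(Y)$ is a $4$-dimensional smooth subvariety of $\mathbf{H}_2(Y)$.
   Context: Work over $\mathbb{C}$. $\mathrm{Gr}(2,5)$ is the Grassmannian of $2$-dimensional subspaces of $V_5=\mathbb{C}^5$ with standard basis $e_0,\dots,e_4$, embedded in $\mathbb{P}(\wedge^2V_5)=\mathbb{P}^9$ by the Plücker embedding with Plücker coordinates $p_{ij}$, $0\le i<j\le 4$. The quintic del Pezzo fourfold is $Y=\mathrm{Gr}(2,5)\cap\{p_{12}-p_{03}=p_{13}-p_{24}=0\}$, with polarization $\mathcal{O}_Y(1)$ restricted from $\mathbb{P}^9$. For $d\ge 1$, $\mathbf{H}_d(Y)$ denotes the Hilbert scheme of curves $C\subset Y$ with Hilbert polynomial $\chi(\mathcal{O}_C(m))=dm+1$; thus $\mathbf{H}_2(Y)$ is the Hilbert scheme of conics in $Y$. A double line $L^2$ in $Y$ supported on a line $L\subset Y$ is given by a sheaf $F\cong\mathcal{O}_{L^2}$ which is a non-split extension $0\to\mathcal{O}_L(-1)\to F\to\mathcal{O}_L\to 0$ on $Y$. *)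

theory Defs
  imports
    "HOL-Analysis.Analysis"
    "HOL-Library.Poly_Mapping"
    "HOL-Library.Function_Algebras"
begin

text \<open>
  Projective algebraic geometry over the complex numbers, in classical language:
  closed subschemes of a projective space are saturated homogeneous ideals, coherent sheaves are
  graded modules up to truncation (Serre), and the Hilbert scheme carries the structure obtained
  from Grothendieck's embedding into a Grassmannian.  Only its closed points, Zariski topology and
  coordinate functions are needed, because a subvariety carries the reduced structure.
\<close>

section \<open>Polynomials\<close>

type_synonym 'v mpoly = "('v \<Rightarrow>\<^sub>0 nat) \<Rightarrow>\<^sub>0 complex"

definition Var :: "'v \<Rightarrow> 'v mpoly" where
  "Var i = Poly_Mapping.single (Poly_Mapping.single i 1) 1"

definition eval_monomial :: "('v \<Rightarrow>\<^sub>0 nat) \<Rightarrow> ('v \<Rightarrow> complex) \<Rightarrow> complex" where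
  "eval_monomial \<mu> x = (\<Prod>i\<in>Poly_Mapping.keys \<mu>. x i ^ Poly_Mapping.lookup \<mu> i)"

definition eval_poly :: "'v mpoly \<Rightarrow> ('v \<Rightarrow> complex) \<Rightarrow> complex" where
  "eval_poly f x = (\<Sum>\<mu>\<in>Poly_Mapping.keys f. Poly_Mapping.lookup f \<mu> * eval_monomial \<mu> x)"

definition vanishing_ideal :: "('v \<Rightarrow> complex) set \<Rightarrow> 'v mpoly set" where
  "vanishing_ideal X = {f. \<forall>x\<in>X. eval_poly f x = 0}"

definition mdeg :: "('v \<Rightarrow>\<^sub>0 nat) \<Rightarrow> nat" where
  "mdeg \<mu> = (\<Sum>i\<in>Poly_Mapping.keys \<mu>. Poly_Mapping.lookup \<mu> i)"

definition monomials :: "nat \<Rightarrow> ('v \<Rightarrow>\<^sub>0 nat) set" where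
  "monomials m = {\<mu>. mdeg \<mu> = m}"

definition forms :: "nat \<Rightarrow> 'v mpoly set" where
  "forms m = {f. Poly_Mapping.keys f \<subseteq> monomials m}"

definition hom_component :: "nat \<Rightarrow> 'v mpoly \<Rightarrow> 'v mpoly" where
  "hom_component m f =
     (\<Sum>\<mu>\<in>Poly_Mapping.keys f \<inter> monomials m. Poly_Mapping.single \<mu> (Poly_Mapping.lookup f \<mu>))"

definition poly_scale :: "complex \<Rightarrow> 'v mpoly \<Rightarrow> 'v mpoly" where
  "poly_scale c f = Poly_Mapping.single 0 c * f"

definition fun_scale :: "complex \<Rightarrow> ('i \<Rightarrow> complex) \<Rightarrow> 'i \<Rightarrow> complex" where
  "fun_scale c v = (\<lambda>i. c * v i)"

interpretation mpoly_vs: vector_space "poly_scale :: complex \<Rightarrow> 'v mpoly \<Rightarrow> 'v mpoly"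
proof -
  have one: "Poly_Mapping.single (0 :: 'v \<Rightarrow>\<^sub>0 nat) (1 :: complex) = 1"
    by simp
  show "vector_space (poly_scale :: complex \<Rightarrow> 'v mpoly \<Rightarrow> 'v mpoly)"
    by unfold_locales
      (simp_all add: poly_scale_def distrib_left distrib_right single_add mult_single one
        flip: mult.assoc)
qed

interpretation fun_vs: vector_space "fun_scale :: complex \<Rightarrow> ('i \<Rightarrow> complex) \<Rightarrow> 'i \<Rightarrow> complex"
  by unfold_locales (simp_all add: fun_scale_def fun_eq_iff algebra_simps)

text \<open>Ideals are the submodules of the ring over itself.\<close>

interpretation mpoly_ideal: module "(*) :: 'v mpoly \<Rightarrow> 'v mpoly \<Rightarrow> 'v mpoly"
  by unfold_locales (simp_all add: algebra_simps)

lemma eval_poly_superset: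
  assumes "finite A" "Poly_Mapping.keys f \<subseteq> A"
  shows "eval_poly f x = (\<Sum>\<mu>\<in>A. Poly_Mapping.lookup f \<mu> * eval_monomial \<mu> x)"
  unfolding eval_poly_def
  using assms by (intro sum.mono_neutral_left) (auto simp: in_keys_iff)

lemma eval_poly_add: "eval_poly (f + g) x = eval_poly f x + eval_poly g x"
proof -
  let ?A = "Poly_Mapping.keys f \<union> Poly_Mapping.keys g"
  have "Poly_Mapping.keys (f + g) \<subseteq> ?A"
    by (rule Poly_Mapping.keys_add)
  then show ?thesis
    by (simp add: eval_poly_superset[of ?A] lookup_add algebra_simps sum.distrib)
qed

lemma eval_poly_zero [simp]: "eval_poly 0 x = 0"
  by (simp add: eval_poly_def)

lemma eval_poly_sum: "eval_poly (\<Sum>i\<in>A. f i) x = (\<Sum>i\<in>A. eval_poly (f i) x)"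
  by (induction A rule: infinite_finite_induct) (simp_all add: eval_poly_add)

lemma eval_poly_single: "eval_poly (Poly_Mapping.single \<mu> c) x = c * eval_monomial \<mu> x"
  by (cases "c = 0") (simp_all add: eval_poly_def)

lemma eval_monomial_superset:
  assumes "finite A" "Poly_Mapping.keys \<mu> \<subseteq> A"
  shows "eval_monomial \<mu> x = (\<Prod>i\<in>A. x i ^ Poly_Mapping.lookup \<mu> i)"
  unfolding eval_monomial_def
  using assms by (intro prod.mono_neutral_left) (auto simp: in_keys_iff)

lemma eval_monomial_add: "eval_monomial (\<mu> + \<nu>) x = eval_monomial \<mu> x * eval_monomial \<nu> x"
proof -
  let ?A = "Poly_Mapping.keys \<mu> \<union> Poly_Mapping.keys \<nu>"
  have "Poly_Mapping.keys (\<mu> + \<nu>) \<subseteq> ?A"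
    by (rule Poly_Mapping.keys_add)
  then show ?thesis
    by (simp add: eval_monomial_superset[of ?A] lookup_add power_add prod.distrib)
qed

lemma mpoly_sum_single:
  "f = (\<Sum>\<mu>\<in>Poly_Mapping.keys f. Poly_Mapping.single \<mu> (Poly_Mapping.lookup f \<mu>))"
  by (rule poly_mapping_eqI)
    (auto simp: lookup_sum lookup_single when_def in_keys_iff sum.delta)

lemma eval_poly_mult: "eval_poly (f * g) x = eval_poly f x * eval_poly g x"
proof -
  have *: "f * g = (\<Sum>\<mu>\<in>Poly_Mapping.keys f. \<Sum>\<nu>\<in>Poly_Mapping.keys g.
      Poly_Mapping.single (\<mu> + \<nu>) (Poly_Mapping.lookup f \<mu> * Poly_Mapping.lookup g \<nu>))"
    by (subst mpoly_sum_single[of f], subst mpoly_sum_single[of g])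
      (simp add: sum_product mult_single)
  show ?thesis
    unfolding * eval_poly_sum eval_poly_single eval_monomial_add
    by (simp add: eval_poly_def sum_product mult_ac)
qed

section \<open>Closed subschemes of projective space\<close>

definition homogeneous_ideal :: "'v mpoly set \<Rightarrow> bool" where
  "homogeneous_ideal I \<longleftrightarrow> mpoly_ideal.subspace I \<and> (\<forall>f\<in>I. \<forall>m. hom_component m f \<in> I)"

definition saturated :: "'v mpoly set \<Rightarrow> bool" where
  "saturated I \<longleftrightarrow> (\<forall>f. (\<exists>n. \<forall>g\<in>forms n. g * f \<in> I) \<longrightarrow> f \<in> I)"

definition hilbert_function :: "'v mpoly set \<Rightarrow> nat \<Rightarrow> nat" where
  "hilbert_function I m = mpoly_vs.dim (forms m :: 'v mpoly set) - mpoly_vs.dim (I \<inter> forms m)"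

text \<open>
  \<open>Hilb J d\<close> is the set of closed points of the Hilbert scheme of curves with Hilbert polynomial
  \<open>d m + 1\<close> in the closed subscheme cut out by the homogeneous ideal \<open>J\<close>.  The Euler
  characteristic of the \<open>m\<close>-th twist is a polynomial in \<open>m\<close> which agrees with the Hilbert function
  of the saturated ideal for all large \<open>m\<close>.
\<close>

definition Hilb :: "'v mpoly set \<Rightarrow> nat \<Rightarrow> 'v mpoly set set" where
  "Hilb J d = {I. homogeneous_ideal I \<and> saturated I \<and> J \<subseteq> I \<and>
     (\<forall>\<^sub>F m in sequentially. hilbert_function I m = d * m + 1)}"

section \<open>Sheaf homomorphisms and double lines\<close>

text \<open>
  \<open>sheaf_hom n k I J \<phi>\<close>: writing \<open>A\<close> and \<open>B\<close> for the subschemes defined by \<open>I\<close> and \<open>J\<close>, the map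
  \<open>\<phi>\<close> on representatives induces a graded homomorphism \<open>(S/I)(-k) \<rightarrow> S/J\<close> of graded modules
  truncated to source degrees at least \<open>n\<close>; that is, a homomorphism from the structure sheaf of \<open>A\<close>
  twisted by \<open>-k\<close> to the structure sheaf of \<open>B\<close>.  Every homomorphism of these coherent sheaves
  arises in this way for some \<open>n\<close>, and exactness and splitting are to be tested in all large degrees.
\<close>

definition sheaf_hom ::
  "nat \<Rightarrow> nat \<Rightarrow> 'v mpoly set \<Rightarrow> 'v mpoly set \<Rightarrow> ('v mpoly \<Rightarrow> 'v mpoly) \<Rightarrow> bool" where
  "sheaf_hom n k I J \<phi> \<longleftrightarrow> (\<forall>l\<ge>n.
     (\<forall>f\<in>forms l. \<phi> f \<in> forms (l + k)) \<and>
     (\<forall>f\<in>forms l \<inter> I. \<phi> f \<in> J) \<and>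
     (\<forall>f\<in>forms l. \<forall>g\<in>forms l. \<phi> (f + g) - (\<phi> f + \<phi> g) \<in> J) \<and>
     (\<forall>f\<in>forms l. \<forall>j. \<forall>h\<in>forms j. \<phi> (h * f) - h * \<phi> f \<in> J))"

text \<open>
  For a line with ideal \<open>L\<close> and a curve with ideal \<open>C\<close>: \<open>(\<alpha>, \<beta>)\<close> is a short exact sequence with sub
  the structure sheaf of the line twisted by \<open>-1\<close>, quotient the structure sheaf of the line, and
  the structure sheaf of the curve in the middle.
\<close>

definition line_extension ::
  "'v mpoly set \<Rightarrow> 'v mpoly set \<Rightarrow> ('v mpoly \<Rightarrow> 'v mpoly) \<Rightarrow> ('v mpoly \<Rightarrow> 'v mpoly) \<Rightarrow> bool" where
  "line_extension L C \<alpha> \<beta> \<longleftrightarrow> (\<exists>n. sheaf_hom n 1 L C \<alpha> \<and> sheaf_hom n 0 C L \<beta> \<and>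
     (\<forall>l\<ge>n.
        (\<forall>f\<in>forms l. \<alpha> f \<in> C \<longrightarrow> f \<in> L) \<and>
        (\<forall>f\<in>forms (l + 1). \<beta> f \<in> L \<longleftrightarrow> (\<exists>g\<in>forms l. f - \<alpha> g \<in> C)) \<and>
        (\<forall>g\<in>forms l. \<exists>f\<in>forms l. \<beta> f - g \<in> L)))"

definition line_extension_splits ::
  "'v mpoly set \<Rightarrow> 'v mpoly set \<Rightarrow> ('v mpoly \<Rightarrow> 'v mpoly) \<Rightarrow> bool" where
  "line_extension_splits L C \<beta> \<longleftrightarrow>
     (\<exists>n \<sigma>. sheaf_hom n 0 L C \<sigma> \<and> (\<forall>l\<ge>n. \<forall>f\<in>forms l. \<beta> (\<sigma> f) - f \<in> L))"

definition double_lines :: "'v mpoly set \<Rightarrow> 'v mpoly set set" where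
  "double_lines J = {C \<in> Hilb J 2. \<exists>L\<in>Hilb J 1. \<exists>\<alpha> \<beta>.
     line_extension L C \<alpha> \<beta> \<and> \<not> line_extension_splits L C \<beta>}"

section \<open>The variety structure of the Hilbert scheme\<close>

text \<open>
  For large \<open>m\<close> the Hilbert scheme is embedded into a Grassmannian by sending \<open>I\<close> to its part of
  degree \<open>m\<close>.  The Grassmannian is covered by affine charts, one for each set \<open>B\<close> of monomials of
  degree \<open>m\<close>, consisting of those subspaces for which \<open>B\<close> is a basis of the quotient; the
  coordinates are the entries of the matrix expressing all monomials of degree \<open>m\<close> in this basis.
\<close>

definition expands ::
  "('v \<Rightarrow>\<^sub>0 nat) set \<Rightarrow> 'v mpoly set \<Rightarrow> ('v \<Rightarrow>\<^sub>0 nat) \<Rightarrow> (('v \<Rightarrow>\<^sub>0 nat) \<Rightarrow> complex) \<Rightarrow> bool" where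
  "expands B I \<mu> c \<longleftrightarrow> (\<forall>b. b \<notin> B \<longrightarrow> c b = 0) \<and>
     Poly_Mapping.single \<mu> 1 - (\<Sum>b\<in>B. Poly_Mapping.single b (c b)) \<in> I"

definition chart :: "nat \<Rightarrow> ('v \<Rightarrow>\<^sub>0 nat) set \<Rightarrow> 'v mpoly set set" where
  "chart m B = {I. \<forall>\<mu>\<in>monomials m. \<exists>!c. expands B I \<mu> c}"

definition chart_coord ::
  "nat \<Rightarrow> ('v \<Rightarrow>\<^sub>0 nat) set \<Rightarrow> 'v mpoly set \<Rightarrow> ('v \<Rightarrow>\<^sub>0 nat) \<times> ('v \<Rightarrow>\<^sub>0 nat) \<Rightarrow> complex" where
  "chart_coord m B I = (\<lambda>(\<mu>, b). if \<mu> \<in> monomials m then (THE c. expands B I \<mu> c) b else 0)"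

text \<open>
  The Zariski topology on a set \<open>H\<close> of ideals: in each chart, open sets are the complements of zero
  sets of families of polynomials in the coordinates.
\<close>

definition zariski_open :: "nat \<Rightarrow> 'v mpoly set set \<Rightarrow> 'v mpoly set set \<Rightarrow> bool" where
  "zariski_open m H U \<longleftrightarrow> U \<subseteq> H \<and> (\<forall>B\<subseteq>monomials m. \<exists>F. \<forall>I\<in>H \<inter> chart m B.
     I \<in> U \<longleftrightarrow> (\<exists>f\<in>F. eval_poly f (chart_coord m B I) \<noteq> 0))"

definition zariski_topology :: "nat \<Rightarrow> 'v mpoly set set \<Rightarrow> 'v mpoly set topology" where
  "zariski_topology m H = topology (zariski_open m H)"

lemma istopology_zariski_open: "istopology (zariski_open m H)"
  unfolding istopology_def
proof (intro conjI allI impI)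
  fix U V assume U: "zariski_open m H U" and V: "zariski_open m H V"
  show "zariski_open m H (U \<inter> V)"
    unfolding zariski_open_def
  proof (intro conjI allI impI)
    show "U \<inter> V \<subseteq> H" using U by (auto simp: zariski_open_def)
    fix B :: "('a \<Rightarrow>\<^sub>0 nat) set" assume B: "B \<subseteq> monomials m"
    obtain F where F: "\<forall>I\<in>H \<inter> chart m B.
        I \<in> U \<longleftrightarrow> (\<exists>f\<in>F. eval_poly f (chart_coord m B I) \<noteq> 0)"
      using U B unfolding zariski_open_def by meson
    obtain G where G: "\<forall>I\<in>H \<inter> chart m B.
        I \<in> V \<longleftrightarrow> (\<exists>f\<in>G. eval_poly f (chart_coord m B I) \<noteq> 0)"
      using V B unfolding zariski_open_def by meson
    show "\<exists>K. \<forall>I\<in>H \<inter> chart m B.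
        I \<in> U \<inter> V \<longleftrightarrow> (\<exists>f\<in>K. eval_poly f (chart_coord m B I) \<noteq> 0)"
      by (rule exI[of _ "{f * g |f g. f \<in> F \<and> g \<in> G}"])
        (use F G in \<open>fastforce simp: eval_poly_mult\<close>)
  qed
next
  fix \<U> assume \<U>: "\<forall>U\<in>\<U>. zariski_open m H U"
  show "zariski_open m H (\<Union>\<U>)"
    unfolding zariski_open_def
  proof (intro conjI allI impI)
    show "\<Union>\<U> \<subseteq> H" using \<U> by (auto simp: zariski_open_def)
    fix B :: "('a \<Rightarrow>\<^sub>0 nat) set" assume B: "B \<subseteq> monomials m"
    have "\<forall>U\<in>\<U>. \<exists>F. \<forall>I\<in>H \<inter> chart m B.
        I \<in> U \<longleftrightarrow> (\<exists>f\<in>F. eval_poly f (chart_coord m B I) \<noteq> 0)"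
      using \<U> B unfolding zariski_open_def by meson
    then obtain F where F: "\<forall>U\<in>\<U>. \<forall>I\<in>H \<inter> chart m B.
        I \<in> U \<longleftrightarrow> (\<exists>f\<in>F U. eval_poly f (chart_coord m B I) \<noteq> 0)"
      by metis
    show "\<exists>K. \<forall>I\<in>H \<inter> chart m B.
        I \<in> \<Union>\<U> \<longleftrightarrow> (\<exists>f\<in>K. eval_poly f (chart_coord m B I) \<noteq> 0)"
      by (rule exI[of _ "\<Union>U\<in>\<U>. F U"]) (use F in blast)
  qed
qed

lemma openin_zariski_topology: "openin (zariski_topology m H) U \<longleftrightarrow> zariski_open m H U"
  by (simp add: zariski_topology_def istopology_zariski_open topology_inverse')

lemma zariski_open_carrier: "zariski_open m H H"
proof -
  have "eval_poly 1 x \<noteq> 0" for x :: "('a \<Rightarrow>\<^sub>0 nat) \<times> ('a \<Rightarrow>\<^sub>0 nat) \<Rightarrow> complex"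
    using eval_poly_single[of 0 1 x] by (simp add: eval_monomial_def flip: single_one)
  then show ?thesis
    unfolding zariski_open_def by (intro conjI allI impI subset_refl exI[of _ "{1}"]) auto
qed

lemma topspace_zariski_topology: "topspace (zariski_topology m H) = H"
  unfolding topspace_def openin_zariski_topology
  using zariski_open_carrier[of m H] by (auto simp: zariski_open_def)

definition irreducible_space :: "'a topology \<Rightarrow> bool" where
  "irreducible_space X \<longleftrightarrow> topspace X \<noteq> {} \<and>
     (\<forall>A B. closedin X A \<and> closedin X B \<and> A \<union> B = topspace X \<longrightarrow> A = topspace X \<or> B = topspace X)"

definition krull_dim :: "'a topology \<Rightarrow> enat" where
  "krull_dim X = Sup {enat n |n. \<exists>Z.
     (\<forall>i\<le>n. closedin X (Z i) \<and> irreducible_space (subtopology X (Z i))) \<and>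
     (\<forall>i<n. Z i \<subset> Z (Suc i))}"

text \<open>
  Zariski tangent space at \<open>x\<close> of the affine variety \<open>X\<close>: the common kernel of the differentials at
  \<open>x\<close> of all polynomials vanishing on \<open>X\<close>.
\<close>

definition tangent_space :: "('i \<Rightarrow> complex) set \<Rightarrow> ('i \<Rightarrow> complex) \<Rightarrow> ('i \<Rightarrow> complex) set" where
  "tangent_space X x = {v. \<forall>f\<in>vanishing_ideal X.
     ((\<lambda>t. eval_poly f (\<lambda>i. x i + t * v i)) has_field_derivative 0) (at 0)}"

text \<open>
  A smooth closed subvariety.  The dimension of the tangent space does not depend on the chart
  around the point.
\<close>

definition smooth_subvariety :: "nat \<Rightarrow> 'v mpoly set set \<Rightarrow> 'v mpoly set set \<Rightarrow> bool" where
  "smooth_subvariety m H D \<longleftrightarrow>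
     closedin (zariski_topology m H) D \<and>
     irreducible_space (subtopology (zariski_topology m H) D) \<and>
     (\<forall>I\<in>D. \<exists>B\<subseteq>monomials m. I \<in> chart m B \<and>
        enat (fun_vs.dim (tangent_space (chart_coord m B ` (D \<inter> chart m B)) (chart_coord m B I)))
          = krull_dim (subtopology (zariski_topology m H) D))"

section \<open>The quintic del Pezzo fourfold\<close>

typedef plucker_index = "{(i, j) :: 5 \<times> 5 |i j. i < j}"
  by (rule exI[of _ "(0, 1)"]) (simp add: less_bit1_def zero_bit1_def one_bit1_def Abs_bit1_inverse)

instance plucker_index :: finite
proof
  have "finite (range Rep_plucker_index)"
    by (rule finite_subset[OF subset_UNIV]) simp
  then show "finite (UNIV :: plucker_index set)"
    by (rule finite_imageD) (simp add: inj_on_def Rep_plucker_index_inject)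
qed

definition plucker_coord :: "5 \<Rightarrow> 5 \<Rightarrow> plucker_index mpoly" where
  "plucker_coord i j = Var (Abs_plucker_index (i, j))"

definition wedge :: "complex ^ 5 \<Rightarrow> complex ^ 5 \<Rightarrow> plucker_index \<Rightarrow> complex" where
  "wedge u w = (\<lambda>k. case Rep_plucker_index k of (i, j) \<Rightarrow> u $ i * w $ j - u $ j * w $ i)"

definition Gr25 :: "(complex ^ 5) set set" where
  "Gr25 = {U. vec.subspace U \<and> vec.dim U = 2}"

text \<open>Homogeneous coordinate vectors of the Pluecker point of \<open>U\<close>, one for each basis of \<open>U\<close>.\<close>

definition plucker_vectors :: "(complex ^ 5) set \<Rightarrow> (plucker_index \<Rightarrow> complex) set" where
  "plucker_vectors U = {wedge u w |u w. vec.span {u, w} = U}"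

definition quintic_del_pezzo :: "plucker_index mpoly set" where
  "quintic_del_pezzo = mpoly_ideal.span
     (vanishing_ideal (\<Union>U\<in>Gr25. plucker_vectors U) \<union>
      {plucker_coord 1 2 - plucker_coord 0 3, plucker_coord 1 3 - plucker_coord 2 4})"

end

theory Submission
  imports Defs "HOL-Computational_Algebra.Polynomial"
begin

text \<open>
  A double line with a non-split structure sheaf extension is the first-order thickening of a line
  in a plane-direction \<open>c\<close>, so by the bilinear Pluecker relations a double line in the Grassmannian
  is given by \<open>(u, v, w, x, l)\<close> with line \<open>\<langle>u \<and> v, u \<and> w\<rangle>\<close> and \<open>c = u \<and> x + l v \<and> w\<close>; containment in
  the fourfold adds six bilinear equations.  Row reduction brings such data into normal forms
  indexed by pivots, and on the double lines with given pivots the equations can be solved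
  successively, so that this set is an affine space \<open>\<complex>\<^sup>4\<close> on which parameters and Grassmannian chart
  coordinates determine each other polynomially.  Thirteen pivot patterns suffice, and all these
  charts meet a common one, so the locus is irreducible; it is closed because a conic is a double
  line iff its ideal contains the square of a linear form outside the ideal.  The dimension of a
  variety covered by affine spaces is read off from the growth of affine Hilbert functions, and
  exactness of the Hilbert functions \<open>m + 1\<close> and \<open>2 m + 1\<close> in every degree comes from cutting with a
  linear form that is regular by the theorem of McCoy.
\<close>

section \<open>Polynomials and polynomial functions\<close>

text \<open>Hilbert functions in \<open>Hilb\<close> are prescribed, and sheaf maps defined, only in
  large degrees, whereas the geometry takes place in degrees one and two: a conic spans a plane
  because its quotient has dimension 3 in degree one, it has an equation in that plane because the
  dimension 5 in degree two is less than 6, and some linear form vanishes on the line but not on the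
  conic because 2 < 3. Hence the effort spent on exact Hilbert functions. That linear form
  \<open>h\<close> links extensions with squares: it annihilates both the subsheaf and the quotient
  sheaf, so \<open>h * h\<close> annihilates the middle term; for a split extension \<open>h\<close>
  itself would. A second obstacle is that openness and tangent spaces refer to chart coordinates of
  one degree \<open>m\<close>. The atlas uses monomial bases with at most one factor
  \<open>x_k\<close>, in which the linear and quadratic relations of a conic, multiplied by a power
  of \<open>x_i\<close>, show up as single coordinates. Finally, over the locus
  \<open>u $ 2 \<noteq> 0\<close> the vector \<open>u\<close> determines the double line; this
  explains the dimension, that of projective 4-space, and the choice of the common chart.\<close>

lemma mdeg_superset:
  assumes "finite A" "Poly_Mapping.keys \<mu> \<subseteq> A"
  shows "mdeg \<mu> = (\<Sum>i\<in>A. Poly_Mapping.lookup \<mu> i)"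
  unfolding mdeg_def using assms by (intro sum.mono_neutral_left) (auto simp: in_keys_iff)

lemma mdeg_zero [simp]: "mdeg 0 = 0"
  by (simp add: mdeg_def)

lemma mdeg_add [simp]: "mdeg (\<mu> + \<nu>) = mdeg \<mu> + mdeg \<nu>"
proof -
  let ?A = "Poly_Mapping.keys \<mu> \<union> Poly_Mapping.keys \<nu>"
  have "Poly_Mapping.keys (\<mu> + \<nu>) \<subseteq> ?A"
    by (rule Poly_Mapping.keys_add)
  then show ?thesis
    by (simp add: mdeg_superset[of ?A] lookup_add sum.distrib)
qed

lemma mdeg_single [simp]: "mdeg (Poly_Mapping.single i n) = n"
  by (simp add: mdeg_def)

lemma mdeg_eq_0_iff: "mdeg \<mu> = 0 \<longleftrightarrow> \<mu> = 0"
proof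
  assume "mdeg \<mu> = 0"
  then have "Poly_Mapping.lookup \<mu> i = 0" for i
    using mdeg_superset[of "insert i (Poly_Mapping.keys \<mu>)" \<mu>] by auto
  then show "\<mu> = 0" by (simp add: poly_mapping_eqI)
qed simp

lemma lookup_le_mdeg: "Poly_Mapping.lookup \<mu> i \<le> mdeg \<mu>"
proof (cases "i \<in> Poly_Mapping.keys \<mu>")
  case True then show ?thesis unfolding mdeg_def by (intro member_le_sum) auto
next
  case False then show ?thesis by (simp add: in_keys_iff)
qed

lemma finite_bounded_exponents:
  "finite {\<mu> :: 'v::finite \<Rightarrow>\<^sub>0 nat. \<forall>i. Poly_Mapping.lookup \<mu> i \<le> d}"
  and card_bounded_exponents:
  "card {\<mu> :: 'v::finite \<Rightarrow>\<^sub>0 nat. \<forall>i. Poly_Mapping.lookup \<mu> i \<le> d} \<le> (d + 1) ^ CARD('v)"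
proof -
  let ?S = "{\<mu> :: 'v \<Rightarrow>\<^sub>0 nat. \<forall>i. Poly_Mapping.lookup \<mu> i \<le> d}"
  let ?T = "PiE (UNIV :: 'v set) (\<lambda>_. {..d})"
  have inj: "inj_on Poly_Mapping.lookup ?S"
    by (rule inj_onI) (simp add: lookup_inject)
  have sub: "Poly_Mapping.lookup ` ?S \<subseteq> ?T" by auto
  have fin: "finite ?T" by (rule finite_PiE) auto
  show "finite ?S"
    using inj sub fin by (meson finite_imageD finite_subset)
  have "card ?S \<le> card ?T"
    using inj sub fin by (metis card_image card_mono)
  then show "card ?S \<le> (d + 1) ^ CARD('v)"
    by (simp add: card_PiE)
qed

lemma finite_monomials [simp]: "finite (monomials m :: ('v::finite \<Rightarrow>\<^sub>0 nat) set)"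
  by (rule finite_subset[OF _ finite_bounded_exponents[of m]])
    (use lookup_le_mdeg in \<open>auto simp: monomials_def\<close>)

lemma mem_monomials: "\<mu> \<in> monomials m \<longleftrightarrow> mdeg \<mu> = m"
  by (simp add: monomials_def)

lemma monomials_nonempty: "\<exists>\<mu> :: 'v \<Rightarrow>\<^sub>0 nat. \<mu> \<in> monomials m"
  by (rule exI[of _ "Poly_Mapping.single undefined m"]) (simp add: mem_monomials)

lemma monomial_decomp:
  assumes "\<mu> \<in> monomials (Suc m)"
  obtains i \<nu> where "\<nu> \<in> monomials m" "\<mu> = Poly_Mapping.single i 1 + \<nu>"
proof -
  from assms have "\<mu> \<noteq> 0" by (auto simp: mem_monomials)
  then have "Poly_Mapping.keys \<mu> \<noteq> {}" by simp
  then obtain i where i: "i \<in> Poly_Mapping.keys \<mu>" by blast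
  define \<nu> where "\<nu> = \<mu> - Poly_Mapping.single i 1"
  have eq: "\<mu> = Poly_Mapping.single i 1 + \<nu>"
    by (rule poly_mapping_eqI)
      (use i in \<open>auto simp: \<nu>_def lookup_add lookup_minus lookup_single when_def in_keys_iff\<close>)
  have "mdeg \<mu> = 1 + mdeg \<nu>" by (simp add: eq)
  with assms have "\<nu> \<in> monomials m" by (simp add: mem_monomials)
  with eq that show ?thesis by blast
qed

lemma lookup_poly_scale [simp]: "Poly_Mapping.lookup (poly_scale c f) \<mu> = c * Poly_Mapping.lookup f \<mu>"
proof -
  have "f = (\<Sum>\<nu>\<in>Poly_Mapping.keys f. Poly_Mapping.single \<nu> (Poly_Mapping.lookup f \<nu>))"
    by (rule mpoly_sum_single)
  then have "poly_scale c f = (\<Sum>\<nu>\<in>Poly_Mapping.keys f. Poly_Mapping.single \<nu> (c * Poly_Mapping.lookup f \<nu>))"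
    unfolding poly_scale_def by (metis (no_types, lifting) mult_single sum.cong sum_distrib_left add_0)
  then show ?thesis
    by (auto simp: lookup_sum lookup_single when_def in_keys_iff)
qed

lemma poly_scale_single [simp]: "poly_scale c (Poly_Mapping.single \<mu> d) = Poly_Mapping.single \<mu> (c * d)"
  by (simp add: poly_scale_def mult_single)

lemma mult_poly_scale: "f * poly_scale c g = poly_scale c (f * g)"
  unfolding poly_scale_def by (rule mult.left_commute)

lemma poly_scale_mult: "poly_scale c g * f = poly_scale c (g * f)"
  unfolding poly_scale_def by (rule mult.assoc)

lemma forms_iff: "f \<in> forms m \<longleftrightarrow> (\<forall>\<mu>. Poly_Mapping.lookup f \<mu> \<noteq> 0 \<longrightarrow> mdeg \<mu> = m)"
  by (auto simp: forms_def monomials_def in_keys_iff)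

lemma forms_zero [simp]: "0 \<in> forms m"
  by (simp add: forms_iff)

lemma forms_add: "f \<in> forms m \<Longrightarrow> g \<in> forms m \<Longrightarrow> f + g \<in> forms m"
  unfolding forms_def using Poly_Mapping.keys_add[of f g] by blast

lemma forms_scale: "f \<in> forms m \<Longrightarrow> poly_scale c f \<in> forms m"
  by (auto simp: forms_iff)

lemma forms_uminus: "f \<in> forms m \<Longrightarrow> - f \<in> forms m"
  by (auto simp: forms_iff)

lemma forms_diff: "f \<in> forms m \<Longrightarrow> g \<in> forms m \<Longrightarrow> f - g \<in> forms m"
  using forms_add[of f m "- g"] forms_uminus by fastforce

lemma forms_sum: "(\<And>i. i \<in> A \<Longrightarrow> f i \<in> forms m) \<Longrightarrow> (\<Sum>i\<in>A. f i) \<in> forms m"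
  by (induction A rule: infinite_finite_induct) (auto intro: forms_add)

lemma forms_single [simp]: "Poly_Mapping.single \<mu> c \<in> forms m \<longleftrightarrow> c = 0 \<or> mdeg \<mu> = m"
  by (auto simp: forms_iff lookup_single when_def)

lemma forms_Var [simp]: "Var i \<in> forms 1"
  by (simp add: Var_def)

lemma forms_Var_Suc [simp]: "Var i \<in> forms (Suc 0)"
  using forms_Var by simp

lemma forms_mult:
  assumes "f \<in> forms m" "g \<in> forms n"
  shows "f * g \<in> forms (m + n)"
proof -
  have "f * g = (\<Sum>\<mu>\<in>Poly_Mapping.keys f. \<Sum>\<nu>\<in>Poly_Mapping.keys g.
      Poly_Mapping.single (\<mu> + \<nu>) (Poly_Mapping.lookup f \<mu> * Poly_Mapping.lookup g \<nu>))"
    by (subst mpoly_sum_single[of f], subst mpoly_sum_single[of g])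
      (simp add: sum_product mult_single)
  also have "\<dots> \<in> forms (m + n)"
    using assms by (intro forms_sum) (auto simp: forms_def monomials_def)
  finally show ?thesis .
qed

lemma forms_subspace: "mpoly_vs.subspace (forms m)"
  by (simp add: mpoly_vs.subspace_def forms_add forms_scale)

lemma forms_expand:
  fixes f :: "'v::finite mpoly"
  assumes "f \<in> forms m"
  shows "f = (\<Sum>\<mu>\<in>monomials m. poly_scale (Poly_Mapping.lookup f \<mu>) (Poly_Mapping.single \<mu> 1))"
  using assms
  by (subst mpoly_sum_single[of f])
    (auto simp: forms_def in_keys_iff intro!: sum.mono_neutral_left)

lemma forms_1_expand:
  fixes f :: "'v::finite mpoly"
  assumes "f \<in> forms 1"
  shows "f = (\<Sum>i\<in>UNIV. poly_scale (Poly_Mapping.lookup f (Poly_Mapping.single i 1)) (Var i))"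
proof (rule poly_mapping_eqI)
  fix \<mu>
  show "Poly_Mapping.lookup f \<mu> = Poly_Mapping.lookup
    (\<Sum>i\<in>UNIV. poly_scale (Poly_Mapping.lookup f (Poly_Mapping.single i 1)) (Var i)) \<mu>"
  proof (cases "mdeg \<mu> = 1")
    case True
    then obtain i \<nu> where "\<nu> \<in> monomials 0" "\<mu> = Poly_Mapping.single i 1 + \<nu>"
      by (metis monomial_decomp One_nat_def mem_monomials)
    then have \<mu>: "\<mu> = Poly_Mapping.single i 1" by (simp add: mem_monomials mdeg_eq_0_iff)
    have inj: "Poly_Mapping.single k (Suc 0) = Poly_Mapping.single i (Suc 0) \<longleftrightarrow> k = i" for k
      by (metis lookup_single_eq lookup_single_not_eq nat.simps(3))
    show ?thesis unfolding \<mu> by (simp add: lookup_sum Var_def lookup_single when_def inj)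
  next
    case False
    then have "Poly_Mapping.lookup f \<mu> = 0" using assms by (auto simp: forms_iff)
    moreover have "Poly_Mapping.single i 1 \<noteq> \<mu>" for i using False by auto
    ultimately show ?thesis by (simp add: lookup_sum Var_def lookup_single when_def)
  qed
qed

lemma lookup_hom_component:
  "Poly_Mapping.lookup (hom_component m f) \<mu> = (if mdeg \<mu> = m then Poly_Mapping.lookup f \<mu> else 0)"
  by (auto simp: hom_component_def lookup_sum lookup_single when_def in_keys_iff monomials_def)

lemma hom_component_forms [simp]: "hom_component m f \<in> forms m"
  by (simp add: forms_iff lookup_hom_component)

lemma hom_component_of_form:
  "f \<in> forms n \<Longrightarrow> hom_component m f = (if m = n then f else 0)"
  by (rule poly_mapping_eqI) (auto simp: lookup_hom_component forms_iff)

lemma hom_component_add: "hom_component m (f + g) = hom_component m f + hom_component m g"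
  by (rule poly_mapping_eqI) (auto simp: lookup_hom_component lookup_add)

lemma sum_hom_components: "\<exists>N. f = (\<Sum>m\<le>N. hom_component m f)"
proof -
  define N where "N = Max (insert 0 (mdeg ` Poly_Mapping.keys f))"
  have "mdeg \<mu> \<le> N" if "Poly_Mapping.lookup f \<mu> \<noteq> 0" for \<mu>
    unfolding N_def using that by (intro Max_ge) (auto simp: in_keys_iff)
  then have "f = (\<Sum>m\<le>N. hom_component m f)"
    by (intro poly_mapping_eqI) (force simp: lookup_sum lookup_hom_component)
  then show ?thesis ..
qed

lemma eval_monomial_single [simp]: "eval_monomial (Poly_Mapping.single i n) x = x i ^ n"
  by (simp add: eval_monomial_def)

lemma eval_monomial_zero [simp]: "eval_monomial 0 x = 1"
  by (simp add: eval_monomial_def)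

lemma eval_poly_Var [simp]: "eval_poly (Var i) x = x i"
  by (simp add: Var_def eval_poly_single)

lemma eval_poly_scale [simp]: "eval_poly (poly_scale c f) x = c * eval_poly f x"
  by (simp add: poly_scale_def eval_poly_mult eval_poly_single)

lemma eval_poly_uminus [simp]: "eval_poly (- f) x = - eval_poly f x"
  using eval_poly_scale[of "-1" f x] by simp

lemma eval_poly_diff: "eval_poly (f - g) x = eval_poly f x - eval_poly g x"
  using eval_poly_add[of f "- g" x] by simp

lemma eval_poly_1 [simp]: "eval_poly 1 x = 1"
  using eval_poly_single[of 0 1 x] by (simp flip: single_one)

lemma eval_poly_power: "eval_poly (f ^ n) x = eval_poly f x ^ n"
  by (induction n) (simp_all add: eval_poly_mult)

lemmas eval_poly_simps = eval_poly_add eval_poly_diff eval_poly_mult eval_poly_sum eval_poly_power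

lemma eval_monomial_scale: "eval_monomial \<mu> (\<lambda>i. r * x i) = r ^ mdeg \<mu> * eval_monomial \<mu> x"
  by (simp add: eval_monomial_def mdeg_def power_mult_distrib prod.distrib power_sum)

lemma eval_form_scale: "f \<in> forms m \<Longrightarrow> eval_poly f (\<lambda>i. r * x i) = r ^ m * eval_poly f x"
  by (auto simp: eval_poly_def eval_monomial_scale sum_distrib_left forms_def monomials_def
      intro!: sum.cong)

text \<open>Every polynomial arises from constants and variables by sums and products, so statements
  about evaluation, derivatives or denominators can be checked on these four constructors.\<close>

lemma mpoly_induct [case_names const Var add mult]:
  assumes "\<And>c. P (Poly_Mapping.single 0 c)" "\<And>i. P (Var i)"
    "\<And>f g. P f \<Longrightarrow> P g \<Longrightarrow> P (f + g)" "\<And>f g. P f \<Longrightarrow> P g \<Longrightarrow> P (f * g)"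
  shows "P f"
proof -
  have P1: "P 1" using assms(1)[of 1] by simp
  have P0: "P 0" using assms(1)[of 0] by simp
  have mon: "P (Poly_Mapping.single \<mu> 1)" if "mdeg \<mu> = n" for \<mu> n
    using that
  proof (induction n arbitrary: \<mu>)
    case 0 then show ?case by (simp add: mdeg_eq_0_iff P1)
  next
    case (Suc n)
    then obtain i \<nu> where "\<nu> \<in> monomials n" "\<mu> = Poly_Mapping.single i 1 + \<nu>"
      by (metis monomial_decomp mem_monomials)
    moreover from this have "Poly_Mapping.single \<mu> 1 = Var i * Poly_Mapping.single \<nu> 1"
      by (simp add: Var_def mult_single)
    ultimately show ?case using Suc.IH assms(2,4) by (simp add: mem_monomials)
  qed
  have "P (Poly_Mapping.single \<mu> c)" for \<mu> c
    using assms(4)[OF assms(1)[of c] mon[OF refl, of \<mu>]] by (simp add: mult_single)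
  then have "P (\<Sum>\<mu>\<in>A. Poly_Mapping.single \<mu> (g \<mu>))" for A :: "('a \<Rightarrow>\<^sub>0 nat) set" and g
    by (induction A rule: infinite_finite_induct) (auto intro: P0 assms(3))
  then show ?thesis by (subst mpoly_sum_single)
qed

section \<open>Polynomial functions and their restrictions to lines\<close>

text \<open>The function replaces its polynomial, so that closure properties become introduction
  rules without explicit witnesses. The index type may be infinite, as it is for chart coordinates,
  which are indexed by pairs of monomials.\<close>

definition polyfun :: "(('v \<Rightarrow> complex) \<Rightarrow> complex) \<Rightarrow> bool" where
  "polyfun F \<longleftrightarrow> (\<exists>p. \<forall>x. F x = eval_poly p x)"

lemma polyfun_eval [intro, simp]: "polyfun (\<lambda>x. eval_poly p x)"
  by (auto simp: polyfun_def)

lemma polyfun_const [intro, simp]: "polyfun (\<lambda>x. c)"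
  unfolding polyfun_def by (rule exI[of _ "Poly_Mapping.single 0 c"]) (simp add: eval_poly_single)

lemma polyfun_coord [intro, simp]: "polyfun (\<lambda>x. x i)"
  unfolding polyfun_def by (rule exI[of _ "Var i"]) simp

lemma polyfun_add [intro]: "polyfun F \<Longrightarrow> polyfun G \<Longrightarrow> polyfun (\<lambda>x. F x + G x)"
  unfolding polyfun_def by (metis eval_poly_add)

lemma polyfun_mult [intro]: "polyfun F \<Longrightarrow> polyfun G \<Longrightarrow> polyfun (\<lambda>x. F x * G x)"
  unfolding polyfun_def by (metis eval_poly_mult)

lemma polyfun_uminus [intro]: "polyfun F \<Longrightarrow> polyfun (\<lambda>x. - F x)"
  unfolding polyfun_def by (metis eval_poly_uminus)

lemma polyfun_diff [intro]: "polyfun F \<Longrightarrow> polyfun G \<Longrightarrow> polyfun (\<lambda>x. F x - G x)"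
  unfolding polyfun_def by (metis eval_poly_diff)

lemma polyfun_compose:
  assumes "\<And>k. polyfun (\<lambda>x. Y x k)"
  shows "polyfun (\<lambda>x. eval_poly f (Y x))"
  by (induction f rule: mpoly_induct)
    (auto simp: eval_poly_simps eval_poly_single intro: assms)

text \<open>On a line a polynomial function of arbitrarily many variables becomes a univariate
  polynomial, where finiteness of roots is available.\<close>

lemma polyfun_line:
  assumes "polyfun F"
  shows "\<exists>q. \<forall>t. F (\<lambda>i. x i + t * v i) = poly q t"
proof -
  have "\<exists>q. \<forall>t. eval_poly f (\<lambda>i. x i + t * v i) = poly q t" for f
  proof (induction f rule: mpoly_induct)
    case (const c)
    show ?case by (rule exI[of _ "[:c:]"]) (simp add: eval_poly_single)
  next
    case (Var i)
    show ?case by (rule exI[of _ "[:x i, v i:]"]) simp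
  next
    case (add f g)
    then obtain p q where "\<forall>t. eval_poly f (\<lambda>i. x i + t * v i) = poly p t"
      "\<forall>t. eval_poly g (\<lambda>i. x i + t * v i) = poly q t" by blast
    then show ?case by (intro exI[of _ "p + q"]) (simp add: eval_poly_add)
  next
    case (mult f g)
    then obtain p q where "\<forall>t. eval_poly f (\<lambda>i. x i + t * v i) = poly p t"
      "\<forall>t. eval_poly g (\<lambda>i. x i + t * v i) = poly q t" by blast
    then show ?case by (intro exI[of _ "p * q"]) (simp add: eval_poly_mult)
  qed
  moreover obtain p where "\<And>x. F x = eval_poly p x"
    using assms by (auto simp: polyfun_def)
  ultimately show ?thesis by simp
qed

text \<open>Irreducibility of affine space in usable form: on the line through \<open>x\<close> (at
  \<open>t = 0\<close>) and \<open>y\<close> (at \<open>t = 1\<close>) both restrictions are nonzero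
  univariate polynomials, hence so is their product.\<close>

lemma polyfun_mult_nonzero:
  assumes "polyfun F" "polyfun G" "F x \<noteq> 0" "G y \<noteq> 0"
  shows "\<exists>t. F (\<lambda>i. x i + t * (y i - x i)) * G (\<lambda>i. x i + t * (y i - x i)) \<noteq> 0"
proof -
  obtain p q where p: "\<And>t. F (\<lambda>i. x i + t * (y i - x i)) = poly p t"
    and q: "\<And>t. G (\<lambda>i. x i + t * (y i - x i)) = poly q t"
    using polyfun_line assms(1,2) by metis
  have "poly p 0 \<noteq> 0" using p[of 0] assms(3) by simp
  moreover have "poly q 1 \<noteq> 0" using q[of 1] assms(4) by simp
  ultimately have "p * q \<noteq> 0" by auto
  then have "\<exists>t. poly (p * q) t \<noteq> 0"
    using poly_all_0_iff_0 by blast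
  then show ?thesis by (simp add: p q)
qed

section \<open>Directional derivatives\<close>

definition pdir :: "'v mpoly \<Rightarrow> ('v \<Rightarrow> complex) \<Rightarrow> ('v \<Rightarrow> complex) \<Rightarrow> complex" where
  "pdir f x v = deriv (\<lambda>t. eval_poly f (\<lambda>i. x i + t * v i)) 0"

lemma line_derivative: "((\<lambda>t. (x::complex) + t * v) has_field_derivative v) (at 0)"
  by (auto intro!: derivative_eq_intros)

text \<open>Chain rule: the derivative depends on the curve only through its value and velocity at
  0. It is applied below to curves in the Grassmannian that are not straight.\<close>

lemma eval_poly_curve_derivative:
  assumes "\<And>k. ((\<lambda>t. y t k) has_field_derivative v k) (at 0)"
  shows "((\<lambda>t. eval_poly f (y t)) has_field_derivative pdir f (y 0) v) (at 0)"
proof -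
  \<comment> \<open>The number \<open>d\<close> has to be fixed before the curve; comparison with
    the straight line of the same value and velocity then identifies it as
    \<open>pdir\<close>.\<close>
  define Q where "Q d \<longleftrightarrow> (\<forall>z. z 0 = y 0 \<longrightarrow>
      (\<forall>k. ((\<lambda>t. z t k) has_field_derivative v k) (at 0)) \<longrightarrow>
      ((\<lambda>t. eval_poly f (z t)) has_field_derivative d) (at 0))" for d
  have "\<exists>d. \<forall>z. z 0 = y 0 \<longrightarrow> (\<forall>k. ((\<lambda>t. z t k) has_field_derivative v k) (at 0)) \<longrightarrow>
      ((\<lambda>t. eval_poly f (z t)) has_field_derivative d) (at 0)"
  proof (induction f rule: mpoly_induct)
    case (const c)
    show ?case by (rule exI[of _ 0]) (simp add: eval_poly_single)
  next
    case (Var i)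
    show ?case by (rule exI[of _ "v i"]) simp
  next
    case (add f g)
    then obtain d e where
      "\<forall>z. z 0 = y 0 \<longrightarrow> (\<forall>k. ((\<lambda>t. z t k) has_field_derivative v k) (at 0)) \<longrightarrow>
        ((\<lambda>t. eval_poly f (z t)) has_field_derivative d) (at 0)"
      "\<forall>z. z 0 = y 0 \<longrightarrow> (\<forall>k. ((\<lambda>t. z t k) has_field_derivative v k) (at 0)) \<longrightarrow>
        ((\<lambda>t. eval_poly g (z t)) has_field_derivative e) (at 0)" by blast
    then show ?case
      by (intro exI[of _ "d + e"]) (auto simp: eval_poly_add intro!: DERIV_add)
  next
    case (mult f g)
    then obtain d e where
      "\<forall>z. z 0 = y 0 \<longrightarrow> (\<forall>k. ((\<lambda>t. z t k) has_field_derivative v k) (at 0)) \<longrightarrow>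
        ((\<lambda>t. eval_poly f (z t)) has_field_derivative d) (at 0)"
      "\<forall>z. z 0 = y 0 \<longrightarrow> (\<forall>k. ((\<lambda>t. z t k) has_field_derivative v k) (at 0)) \<longrightarrow>
        ((\<lambda>t. eval_poly g (z t)) has_field_derivative e) (at 0)" by blast
    then show ?case
      by (intro exI[of _ "d * eval_poly g (y 0) + e * eval_poly f (y 0)"])
        (auto simp: eval_poly_mult intro!: DERIV_mult[THEN DERIV_cong])
  qed
  then obtain d where d: "Q d" unfolding Q_def by blast
  have "((\<lambda>t. eval_poly f (\<lambda>i. y 0 i + t * v i)) has_field_derivative d) (at 0)"
    using d[unfolded Q_def, rule_format, of "\<lambda>t i. y 0 i + t * v i"]
    by (simp add: line_derivative)
  then have "pdir f (y 0) v = d" by (simp add: pdir_def DERIV_imp_deriv)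
  then show ?thesis using d assms unfolding Q_def by blast
qed

lemma pdir_line_derivative:
  "((\<lambda>t. eval_poly f (\<lambda>i. x i + t * v i)) has_field_derivative pdir f x v) (at 0)"
  using eval_poly_curve_derivative[of "\<lambda>t i. x i + t * v i" v f]
  by (simp add: line_derivative)

lemma pdir_eqI:
  "((\<lambda>t. eval_poly f (\<lambda>i. x i + t * v i)) has_field_derivative d) (at 0) \<Longrightarrow> pdir f x v = d"
  using pdir_line_derivative DERIV_unique by blast

lemma pdir_Var [simp]: "pdir (Var i) x v = v i"
  by (rule pdir_eqI) (auto intro!: derivative_eq_intros)

lemma pdir_const [simp]: "pdir (Poly_Mapping.single 0 c) x v = 0"
  by (rule pdir_eqI) (simp add: eval_poly_single)

lemma pdir_add: "pdir (f + g) x v = pdir f x v + pdir g x v"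
  by (rule pdir_eqI) (auto simp: eval_poly_add intro!: DERIV_add pdir_line_derivative)

lemma pdir_mult: "pdir (f * g) x v = pdir f x v * eval_poly g x + eval_poly f x * pdir g x v"
  by (rule pdir_eqI)
    (auto simp: eval_poly_mult mult.commute
      intro!: DERIV_mult[OF pdir_line_derivative pdir_line_derivative, THEN DERIV_cong])

lemma pdir_zero [simp]: "pdir 0 x v = 0"
  using pdir_const[of 0] by simp

lemma pdir_scale [simp]: "pdir (poly_scale c f) x v = c * pdir f x v"
  by (simp add: poly_scale_def pdir_mult eval_poly_single)

lemma pdir_uminus [simp]: "pdir (- f) x v = - pdir f x v"
  using pdir_scale[of "-1" f] by simp

lemma pdir_diff: "pdir (f - g) x v = pdir f x v - pdir g x v"
  using pdir_add[of f "- g"] by simp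

lemma pdir_sum: "pdir (\<Sum>i\<in>A. f i) x v = (\<Sum>i\<in>A. pdir (f i) x v)"
  by (induction A rule: infinite_finite_induct) (simp_all add: pdir_add)

lemma pdir_linear: "pdir f x (\<lambda>i. r * v i + s * w i) = r * pdir f x v + s * pdir f x w"
  by (induction f rule: mpoly_induct) (simp_all add: pdir_add pdir_mult algebra_simps)

lemma polynomial_sum_zero:
  fixes c :: "nat \<Rightarrow> complex"
  assumes "\<And>r. (\<Sum>m\<le>N. c m * r ^ m) = 0" "m \<le> N"
  shows "c m = 0"
  using polyfun_eq_0[of c N] assms by auto

section \<open>Chains of irreducible affine varieties\<close>

text \<open>Dimension count for indexed families. A family that repeats a vector has a relation for
  that reason alone, so the bound on independent sets is needed in the injective case.\<close>

lemma linear_relation_exists: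
  assumes "finite T" "finite A" "\<And>i. i \<in> A \<Longrightarrow> p i \<in> mpoly_vs.span T" "card T < card A"
  obtains c where "\<exists>i\<in>A. c i \<noteq> 0" "(\<Sum>i\<in>A. poly_scale (c i) (p i)) = 0"
proof (cases "inj_on p A")
  case True
  have "mpoly_vs.dependent (p ` A)"
  proof (rule ccontr)
    assume "\<not> ?thesis"
    then have "card (p ` A) \<le> card T"
      using mpoly_vs.independent_span_bound[of T "p ` A"] assms by auto
    then show False using True assms(4) by (simp add: card_image)
  qed
  then obtain u where u: "\<exists>v\<in>p ` A. u v \<noteq> 0" "(\<Sum>v\<in>p ` A. poly_scale (u v) v) = 0"
    using mpoly_vs.dependent_finite[of "p ` A"] assms(2) by auto
  have "(\<Sum>i\<in>A. poly_scale (u (p i)) (p i)) = 0"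
    using u(2) by (simp add: sum.reindex[OF True])
  then show ?thesis using u(1) that[of "\<lambda>i. u (p i)"] by auto
next
  case False
  then obtain i j where ij: "i \<in> A" "j \<in> A" "i \<noteq> j" "p i = p j" by (auto simp: inj_on_def)
  define c where "c = (\<lambda>k. if k = i then 1 :: complex else if k = j then - 1 else 0)"
  have "(\<Sum>k\<in>A. poly_scale (c k) (p k)) = (\<Sum>k\<in>{i, j}. poly_scale (c k) (p k))"
    using assms(2) ij by (intro sum.mono_neutral_right) (auto simp: c_def)
  also have "\<dots> = 0" using ij by (simp add: c_def)
  finally have "(\<Sum>k\<in>A. poly_scale (c k) (p k)) = 0" .
  moreover have "\<exists>k\<in>A. c k \<noteq> 0"
    using ij by (intro bexI[of _ i]) (auto simp: c_def)
  ultimately show ?thesis using that by blast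
qed

text \<open>Bounding each exponent separately, instead of the total degree, makes the number of
  monomials at most a plain power of \<open>d + 1\<close>, and the bound is still additive under
  products.\<close>

definition box_degree_le :: "nat \<Rightarrow> 'n mpoly set" where
  "box_degree_le d = {f. \<forall>\<mu>\<in>Poly_Mapping.keys f. \<forall>i. Poly_Mapping.lookup \<mu> i \<le> d}"

lemma box_degree_le_mono: "f \<in> box_degree_le d \<Longrightarrow> d \<le> e \<Longrightarrow> f \<in> box_degree_le e"
  unfolding box_degree_le_def by (blast intro: order_trans)

lemma box_degree_le_mult:
  assumes "f \<in> box_degree_le d" "g \<in> box_degree_le e"
  shows "f * g \<in> box_degree_le (d + e)"
  unfolding box_degree_le_def
proof safe
  fix \<mu> i assume "\<mu> \<in> Poly_Mapping.keys (f * g)"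
  then obtain a b where "a \<in> Poly_Mapping.keys f" "b \<in> Poly_Mapping.keys g" "\<mu> = a + b"
    using Poly_Mapping.keys_mult[of f g] by blast
  then show "Poly_Mapping.lookup \<mu> i \<le> d + e"
    using assms by (auto simp: box_degree_le_def lookup_add intro!: add_mono)
qed

lemma box_degree_le_exists: "\<exists>d. f \<in> box_degree_le d"
proof -
  define d where "d = Max (insert 0 (mdeg ` Poly_Mapping.keys f))"
  have "Poly_Mapping.lookup \<mu> i \<le> d" if "\<mu> \<in> Poly_Mapping.keys f" for \<mu> i
  proof -
    have "mdeg \<mu> \<le> d" unfolding d_def using that by (intro Max_ge) auto
    then show ?thesis using lookup_le_mdeg[of \<mu> i] by linarith
  qed
  then show ?thesis by (auto simp: box_degree_le_def)
qed

text \<open>A lower bound for the affine Hilbert function of the closure of \<open>Y\<close>.\<close>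

definition hilbert_ge :: "('n \<Rightarrow> complex) set \<Rightarrow> nat \<Rightarrow> nat \<Rightarrow> bool" where
  "hilbert_ge Y d r \<longleftrightarrow> (\<exists>p. (\<forall>i<r. p i \<in> box_degree_le d) \<and>
     (\<forall>c. (\<forall>z\<in>Y. (\<Sum>i<r. c i * eval_poly (p i) z) = 0) \<longrightarrow> (\<forall>i<r. c i = 0)))"

text \<open>A linear relation between polynomials persists on \<open>Y\<close>, so independence on
  \<open>Y\<close> requires at least as many monomials in the box as members of the family.\<close>

lemma hilbert_ge_bound:
  fixes Y :: "('n::finite \<Rightarrow> complex) set"
  assumes "hilbert_ge Y d r"
  shows "r \<le> (d + 1) ^ CARD('n)"
proof (rule ccontr)
  assume less: "\<not> ?thesis"
  let ?S = "{\<mu> :: 'n \<Rightarrow>\<^sub>0 nat. \<forall>i. Poly_Mapping.lookup \<mu> i \<le> d}"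
  let ?T = "(\<lambda>\<mu>. Poly_Mapping.single \<mu> (1::complex)) ` ?S"
  obtain p where p: "\<And>i. i < r \<Longrightarrow> p i \<in> box_degree_le d"
    and ind: "\<And>c. (\<And>z. z \<in> Y \<Longrightarrow> (\<Sum>i<r. c i * eval_poly (p i) z) = 0) \<Longrightarrow> \<forall>i<r. c i = 0"
    using assms unfolding hilbert_ge_def by metis
  have "p i \<in> mpoly_vs.span ?T" if "i < r" for i
  proof -
    have "(\<Sum>\<mu>\<in>Poly_Mapping.keys (p i). Poly_Mapping.single \<mu> (Poly_Mapping.lookup (p i) \<mu>)) \<in> mpoly_vs.span ?T"
    proof (rule mpoly_vs.span_sum)
      fix \<mu> assume "\<mu> \<in> Poly_Mapping.keys (p i)"
      then have "\<mu> \<in> ?S" using p[OF that] by (auto simp: box_degree_le_def)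
      then have "poly_scale (Poly_Mapping.lookup (p i) \<mu>) (Poly_Mapping.single \<mu> 1) \<in> mpoly_vs.span ?T"
        by (intro mpoly_vs.span_scale mpoly_vs.span_base) blast
      then show "Poly_Mapping.single \<mu> (Poly_Mapping.lookup (p i) \<mu>) \<in> mpoly_vs.span ?T" by simp
    qed
    then show ?thesis by (simp flip: mpoly_sum_single)
  qed
  moreover have "card ?T < card {..<r}"
  proof -
    have "card ?T \<le> card ?S" by (rule card_image_le[OF finite_bounded_exponents])
    also have "\<dots> \<le> (d + 1) ^ CARD('n)" by (rule card_bounded_exponents)
    finally show ?thesis using less by simp
  qed
  moreover have "finite ?T" using finite_bounded_exponents by blast
  ultimately obtain c where c: "\<exists>i\<in>{..<r}. c i \<noteq> 0" "(\<Sum>i<r. poly_scale (c i) (p i)) = 0"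
    using linear_relation_exists[of ?T "{..<r}" p] by blast
  have "(\<Sum>i<r. c i * eval_poly (p i) z) = 0" for z
    using arg_cong[OF c(2), of "\<lambda>f. eval_poly f z"] by (simp add: eval_poly_sum)
  then show False using ind[of c] c(1) by auto
qed

lemma sum_lessThan_add: "(\<Sum>i<r + s. g i) = (\<Sum>i<r. g i) + (\<Sum>i<s. g (r + i))"
  for g :: "nat \<Rightarrow> 'b::comm_monoid_add"
  by (induction s) (simp_all add: add.assoc)

text \<open>Primality of the vanishing ideal, expressed on the points of \<open>Y\<close>; no
  closedness of \<open>Y\<close> is involved.\<close>

definition prime_set :: "('n \<Rightarrow> complex) set \<Rightarrow> bool" where
  "prime_set Y \<longleftrightarrow> Y \<noteq> {} \<and> (\<forall>f g. (\<forall>z\<in>Y. eval_poly f z * eval_poly g z = 0) \<longrightarrow>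
     (\<forall>z\<in>Y. eval_poly f z = 0) \<or> (\<forall>z\<in>Y. eval_poly g z = 0))"

text \<open>The exact sequence of multiplication by an equation of \<open>Y\<close> in \<open>Y'\<close>.\<close>

lemma hilbert_ge_step:
  assumes "prime_set Y'" "Y \<subseteq> Y'" "f \<in> box_degree_le e"
    and f0: "\<And>z. z \<in> Y \<Longrightarrow> eval_poly f z = 0" and f1: "\<exists>z\<in>Y'. eval_poly f z \<noteq> 0"
    and "hilbert_ge Y d r" "hilbert_ge Y' d' r'" "d \<le> d' + e"
  shows "hilbert_ge Y' (d' + e) (r + r')"
proof -
  obtain p where p: "\<And>i. i < r \<Longrightarrow> p i \<in> box_degree_le d"
    and indp: "\<And>c. (\<And>z. z \<in> Y \<Longrightarrow> (\<Sum>i<r. c i * eval_poly (p i) z) = 0) \<Longrightarrow> \<forall>i<r. c i = 0"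
    using assms(6) unfolding hilbert_ge_def by metis
  obtain q where q: "\<And>i. i < r' \<Longrightarrow> q i \<in> box_degree_le d'"
    and indq: "\<And>c. (\<And>z. z \<in> Y' \<Longrightarrow> (\<Sum>i<r'. c i * eval_poly (q i) z) = 0) \<Longrightarrow> \<forall>i<r'. c i = 0"
    using assms(7) unfolding hilbert_ge_def by metis
  \<comment> \<open>On \<open>Y\<close> the second block vanishes with \<open>f\<close>, so the
    coefficients of the first block are zero. What remains is \<open>f\<close> times a combination
    of the \<open>q\<close>, and primality of \<open>Y'\<close> cancels \<open>f\<close>.\<close>
  define u where "u = (\<lambda>i. if i < r then p i else q (i - r) * f)"
  have "u i \<in> box_degree_le (d' + e)" if "i < r + r'" for i
    using that p q assms(3,8)
    by (auto simp: u_def intro: box_degree_le_mono box_degree_le_mult)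
  moreover have "\<forall>i<r + r'. c i = 0"
    if c: "\<And>z. z \<in> Y' \<Longrightarrow> (\<Sum>i<r + r'. c i * eval_poly (u i) z) = 0" for c
  proof -
    have eq: "(\<Sum>i<r + r'. c i * eval_poly (u i) z) = (\<Sum>i<r. c i * eval_poly (p i) z)
        + eval_poly f z * (\<Sum>i<r'. c (r + i) * eval_poly (q i) z)" for z
      unfolding sum_lessThan_add by (simp add: u_def eval_poly_mult sum_distrib_left mult_ac)
    have c1: "\<forall>i<r. c i = 0"
    proof (rule indp)
      fix z assume z: "z \<in> Y"
      then show "(\<Sum>i<r. c i * eval_poly (p i) z) = 0"
        using c[of z] assms(2) f0[OF z] by (auto simp: eq)
    qed
    define s where "s = (\<Sum>i<r'. poly_scale (c (r + i)) (q i))"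
    have "\<forall>z\<in>Y'. eval_poly f z * eval_poly s z = 0"
      using c c1 by (simp add: eq s_def eval_poly_sum)
    then have "\<forall>z\<in>Y'. eval_poly s z = 0"
      using assms(1) f1 unfolding prime_set_def by blast
    then have "\<forall>i<r'. c (r + i) = 0"
      by (intro indq) (simp add: s_def eval_poly_sum)
    show ?thesis
    proof (intro allI impI)
      fix i assume "i < r + r'"
      then show "c i = 0"
        using c1 \<open>\<forall>i<r'. c (r + i) = 0\<close>[rule_format, of "i - r"] by (cases "i < r") auto
    qed
  qed
  ultimately show ?thesis unfolding hilbert_ge_def by blast
qed

text \<open>Each step of a chain raises the growth exponent of the affine Hilbert function by one, and
  that of the whole space is its dimension.\<close>

lemma prime_chain_length:
  fixes Y :: "nat \<Rightarrow> ('n::finite \<Rightarrow> complex) set"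
  assumes pr: "\<And>i. i \<le> n \<Longrightarrow> prime_set (Y i)" and sub: "\<And>i. i < n \<Longrightarrow> Y i \<subseteq> Y (Suc i)"
    and sep: "\<And>i. i < n \<Longrightarrow> \<exists>f. (\<forall>z\<in>Y i. eval_poly f z = 0) \<and> (\<exists>z\<in>Y (Suc i). eval_poly f z \<noteq> 0)"
  shows "n \<le> CARD('n)"
proof -
  have "\<exists>e. \<forall>d. hilbert_ge (Y j) (e * d) (d ^ j)" if "j \<le> n" for j
    using that
  proof (induction j)
    case 0
    obtain z where z: "z \<in> Y 0" using pr[of 0] by (auto simp: prime_set_def)
    have "(1 :: 'n mpoly) \<in> box_degree_le 0" by (simp add: box_degree_le_def)
    then have "hilbert_ge (Y 0) 0 1"
      unfolding hilbert_ge_def using z by (intro exI[of _ "\<lambda>_. 1"]) auto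
    then show ?case by (intro exI[of _ 0]) simp
  next
    case (Suc j)
    then obtain e where e: "\<And>d. hilbert_ge (Y j) (e * d) (d ^ j)" by auto
    obtain f where f: "\<And>z. z \<in> Y j \<Longrightarrow> eval_poly f z = 0" "\<exists>z\<in>Y (Suc j). eval_poly f z \<noteq> 0"
      using sep[of j] Suc.prems by auto
    obtain e' where e': "f \<in> box_degree_le e'" using box_degree_le_exists by blast
    \<comment> \<open>Multiplication by \<open>f\<close> is iterated \<open>k\<close> times at fixed
      \<open>d\<close>. Taking \<open>k = d\<close> gives \<open>d * d ^ j\<close> independent
      functions of degree \<open>(e + e') * d\<close>, one power of \<open>d\<close> more than for
      \<open>Y j\<close>.\<close>
    have "hilbert_ge (Y (Suc j)) (e * d + k * e') (k * d ^ j)" for d k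
    proof (induction k)
      case 0 then show ?case by (simp add: hilbert_ge_def)
    next
      case (Suc k)
      have "hilbert_ge (Y (Suc j)) ((e * d + k * e') + e') (d ^ j + k * d ^ j)"
        by (rule hilbert_ge_step[OF _ _ e' f e Suc.IH])
          (use pr sub Suc.prems \<open>Suc j \<le> n\<close> in auto)
      then show ?case by (simp add: algebra_simps)
    qed
    from this[where k = d and d = d for d] show ?case
      by (intro exI[of _ "e + e'"]) (simp add: algebra_simps)
  qed
  then obtain e where "\<And>d. hilbert_ge (Y n) (e * d) (d ^ n)" by blast
  then have bound: "d ^ n \<le> (e * d + 1) ^ CARD('n)" for d
    using hilbert_ge_bound by blast
  show ?thesis
  proof (rule ccontr)
    assume "\<not> ?thesis"
    then have n: "Suc CARD('n) \<le> n" by simp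
    \<comment> \<open>Just above the constant on the right, so that
      \<open>d * d ^ CARD('n) \<le> (e + 1) ^ CARD('n) * d ^ CARD('n)\<close> becomes
      impossible.\<close>
    define d where "d = (e + 1) ^ CARD('n) + 1"
    have "d \<ge> 1" by (simp add: d_def)
    have "d * d ^ CARD('n) \<le> d ^ n"
      using power_increasing[OF n \<open>d \<ge> 1\<close>] by simp
    also have "\<dots> \<le> (e * d + 1) ^ CARD('n)" by (rule bound)
    also have "\<dots> \<le> ((e + 1) * d) ^ CARD('n)"
      using \<open>d \<ge> 1\<close> by (intro power_mono) auto
    also have "\<dots> = (e + 1) ^ CARD('n) * d ^ CARD('n)" by (rule power_mult_distrib)
    finally have "d * d ^ CARD('n) \<le> (e + 1) ^ CARD('n) * d ^ CARD('n)" .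
    then have "d \<le> (e + 1) ^ CARD('n)" using \<open>d \<ge> 1\<close> by simp
    then show False by (simp add: d_def)
  qed
qed

lemma prime_set_coordinate_subspace: "prime_set {z :: 'n \<Rightarrow> complex. \<forall>i\<in>A. z i = 0}"
  unfolding prime_set_def
proof (intro conjI allI impI)
  show "{z :: 'n \<Rightarrow> complex. \<forall>i\<in>A. z i = 0} \<noteq> {}" by (auto intro: exI[of _ "\<lambda>_. 0"])
  fix f g :: "'n mpoly"
  assume fg: "\<forall>z\<in>{z. \<forall>i\<in>A. z i = 0}. eval_poly f z * eval_poly g z = 0"
  show "(\<forall>z\<in>{z. \<forall>i\<in>A. z i = 0}. eval_poly f z = 0) \<or> (\<forall>z\<in>{z. \<forall>i\<in>A. z i = 0}. eval_poly g z = 0)"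
  proof (rule ccontr)
    assume "\<not> ?thesis"
    then obtain x y where xy: "\<forall>i\<in>A. x i = 0" "eval_poly f x \<noteq> 0" "\<forall>i\<in>A. y i = 0" "eval_poly g y \<noteq> 0"
      by auto
    obtain t where "eval_poly f (\<lambda>i. x i + t * (y i - x i)) * eval_poly g (\<lambda>i. x i + t * (y i - x i)) \<noteq> 0"
      using polyfun_mult_nonzero[of "eval_poly f" "eval_poly g" x y] xy by auto
    moreover have "\<forall>i\<in>A. x i + t * (y i - x i) = 0" using xy by auto
    ultimately show False using fg by auto
  qed
qed

section \<open>Charts of the Grassmannian\<close>

lemma ideal_imp_subspace: "mpoly_ideal.subspace I \<Longrightarrow> mpoly_vs.subspace I"
  by (simp add: mpoly_ideal.subspace_def mpoly_vs.subspace_def poly_scale_def)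

lemma finite_monomial_subset: "B \<subseteq> monomials m \<Longrightarrow> finite (B :: ('v::finite \<Rightarrow>\<^sub>0 nat) set)"
  using finite_subset finite_monomials by blast

lemma subspace_sub: "mpoly_vs.subspace I \<Longrightarrow> f \<in> I \<Longrightarrow> g \<in> I \<Longrightarrow> f - g \<in> I"
  by (rule mpoly_vs.subspace_diff)

lemma chart_expands:
  assumes "I \<in> chart m B" "\<mu> \<in> monomials m"
  shows "expands B I \<mu> (\<lambda>b. chart_coord m B I (\<mu>, b))"
proof -
  have "\<exists>!c. expands B I \<mu> c" using assms by (simp add: chart_def)
  then have "expands B I \<mu> (THE c. expands B I \<mu> c)" by (rule theI')
  then show ?thesis using assms(2) by (simp add: chart_coord_def)
qed

lemma chart_coord_unique:
  assumes "I \<in> chart m B" "\<mu> \<in> monomials m" "expands B I \<mu> c"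
  shows "chart_coord m B I (\<mu>, b) = c b"
proof -
  have "\<exists>!c. expands B I \<mu> c" using assms(1,2) by (simp add: chart_def)
  then have "(THE c. expands B I \<mu> c) = c" using assms(3) by (metis the1_equality)
  then show ?thesis using assms(2) by (simp add: chart_coord_def)
qed

lemma chart_coord_0 [simp]: "\<mu> \<notin> monomials m \<Longrightarrow> chart_coord m B I (\<mu>, b) = 0"
  by (simp add: chart_coord_def)

lemma chart_coord_outside: "I \<in> chart m B \<Longrightarrow> b \<notin> B \<Longrightarrow> chart_coord m B I (\<mu>, b) = 0"
  using chart_expands[of I m B \<mu>] by (cases "\<mu> \<in> monomials m") (auto simp: expands_def)

text \<open>Independence is hidden in the uniqueness of expansions: a relation added to the
  expansion of any one monomial gives a second expansion of it.\<close>

lemma chart_independent: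
  fixes B :: "('v \<Rightarrow>\<^sub>0 nat) set"
  assumes I: "I \<in> chart m B" "mpoly_vs.subspace I" and c: "(\<Sum>b\<in>B. Poly_Mapping.single b (c b)) \<in> I"
    and b: "b \<in> B"
  shows "c b = 0"
proof -
  obtain \<mu> :: "'v \<Rightarrow>\<^sub>0 nat" where \<mu>: "\<mu> \<in> monomials m" using monomials_nonempty by blast
  let ?d = "\<lambda>b. chart_coord m B I (\<mu>, b)"
  have d: "expands B I \<mu> ?d" by (rule chart_expands[OF I(1) \<mu>])
  have "expands B I \<mu> (\<lambda>b. ?d b - (if b \<in> B then c b else 0))"
  proof -
    have "(\<Sum>b\<in>B. Poly_Mapping.single b (?d b - (if b \<in> B then c b else 0)))
      = (\<Sum>b\<in>B. Poly_Mapping.single b (?d b)) - (\<Sum>b\<in>B. Poly_Mapping.single b (c b))"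
      by (simp add: single_diff sum_subtractf)
    then have eq: "Poly_Mapping.single \<mu> 1 - (\<Sum>b\<in>B. Poly_Mapping.single b (?d b - (if b \<in> B then c b else 0)))
      = (Poly_Mapping.single \<mu> 1 - (\<Sum>b\<in>B. Poly_Mapping.single b (?d b))) + (\<Sum>b\<in>B. Poly_Mapping.single b (c b))"
      by simp
    have "(Poly_Mapping.single \<mu> 1 - (\<Sum>b\<in>B. Poly_Mapping.single b (?d b))) + (\<Sum>b\<in>B. Poly_Mapping.single b (c b)) \<in> I"
      using d by (intro mpoly_vs.subspace_add[OF I(2) _ c]) (simp add: expands_def)
    then show ?thesis
      using d unfolding expands_def eq by simp
  qed
  from chart_coord_unique[OF I(1) \<mu> this, of b] b show ?thesis by simp
qed

lemma chart_intro:
  assumes "mpoly_vs.subspace I"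
    and ex: "\<And>\<mu>. \<mu> \<in> monomials m \<Longrightarrow> \<exists>c. expands B I \<mu> c"
    and ind: "\<And>c b. (\<Sum>b\<in>B. Poly_Mapping.single b (c b)) \<in> I \<Longrightarrow> b \<in> B \<Longrightarrow> c b = 0"
  shows "I \<in> chart m B"
proof -
  have "c = d" if "expands B I \<mu> c" "expands B I \<mu> d" for \<mu> c d
  proof -
    have "(\<Sum>b\<in>B. Poly_Mapping.single b (c b - d b)) =
      (Poly_Mapping.single \<mu> 1 - (\<Sum>b\<in>B. Poly_Mapping.single b (d b))) -
      (Poly_Mapping.single \<mu> 1 - (\<Sum>b\<in>B. Poly_Mapping.single b (c b)))"
      by (simp add: single_diff sum_subtractf)
    also have "\<dots> \<in> I"
      by (rule subspace_sub[OF assms(1)]) (use that in \<open>auto simp: expands_def\<close>)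
    finally have sum: "(\<Sum>b\<in>B. Poly_Mapping.single b (c b - d b)) \<in> I" .
    have "c b - d b = 0" if "b \<in> B" for b by (rule ind[OF sum that])
    then show "c = d" using that by (intro ext) (metis expands_def right_minus_eq)
  qed
  then show ?thesis
    unfolding chart_def by (intro CollectI ballI ex_ex1I ex)
qed

lemma chart_reduce:
  fixes f :: "'v::finite mpoly"
  assumes "I \<in> chart m B" "mpoly_vs.subspace I" "f \<in> forms m"
  shows "f - (\<Sum>b\<in>B. Poly_Mapping.single b (\<Sum>\<mu>\<in>monomials m. Poly_Mapping.lookup f \<mu> * chart_coord m B I (\<mu>, b))) \<in> I"
proof -
  have single_sum: "Poly_Mapping.single b (\<Sum>\<mu>\<in>A. h \<mu>) = (\<Sum>\<mu>\<in>A. Poly_Mapping.single b (h \<mu>))"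
    for b :: "'v \<Rightarrow>\<^sub>0 nat" and h :: "('v \<Rightarrow>\<^sub>0 nat) \<Rightarrow> complex" and A
    by (induction A rule: infinite_finite_induct) (simp_all add: single_add)
  have "(\<Sum>\<mu>\<in>monomials m. poly_scale (Poly_Mapping.lookup f \<mu>)
     (Poly_Mapping.single \<mu> 1 - (\<Sum>b\<in>B. Poly_Mapping.single b (chart_coord m B I (\<mu>, b))))) \<in> I"
    using chart_expands[OF assms(1)]
    by (intro mpoly_vs.subspace_sum[OF assms(2)] mpoly_vs.subspace_scale[OF assms(2)])
      (auto simp: expands_def)
  also have "(\<Sum>\<mu>\<in>monomials m. poly_scale (Poly_Mapping.lookup f \<mu>)
     (Poly_Mapping.single \<mu> 1 - (\<Sum>b\<in>B. Poly_Mapping.single b (chart_coord m B I (\<mu>, b)))))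
    = f - (\<Sum>b\<in>B. Poly_Mapping.single b (\<Sum>\<mu>\<in>monomials m. Poly_Mapping.lookup f \<mu> * chart_coord m B I (\<mu>, b)))"
    unfolding single_sum using forms_expand[OF assms(3)]
    by (subst sum.swap)
      (simp add: mpoly_vs.scale_right_diff_distrib mpoly_vs.scale_sum_right sum_subtractf)
  finally show ?thesis .
qed

lemma chart_mem_iff:
  fixes f :: "'v::finite mpoly"
  assumes "I \<in> chart m B" "mpoly_vs.subspace I" "f \<in> forms m"
  shows "f \<in> I \<longleftrightarrow> (\<forall>b\<in>B. (\<Sum>\<mu>\<in>monomials m. Poly_Mapping.lookup f \<mu> * chart_coord m B I (\<mu>, b)) = 0)"
proof
  assume "f \<in> I"
  from subspace_sub[OF assms(2) this chart_reduce[OF assms]]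
  have *: "(\<Sum>b\<in>B. Poly_Mapping.single b (\<Sum>\<mu>\<in>monomials m. Poly_Mapping.lookup f \<mu> * chart_coord m B I (\<mu>, b))) \<in> I"
    by simp
  show "\<forall>b\<in>B. (\<Sum>\<mu>\<in>monomials m. Poly_Mapping.lookup f \<mu> * chart_coord m B I (\<mu>, b)) = 0"
    by (intro ballI chart_independent[OF assms(1,2) *])
next
  assume "\<forall>b\<in>B. (\<Sum>\<mu>\<in>monomials m. Poly_Mapping.lookup f \<mu> * chart_coord m B I (\<mu>, b)) = 0"
  then show "f \<in> I" using chart_reduce[OF assms] by simp
qed

lemma expands_basis:
  assumes "finite B" "b \<in> B" "mpoly_vs.subspace I"
  shows "expands B I b (\<lambda>b'. if b' = b then 1 else 0)"
proof -
  have "(\<Sum>b'\<in>B. Poly_Mapping.single b' (if b' = b then 1 else 0 :: complex)) = (\<Sum>b'\<in>{b}. Poly_Mapping.single b' 1)"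
    using assms by (intro sum.mono_neutral_cong_right) auto
  then show ?thesis using assms(2,3) by (auto simp: expands_def mpoly_vs.subspace_0)
qed

section \<open>Change of chart\<close>

text \<open>One step of Gauss-Jordan elimination: \<open>b'\<close> enters the basis,
  \<open>b\<close> leaves it, and the entry at \<open>(b', b)\<close> is the pivot and the only
  denominator of the new coordinates.\<close>

lemma chart_exchange:
  fixes B :: "('v::finite \<Rightarrow>\<^sub>0 nat) set"
  assumes B: "B \<subseteq> monomials m" and I: "I \<in> chart m B" "mpoly_vs.subspace I"
    and b': "b' \<in> monomials m" "b' \<notin> B" and b: "b \<in> B" "chart_coord m B I (b', b) \<noteq> 0"
  shows "I \<in> chart m (insert b' (B - {b}))" (is "_ \<in> chart m ?B'")
    and "chart_coord m (insert b' (B - {b})) I (\<mu>, \<beta>) =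
      (if \<beta> = b' then chart_coord m B I (\<mu>, b) / chart_coord m B I (b', b)
       else if \<beta> \<in> B - {b} then chart_coord m B I (\<mu>, \<beta>)
         - chart_coord m B I (\<mu>, b) * chart_coord m B I (b', \<beta>) / chart_coord m B I (b', b) else 0)"
proof -
  let ?y = "\<lambda>\<mu> b. chart_coord m B I (\<mu>, b)"
  let ?z = "\<lambda>\<mu> \<beta>. if \<beta> = b' then ?y \<mu> b / ?y b' b
       else if \<beta> \<in> B - {b} then ?y \<mu> \<beta> - ?y \<mu> b * ?y b' \<beta> / ?y b' b else 0"
  have fin: "finite B" using B by (rule finite_monomial_subset)
  have split: "(\<Sum>\<beta>\<in>?B'. Poly_Mapping.single \<beta> (h \<beta>)) = Poly_Mapping.single b' (h b')
      + (\<Sum>\<beta>\<in>B - {b}. Poly_Mapping.single \<beta> (h \<beta>))" for h :: "_ \<Rightarrow> complex"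
    using fin b'(2) by simp
  have splitB: "(\<Sum>\<beta>\<in>B. Poly_Mapping.single \<beta> (h \<beta>)) = Poly_Mapping.single b (h b)
      + (\<Sum>\<beta>\<in>B - {b}. Poly_Mapping.single \<beta> (h \<beta>))" for h :: "_ \<Rightarrow> complex"
    using fin b(1) by (rule sum.remove)
  have red: "Poly_Mapping.single \<mu> 1 - (\<Sum>\<beta>\<in>B. Poly_Mapping.single \<beta> (?y \<mu> \<beta>)) \<in> I"
    if "\<mu> \<in> monomials m" for \<mu>
    using chart_expands[OF I(1) that] by (simp add: expands_def)
  have exp: "expands ?B' I \<mu> (?z \<mu>)" if \<mu>: "\<mu> \<in> monomials m" for \<mu>
  proof -
    let ?r = "?y \<mu> b / ?y b' b"
    have "(Poly_Mapping.single \<mu> 1 - (\<Sum>\<beta>\<in>B. Poly_Mapping.single \<beta> (?y \<mu> \<beta>)))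
        - poly_scale ?r (Poly_Mapping.single b' 1 - (\<Sum>\<beta>\<in>B. Poly_Mapping.single \<beta> (?y b' \<beta>))) \<in> I"
      by (rule subspace_sub[OF I(2) red[OF \<mu>] mpoly_vs.subspace_scale[OF I(2) red[OF b'(1)]]])
    also have "(Poly_Mapping.single \<mu> 1 - (\<Sum>\<beta>\<in>B. Poly_Mapping.single \<beta> (?y \<mu> \<beta>)))
        - poly_scale ?r (Poly_Mapping.single b' 1 - (\<Sum>\<beta>\<in>B. Poly_Mapping.single \<beta> (?y b' \<beta>)))
      = Poly_Mapping.single \<mu> 1 - (\<Sum>\<beta>\<in>?B'. Poly_Mapping.single \<beta> (?z \<mu> \<beta>))"
    proof -
      have "(\<Sum>\<beta>\<in>B - {b}. Poly_Mapping.single \<beta> (?z \<mu> \<beta>)) =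
        (\<Sum>\<beta>\<in>B - {b}. Poly_Mapping.single \<beta> (?y \<mu> \<beta>) - Poly_Mapping.single \<beta> (?r * ?y b' \<beta>))"
        using b'(2) by (intro sum.cong) (auto simp: single_diff)
      then have "(\<Sum>\<beta>\<in>?B'. Poly_Mapping.single \<beta> (?z \<mu> \<beta>)) = Poly_Mapping.single b' ?r
        + ((\<Sum>\<beta>\<in>B - {b}. Poly_Mapping.single \<beta> (?y \<mu> \<beta>)) - (\<Sum>\<beta>\<in>B - {b}. Poly_Mapping.single \<beta> (?r * ?y b' \<beta>)))"
        unfolding split by (simp add: sum_subtractf)
      moreover have "poly_scale ?r (\<Sum>\<beta>\<in>B. Poly_Mapping.single \<beta> (?y b' \<beta>))
        = Poly_Mapping.single b (?y \<mu> b) + (\<Sum>\<beta>\<in>B - {b}. Poly_Mapping.single \<beta> (?r * ?y b' \<beta>))"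
        unfolding splitB using b(2) by (simp add: mpoly_vs.scale_right_distrib mpoly_vs.scale_sum_right)
      ultimately show ?thesis
        unfolding splitB by (simp add: mpoly_vs.scale_right_diff_distrib)
    qed
    finally show ?thesis by (auto simp: expands_def)
  qed
  show chart': "I \<in> chart m ?B'"
  proof (rule chart_intro[OF I(2)])
    show "\<exists>c. expands ?B' I \<mu> c" if "\<mu> \<in> monomials m" for \<mu> using exp[OF that] by blast
    fix c \<beta> assume c: "(\<Sum>\<beta>\<in>?B'. Poly_Mapping.single \<beta> (c \<beta>)) \<in> I" and \<beta>: "\<beta> \<in> ?B'"
    have "(\<Sum>\<beta>\<in>?B'. Poly_Mapping.single \<beta> (c \<beta>))
        - poly_scale (c b') (Poly_Mapping.single b' 1 - (\<Sum>\<beta>\<in>B. Poly_Mapping.single \<beta> (?y b' \<beta>))) \<in> I"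
      by (rule subspace_sub[OF I(2) c mpoly_vs.subspace_scale[OF I(2) red[OF b'(1)]]])
    also have "(\<Sum>\<beta>\<in>?B'. Poly_Mapping.single \<beta> (c \<beta>))
        - poly_scale (c b') (Poly_Mapping.single b' 1 - (\<Sum>\<beta>\<in>B. Poly_Mapping.single \<beta> (?y b' \<beta>)))
      = (\<Sum>\<beta>\<in>B. Poly_Mapping.single \<beta> ((if \<beta> = b then 0 else c \<beta>) + c b' * ?y b' \<beta>))"
      unfolding split splitB
      by (simp add: mpoly_vs.scale_right_distrib mpoly_vs.scale_right_diff_distrib
          mpoly_vs.scale_sum_right single_add sum.distrib)
    finally have sum: "(\<Sum>\<beta>\<in>B. Poly_Mapping.single \<beta> ((if \<beta> = b then 0 else c \<beta>) + c b' * ?y b' \<beta>)) \<in> I" .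
    have 0: "(if \<beta> = b then 0 else c \<beta>) + c b' * ?y b' \<beta> = 0" if "\<beta> \<in> B" for \<beta>
      by (rule chart_independent[OF I sum that])
    have "c b' = 0" using 0[OF b(1)] b(2) by simp
    then show "c \<beta> = 0" using 0[of \<beta>] \<beta> by auto
  qed
  show "chart_coord m ?B' I (\<mu>, \<beta>) = ?z \<mu> \<beta>"
  proof (cases "\<mu> \<in> monomials m")
    case True
    show ?thesis by (rule chart_coord_unique[OF chart' True exp[OF True]])
  qed simp
qed

text \<open>If the coordinates \<open>y'\<close> are fractions in \<open>y\<close> with denominator
  \<open>D\<close>, a power of \<open>D\<close> turns a polynomial in \<open>y'\<close> into one in
  \<open>y\<close>. The relation \<open>P\<close> stands for a partially defined change of
  chart.\<close>

lemma clear_denominators: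
  assumes "\<And>y y'. P y y' \<Longrightarrow> \<forall>k. eval_poly D y * y' k = eval_poly (G k) y"
  shows "\<exists>N g. \<forall>y y'. P y y' \<longrightarrow> eval_poly D y ^ N * eval_poly f y' = eval_poly g y"
proof (induction f rule: mpoly_induct)
  case (const c)
  show ?case by (rule exI[of _ 0], rule exI[of _ "Poly_Mapping.single 0 c"]) (simp add: eval_poly_single)
next
  case (Var i)
  show ?case by (rule exI[of _ 1], rule exI[of _ "G i"]) (use assms in simp)
next
  case (add f g)
  then obtain N M p q where
    1: "\<And>y y'. P y y' \<Longrightarrow> eval_poly D y ^ N * eval_poly f y' = eval_poly p y" and
    2: "\<And>y y'. P y y' \<Longrightarrow> eval_poly D y ^ M * eval_poly g y' = eval_poly q y" by blast
  show ?case
  proof (intro exI allI impI)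
    fix y y' assume P: "P y y'"
    show "eval_poly D y ^ (N + M) * eval_poly (f + g) y' = eval_poly (D ^ M * p + D ^ N * q) y"
      by (simp add: eval_poly_simps power_add 1[OF P, symmetric] 2[OF P, symmetric] algebra_simps)
  qed
next
  case (mult f g)
  then obtain N M p q where
    1: "\<And>y y'. P y y' \<Longrightarrow> eval_poly D y ^ N * eval_poly f y' = eval_poly p y" and
    2: "\<And>y y'. P y y' \<Longrightarrow> eval_poly D y ^ M * eval_poly g y' = eval_poly q y" by blast
  show ?case
  proof (intro exI allI impI)
    fix y y' assume P: "P y y'"
    show "eval_poly D y ^ (N + M) * eval_poly (f * g) y' = eval_poly (p * q) y"
      by (simp add: eval_poly_simps power_add 1[OF P, symmetric] 2[OF P, symmetric] algebra_simps)
  qed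
qed

text \<open>Openness may be tested in a single chart around each point: any two charts are connected by
  exchanging one basis monomial at a time.\<close>

lemma open_condition_transfer:
  fixes H :: "'v::finite mpoly set set"
  assumes H: "\<And>I. I \<in> H \<Longrightarrow> mpoly_vs.subspace I" and I0: "I0 \<in> H"
    and B0: "B0 \<subseteq> monomials m" "I0 \<in> chart m B0"
    and f: "eval_poly f (chart_coord m B0 I0) \<noteq> 0"
      "\<And>I. I \<in> H \<Longrightarrow> I \<in> chart m B0 \<Longrightarrow> eval_poly f (chart_coord m B0 I) \<noteq> 0 \<Longrightarrow> I \<in> U"
    and B: "B \<subseteq> monomials m" "I0 \<in> chart m B"
  shows "\<exists>g. eval_poly g (chart_coord m B I0) \<noteq> 0 \<and>
    (\<forall>I\<in>H \<inter> chart m B. eval_poly g (chart_coord m B I) \<noteq> 0 \<longrightarrow> I \<in> U)"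
  using B
proof (induction "card (B0 - B)" arbitrary: B)
  case 0
  have fin: "finite B0" "finite B"
    using B0(1) 0(2) by (auto intro: finite_monomial_subset)
  then have sub: "B0 \<subseteq> B" using 0(1) by auto
  \<comment> \<open>An element of \<open>B\<close> outside \<open>B0\<close> would be a combination
    of \<open>B0\<close>, hence of other elements of \<open>B\<close>; so the two bases
    agree.\<close>
  have "b \<in> B0" if b: "b \<in> B" for b
  proof (rule ccontr)
    assume nb: "b \<notin> B0"
    let ?y = "\<lambda>\<beta>. chart_coord m B0 I0 (b, \<beta>)"
    have "Poly_Mapping.single b 1 - (\<Sum>\<beta>\<in>B0. Poly_Mapping.single \<beta> (?y \<beta>)) \<in> I0"
      using chart_expands[OF B0(2), of b] b 0(2) by (auto simp: expands_def)
    also have "(\<Sum>\<beta>\<in>B0. Poly_Mapping.single \<beta> (?y \<beta>)) = (\<Sum>\<beta>\<in>B. Poly_Mapping.single \<beta> (?y \<beta>))"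
      using sub fin chart_coord_outside[OF B0(2)] by (intro sum.mono_neutral_left) auto
    also have "Poly_Mapping.single b 1 = (\<Sum>\<beta>\<in>B. Poly_Mapping.single \<beta> (if \<beta> = b then 1 else 0 :: complex))"
      using fin b by (subst sum.remove[of B b]) auto
    also have "(\<Sum>\<beta>\<in>B. Poly_Mapping.single \<beta> (if \<beta> = b then 1 else 0)) - (\<Sum>\<beta>\<in>B. Poly_Mapping.single \<beta> (?y \<beta>))
      = (\<Sum>\<beta>\<in>B. Poly_Mapping.single \<beta> ((if \<beta> = b then 1 else 0) - ?y \<beta>))"
      by (simp add: single_diff sum_subtractf)
    finally have "1 - ?y b = 0"
      using chart_independent[OF 0(3) H[OF I0], of "\<lambda>\<beta>. (if \<beta> = b then 1 else 0) - ?y \<beta>" b] b by simp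
    then show False using chart_coord_outside[OF B0(2) nb, of b] by simp
  qed
  then have "B = B0" using sub by blast
  then show ?case using f by blast
next
  case (Suc n)
  have fin: "finite B0" "finite B"
    using B0(1) Suc(3) by (auto intro: finite_monomial_subset)
  have "B0 - B \<noteq> {}" using Suc(2) by (metis card.empty Zero_not_Suc)
  then obtain b' where b': "b' \<in> B0" "b' \<notin> B" by blast
  then have b'm: "b' \<in> monomials m" using B0(1) by blast
  \<comment> \<open>Steinitz exchange: if no such \<open>b\<close> existed, the expansion of
    \<open>b'\<close> would use only \<open>B \<inter> B0\<close>, contradicting the independence of
    \<open>B0\<close>.\<close>
  have "\<exists>b\<in>B - B0. chart_coord m B I0 (b', b) \<noteq> 0"
  proof (rule ccontr)
    assume none: "\<not> ?thesis"
    let ?y = "\<lambda>\<beta>. chart_coord m B I0 (b', \<beta>)"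
    have "Poly_Mapping.single b' 1 - (\<Sum>\<beta>\<in>B. Poly_Mapping.single \<beta> (?y \<beta>)) \<in> I0"
      using chart_expands[OF Suc(4) b'm] by (auto simp: expands_def)
    also have "(\<Sum>\<beta>\<in>B. Poly_Mapping.single \<beta> (?y \<beta>)) = (\<Sum>\<beta>\<in>B \<inter> B0. Poly_Mapping.single \<beta> (?y \<beta>))"
      using none fin by (intro sum.mono_neutral_right) auto
    also have "\<dots> = (\<Sum>\<beta>\<in>B0. Poly_Mapping.single \<beta> (?y \<beta>))"
    proof (rule sum.mono_neutral_left)
      show "\<forall>\<beta>\<in>B0 - B \<inter> B0. Poly_Mapping.single \<beta> (?y \<beta>) = 0"
      proof
        fix \<beta> assume "\<beta> \<in> B0 - B \<inter> B0"
        then have "\<beta> \<notin> B" by blast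
        then show "Poly_Mapping.single \<beta> (?y \<beta>) = 0"
          using chart_coord_outside[OF Suc(4)] by simp
      qed
    qed (use fin in auto)
    also have "Poly_Mapping.single b' 1 = (\<Sum>\<beta>\<in>B0. Poly_Mapping.single \<beta> (if \<beta> = b' then 1 else 0 :: complex))"
      using fin b' by (subst sum.remove[of B0 b']) auto
    also have "(\<Sum>\<beta>\<in>B0. Poly_Mapping.single \<beta> (if \<beta> = b' then 1 else 0)) - (\<Sum>\<beta>\<in>B0. Poly_Mapping.single \<beta> (?y \<beta>))
      = (\<Sum>\<beta>\<in>B0. Poly_Mapping.single \<beta> ((if \<beta> = b' then 1 else 0) - ?y \<beta>))"
      by (simp add: single_diff sum_subtractf)
    finally have "1 - ?y b' = 0"
      using chart_independent[OF B0(2) H[OF I0], of "\<lambda>\<beta>. (if \<beta> = b' then 1 else 0) - ?y \<beta>" b'] b' by simp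
    then show False using chart_coord_outside[OF Suc(4) b'(2), of b'] by simp
  qed
  then obtain b where b: "b \<in> B" "b \<notin> B0" "chart_coord m B I0 (b', b) \<noteq> 0" by blast
  define B' where "B' = insert b' (B - {b})"
  have "B0 - B = insert b' (B0 - B')" using b b' by (auto simp: B'_def)
  then have card: "n = card (B0 - B')" using Suc(2) fin by (simp add: B'_def)
  have B': "B' \<subseteq> monomials m" using Suc(3) b'm by (auto simp: B'_def)
  have "I0 \<in> chart m B'"
    unfolding B'_def by (rule chart_exchange[OF Suc(3,4) H[OF I0] b'm b'(2) b(1,3)])
  from Suc(1)[OF card B' this] obtain g where
    g: "eval_poly g (chart_coord m B' I0) \<noteq> 0"
      "\<And>I. I \<in> H \<Longrightarrow> I \<in> chart m B' \<Longrightarrow> eval_poly g (chart_coord m B' I) \<noteq> 0 \<Longrightarrow> I \<in> U" by blast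
  define D where "D = Var (b', b)"
  define P where "P y y' \<longleftrightarrow> (\<exists>I\<in>H. I \<in> chart m B \<and> chart_coord m B I (b', b) \<noteq> 0 \<and>
     y = chart_coord m B I \<and> y' = chart_coord m B' I)" for y y'
  define G where "G = (\<lambda>(\<mu>, \<beta>). if \<beta> = b' then Var (\<mu>, b)
      else if \<beta> \<in> B - {b} then D * Var (\<mu>, \<beta>) - Var (\<mu>, b) * Var (b', \<beta>) else 0)"
  have "\<forall>k. eval_poly D y * y' k = eval_poly (G k) y" if "P y y'" for y y'
  proof
    fix k :: "('v \<Rightarrow>\<^sub>0 nat) \<times> ('v \<Rightarrow>\<^sub>0 nat)"
    obtain \<mu> \<beta> where k: "k = (\<mu>, \<beta>)" by (cases k)
    from that obtain I where I: "I \<in> H" "I \<in> chart m B" "chart_coord m B I (b', b) \<noteq> 0"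
      "y = chart_coord m B I" "y' = chart_coord m B' I" unfolding P_def by blast
    show "eval_poly D y * y' k = eval_poly (G k) y"
      using I(3) unfolding I(4,5) k B'_def
        chart_exchange(2)[OF Suc(3) I(2) H[OF I(1)] b'm b'(2) b(1) I(3)]
      by (simp add: D_def G_def eval_poly_simps field_simps)
  qed
  then obtain N g' where g': "\<And>y y'. P y y' \<Longrightarrow> eval_poly D y ^ N * eval_poly g y' = eval_poly g' y"
    using clear_denominators[of P D G g] by blast
  have key: "eval_poly g' (chart_coord m B I) = chart_coord m B I (b', b) ^ N * eval_poly g (chart_coord m B' I)"
    if "I \<in> H" "I \<in> chart m B" "chart_coord m B I (b', b) \<noteq> 0" for I
  proof -
    have "P (chart_coord m B I) (chart_coord m B' I)" using that unfolding P_def by blast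
    from g'[OF this] show ?thesis by (simp add: D_def)
  qed
  show ?case
  proof (intro exI conjI ballI impI)
    \<comment> \<open>The factor \<open>D\<close> keeps the pivot nonzero, so that wherever the
      product is nonzero the ideal also lies in the chart of \<open>B'\<close>.\<close>
    show "eval_poly (D * g') (chart_coord m B I0) \<noteq> 0"
      using key[OF I0 Suc(4) b(3)] b(3) g(1) by (simp add: eval_poly_mult D_def)
    fix I assume I: "I \<in> H \<inter> chart m B" "eval_poly (D * g') (chart_coord m B I) \<noteq> 0"
    then have nz: "chart_coord m B I (b', b) \<noteq> 0" "eval_poly g' (chart_coord m B I) \<noteq> 0"
      by (auto simp: eval_poly_mult D_def)
    then have "eval_poly g (chart_coord m B' I) \<noteq> 0" using key[of I] I by auto
    moreover have "I \<in> chart m B'"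
      unfolding B'_def using chart_exchange(1)[OF Suc(3) _ H b'm b'(2) b(1) nz(1)] I by blast
    ultimately show "I \<in> U" using g(2) I by blast
  qed
qed

lemma zariski_open_local:
  fixes H :: "'v::finite mpoly set set"
  assumes H: "\<And>I. I \<in> H \<Longrightarrow> mpoly_vs.subspace I" and "U \<subseteq> H"
    and loc: "\<And>I0. I0 \<in> U \<Longrightarrow> \<exists>B f. B \<subseteq> monomials m \<and> I0 \<in> chart m B \<and>
      eval_poly f (chart_coord m B I0) \<noteq> 0 \<and>
      (\<forall>I\<in>H \<inter> chart m B. eval_poly f (chart_coord m B I) \<noteq> 0 \<longrightarrow> I \<in> U)"
  shows "zariski_open m H U"
  unfolding zariski_open_def
proof (intro conjI allI impI \<open>U \<subseteq> H\<close>)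
  fix B :: "('v \<Rightarrow>\<^sub>0 nat) set" assume B: "B \<subseteq> monomials m"
  \<comment> \<open>The largest possible family: all polynomials whose nonvanishing on this chart
    already forces membership in \<open>U\<close>.\<close>
  let ?F = "{g. \<forall>I\<in>H \<inter> chart m B. eval_poly g (chart_coord m B I) \<noteq> 0 \<longrightarrow> I \<in> U}"
  show "\<exists>F. \<forall>I\<in>H \<inter> chart m B. I \<in> U \<longleftrightarrow> (\<exists>f\<in>F. eval_poly f (chart_coord m B I) \<noteq> 0)"
  proof (intro exI[of _ ?F] ballI iffI)
    fix I0 assume I0: "I0 \<in> H \<inter> chart m B" "I0 \<in> U"
    obtain B0 f where f: "B0 \<subseteq> monomials m" "I0 \<in> chart m B0"
      "eval_poly f (chart_coord m B0 I0) \<noteq> 0"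
      "\<And>I. I \<in> H \<Longrightarrow> I \<in> chart m B0 \<Longrightarrow> eval_poly f (chart_coord m B0 I) \<noteq> 0 \<Longrightarrow> I \<in> U"
      using loc[OF I0(2)] by blast
    show "\<exists>f\<in>?F. eval_poly f (chart_coord m B I0) \<noteq> 0"
      using open_condition_transfer[OF H _ f B] I0 by blast
  qed blast
qed

lemma closedin_zariski_chart:
  assumes "closedin (zariski_topology m H) Z" "B \<subseteq> monomials m"
  obtains F where "\<And>I. I \<in> H \<Longrightarrow> I \<in> chart m B \<Longrightarrow>
    I \<in> Z \<longleftrightarrow> (\<forall>f\<in>F. eval_poly f (chart_coord m B I) = 0)"
proof -
  have "zariski_open m H (H - Z)"
    using assms(1) by (simp add: closedin_def topspace_zariski_topology openin_zariski_topology)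
  then obtain F where "\<forall>I\<in>H \<inter> chart m B.
     I \<in> H - Z \<longleftrightarrow> (\<exists>f\<in>F. eval_poly f (chart_coord m B I) \<noteq> 0)"
    unfolding zariski_open_def using assms(2) by meson
  then show ?thesis using that[of F] by blast
qed

section \<open>Varieties covered by affine spaces\<close>

lemma pdir_sum_direction: "pdir f x (\<lambda>i. \<Sum>j\<in>A. c j * v j i) = (\<Sum>j\<in>A. c j * pdir f x (v j))"
proof (induction A rule: infinite_finite_induct)
  case (insert j A)
  then show ?case using pdir_linear[of f x "c j" "v j" 1 "\<lambda>i. \<Sum>j\<in>A. c j * v j i"] by simp
next
  case empty
  show ?case using pdir_linear[of f x 0 "\<lambda>_. 0" 0 "\<lambda>_. 0"] by simp
next
  case (infinite A)
  then show ?case using pdir_linear[of f x 0 "\<lambda>_. 0" 0 "\<lambda>_. 0"] by simp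
qed

lemma sum_fun_apply: "(\<Sum>n\<in>A. f n) k = (\<Sum>n\<in>A. f n k)"
  for f :: "'a \<Rightarrow> 'b \<Rightarrow> 'c::comm_monoid_add"
  by (induction A rule: infinite_finite_induct) auto

text \<open>A polynomial left inverse makes the parametrization a closed embedding: the image is cut
  out by the equations \<open>y = \<Phi> (h y)\<close> and the differential is injective. The
  tangent space is the image of the differential, whose dimension is the number of
  parameters.\<close>

lemma dim_tangent_space_parametrized:
  fixes G :: "'k \<Rightarrow> 'n::finite mpoly" and h :: "'n \<Rightarrow> 'k mpoly"
  defines "\<Phi> \<equiv> \<lambda>z k. eval_poly (G k) z"
  assumes inv: "\<And>z n. eval_poly (h n) (\<Phi> z) = z n"
  shows "fun_vs.dim (tangent_space (range \<Phi>) (\<Phi> z0)) = CARD('n)"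
proof -
  define d where "d w = (\<lambda>k. pdir (G k) z0 w)" for w
  define e :: "'n \<Rightarrow> 'n \<Rightarrow> complex" where "e n = (\<lambda>i. if i = n then 1 else 0)" for n
  have curve: "((\<lambda>t. \<Phi> (\<lambda>i. z0 i + t * w i) k) has_field_derivative d w k) (at 0)" for w k
    unfolding \<Phi>_def d_def by (rule pdir_line_derivative)
  have chain: "((\<lambda>t. eval_poly f (\<Phi> (\<lambda>i. z0 i + t * w i))) has_field_derivative pdir f (\<Phi> z0) (d w)) (at 0)"
    for f w
    using eval_poly_curve_derivative[of "\<lambda>t. \<Phi> (\<lambda>i. z0 i + t * w i)", OF curve] by simp
  have tangent: "tangent_space (range \<Phi>) (\<Phi> z0) = range d"
  proof (intro equalityI subsetI)
    fix v assume v: "v \<in> tangent_space (range \<Phi>) (\<Phi> z0)"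
    define w where "w n = pdir (h n) (\<Phi> z0) v" for n
    have "v k = d w k" for k
    proof -
      \<comment> \<open>Differentiating this equation of the image along \<open>v\<close> shows that
        \<open>v\<close> is the differential applied to the derivative of \<open>h\<close> along
        \<open>v\<close>.\<close>
      have "polyfun (\<lambda>y. y k - eval_poly (G k) (\<lambda>n. eval_poly (h n) y))"
        by (intro polyfun_diff polyfun_coord polyfun_compose polyfun_eval)
      then obtain p where p: "\<And>y. eval_poly p y = y k - eval_poly (G k) (\<lambda>n. eval_poly (h n) y)"
        unfolding polyfun_def by metis
      have "p \<in> vanishing_ideal (range \<Phi>)"
        by (auto simp: vanishing_ideal_def p inv) (simp add: \<Phi>_def)
      then have "((\<lambda>t. eval_poly p (\<lambda>i. \<Phi> z0 i + t * v i)) has_field_derivative 0) (at 0)"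
        using v by (simp add: tangent_space_def)
      moreover have "((\<lambda>t. eval_poly (G k) (\<lambda>n. eval_poly (h n) (\<lambda>i. \<Phi> z0 i + t * v i)))
          has_field_derivative pdir (G k) (\<lambda>n. eval_poly (h n) (\<lambda>i. \<Phi> z0 i + 0 * v i)) w) (at 0)"
        unfolding w_def by (rule eval_poly_curve_derivative) (rule pdir_line_derivative)
      then have "((\<lambda>t. eval_poly p (\<lambda>i. \<Phi> z0 i + t * v i)) has_field_derivative v k - d w k) (at 0)"
        unfolding p d_def by (intro DERIV_diff line_derivative) (simp add: inv)
      ultimately have "0 = v k - d w k" by (rule DERIV_unique)
      then show ?thesis by simp
    qed
    then show "v \<in> range d" by blast
  next
    fix v assume "v \<in> range d"
    then obtain w where v: "v = d w" by blast
    show "v \<in> tangent_space (range \<Phi>) (\<Phi> z0)"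
      unfolding tangent_space_def
    proof safe
      fix f assume f: "f \<in> vanishing_ideal (range \<Phi>)"
      have "((\<lambda>t. 0) has_field_derivative pdir f (\<Phi> z0) (d w)) (at (0::complex))"
        using chain[of f w] f by (simp add: vanishing_ideal_def)
      from DERIV_unique[OF this DERIV_const] have "pdir f (\<Phi> z0) v = 0" using v by simp
      then show "((\<lambda>t. eval_poly f (\<lambda>i. \<Phi> z0 i + t * v i)) has_field_derivative 0) (at 0)"
        using pdir_line_derivative by metis
    qed
  qed
  have expand: "d w = (\<Sum>n\<in>UNIV. fun_scale (w n) (d (e n)))" for w
  proof
    fix k
    have "w = (\<lambda>i. \<Sum>n\<in>UNIV. w n * e n i)" by (simp add: e_def if_distrib cong: if_cong)
    then have "d w k = pdir (G k) z0 (\<lambda>i. \<Sum>n\<in>UNIV. w n * e n i)" by (simp add: d_def)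
    also have "\<dots> = (\<Sum>n\<in>UNIV. w n * d (e n) k)" by (simp add: pdir_sum_direction d_def)
    finally show "d w k = (\<Sum>n\<in>UNIV. fun_scale (w n) (d (e n))) k"
      by (simp add: fun_scale_def sum_fun_apply)
  qed
  have left: "pdir (h n) (\<Phi> z0) (d w) = w n" for n w
    using DERIV_unique[OF chain[of "h n" w, unfolded inv] line_derivative] .
  have inj_d: "inj d" using left by (intro injI) (metis ext)
  have inj_e: "inj e" by (rule injI) (metis e_def zero_neq_one)
  have inj: "inj (\<lambda>n. d (e n))"
    using inj_d inj_e by (simp add: inj_def)
  show ?thesis
  proof (rule fun_vs.dim_unique)
    show "range (\<lambda>n. d (e n)) \<subseteq> tangent_space (range \<Phi>) (\<Phi> z0)" unfolding tangent by blast
    show "tangent_space (range \<Phi>) (\<Phi> z0) \<subseteq> fun_vs.span (range (\<lambda>n. d (e n)))"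
    proof
      fix v assume "v \<in> tangent_space (range \<Phi>) (\<Phi> z0)"
      then obtain w where "v = (\<Sum>n\<in>UNIV. fun_scale (w n) (d (e n)))"
        unfolding tangent using expand by blast
      moreover have "fun_scale (w n) (d (e n)) \<in> fun_vs.span (range (\<lambda>n. d (e n)))" for n
        by (rule fun_vs.span_scale[OF fun_vs.span_base]) blast
      ultimately show "v \<in> fun_vs.span (range (\<lambda>n. d (e n)))"
        by (simp add: fun_vs.span_sum)
    qed
    show "fun_vs.independent (range (\<lambda>n. d (e n)))"
    proof (rule fun_vs.independent_if_scalars_zero)
      fix f v assume 0: "(\<Sum>x\<in>range (\<lambda>n. d (e n)). fun_scale (f x) x) = 0" and v: "v \<in> range (\<lambda>n. d (e n))"
      have "(\<Sum>x\<in>range (\<lambda>n. d (e n)). fun_scale (f x) x) = d (\<lambda>n. f (d (e n)))"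
        unfolding expand[of "\<lambda>n. f (d (e n))"] by (simp add: sum.reindex[OF inj])
      then have "d (\<lambda>n. f (d (e n))) = 0" using 0 by simp
      moreover have "d (\<lambda>n. 0) = 0"
        unfolding expand[of "\<lambda>n. 0"] by simp
      ultimately have "(\<lambda>n. f (d (e n))) = (\<lambda>n. 0)" using inj_d by (metis injD)
      then show "f v = 0" using v by (metis rangeE)
    qed simp
    show "card (range (\<lambda>n. d (e n))) = CARD('n)" using inj by (rule card_image)
  qed
qed

section \<open>Irreducibility and dimension from an atlas\<close>

lemma irreducible_space_open_Int:
  assumes "irreducible_space X" "openin X U" "openin X V" "U \<noteq> {}" "V \<noteq> {}"
  shows "U \<inter> V \<noteq> {}"
proof
  assume 0: "U \<inter> V = {}"
  have "closedin X (topspace X - U)" "closedin X (topspace X - V)" using assms by auto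
  moreover have "(topspace X - U) \<union> (topspace X - V) = topspace X" using 0 by auto
  ultimately have "topspace X - U = topspace X \<or> topspace X - V = topspace X"
    using assms(1) unfolding irreducible_space_def by blast
  then show False using assms(2-5) openin_subset by blast
qed

lemma irreducible_space_closure_of:
  assumes "S \<subseteq> topspace X" "S \<noteq> {}"
    and irr: "\<And>A B. closedin X A \<Longrightarrow> closedin X B \<Longrightarrow> S \<subseteq> A \<union> B \<Longrightarrow> S \<subseteq> A \<or> S \<subseteq> B"
  shows "irreducible_space (subtopology X (X closure_of S))"
  unfolding irreducible_space_def
proof (intro conjI allI impI)
  have top: "topspace (subtopology X (X closure_of S)) = X closure_of S"
    by (simp add: closure_of_subset_topspace inf_absorb2)
  show "topspace (subtopology X (X closure_of S)) \<noteq> {}"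
    unfolding top using assms(1,2) closure_of_subset by blast
  fix A B
  assume AB: "closedin (subtopology X (X closure_of S)) A \<and> closedin (subtopology X (X closure_of S)) B
    \<and> A \<union> B = topspace (subtopology X (X closure_of S))"
  then have cl: "closedin X A" "closedin X B" "A \<union> B = X closure_of S"
    unfolding top by (auto intro: closedin_trans_full)
  then have "S \<subseteq> A \<union> B" using closure_of_subset[OF assms(1)] by simp
  then have "S \<subseteq> A \<or> S \<subseteq> B" using irr cl by blast
  then have "X closure_of S \<subseteq> A \<or> X closure_of S \<subseteq> B" using cl closure_of_minimal by blast
  then show "A = topspace (subtopology X (X closure_of S)) \<or> B = topspace (subtopology X (X closure_of S))"
    unfolding top using cl(3) by blast
qed

text \<open>Pieces isomorphic to affine space, each cut out of \<open>D\<close> by a Grassmannian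
  chart. The polynomial \<open>inverse\<close> turns parameters into coordinate functions and so
  yields injectivity and openness. Overlaps with one chart \<open>base\<close> suffice because each
  piece is irreducible.\<close>

locale affine_atlas =
  fixes m :: nat and H D :: "'v::finite mpoly set set" and \<A> :: "'a set"
    and B :: "'a \<Rightarrow> ('v \<Rightarrow>\<^sub>0 nat) set" and \<phi> :: "'a \<Rightarrow> ('n::finite \<Rightarrow> complex) \<Rightarrow> 'v mpoly set"
    and base :: 'a
  assumes subspaces: "I \<in> H \<Longrightarrow> mpoly_vs.subspace I"
    and sub: "D \<subseteq> H"
    and closed: "closedin (zariski_topology m H) D"
    and B: "a \<in> \<A> \<Longrightarrow> B a \<subseteq> monomials m"
    and image: "a \<in> \<A> \<Longrightarrow> D \<inter> chart m (B a) = range (\<phi> a)"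
    and coords: "a \<in> \<A> \<Longrightarrow> polyfun (\<lambda>z. chart_coord m (B a) (\<phi> a z) k)"
    and inverse: "a \<in> \<A> \<Longrightarrow> \<exists>h. \<forall>z n. eval_poly (h n) (chart_coord m (B a) (\<phi> a z)) = z n"
    and cover: "D \<subseteq> (\<Union>a\<in>\<A>. range (\<phi> a))"
    and base: "base \<in> \<A>"
    and overlap: "a \<in> \<A> \<Longrightarrow> \<exists>z. \<phi> a z \<in> range (\<phi> base)"
begin

abbreviation "X \<equiv> subtopology (zariski_topology m H) D"

lemma topspace_X: "topspace X = D"
  using sub by (simp add: topspace_zariski_topology inf_absorb2)

lemma in_D: "a \<in> \<A> \<Longrightarrow> \<phi> a z \<in> D"
  and in_chart: "a \<in> \<A> \<Longrightarrow> \<phi> a z \<in> chart m (B a)"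
  using image by blast+

lemma inj_\<phi>: "a \<in> \<A> \<Longrightarrow> \<phi> a z = \<phi> a z' \<Longrightarrow> z = z'"
  using inverse by (metis ext)

lemma closed_pullback:
  assumes Z: "closedin X Z" and a: "a \<in> \<A>"
  obtains F where "\<And>z. \<phi> a z \<in> Z \<longleftrightarrow> (\<forall>f\<in>F. eval_poly f z = 0)"
proof -
  have "closedin (zariski_topology m H) Z" using Z closed by (rule closedin_trans_full)
  then obtain F where F: "\<And>I. I \<in> H \<Longrightarrow> I \<in> chart m (B a) \<Longrightarrow>
    I \<in> Z \<longleftrightarrow> (\<forall>f\<in>F. eval_poly f (chart_coord m (B a) I) = 0)"
    using closedin_zariski_chart B[OF a] by blast
  have "\<exists>p. \<forall>z. eval_poly f (chart_coord m (B a) (\<phi> a z)) = eval_poly p z" for f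
    using polyfun_compose[of "\<lambda>z. chart_coord m (B a) (\<phi> a z)" f, OF coords[OF a]]
    by (simp add: polyfun_def)
  then obtain p where p: "\<And>f z. eval_poly f (chart_coord m (B a) (\<phi> a z)) = eval_poly (p f) z" by metis
  have "\<phi> a z \<in> Z \<longleftrightarrow> (\<forall>f\<in>p ` F. eval_poly f z = 0)" for z
    using F[of "\<phi> a z"] in_D[OF a, of z] in_chart[OF a, of z] sub by (auto simp: p)
  then show ?thesis by (rule that)
qed

text \<open>The parameters are polynomials in the chart coordinates, so a nonvanishing condition on
  them extends to an open condition on \<open>H\<close>, tested in this single chart.\<close>

lemma open_image:
  assumes a: "a \<in> \<A>"
  shows "openin X {\<phi> a z |z. eval_poly f z \<noteq> 0}"
proof -
  obtain h where h: "\<And>z n. eval_poly (h n) (chart_coord m (B a) (\<phi> a z)) = z n"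
    using inverse[OF a] by blast
  have "polyfun (\<lambda>y. eval_poly f (\<lambda>n. eval_poly (h n) y))"
    by (rule polyfun_compose) (rule polyfun_eval)
  then obtain q where q: "\<And>y. eval_poly f (\<lambda>n. eval_poly (h n) y) = eval_poly q y"
    by (auto simp: polyfun_def)
  let ?U = "{I \<in> H \<inter> chart m (B a). eval_poly q (chart_coord m (B a) I) \<noteq> 0}"
  have "zariski_open m H ?U"
  proof (rule zariski_open_local[OF subspaces])
    fix I0 assume "I0 \<in> ?U"
    then show "\<exists>B f. B \<subseteq> monomials m \<and> I0 \<in> chart m B \<and> eval_poly f (chart_coord m B I0) \<noteq> 0 \<and>
      (\<forall>I\<in>H \<inter> chart m B. eval_poly f (chart_coord m B I) \<noteq> 0 \<longrightarrow> I \<in> ?U)"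
      using B[OF a] by (intro exI[of _ "B a"] exI[of _ q]) simp
  qed auto
  moreover have "{\<phi> a z |z. eval_poly f z \<noteq> 0} = ?U \<inter> D"
  proof (intro equalityI subsetI)
    fix I assume "I \<in> {\<phi> a z |z. eval_poly f z \<noteq> 0}"
    then show "I \<in> ?U \<inter> D"
      using in_D[OF a] in_chart[OF a] sub by (auto simp: h simp flip: q)
  next
    fix I assume I: "I \<in> ?U \<inter> D"
    then obtain z where "I = \<phi> a z" using image[OF a] by blast
    then show "I \<in> {\<phi> a z |z. eval_poly f z \<noteq> 0}" using I by (auto simp: h simp flip: q)
  qed
  ultimately show ?thesis
    by (auto simp: openin_subtopology openin_zariski_topology)
qed

lemma open_chart: "a \<in> \<A> \<Longrightarrow> openin X (range (\<phi> a))"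
  using open_image[of a 1] by (simp add: full_SetCompr_eq)

lemma irreducible_closure_image:
  assumes a: "a \<in> \<A>" and L: "prime_set L"
  shows "irreducible_space (subtopology X (X closure_of (\<phi> a ` L)))"
proof (rule irreducible_space_closure_of)
  show "\<phi> a ` L \<subseteq> topspace X" unfolding topspace_X using in_D[OF a] by blast
  show "\<phi> a ` L \<noteq> {}" using L by (simp add: prime_set_def)
  fix P Q assume PQ: "closedin X P" "closedin X Q" "\<phi> a ` L \<subseteq> P \<union> Q"
  obtain F where F: "\<And>z. \<phi> a z \<in> P \<longleftrightarrow> (\<forall>f\<in>F. eval_poly f z = 0)"
    using closed_pullback[OF PQ(1) a] by blast
  obtain G where G: "\<And>z. \<phi> a z \<in> Q \<longleftrightarrow> (\<forall>f\<in>G. eval_poly f z = 0)"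
    using closed_pullback[OF PQ(2) a] by blast
  show "\<phi> a ` L \<subseteq> P \<or> \<phi> a ` L \<subseteq> Q"
  proof (rule ccontr)
    assume "\<not> ?thesis"
    then obtain x y f g where "x \<in> L" "f \<in> F" "eval_poly f x \<noteq> 0" "y \<in> L" "g \<in> G" "eval_poly g y \<noteq> 0"
      using F G by (smt (verit) image_subsetI)
    moreover have "\<forall>z\<in>L. eval_poly f z * eval_poly g z = 0"
    proof
      fix z assume "z \<in> L"
      then have "\<phi> a z \<in> P \<or> \<phi> a z \<in> Q" using PQ(3) by blast
      then show "eval_poly f z * eval_poly g z = 0" using F G \<open>f \<in> F\<close> \<open>g \<in> G\<close> by auto
    qed
    ultimately show False using L unfolding prime_set_def by blast
  qed
qed

text \<open>Suppose a point of some piece lay outside the closure. A polynomial detecting this and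
  one detecting the base chart are both somewhere nonzero on the parameter space, hence
  simultaneously so; such a point would lie in the base chart and outside its closure.\<close>

lemma closure_base: "X closure_of (range (\<phi> base)) = D"
proof (intro equalityI)
  show "X closure_of (range (\<phi> base)) \<subseteq> D"
    using closure_of_subset_topspace[of X] by (simp only: topspace_X)
  have "range (\<phi> a) \<subseteq> X closure_of (range (\<phi> base))" (is "_ \<subseteq> ?Z") if a: "a \<in> \<A>" for a
  proof (rule ccontr)
    assume "\<not> ?thesis"
    then obtain x where x: "\<phi> a x \<notin> ?Z" by blast
    obtain F where F: "\<And>z. \<phi> a z \<in> ?Z \<longleftrightarrow> (\<forall>f\<in>F. eval_poly f z = 0)"
      using closed_pullback[OF _ a, of ?Z] by auto
    obtain f where f: "f \<in> F" "eval_poly f x \<noteq> 0" using F x by blast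
    have "closedin X (topspace X - range (\<phi> base))"
      by (intro closedin_diff closedin_topspace open_chart base)
    then obtain G where G: "\<And>z. \<phi> a z \<in> topspace X - range (\<phi> base) \<longleftrightarrow> (\<forall>f\<in>G. eval_poly f z = 0)"
      using closed_pullback[OF _ a] by blast
    obtain y where "\<phi> a y \<in> range (\<phi> base)" using overlap[OF a] by blast
    then obtain g where g: "g \<in> G" "eval_poly g y \<noteq> 0" using G by blast
    obtain z where z: "eval_poly f z * eval_poly g z \<noteq> 0"
      using polyfun_mult_nonzero[of "eval_poly f" "eval_poly g" x y] f g by auto
    then have "\<phi> a z \<notin> topspace X - range (\<phi> base)" using G g by auto
    then have "\<phi> a z \<in> range (\<phi> base)" using in_D[OF a] unfolding topspace_X by blast
    moreover have "range (\<phi> base) \<subseteq> ?Z"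
      by (rule closure_of_subset, unfold topspace_X) (use in_D[OF base] in blast)
    ultimately show False using F f z by auto
  qed
  then show "D \<subseteq> X closure_of (range (\<phi> base))" using cover by blast
qed

lemma irreducible: "irreducible_space X"
proof -
  have "prime_set (UNIV :: ('n \<Rightarrow> complex) set)"
    using prime_set_coordinate_subspace[of "{}"] by simp
  from irreducible_closure_image[OF base this] show ?thesis
    unfolding closure_base by (simp add: subtopology_subtopology)
qed

text \<open>The chain is pulled back to the piece around a point of its smallest member, so that no
  member becomes empty and the bound for affine space applies.\<close>

lemma chain_le:
  assumes cl: "\<And>i. i \<le> n \<Longrightarrow> closedin X (Z i)" and irr: "\<And>i. i \<le> n \<Longrightarrow> irreducible_space (subtopology X (Z i))"
    and less: "\<And>i. i < n \<Longrightarrow> Z i \<subset> Z (Suc i)"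
  shows "n \<le> CARD('n)"
proof -
  have top: "topspace (subtopology X (Z i)) = Z i" if "i \<le> n" for i
    using closedin_subset[OF cl[OF that]] topspace_subtopology[of X "Z i"] by blast
  have "Z 0 \<noteq> {}" using irr[of 0] top[of 0] by (simp add: irreducible_space_def)
  then obtain I0 where I0: "I0 \<in> Z 0" by blast
  then have "I0 \<in> D" using closedin_subset[OF cl[of 0]] topspace_X by auto
  then obtain a where a: "a \<in> \<A>" "I0 \<in> range (\<phi> a)" using cover by blast
  have I0Z: "I0 \<in> Z i" if "i \<le> n" for i
    using that by (induction i) (use I0 less in \<open>auto simp: Suc_le_eq\<close>)
  have openZ: "openin (subtopology X (Z i)) (O' \<inter> Z i)" if "openin X O'" for i O'
    using that by (auto simp: openin_subtopology)
  define Y where "Y i = {z. \<phi> a z \<in> Z i}" for i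
  show ?thesis
  proof (rule prime_chain_length[of n Y])
    fix i assume i: "i \<le> n"
    show "prime_set (Y i)"
      unfolding prime_set_def
    proof (intro conjI allI impI)
      show "Y i \<noteq> {}" using I0Z[OF i] a(2) by (auto simp: Y_def)
      fix f g assume fg: "\<forall>z\<in>Y i. eval_poly f z * eval_poly g z = 0"
      let ?O = "\<lambda>f. {\<phi> a z |z. eval_poly f z \<noteq> 0} \<inter> Z i"
      have "?O f = {} \<or> ?O g = {}"
      proof (rule ccontr)
        assume "\<not> ?thesis"
        then have "?O f \<noteq> {}" "?O g \<noteq> {}" by simp_all
        from irreducible_space_open_Int[OF irr[OF i] openZ[OF open_image[OF a(1)]] openZ[OF open_image[OF a(1)]] this]
        obtain I where I: "I \<in> ?O f" "I \<in> ?O g" by blast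
        obtain z where z: "eval_poly f z \<noteq> 0" "I = \<phi> a z" "I \<in> Z i" using I(1) by auto
        obtain z' where z': "eval_poly g z' \<noteq> 0" "I = \<phi> a z'" using I(2) by auto
        have "z' = z" using inj_\<phi>[OF a(1)] z(2) z'(2) by metis
        then show False using fg z z'(1) by (auto simp: Y_def)
      qed
      then show "(\<forall>z\<in>Y i. eval_poly f z = 0) \<or> (\<forall>z\<in>Y i. eval_poly g z = 0)"
        unfolding Y_def by blast
    qed
  next
    fix i assume i: "i < n"
    show "Y i \<subseteq> Y (Suc i)" using less[OF i] by (auto simp: Y_def)
    obtain F where F: "\<And>z. \<phi> a z \<in> Z i \<longleftrightarrow> (\<forall>f\<in>F. eval_poly f z = 0)"
      using closed_pullback[OF cl a(1)] i by (metis less_imp_le)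
    have "openin X (topspace X - Z i)" by (intro openin_diff openin_topspace cl) (use i in simp)
    then have "openin (subtopology X (Z (Suc i))) ((topspace X - Z i) \<inter> Z (Suc i))" by (rule openZ)
    moreover have "(topspace X - Z i) \<inter> Z (Suc i) \<noteq> {}"
      using less[OF i] closedin_subset[OF cl[of "Suc i"]] Suc_leI[OF i] by blast
    moreover have "range (\<phi> a) \<inter> Z (Suc i) \<noteq> {}" using a(2) I0Z[of "Suc i"] i by auto
    \<comment> \<open>Strictness survives in the piece: inside the irreducible
      \<open>Z (Suc i)\<close> the complement of \<open>Z i\<close> and the piece are nonempty and
      open, so they meet.\<close>
    ultimately have "((topspace X - Z i) \<inter> Z (Suc i)) \<inter> (range (\<phi> a) \<inter> Z (Suc i)) \<noteq> {}"
      using Suc_leI[OF i] by (intro irreducible_space_open_Int[OF irr[of "Suc i"] _ openZ[OF open_chart[OF a(1)]]])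
    then obtain z where "\<phi> a z \<in> Z (Suc i)" "\<phi> a z \<notin> Z i" by blast
    then show "\<exists>f. (\<forall>z\<in>Y i. eval_poly f z = 0) \<and> (\<exists>z\<in>Y (Suc i). eval_poly f z \<noteq> 0)"
      using F by (auto simp: Y_def)
  qed
qed

text \<open>Closures of coordinate subspaces of the base chart: \<open>L i\<close> leaves
  \<open>i\<close> coordinates free, and the coordinate \<open>e i\<close> separates the closures
  belonging to \<open>L i\<close> and \<open>L (Suc i)\<close>.\<close>

lemma chain_exists:
  "\<exists>Z. (\<forall>i\<le>CARD('n). closedin X (Z i) \<and> irreducible_space (subtopology X (Z i))) \<and>
     (\<forall>i<CARD('n). Z i \<subset> Z (Suc i))"
proof -
  obtain e :: "nat \<Rightarrow> 'n" where e: "bij_betw e {..<CARD('n)} UNIV"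
    using ex_bij_betw_nat_finite[of "UNIV :: 'n set"] by (auto simp: atLeast0LessThan)
  define L where "L i = {z :: 'n \<Rightarrow> complex. \<forall>k\<in>e ` {i..<CARD('n)}. z k = 0}" for i
  define Z where "Z i = X closure_of (\<phi> base ` L i)" for i
  have "Z i \<subset> Z (Suc i)" if i: "i < CARD('n)" for i
  proof
    have "L i \<subseteq> L (Suc i)" by (auto simp: L_def)
    then show "Z i \<subseteq> Z (Suc i)" unfolding Z_def by (intro closure_of_mono image_mono)
    define z :: "'n \<Rightarrow> complex" where "z = (\<lambda>k. if k = e i then 1 else 0)"
    let ?U = "{\<phi> base z |z. eval_poly (Var (e i)) z \<noteq> 0}"
    have "?U \<inter> \<phi> base ` L i = {}"
    proof -
      have "eval_poly (Var (e i)) z' = 0" if "z' \<in> L i" for z' using that i by (auto simp: L_def)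
      then show ?thesis using inj_\<phi>[OF base] by blast
    qed
    then have U: "?U \<inter> Z i = {}"
      unfolding Z_def by (simp only: openin_Int_closure_of_eq_empty[OF open_image[OF base]])
    have "eval_poly (Var (e i)) z \<noteq> 0" by (simp add: z_def)
    then have "\<phi> base z \<in> ?U" by blast
    then have "\<phi> base z \<notin> Z i" using U by blast
    moreover have "z \<in> L (Suc i)"
      unfolding L_def
    proof (intro CollectI ballI)
      fix k assume "k \<in> e ` {Suc i..<CARD('n)}"
      then obtain j where "k = e j" "j \<noteq> i" "j \<in> {..<CARD('n)}" by auto
      then show "z k = 0"
        using i e unfolding z_def bij_betw_def by (auto dest: inj_onD)
    qed
    then have "\<phi> base z \<in> Z (Suc i)"
      unfolding Z_def using closure_of_subset[of "\<phi> base ` L (Suc i)" X, unfolded topspace_X] in_D[OF base]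
      by blast
    ultimately show "Z i \<noteq> Z (Suc i)" by blast
  qed
  moreover have "irreducible_space (subtopology X (Z i))" for i
    unfolding Z_def L_def by (intro irreducible_closure_image base prime_set_coordinate_subspace)
  moreover have "closedin X (Z i)" for i unfolding Z_def by (rule closedin_closure_of)
  ultimately show ?thesis by (intro exI[of _ Z]) simp
qed

lemma krull_dim_eq: "krull_dim X = enat CARD('n)"
  unfolding krull_dim_def
proof (rule antisym)
  show "Sup {enat n |n. \<exists>Z. (\<forall>i\<le>n. closedin X (Z i) \<and> irreducible_space (subtopology X (Z i))) \<and>
      (\<forall>i<n. Z i \<subset> Z (Suc i))} \<le> enat CARD('n)"
  proof (rule Sup_least, elim CollectE exE conjE)
    fix x n Z assume x: "x = enat n" and Z: "\<forall>i\<le>n. closedin X (Z i) \<and> irreducible_space (subtopology X (Z i))"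
      "\<forall>i<n. Z i \<subset> Z (Suc i)"
    have "n \<le> CARD('n)" using Z by (intro chain_le[of n Z]) blast+
    then show "x \<le> enat CARD('n)" using x by simp
  qed
  show "enat CARD('n) \<le> Sup {enat n |n. \<exists>Z. (\<forall>i\<le>n. closedin X (Z i) \<and> irreducible_space (subtopology X (Z i))) \<and>
      (\<forall>i<n. Z i \<subset> Z (Suc i))}"
    by (rule Sup_upper) (use chain_exists in blast)
qed

lemma smooth: "smooth_subvariety m H D"
  unfolding smooth_subvariety_def
proof (intro conjI closed irreducible ballI)
  fix I assume "I \<in> D"
  then obtain a z0 where a: "a \<in> \<A>" and I: "I = \<phi> a z0" using cover by blast
  obtain G where G: "\<And>k z. chart_coord m (B a) (\<phi> a z) k = eval_poly (G k) z"
    using coords[OF a] unfolding polyfun_def by metis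
  have G': "chart_coord m (B a) (\<phi> a z) = (\<lambda>k. eval_poly (G k) z)" for z
    by (rule ext) (rule G)
  obtain h where h: "\<And>z n. eval_poly (h n) (\<lambda>k. eval_poly (G k) z) = z n"
    using inverse[OF a] unfolding G' by blast
  have "chart_coord m (B a) ` (D \<inter> chart m (B a)) = range (\<lambda>z k. eval_poly (G k) z)"
    unfolding image[OF a] by (simp add: image_image G')
  then have "fun_vs.dim (tangent_space (chart_coord m (B a) ` (D \<inter> chart m (B a))) (chart_coord m (B a) I)) = CARD('n)"
    using dim_tangent_space_parametrized[of h G z0, OF h] by (simp add: I G')
  then show "\<exists>B\<subseteq>monomials m. I \<in> chart m B \<and>
    enat (fun_vs.dim (tangent_space (chart_coord m B ` (D \<inter> chart m B)) (chart_coord m B I))) = krull_dim X"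
    using B[OF a] in_chart[OF a] unfolding krull_dim_eq I by metis
qed

end

section \<open>Hilbert functions of lines and conics\<close>

definition indep_mod :: "'v mpoly set \<Rightarrow> nat \<Rightarrow> (nat \<Rightarrow> 'v mpoly) \<Rightarrow> bool" where
  "indep_mod I r p \<longleftrightarrow> (\<forall>c. (\<Sum>i<r. poly_scale (c i) (p i)) \<in> I \<longrightarrow> (\<forall>i<r. c i = 0))"

lemma single_eq_scale: "Poly_Mapping.single b c = poly_scale c (Poly_Mapping.single b 1)"
  by simp

text \<open>A maximal set of monomials of degree \<open>m\<close> that is independent modulo
  \<open>I\<close> is a basis of the quotient; thus every ideal lies in some chart.\<close>

lemma exists_chart:
  fixes I :: "'v::finite mpoly set"
  assumes I: "mpoly_vs.subspace I"
  obtains B where "B \<subseteq> monomials m" "I \<in> chart m B"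
proof -
  define P where "P B \<longleftrightarrow> B \<subseteq> monomials m \<and>
    (\<forall>c. (\<Sum>b\<in>B. Poly_Mapping.single b (c b)) \<in> I \<longrightarrow> (\<forall>b\<in>B. c b = (0::complex)))" for B :: "('v \<Rightarrow>\<^sub>0 nat) set"
  have fin: "finite (Collect P)"
    by (rule finite_subset[of _ "Pow (monomials m)"]) (auto simp: P_def)
  have "P {}" by (simp add: P_def)
  then have ne: "Collect P \<noteq> {}" by blast
  obtain B where B: "P B" and max: "\<And>C. P C \<Longrightarrow> B \<subseteq> C \<Longrightarrow> C = B"
    using finite_has_maximal[OF fin ne] by auto
  have finB: "finite B" using B finite_monomial_subset by (auto simp: P_def)
  have "\<exists>c. expands B I \<mu> c" if \<mu>: "\<mu> \<in> monomials m" for \<mu>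
  proof (cases "\<mu> \<in> B")
    case True
    then show ?thesis using expands_basis[OF finB _ I] by blast
  next
    case False
    then have "\<not> P (insert \<mu> B)" using max[of "insert \<mu> B"] by blast
    then obtain c b where c: "(\<Sum>b\<in>insert \<mu> B. Poly_Mapping.single b (c b)) \<in> I" "b \<in> insert \<mu> B" "c b \<noteq> 0"
      using B \<mu> unfolding P_def by blast
    have c': "Poly_Mapping.single \<mu> (c \<mu>) + (\<Sum>b\<in>B. Poly_Mapping.single b (c b)) \<in> I"
      using c(1) False finB by simp
    have "c \<mu> \<noteq> 0"
    proof
      assume "c \<mu> = 0"
      then have "(\<Sum>b\<in>B. Poly_Mapping.single b (c b)) \<in> I" using c' by simp
      then have "\<forall>b\<in>B. c b = 0" using B unfolding P_def by blast
      then show False using c \<open>c \<mu> = 0\<close> by auto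
    qed
    let ?d = "\<lambda>b. if b \<in> B then - c b / c \<mu> else 0"
    have "poly_scale (1 / c \<mu>) (Poly_Mapping.single \<mu> (c \<mu>) + (\<Sum>b\<in>B. Poly_Mapping.single b (c b)))
      = Poly_Mapping.single \<mu> 1 - (\<Sum>b\<in>B. Poly_Mapping.single b (?d b))"
      using \<open>c \<mu> \<noteq> 0\<close>
      by (simp add: mpoly_vs.scale_right_distrib mpoly_vs.scale_sum_right single_uminus sum_negf)
    then have "expands B I \<mu> ?d"
      using mpoly_vs.subspace_scale[OF I c', of "1 / c \<mu>"] by (simp add: expands_def)
    then show ?thesis by blast
  qed
  then have "I \<in> chart m B"
    using B by (intro chart_intro[OF I]) (auto simp: P_def)
  then show ?thesis using that B by (auto simp: P_def)
qed

lemma card_le_of_indep_mod: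
  fixes I :: "'v::finite mpoly set"
  assumes B: "B \<subseteq> monomials m" "I \<in> chart m B" and I: "mpoly_vs.subspace I"
    and p: "\<And>i. i < r \<Longrightarrow> p i \<in> forms m" and ind: "indep_mod I r p"
  shows "r \<le> card B"
proof (rule ccontr)
  assume less: "\<not> ?thesis"
  define q where "q i = (\<Sum>b\<in>B. Poly_Mapping.single b (\<Sum>\<mu>\<in>monomials m.
    Poly_Mapping.lookup (p i) \<mu> * chart_coord m B I (\<mu>, b)))" for i
  have finB: "finite B" using B finite_monomial_subset by blast
  let ?T = "(\<lambda>b. Poly_Mapping.single b (1::complex)) ` B"
  have "q i \<in> mpoly_vs.span ?T" for i
    unfolding q_def
    by (intro mpoly_vs.span_sum, subst single_eq_scale) (intro mpoly_vs.span_scale mpoly_vs.span_base imageI)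
  moreover have "card ?T < card {..<r}" using less card_image_le[OF finB, of "\<lambda>b. Poly_Mapping.single b (1::complex)"] by simp
  ultimately obtain c where c: "\<exists>i\<in>{..<r}. c i \<noteq> 0" "(\<Sum>i<r. poly_scale (c i) (q i)) = 0"
    using linear_relation_exists[of ?T "{..<r}" q] finB by blast
  have "(\<Sum>i<r. poly_scale (c i) (p i - q i)) \<in> I"
    using chart_reduce[OF B(2) I p]
    by (intro mpoly_vs.subspace_sum[OF I] mpoly_vs.subspace_scale[OF I]) (simp add: q_def)
  then have "(\<Sum>i<r. poly_scale (c i) (p i)) \<in> I"
    using c(2) by (simp add: mpoly_vs.scale_right_diff_distrib sum_subtractf)
  then show False using ind c(1) unfolding indep_mod_def by auto
qed

lemma card_ge_of_spanning:
  fixes I :: "'v::finite mpoly set"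
  assumes B: "B \<subseteq> monomials m" "I \<in> chart m B" and I: "mpoly_vs.subspace I"
    and "finite A" and span: "\<And>f. f \<in> forms m \<Longrightarrow> \<exists>c. f - (\<Sum>i\<in>A. poly_scale (c i) (p i)) \<in> I"
  shows "card B \<le> card A"
proof (rule ccontr)
  assume less: "\<not> ?thesis"
  have finB: "finite B" using B finite_monomial_subset by blast
  have "\<exists>c. Poly_Mapping.single b 1 - (\<Sum>i\<in>A. poly_scale (c i) (p i)) \<in> I" if "b \<in> B" for b
    using that B(1) by (intro span) (auto simp: mem_monomials)
  then obtain c where c: "\<And>b. b \<in> B \<Longrightarrow> Poly_Mapping.single b 1 - (\<Sum>i\<in>A. poly_scale (c b i) (p i)) \<in> I"
    by metis
  define q where "q b = (\<Sum>i\<in>A. poly_scale (c b i) (p i))" for b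
  have "q b \<in> mpoly_vs.span (p ` A)" for b
    unfolding q_def by (intro mpoly_vs.span_sum mpoly_vs.span_scale mpoly_vs.span_base imageI)
  moreover have "card (p ` A) < card B" using less card_image_le[OF \<open>finite A\<close>, of p] by simp
  ultimately obtain d where d: "\<exists>b\<in>B. d b \<noteq> 0" "(\<Sum>b\<in>B. poly_scale (d b) (q b)) = 0"
    using linear_relation_exists[of "p ` A" B q] finB \<open>finite A\<close> by blast
  have "(\<Sum>b\<in>B. poly_scale (d b) (Poly_Mapping.single b 1 - q b)) \<in> I"
    using c by (intro mpoly_vs.subspace_sum[OF I] mpoly_vs.subspace_scale[OF I]) (simp add: q_def)
  moreover have "(\<Sum>b\<in>B. poly_scale (d b) (Poly_Mapping.single b 1 - q b)) = (\<Sum>b\<in>B. Poly_Mapping.single b (d b))"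
    using d(2) by (simp add: mpoly_vs.scale_right_diff_distrib sum_subtractf)
  ultimately have "(\<Sum>b\<in>B. Poly_Mapping.single b (d b)) \<in> I" by simp
  then have "\<forall>b\<in>B. d b = 0" using chart_independent[OF B(2) I, of d] by blast
  then show False using d(1) by blast
qed

text \<open>A basis of the degree \<open>m\<close> part of \<open>I\<close> together with the
  monomials of \<open>B\<close> is a basis of all forms, so the natural-number subtraction in
  \<open>hilbert_function\<close> does not truncate.\<close>

lemma hilbert_function_chart:
  fixes I :: "'v::finite mpoly set"
  assumes B: "B \<subseteq> monomials m" "I \<in> chart m B" and I: "mpoly_vs.subspace I"
  shows "hilbert_function I m = card B"
proof -
  have finB: "finite B" using B finite_monomial_subset by blast
  let ?s = "\<lambda>b :: 'v \<Rightarrow>\<^sub>0 nat. Poly_Mapping.single b (1::complex)"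
  have inj: "inj ?s" by (rule injI) (metis lookup_single_eq lookup_single_not_eq zero_neq_one)
  have fs: "mpoly_vs.span (?s ` monomials m) = forms m"
  proof (intro equalityI subsetI)
    fix f :: "'v mpoly" assume "f \<in> mpoly_vs.span (?s ` monomials m)"
    moreover have "mpoly_vs.span (?s ` monomials m) \<subseteq> forms m"
      by (rule mpoly_vs.span_minimal) (auto simp: forms_subspace mem_monomials)
    ultimately show "f \<in> forms m" by blast
  next
    fix f :: "'v mpoly" assume "f \<in> forms m"
    have "(\<Sum>\<mu>\<in>monomials m. poly_scale (Poly_Mapping.lookup f \<mu>) (?s \<mu>)) \<in> mpoly_vs.span (?s ` monomials m)"
      by (intro mpoly_vs.span_sum mpoly_vs.span_scale mpoly_vs.span_base imageI)
    then show "f \<in> mpoly_vs.span (?s ` monomials m)" using forms_expand[OF \<open>f \<in> forms m\<close>] by simp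
  qed
  obtain K where K: "K \<subseteq> I \<inter> forms m" "mpoly_vs.independent K" "I \<inter> forms m \<subseteq> mpoly_vs.span K"
    "card K = mpoly_vs.dim (I \<inter> forms m)"
    using mpoly_vs.basis_exists by blast
  have finK: "finite K"
    using mpoly_vs.independent_span_bound[of "?s ` monomials m" K] K fs by auto
  have disj: "K \<inter> ?s ` B = {}"
  proof (rule ccontr)
    assume "\<not> ?thesis"
    then obtain b where b: "b \<in> B" "?s b \<in> I" using K(1) by blast
    have "(\<Sum>b'\<in>B. Poly_Mapping.single b' (if b' = b then 1 else 0 :: complex)) = ?s b"
      using finB b(1) by (subst sum.remove[of B b]) auto
    then have "(if b = b then 1 else 0 :: complex) = 0"
      using chart_independent[OF B(2) I, of "\<lambda>b'. if b' = b then 1 else 0" b] b by simp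
    then show False by simp
  qed
  have "mpoly_vs.dim (forms m :: 'v mpoly set) = card (K \<union> ?s ` B)"
  proof (rule mpoly_vs.dim_unique[OF _ _ _ refl])
    show "K \<union> ?s ` B \<subseteq> forms m" using K B by (auto simp: mem_monomials)
    show "forms m \<subseteq> mpoly_vs.span (K \<union> ?s ` B)"
    proof
      fix f :: "'v mpoly" assume f: "f \<in> forms m"
      let ?r = "\<Sum>b\<in>B. Poly_Mapping.single b (\<Sum>\<mu>\<in>monomials m. Poly_Mapping.lookup f \<mu> * chart_coord m B I (\<mu>, b))"
      have r: "?r \<in> mpoly_vs.span (K \<union> ?s ` B)"
        by (intro mpoly_vs.span_sum, subst single_eq_scale)
          (intro mpoly_vs.span_scale mpoly_vs.span_base UnI2 imageI)
      have "?r \<in> forms m" using B(1) by (intro forms_sum) (auto simp: mem_monomials)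
      then have "f - ?r \<in> I \<inter> forms m" using chart_reduce[OF B(2) I f] f by (simp add: forms_diff)
      then have "f - ?r \<in> mpoly_vs.span (K \<union> ?s ` B)"
        using K(3) mpoly_vs.span_mono[of K "K \<union> ?s ` B"] by blast
      from mpoly_vs.span_add[OF this r] show "f \<in> mpoly_vs.span (K \<union> ?s ` B)" by simp
    qed
    show "mpoly_vs.independent (K \<union> ?s ` B)"
    proof (rule mpoly_vs.independent_if_scalars_zero)
      fix u v assume u: "(\<Sum>x\<in>K \<union> ?s ` B. poly_scale (u x) x) = 0" and v: "v \<in> K \<union> ?s ` B"
      have "(\<Sum>x\<in>K. poly_scale (u x) x) + (\<Sum>b\<in>B. Poly_Mapping.single b (u (?s b))) = 0"
        using u disj finK finB by (simp add: sum.union_disjoint sum.reindex[OF inj_on_subset[OF inj]])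
      moreover have "(\<Sum>x\<in>K. poly_scale (u x) x) \<in> I"
        using K(1) by (intro mpoly_vs.subspace_sum[OF I] mpoly_vs.subspace_scale[OF I]) auto
      ultimately have "(\<Sum>b\<in>B. Poly_Mapping.single b (u (?s b))) \<in> I"
        using subspace_sub[OF I mpoly_vs.subspace_0[OF I], of "\<Sum>x\<in>K. poly_scale (u x) x"]
        by (simp add: add_eq_0_iff)
      then have uB: "\<forall>b\<in>B. u (?s b) = 0" using chart_independent[OF B(2) I, of "\<lambda>b. u (?s b)"] by blast
      then have "(\<Sum>x\<in>K. poly_scale (u x) x) = 0"
        using \<open>(\<Sum>x\<in>K. poly_scale (u x) x) + (\<Sum>b\<in>B. Poly_Mapping.single b (u (?s b))) = 0\<close> by simp
      then have "\<forall>x\<in>K. u x = 0" using K(2) mpoly_vs.dependent_finite[OF finK] by blast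
      then show "u v = 0" using uB v by blast
    qed (use finK finB in simp)
  qed
  also have "\<dots> = card K + card B"
    using disj finK finB inj_on_subset[OF inj] by (subst card_Un_disjoint) (auto simp: card_image)
  finally show ?thesis using K(4) by (simp add: hilbert_function_def)
qed

lemma hilbert_function_ge:
  fixes I :: "'v::finite mpoly set"
  assumes "mpoly_vs.subspace I" "\<And>i. i < r \<Longrightarrow> p i \<in> forms m" "indep_mod I r p"
  shows "r \<le> hilbert_function I m"
proof -
  obtain B where "B \<subseteq> monomials m" "I \<in> chart m B" by (rule exists_chart[OF assms(1)])
  then show ?thesis using card_le_of_indep_mod hilbert_function_chart assms by metis
qed

lemma hilbert_function_le:
  fixes I :: "'v::finite mpoly set"
  assumes "mpoly_vs.subspace I" "finite A"
    "\<And>f. f \<in> forms m \<Longrightarrow> \<exists>c. f - (\<Sum>i\<in>A. poly_scale (c i) (p i)) \<in> I"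
  shows "hilbert_function I m \<le> card A"
proof -
  obtain B where "B \<subseteq> monomials m" "I \<in> chart m B" by (rule exists_chart[OF assms(1)])
  then show ?thesis using card_ge_of_spanning[OF _ _ assms] hilbert_function_chart[OF _ _ assms(1)] by metis
qed

section \<open>Linear forms that are regular modulo a saturated ideal\<close>

text \<open>Rows over the polynomial ring in \<open>t\<close> either satisfy a relation over that
  ring or become dependent at finitely many values of \<open>t\<close> only. Elimination without
  fractions: a nonzero entry of the last row is the pivot, and its roots join the exceptional
  set.\<close>

lemma elimination:
  fixes v :: "nat \<Rightarrow> 'b \<Rightarrow> complex poly"
  shows "(\<exists>c. (\<exists>i<n. c i \<noteq> 0) \<and> (\<forall>b. (\<Sum>i<n. c i * v i b) = 0)) \<or>
    finite {t. \<exists>c. (\<exists>i<n. c i \<noteq> 0) \<and> (\<forall>b. (\<Sum>i<n. c i * poly (v i b) t) = 0)}"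
proof (induction n arbitrary: v)
  case 0 then show ?case by simp
next
  case (Suc n)
  show ?case
  proof (cases "\<forall>b. v n b = 0")
    case True
    have "(\<exists>i<Suc n. (if i = n then 1 else 0 :: complex poly) \<noteq> 0) \<and>
      (\<forall>b. (\<Sum>i<Suc n. (if i = n then 1 else 0) * v i b) = 0)"
      using True by (auto intro!: exI[of _ n])
    then show ?thesis by (intro disjI1 exI[of _ "\<lambda>i. if i = n then 1 else 0"])
  next
    case False
    then obtain b0 where b0: "v n b0 \<noteq> 0" by blast
    define w where "w i b = v n b0 * v i b - v i b0 * v n b" for i b
    from Suc.IH[of w] show ?thesis
    proof
      assume "\<exists>c. (\<exists>i<n. c i \<noteq> 0) \<and> (\<forall>b. (\<Sum>i<n. c i * w i b) = 0)"
      then obtain c where c: "\<exists>i<n. c i \<noteq> 0" "\<And>b. (\<Sum>i<n. c i * w i b) = 0" by blast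
      \<comment> \<open>A relation between the eliminated rows lifts after multiplication by the
        pivot; the last coefficient collects the multiples of row \<open>n\<close> that were
        subtracted.\<close>
      define d where "d i = (if i = n then - (\<Sum>i<n. c i * v i b0) else c i * v n b0)" for i
      have "(\<Sum>i<Suc n. d i * v i b) = 0" for b
      proof -
        have "(\<Sum>i<Suc n. d i * v i b) = (\<Sum>i<n. c i * v n b0 * v i b) - (\<Sum>i<n. c i * v i b0) * v n b"
          by (simp add: d_def)
        also have "\<dots> = (\<Sum>i<n. c i * w i b)"
          by (simp add: w_def right_diff_distrib sum_subtractf sum_distrib_left sum_distrib_right mult_ac)
        finally show ?thesis using c(2) by simp
      qed
      moreover have "\<exists>i<Suc n. d i \<noteq> 0" using c(1) b0 by (auto simp: d_def less_Suc_eq)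
      ultimately show ?thesis by blast
    next
      assume fin: "finite {t. \<exists>c. (\<exists>i<n. c i \<noteq> 0) \<and> (\<forall>b. (\<Sum>i<n. c i * poly (w i b) t) = 0)}" (is "finite ?T")
      have "{t. \<exists>c. (\<exists>i<Suc n. c i \<noteq> 0) \<and> (\<forall>b. (\<Sum>i<Suc n. c i * poly (v i b) t) = 0)} \<subseteq> ?T \<union> {t. poly (v n b0) t = 0}"
      proof
        fix t assume "t \<in> {t. \<exists>c. (\<exists>i<Suc n. c i \<noteq> 0) \<and> (\<forall>b. (\<Sum>i<Suc n. c i * poly (v i b) t) = 0)}"
        then obtain c j where c: "j < Suc n" "c j \<noteq> 0" "\<And>b. (\<Sum>i<n. c i * poly (v i b) t) + c n * poly (v n b) t = 0"
          by auto
        have rel: "(\<Sum>i<n. c i * poly (w i b) t) = 0" for b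
        proof -
          have "(\<Sum>i<n. c i * poly (w i b) t) = poly (v n b0) t * (\<Sum>i<n. c i * poly (v i b) t)
              - (\<Sum>i<n. c i * poly (v i b0) t) * poly (v n b) t"
            by (simp add: w_def right_diff_distrib sum_subtractf sum_distrib_left sum_distrib_right mult_ac)
          also have "(\<Sum>i<n. c i * poly (v i b) t) = - (c n * poly (v n b) t)"
            using c(3)[of b] by (simp add: add_eq_0_iff)
          also have "(\<Sum>i<n. c i * poly (v i b0) t) = - (c n * poly (v n b0) t)"
            using c(3)[of b0] by (simp add: add_eq_0_iff)
          finally show ?thesis by simp
        qed
        show "t \<in> ?T \<union> {t. poly (v n b0) t = 0}"
        proof (cases "\<exists>i<n. c i \<noteq> 0")
          case True
          then show ?thesis using rel by blast
        next
          case False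
          then have "c n \<noteq> 0" using c(1,2) less_Suc_eq by auto
          moreover have "c n * poly (v n b0) t = 0" using c(3)[of b0] False by simp
          ultimately show ?thesis by simp
        qed
      qed
      then show ?thesis using fin poly_roots_finite[OF b0] by (intro disjI2) (meson finite_UnI finite_subset)
    qed
  qed
qed

text \<open>McCoy: a zero divisor in \<open>(S/I)[t]\<close> is annihilated by a nonzero constant.\<close>

lemma McCoy:
  fixes I :: "'v mpoly set" and e :: "nat \<Rightarrow> 'v"
  assumes I: "mpoly_ideal.subspace I"
    and sat: "\<And>f. (\<And>i. i < N \<Longrightarrow> Var (e i) * f \<in> I) \<Longrightarrow> f \<in> I"
    and "\<And>j. j \<ge> r \<Longrightarrow> k j \<in> I"
    and "\<And>n. (\<Sum>i | i < N \<and> i \<le> n. Var (e i) * k (n - i)) \<in> I"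
  shows "k j \<in> I"
  using assms(3,4)
proof (induction r arbitrary: k j)
  case 0 then show ?case by simp
next
  case (Suc r)
  \<comment> \<open>The leading coefficient \<open>k r\<close> is treated by hand. In the
    coefficient of degree \<open>i + r\<close> of the product, terms with smaller variable index
    contain some \<open>k j\<close> with \<open>j > r\<close>, and terms with larger index are
    covered by downward induction on \<open>i\<close>.\<close>
  have all: "Var (e i) * k j \<in> I" if "i < N" for i j
    using that
  proof (induction "N - i" arbitrary: i j rule: less_induct)
    case less
    let ?f = "\<lambda>i'. Var (e i') * k (i + r - i')"
    have fin: "finite {i'. i' < N \<and> i' \<le> i + r}" by simp
    have split: "(\<Sum>i' | i' < N \<and> i' \<le> i + r. ?f i') = ?f i + (\<Sum>i'\<in>{i'. i' < N \<and> i' \<le> i + r} - {i}. ?f i')"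
      using less.prems by (intro sum.remove) auto
    have rest: "(\<Sum>i'\<in>{i'. i' < N \<and> i' \<le> i + r} - {i}. ?f i') \<in> I"
    proof (rule mpoly_ideal.subspace_sum[OF I])
      fix i' assume i': "i' \<in> {i'. i' < N \<and> i' \<le> i + r} - {i}"
      show "?f i' \<in> I"
      proof (cases "i' < i")
        case True
        then have "k (i + r - i') \<in> I" by (intro Suc.prems(1)) simp
        then show ?thesis by (rule mpoly_ideal.subspace_scale[OF I])
      next
        case False
        then show ?thesis using i' less.hyps[of i'] by auto
      qed
    qed
    have "?f i \<in> I"
      using mpoly_ideal.subspace_diff[OF I Suc.prems(2)[of "i + r"] rest] unfolding split by simp
    then have top: "Var (e i) * k r \<in> I" by simp
    \<comment> \<open>Multiplied by this variable, the family has one coefficient fewer modulo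
      \<open>I\<close> and satisfies the same equations, so the outer induction applies to
      it.\<close>
    have "Var (e i) * k j \<in> I" for j
    proof (rule Suc.IH)
      show "Var (e i) * k j \<in> I" if "j \<ge> r" for j
        using that top Suc.prems(1) mpoly_ideal.subspace_scale[OF I]
        by (cases "j = r") (auto simp: not_less_eq_eq)
      show "(\<Sum>i' | i' < N \<and> i' \<le> n. Var (e i') * (Var (e i) * k (n - i'))) \<in> I" for n
      proof -
        have "(\<Sum>i' | i' < N \<and> i' \<le> n. Var (e i') * (Var (e i) * k (n - i')))
          = Var (e i) * (\<Sum>i' | i' < N \<and> i' \<le> n. Var (e i') * k (n - i'))"
          unfolding sum_distrib_left by (rule sum.cong[OF refl mult.left_commute])
        then show ?thesis using mpoly_ideal.subspace_scale[OF I Suc.prems(2)[of n], of "Var (e i)"] by simp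
      qed
    qed
    then show ?case .
  qed
  show ?case by (rule sat) (rule all)
qed


text \<open>Linear forms with coefficients \<open>t ^ i\<close> make multiplication on degree
  \<open>l\<close> a matrix polynomial in \<open>t\<close>. If it failed to be injective for
  infinitely many \<open>t\<close>, there would be a kernel vector over the polynomial ring in
  \<open>t\<close>, which McCoy's theorem and saturation exclude.\<close>

lemma polynomial_family_injective:
  fixes I :: "'v::finite mpoly set"
  assumes I: "mpoly_ideal.subspace I" and sat: "\<And>f. (\<And>i. Var i * f \<in> I) \<Longrightarrow> f \<in> I"
    and e: "e ` {..<N} = (UNIV :: 'v set)"
  shows "finite {t. \<exists>f\<in>forms l. f \<notin> I \<and> (\<Sum>i<N. poly_scale (t ^ i) (Var (e i))) * f \<in> I}"
    (is "finite ?T")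
proof -
  have Iv: "mpoly_vs.subspace I" using I by (rule ideal_imp_subspace)
  obtain B where B: "B \<subseteq> monomials l" "I \<in> chart l B" by (rule exists_chart[OF Iv])
  obtain C where C: "C \<subseteq> monomials (Suc l)" "I \<in> chart (Suc l) C" by (rule exists_chart[OF Iv])
  have finB: "finite B" using B finite_monomial_subset by blast
  obtain \<beta> where \<beta>: "bij_betw \<beta> {..<card B} B"
    using ex_bij_betw_nat_finite[OF finB] by (auto simp: atLeast0LessThan)
  have sumB: "(\<Sum>b\<in>B. h b) = (\<Sum>s<card B. h (\<beta> s))" for h :: "_ \<Rightarrow> 'c::comm_monoid_add"
    using sum.reindex_bij_betw[OF \<beta>, of h] by simp
  have \<beta>l: "mdeg (\<beta> s) = l" if "s < card B" for s
    using bij_betwE[OF \<beta>] that B(1) by (auto simp: mem_monomials)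
  define y where "y b f = (\<Sum>\<mu>\<in>monomials (Suc l). Poly_Mapping.lookup f \<mu> * chart_coord (Suc l) C I (\<mu>, b))"
    for b and f :: "'v mpoly"
  have y_mem: "f \<in> I \<longleftrightarrow> (\<forall>b. y b f = 0)" if "f \<in> forms (Suc l)" for f
    using chart_mem_iff[OF C(2) Iv that] chart_coord_outside[OF C(2)] unfolding y_def
    by (metis (no_types, lifting) mult_zero_right sum.neutral)
  have y_add: "y b (f + g) = y b f + y b g" for b f g
    by (simp add: y_def lookup_add sum.distrib distrib_right)
  have y_scale: "y b (poly_scale c f) = c * y b f" for b c f
    by (simp add: y_def sum_distrib_left mult.assoc)
  have y_0: "y b 0 = 0" for b by (simp add: y_def)
  have y_sum: "y b (\<Sum>i\<in>A. f i) = (\<Sum>i\<in>A. y b (f i))" for b f and A :: "nat set"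
    by (induction A rule: infinite_finite_induct) (simp_all add: y_add y_0)
  define u where "u i s = Var (e i) * Poly_Mapping.single (\<beta> s) 1" for i s
  define v where "v s b = (\<Sum>i<N. monom (y b (u i s)) i)" for s b
  have poly_v: "poly (v s b) t = y b ((\<Sum>i<N. poly_scale (t ^ i) (Var (e i))) * Poly_Mapping.single (\<beta> s) 1)" for s b t
  proof -
    have "poly (v s b) t = (\<Sum>i<N. t ^ i * y b (u i s))"
      unfolding v_def poly_sum poly_monom by (rule sum.cong[OF refl mult.commute])
    then show ?thesis by (simp add: sum_distrib_right poly_scale_mult y_sum y_scale u_def)
  qed
  have coeff_v: "coeff (v s b) i = (if i < N then y b (u i s) else 0)" for s b i
    by (simp add: v_def coeff_sum)
  from elimination[of "card B" v] show ?thesis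
  proof
    assume "\<exists>c. (\<exists>s<card B. c s \<noteq> 0) \<and> (\<forall>b. (\<Sum>s<card B. c s * v s b) = 0)"
    then obtain c where cc: "(\<exists>s<card B. c s \<noteq> 0) \<and> (\<forall>b. (\<Sum>s<card B. c s * v s b) = 0)" ..
    have c0: "\<exists>s<card B. c s \<noteq> 0" using cc by (rule conjunct1)
    have c1: "\<forall>b. (\<Sum>s<card B. c s * v s b) = 0" using cc by (rule conjunct2)
    from c0 obtain s0 where s0: "s0 < card B" "c s0 \<noteq> 0" by blast
    have c: "(\<Sum>s<card B. c s * v s b) = 0" for b using c1 by (rule spec)
    \<comment> \<open>The coefficient of \<open>t ^ j\<close> in the kernel vector, read as a form
      of degree \<open>l\<close>; the kernel equations, compared power by power, are the ones
      McCoy's theorem asks for.\<close>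
    define k where "k j = (\<Sum>s<card B. Poly_Mapping.single (\<beta> s) (coeff (c s) j))" for j
    define r where "r = Suc (Max ((\<lambda>s. degree (c s)) ` {..<card B}))"
    have "k j \<in> I" for j
    proof (rule McCoy[OF I, of N e r k])
      show "f \<in> I" if "\<And>i. i < N \<Longrightarrow> Var (e i) * f \<in> I" for f
      proof (rule sat)
        fix i
        have "i \<in> e ` {..<N}" using e by simp
        then obtain n where "n < N" "i = e n" by blast
        then show "Var i * f \<in> I" using that by simp
      qed
      show "k j \<in> I" if "j \<ge> r" for j
      proof -
        have "degree (c s) < j" if "s < card B" for s
        proof -
          have "degree (c s) \<le> Max ((\<lambda>s. degree (c s)) ` {..<card B})" using that by (intro Max_ge) auto
          then show ?thesis using \<open>j \<ge> r\<close> by (simp add: r_def)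
        qed
        then have "k j = 0" by (simp add: k_def coeff_eq_0)
        then show ?thesis using mpoly_ideal.subspace_0[OF I] by simp
      qed
      show "(\<Sum>i | i < N \<and> i \<le> n. Var (e i) * k (n - i)) \<in> I" for n
      proof -
        let ?A = "{i. i < N \<and> i \<le> n}"
        have uk: "Var (e i) * k j = (\<Sum>s<card B. poly_scale (coeff (c s) j) (u i s))" for i j
          unfolding k_def u_def sum_distrib_left
          by (intro sum.cong refl, subst single_eq_scale) (rule mult_poly_scale)
        have "(\<Sum>i\<in>?A. Var (e i) * k (n - i)) \<in> forms (Suc l)"
          unfolding uk u_def using forms_mult[OF forms_Var, of "Poly_Mapping.single (\<beta> s) 1" l for s] \<beta>l
          by (intro forms_sum forms_scale) (simp add: Var_def mult_single)
        moreover have "y b (\<Sum>i\<in>?A. Var (e i) * k (n - i)) = 0" for b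
        proof -
          have "y b (\<Sum>i\<in>?A. Var (e i) * k (n - i)) = (\<Sum>i\<in>?A. \<Sum>s<card B. coeff (c s) (n - i) * y b (u i s))"
            by (simp add: uk y_sum y_scale)
          also have "\<dots> = (\<Sum>i\<le>n. \<Sum>s<card B. coeff (c s) (n - i) * coeff (v s b) i)"
          proof (rule sum.mono_neutral_cong_left)
            show "\<forall>i\<in>{..n} - ?A. (\<Sum>s<card B. coeff (c s) (n - i) * coeff (v s b) i) = 0"
              by (intro ballI sum.neutral) (auto simp: coeff_v)
          qed (simp_all add: coeff_v subset_iff)
          also have "\<dots> = coeff (\<Sum>s<card B. v s b * c s) n"
            unfolding coeff_sum coeff_mult
            by (subst sum.swap) (intro sum.cong refl mult.commute)
          also have "(\<Sum>s<card B. v s b * c s) = (\<Sum>s<card B. c s * v s b)"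
            by (intro sum.cong refl mult.commute)
          also have "coeff \<dots> n = 0" using c[of b] by simp
          finally show ?thesis .
        qed
        ultimately show ?thesis by (simp add: y_mem)
      qed
    qed
    then have *: "(\<Sum>b\<in>B. Poly_Mapping.single b (coeff (c (the_inv_into {..<card B} \<beta> b)) j)) \<in> I" for j
      using \<beta> by (simp add: sumB k_def the_inv_into_f_f bij_betw_def)
    have "coeff (c s0) j = 0" for j
      using chart_independent[OF B(2) Iv *[of j], of "\<beta> s0"] \<beta> s0(1)
      by (auto simp: the_inv_into_f_f bij_betw_def)
    then have "c s0 = 0" by (simp add: poly_eq_iff)
    then show ?thesis using s0 by simp
  next
    assume fin: "finite {t. \<exists>c. (\<exists>s<card B. c s \<noteq> 0) \<and> (\<forall>b. (\<Sum>s<card B. c s * poly (v s b) t) = 0)}"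
    show ?thesis
    proof (rule finite_subset[OF _ fin], safe)
      fix t f assume f: "f \<in> forms l" "f \<notin> I" and gf: "(\<Sum>i<N. poly_scale (t ^ i) (Var (e i))) * f \<in> I"
      let ?g = "\<Sum>i<N. poly_scale (t ^ i) (Var (e i))"
      define d where "d b = (\<Sum>\<mu>\<in>monomials l. Poly_Mapping.lookup f \<mu> * chart_coord l B I (\<mu>, b))" for b
      define c where "c s = d (\<beta> s)" for s
      have red: "f - (\<Sum>s<card B. poly_scale (c s) (Poly_Mapping.single (\<beta> s) 1)) \<in> I"
        using chart_reduce[OF B(2) Iv f(1)] by (simp add: sumB c_def d_def)
      have "\<exists>s<card B. c s \<noteq> 0"
      proof (rule ccontr)
        assume "\<not> ?thesis"
        then show False using red f(2) by simp
      qed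
      moreover have "(\<Sum>s<card B. c s * poly (v s b) t) = 0" for b
      proof -
        let ?h = "?g * (\<Sum>s<card B. poly_scale (c s) (Poly_Mapping.single (\<beta> s) 1))"
        have "?g * f - ?g * (f - (\<Sum>s<card B. poly_scale (c s) (Poly_Mapping.single (\<beta> s) 1))) \<in> I"
          by (rule mpoly_ideal.subspace_diff[OF I gf mpoly_ideal.subspace_scale[OF I red]])
        then have "?h \<in> I" by (simp add: right_diff_distrib)
        moreover have "?g \<in> forms 1" by (intro forms_sum forms_scale forms_Var)
        then have "?h \<in> forms (1 + l)"
          using \<beta>l by (intro forms_mult forms_sum forms_scale) auto
        ultimately have "y b ?h = 0" using y_mem by simp
        moreover have "y b ?h = (\<Sum>s<card B. c s * poly (v s b) t)"
          unfolding poly_v sum_distrib_left[of ?g] mult_poly_scale y_sum y_scale ..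
        ultimately show ?thesis by simp
      qed
      ultimately show "\<exists>c. (\<exists>s<card B. c s \<noteq> 0) \<and> (\<forall>b. (\<Sum>s<card B. c s * poly (v s b) t) = 0)" by blast
    qed
  qed
qed

text \<open>Each degree up to \<open>M\<close> excludes finitely many members of the family, and the
  bound \<open>M\<close> keeps the union of the excluded sets finite.\<close>

lemma exists_regular_linear_form:
  fixes I :: "'v::finite mpoly set"
  assumes I: "mpoly_ideal.subspace I" and sat: "\<And>f. (\<And>i. Var i * f \<in> I) \<Longrightarrow> f \<in> I"
  obtains g where "g \<in> forms 1" "\<And>l f. l \<le> M \<Longrightarrow> f \<in> forms l \<Longrightarrow> g * f \<in> I \<Longrightarrow> f \<in> I"
proof -
  obtain e :: "nat \<Rightarrow> 'v" where "bij_betw e {..<CARD('v)} UNIV"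
    using ex_bij_betw_nat_finite[of "UNIV :: 'v set"] by (auto simp: atLeast0LessThan)
  then have e: "e ` {..<CARD('v)} = UNIV" by (simp add: bij_betw_def)
  let ?g = "\<lambda>t. \<Sum>i<CARD('v). poly_scale (t ^ i) (Var (e i))"
  have "finite (\<Union>l\<le>M. {t. \<exists>f\<in>forms l. f \<notin> I \<and> ?g t * f \<in> I})"
    by (intro finite_UN_I finite_atMost polynomial_family_injective[OF I sat e])
  then obtain t where "t \<notin> (\<Union>l\<le>M. {t. \<exists>f\<in>forms l. f \<notin> I \<and> ?g t * f \<in> I})"
    using infinite_UNIV_char_0 ex_new_if_finite by blast
  then show ?thesis
    by (intro that[of "?g t"]) (auto intro!: forms_sum forms_scale)
qed

lemma saturated_Var:
  fixes I :: "'v::finite mpoly set"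
  assumes I: "mpoly_ideal.subspace I" "saturated I" and f: "\<And>i. Var i * f \<in> I"
  shows "f \<in> I"
proof -
  have "g * f \<in> I" if "g \<in> forms 1" for g
  proof -
    have "(\<Sum>i\<in>UNIV. poly_scale (Poly_Mapping.lookup g (Poly_Mapping.single i 1)) (Var i) * f) \<in> I"
      using f ideal_imp_subspace[OF I(1)]
      by (intro mpoly_ideal.subspace_sum[OF I(1)]) (simp add: poly_scale_mult mpoly_vs.subspace_scale)
    then show ?thesis by (subst forms_1_expand[OF that]) (simp add: sum_distrib_right)
  qed
  then show ?thesis using I(2) unfolding saturated_def by blast
qed

section \<open>Growth of the Hilbert function under a hyperplane section\<close>

text \<open>The coordinate ring cut by \<open>g\<close> has dimension at most one in degree
  \<open>l + 1\<close>, spanned by \<open>e\<close>; the choice \<open>e = 0\<close> says that it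
  vanishes there.\<close>

definition spans_next :: "'v mpoly set \<Rightarrow> 'v mpoly \<Rightarrow> nat \<Rightarrow> 'v mpoly \<Rightarrow> bool" where
  "spans_next I g l e \<longleftrightarrow> (\<forall>f\<in>forms (Suc l). \<exists>a\<in>forms l. \<exists>c. f - g * a - poly_scale c e \<in> I)"

text \<open>The smallest case of Macaulay's growth bound: for the ring cut by \<open>g\<close>,
  dimension at most one passes to the next degree, and dimension zero stays zero.\<close>

lemma spans_next_propagates:
  fixes I :: "'v::finite mpoly set"
  assumes I: "mpoly_ideal.subspace I" and e: "e \<in> forms (Suc l)" and sp: "spans_next I g l e"
  obtains e' where "e' \<in> forms (Suc (Suc l))" "spans_next I g (Suc l) e'" "e = 0 \<Longrightarrow> e' = 0"
proof -
  have Iv: "mpoly_vs.subspace I" using I by (rule ideal_imp_subspace)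
  define J where "J l f \<longleftrightarrow> (\<exists>a\<in>forms l. f - g * a \<in> I)" for l f
  have J_add: "J l f \<Longrightarrow> J l f' \<Longrightarrow> J l (f + f')" for l f f'
  proof -
    assume "J l f" "J l f'"
    then obtain a a' where "a \<in> forms l" "f - g * a \<in> I" "a' \<in> forms l" "f' - g * a' \<in> I"
      unfolding J_def by blast
    moreover have "f + f' - g * (a + a') = (f - g * a) + (f' - g * a')" by (simp add: distrib_left)
    ultimately show "J l (f + f')"
      unfolding J_def using forms_add mpoly_vs.subspace_add[OF Iv] by metis
  qed
  have J_scale: "J l f \<Longrightarrow> J l (poly_scale c f)" for l f c
  proof -
    assume "J l f"
    then obtain a where "a \<in> forms l" "f - g * a \<in> I" unfolding J_def by blast
    moreover have "poly_scale c f - g * poly_scale c a = poly_scale c (f - g * a)"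
      by (simp add: mpoly_vs.scale_right_diff_distrib mult_poly_scale)
    ultimately show "J l (poly_scale c f)"
      unfolding J_def using forms_scale mpoly_vs.subspace_scale[OF Iv] by metis
  qed
  have J_Var: "J l f \<Longrightarrow> J (Suc l) (Var i * f)" for l f i
  proof -
    assume "J l f"
    then obtain a where a: "a \<in> forms l" "f - g * a \<in> I" unfolding J_def by blast
    have "Var i * a \<in> forms (Suc l)" using forms_mult[OF forms_Var a(1)] by simp
    moreover have "Var i * f - g * (Var i * a) = Var i * (f - g * a)"
      by (simp add: right_diff_distrib mult.left_commute)
    ultimately show "J (Suc l) (Var i * f)"
      unfolding J_def using mpoly_ideal.subspace_scale[OF I a(2)] by metis
  qed
  have J_0: "J l 0" for l
    unfolding J_def using mpoly_vs.subspace_0[OF Iv] by (intro bexI[of _ 0]) auto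
  have lift: "spans_next I g n e'"
    if e': "\<And>\<mu>. \<mu> \<in> monomials (Suc n) \<Longrightarrow> \<exists>c. J n (Poly_Mapping.single \<mu> 1 - poly_scale c e')" for n e'
  proof -
    obtain c where c: "\<And>\<mu>. \<mu> \<in> monomials (Suc n) \<Longrightarrow> J n (Poly_Mapping.single \<mu> 1 - poly_scale (c \<mu>) e')"
      using e' by metis
    have J_sum: "J n (\<Sum>i\<in>A. h i)" if "\<And>i. i \<in> A \<Longrightarrow> J n (h i)" for A and h :: "('v \<Rightarrow>\<^sub>0 nat) \<Rightarrow> _"
      using that by (induction A rule: infinite_finite_induct) (auto intro: J_0 J_add)
    have "\<exists>d. J n (f - poly_scale d e')" if f: "f \<in> forms (Suc n)" for f
    proof
      have "J n (\<Sum>\<mu>\<in>monomials (Suc n). poly_scale (Poly_Mapping.lookup f \<mu>) (Poly_Mapping.single \<mu> 1 - poly_scale (c \<mu>) e'))"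
        by (intro J_sum J_scale c)
      then show "J n (f - poly_scale (\<Sum>\<mu>\<in>monomials (Suc n). Poly_Mapping.lookup f \<mu> * c \<mu>) e')"
        using forms_expand[OF f]
        by (simp add: mpoly_vs.scale_right_diff_distrib sum_subtractf mpoly_vs.scale_sum_left)
    qed
    note red = this
    show ?thesis
      unfolding spans_next_def
    proof
      fix f :: "'v mpoly" assume "f \<in> forms (Suc n)"
      then obtain d a where a: "a \<in> forms n" "f - poly_scale d e' - g * a \<in> I"
        using red unfolding J_def by blast
      have "f - g * a - poly_scale d e' = f - poly_scale d e' - g * a" by (simp add: algebra_simps)
      then have "f - g * a - poly_scale d e' \<in> I" using a(2) by (simp only:)
      then show "\<exists>a\<in>forms n. \<exists>c. f - g * a - poly_scale c e' \<in> I" using a(1) by blast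
    qed
  qed
  show ?thesis
  proof (cases "\<forall>\<mu>\<in>monomials (Suc l). J l (Poly_Mapping.single \<mu> 1)")
    case True
    have "spans_next I g (Suc l) 0"
    proof (rule lift)
      fix \<mu> :: "'v \<Rightarrow>\<^sub>0 nat" assume "\<mu> \<in> monomials (Suc (Suc l))"
      then obtain i \<nu> where "\<nu> \<in> monomials (Suc l)" "\<mu> = Poly_Mapping.single i 1 + \<nu>"
        by (rule monomial_decomp)
      then have "J (Suc l) (Poly_Mapping.single \<mu> 1)"
        using J_Var[of l "Poly_Mapping.single \<nu> 1" i] True by (simp add: Var_def mult_single)
      then show "\<exists>c. J (Suc l) (Poly_Mapping.single \<mu> 1 - poly_scale c 0)" by simp
    qed
    then show ?thesis using that[of 0] by simp
  next
    case False
    then obtain \<mu>0 where \<mu>0: "\<mu>0 \<in> monomials (Suc l)" "\<not> J l (Poly_Mapping.single \<mu>0 1)" by blast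
    let ?m = "Poly_Mapping.single \<mu>0 (1::complex)"
    have "?m \<in> forms (Suc l)" using \<mu>0(1) by (simp add: mem_monomials)
    then obtain a0 c0 where a0: "a0 \<in> forms l" "?m - g * a0 - poly_scale c0 e \<in> I"
      using sp unfolding spans_next_def by blast
    have c0: "c0 \<noteq> 0 \<and> e \<noteq> 0" using a0 \<mu>0(2) unfolding J_def by auto
    have red: "\<exists>c. J l (f - poly_scale c ?m)" if f: "f \<in> forms (Suc l)" for f
    proof -
      obtain a c where a: "a \<in> forms l" "f - g * a - poly_scale c e \<in> I"
        using sp f unfolding spans_next_def by blast
      let ?r = "c / c0"
      have "(f - g * a - poly_scale c e) - poly_scale ?r (?m - g * a0 - poly_scale c0 e) \<in> I"
        by (rule subspace_sub[OF Iv a(2) mpoly_vs.subspace_scale[OF Iv a0(2)]])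
      moreover have "(f - g * a - poly_scale c e) - poly_scale ?r (?m - g * a0 - poly_scale c0 e)
        = (f - poly_scale ?r ?m) - g * (a - poly_scale ?r a0)"
        using c0 by (simp add: mpoly_vs.scale_right_diff_distrib right_diff_distrib mult_poly_scale)
      moreover have "a - poly_scale ?r a0 \<in> forms l" by (intro forms_diff forms_scale a(1) a0(1))
      ultimately show ?thesis unfolding J_def by metis
    qed
    \<comment> \<open>Since \<open>?m\<close> is \<open>x_k\<close> times \<open>\<nu>\<close> and
      spans degree \<open>l + 1\<close>, a product \<open>x_j \<kappa>\<close> is a multiple of
      \<open>x_k (x_j \<nu>)\<close>, and \<open>x_j \<nu>\<close> is again a multiple of
      \<open>?m\<close>. So \<open>x_k ?m\<close> spans the next degree.\<close>
    obtain k \<nu> where k: "\<nu> \<in> monomials l" "\<mu>0 = Poly_Mapping.single k 1 + \<nu>"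
      using \<mu>0(1) by (rule monomial_decomp)
    have mk: "?m = Var k * Poly_Mapping.single \<nu> 1" by (simp add: k(2) Var_def mult_single)
    let ?e' = "Var k * ?m"
    have "spans_next I g (Suc l) ?e'"
    proof (rule lift)
      fix \<mu> :: "'v \<Rightarrow>\<^sub>0 nat" assume "\<mu> \<in> monomials (Suc (Suc l))"
      then obtain j \<kappa> where j: "\<kappa> \<in> monomials (Suc l)" "\<mu> = Poly_Mapping.single j 1 + \<kappa>"
        by (rule monomial_decomp)
      have mj: "Poly_Mapping.single \<mu> 1 = Var j * Poly_Mapping.single \<kappa> (1::complex)"
        by (simp add: j(2) Var_def mult_single)
      obtain c where c: "J l (Poly_Mapping.single \<kappa> 1 - poly_scale c ?m)"
        using red[of "Poly_Mapping.single \<kappa> 1"] j(1) by (auto simp: mem_monomials)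
      have "Var j * Poly_Mapping.single \<nu> 1 \<in> forms (Suc l)"
        using k(1) by (simp add: Var_def mult_single mem_monomials)
      then obtain c' where c': "J l (Var j * Poly_Mapping.single \<nu> 1 - poly_scale c' ?m)"
        using red by blast
      have "J (Suc l) (Var j * (Poly_Mapping.single \<kappa> 1 - poly_scale c ?m)
        + poly_scale c (Var k * (Var j * Poly_Mapping.single \<nu> 1 - poly_scale c' ?m)))"
        by (intro J_add J_scale J_Var c c')
      moreover have "Var j * (Poly_Mapping.single \<kappa> 1 - poly_scale c ?m)
        + poly_scale c (Var k * (Var j * Poly_Mapping.single \<nu> 1 - poly_scale c' ?m))
        = Poly_Mapping.single \<mu> 1 - poly_scale (c * c') ?e'"
      proof -
        have "Var k * (Var j * Poly_Mapping.single \<nu> 1) = Var j * ?m"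
          unfolding mk by (rule mult.left_commute)
        then show ?thesis
          unfolding mj right_diff_distrib mult_poly_scale mpoly_vs.scale_right_diff_distrib
          by simp
      qed
      ultimately show "\<exists>c. J (Suc l) (Poly_Mapping.single \<mu> 1 - poly_scale c ?e')" by metis
    qed
    moreover have "?e' \<in> forms (Suc (Suc l))"
      using \<mu>0(1) by (simp add: Var_def mult_single mem_monomials)
    ultimately show ?thesis using that c0 by blast
  qed
qed

lemma hilbert_function_step_le:
  fixes I :: "'v::finite mpoly set"
  assumes I: "mpoly_ideal.subspace I" and sp: "spans_next I g l e"
  shows "hilbert_function I (Suc l) \<le> hilbert_function I l + (if e = 0 then 0 else 1)"
proof -
  have Iv: "mpoly_vs.subspace I" using I by (rule ideal_imp_subspace)
  obtain B where B: "B \<subseteq> monomials l" "I \<in> chart l B" by (rule exists_chart[OF Iv])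
  have finB: "finite B" using B finite_monomial_subset by blast
  define A where "A = Some ` B \<union> (if e = 0 then {} else {None})"
  define p where "p = case_option e (\<lambda>b. g * Poly_Mapping.single b 1)"
  have split: "(\<Sum>i\<in>A. poly_scale (c i) (p i)) =
    (\<Sum>b\<in>B. poly_scale (c (Some b)) (g * Poly_Mapping.single b 1)) + poly_scale (c None) e" for c
    using finB by (cases "e = 0") (simp_all add: A_def p_def sum.reindex add.commute)
  have "hilbert_function I (Suc l) \<le> card A"
  proof (rule hilbert_function_le[OF Iv, of A "Suc l" p])
    show "finite A" using finB by (simp add: A_def)
    fix f :: "'v mpoly" assume f: "f \<in> forms (Suc l)"
    obtain a c where a: "a \<in> forms l" "f - g * a - poly_scale c e \<in> I"
      using sp f unfolding spans_next_def by blast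
    define d where "d b = (\<Sum>\<mu>\<in>monomials l. Poly_Mapping.lookup a \<mu> * chart_coord l B I (\<mu>, b))" for b
    have "a - (\<Sum>b\<in>B. Poly_Mapping.single b (d b)) \<in> I"
      using chart_reduce[OF B(2) Iv a(1)] by (simp add: d_def)
    then have "(f - g * a - poly_scale c e) + g * (a - (\<Sum>b\<in>B. Poly_Mapping.single b (d b))) \<in> I"
      using mpoly_ideal.subspace_add[OF I a(2) mpoly_ideal.subspace_scale[OF I]] by blast
    moreover have "g * (\<Sum>b\<in>B. Poly_Mapping.single b (d b)) = (\<Sum>b\<in>B. poly_scale (d b) (g * Poly_Mapping.single b 1))"
      unfolding sum_distrib_left by (intro sum.cong refl, subst single_eq_scale) (rule mult_poly_scale)
    ultimately have "f - ((\<Sum>b\<in>B. poly_scale (d b) (g * Poly_Mapping.single b 1)) + poly_scale c e) \<in> I"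
      by (simp add: right_diff_distrib algebra_simps)
    then show "\<exists>c. f - (\<Sum>i\<in>A. poly_scale (c i) (p i)) \<in> I"
      unfolding split by (intro exI[of _ "case_option c d"]) simp
  qed
  also have "card A \<le> card B + (if e = 0 then 0 else 1)"
    unfolding A_def using finB by (auto simp: card_image card_insert_if)
  finally show ?thesis using hilbert_function_chart[OF B Iv] by simp
qed

lemma indep_mod_extend:
  assumes I: "mpoly_vs.subspace I" and ind: "indep_mod I r p"
    and e: "\<And>c. e - (\<Sum>i<r. poly_scale (c i) (p i)) \<notin> I"
  shows "indep_mod I (Suc r) (p(r := e))"
  unfolding indep_mod_def
proof (rule allI, rule impI)
  fix c assume "(\<Sum>i<Suc r. poly_scale (c i) ((p(r := e)) i)) \<in> I"
  then have c: "(\<Sum>i<r. poly_scale (c i) (p i)) + poly_scale (c r) e \<in> I" by simp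
  have "c r = 0"
  proof (rule ccontr)
    assume nz: "c r \<noteq> 0"
    have eq: "poly_scale (1 / c r) ((\<Sum>i<r. poly_scale (c i) (p i)) + poly_scale (c r) e)
      = e - (\<Sum>i<r. poly_scale (- c i / c r) (p i))"
      using nz by (simp add: mpoly_vs.scale_right_distrib mpoly_vs.scale_sum_right sum_negf)
    show False using e mpoly_vs.subspace_scale[OF I c, of "1 / c r"] unfolding eq by (rule notE)
  qed
  then show "\<forall>i<Suc r. c i = 0"
    using c ind unfolding indep_mod_def by (auto simp: less_Suc_eq)
qed

lemma indep_mod_mult:
  fixes I :: "'v::finite mpoly set"
  assumes I: "mpoly_ideal.subspace I"
    and reg: "\<And>f. f \<in> forms l \<Longrightarrow> g * f \<in> I \<Longrightarrow> f \<in> I"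
  obtains q where "\<And>i. q i \<in> forms l" "indep_mod I (hilbert_function I l) (\<lambda>i. g * q i)"
proof -
  have Iv: "mpoly_vs.subspace I" using I by (rule ideal_imp_subspace)
  obtain B where B: "B \<subseteq> monomials l" "I \<in> chart l B" by (rule exists_chart[OF Iv])
  have finB: "finite B" using B finite_monomial_subset by blast
  obtain \<beta> where \<beta>: "bij_betw \<beta> {..<card B} B"
    using ex_bij_betw_nat_finite[OF finB] by (auto simp: atLeast0LessThan)
  define q where "q i = (if i < card B then Poly_Mapping.single (\<beta> i) (1::complex) else 0)" for i
  have q: "q i \<in> forms l" for i
    using bij_betwE[OF \<beta>] B(1) by (auto simp: q_def mem_monomials)
  have "indep_mod I (card B) (\<lambda>i. g * q i)"
    unfolding indep_mod_def
  proof (rule allI, rule impI)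
    fix c assume "(\<Sum>i<card B. poly_scale (c i) (g * q i)) \<in> I"
    then have "g * (\<Sum>i<card B. poly_scale (c i) (q i)) \<in> I"
      by (simp add: sum_distrib_left mult_poly_scale)
    moreover have "(\<Sum>i<card B. poly_scale (c i) (q i)) \<in> forms l" by (intro forms_sum forms_scale q)
    ultimately have "(\<Sum>i<card B. poly_scale (c i) (q i)) \<in> I" using reg by blast
    also have "(\<Sum>i<card B. poly_scale (c i) (q i)) = (\<Sum>i<card B. Poly_Mapping.single (\<beta> i) (c (the_inv_into {..<card B} \<beta> (\<beta> i))))"
      using \<beta> by (intro sum.cong) (auto simp: q_def the_inv_into_f_f bij_betw_def)
    also have "\<dots> = (\<Sum>b\<in>B. Poly_Mapping.single b (c (the_inv_into {..<card B} \<beta> b)))"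
      by (rule sum.reindex_bij_betw[OF \<beta>])
    finally have *: "(\<Sum>b\<in>B. Poly_Mapping.single b (c (the_inv_into {..<card B} \<beta> b))) \<in> I" .
    show "\<forall>i<card B. c i = 0"
    proof (intro allI impI)
      fix i assume i: "i < card B"
      then have "\<beta> i \<in> B" using \<beta> by (auto simp: bij_betw_def)
      from chart_independent[OF B(2) Iv * this] show "c i = 0"
        using \<beta> i by (simp add: the_inv_into_f_f bij_betw_def)
    qed
  qed
  then show ?thesis using that[of q] q hilbert_function_chart[OF B Iv] by simp
qed

lemma hilbert_function_step_ge1:
  fixes I :: "'v::finite mpoly set"
  assumes I: "mpoly_ideal.subspace I" and g: "g \<in> forms 1"
    and reg: "\<And>f. f \<in> forms l \<Longrightarrow> g * f \<in> I \<Longrightarrow> f \<in> I"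
    and ns: "\<not> spans_next I g l 0"
  shows "hilbert_function I l + 1 \<le> hilbert_function I (Suc l)"
proof -
  have Iv: "mpoly_vs.subspace I" using I by (rule ideal_imp_subspace)
  obtain q where q: "\<And>i. q i \<in> forms l" "indep_mod I (hilbert_function I l) (\<lambda>i. g * q i)"
    using indep_mod_mult[OF I reg] by blast
  obtain e where e: "e \<in> forms (Suc l)" "\<And>a. a \<in> forms l \<Longrightarrow> e - g * a \<notin> I"
    using ns unfolding spans_next_def by auto
  have ind: "indep_mod I (Suc (hilbert_function I l)) ((\<lambda>i. g * q i)(hilbert_function I l := e))"
  proof (rule indep_mod_extend[OF Iv q(2)])
    fix c
    have "(\<Sum>i<hilbert_function I l. poly_scale (c i) (q i)) \<in> forms l" by (intro forms_sum forms_scale q)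
    from e(2)[OF this] show "e - (\<Sum>i<hilbert_function I l. poly_scale (c i) (g * q i)) \<notin> I"
      by (simp add: sum_distrib_left mult_poly_scale)
  qed
  have fm: "((\<lambda>i. g * q i)(hilbert_function I l := e)) i \<in> forms (Suc l)" for i
    using e(1) forms_mult[OF g q(1)] by simp
  show ?thesis using hilbert_function_ge[OF Iv fm ind] by simp
qed

text \<open>Multiples of the regular form \<open>g\<close> contribute the whole dimension of degree
  \<open>l\<close>; if no single form spans the rest, two further independent classes exist.\<close>

lemma hilbert_function_step_ge2:
  fixes I :: "'v::finite mpoly set"
  assumes I: "mpoly_ideal.subspace I" and g: "g \<in> forms 1"
    and reg: "\<And>f. f \<in> forms l \<Longrightarrow> g * f \<in> I \<Longrightarrow> f \<in> I"
    and ns: "\<And>e. e \<in> forms (Suc l) \<Longrightarrow> \<not> spans_next I g l e"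
  shows "hilbert_function I l + 2 \<le> hilbert_function I (Suc l)"
proof -
  have Iv: "mpoly_vs.subspace I" using I by (rule ideal_imp_subspace)
  let ?n = "hilbert_function I l"
  obtain q where q: "\<And>i. q i \<in> forms l" "indep_mod I ?n (\<lambda>i. g * q i)"
    using indep_mod_mult[OF I reg] by blast
  obtain e where e: "e \<in> forms (Suc l)" "\<And>a. a \<in> forms l \<Longrightarrow> e - g * a \<notin> I"
    using ns[of 0] unfolding spans_next_def by auto
  obtain e' where e': "e' \<in> forms (Suc l)" "\<And>a c. a \<in> forms l \<Longrightarrow> e' - g * a - poly_scale c e \<notin> I"
    using ns[OF e(1)] unfolding spans_next_def by auto
  have qf: "(\<Sum>i<?n. poly_scale (c i) (q i)) \<in> forms l" for c by (intro forms_sum forms_scale q)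
  have gq: "(\<Sum>i<?n. poly_scale (c i) (g * q i)) = g * (\<Sum>i<?n. poly_scale (c i) (q i))" for c
    by (simp add: sum_distrib_left mult_poly_scale)
  let ?p = "(\<lambda>i. g * q i)(?n := e)"
  have "indep_mod I (Suc ?n) ?p"
    by (rule indep_mod_extend[OF Iv q(2)]) (use e(2)[OF qf] in \<open>simp add: gq\<close>)
  moreover have "e' - (\<Sum>i<Suc ?n. poly_scale (c i) (?p i)) \<notin> I" for c
    using e'(2)[OF qf, of c "c ?n"] by (simp add: gq diff_diff_eq)
  ultimately have ind: "indep_mod I (Suc (Suc ?n)) (?p(Suc ?n := e'))"
    by (rule indep_mod_extend[OF Iv])
  have fm: "(?p(Suc ?n := e')) i \<in> forms (Suc l)" for i
    using e(1) e'(1) forms_mult[OF g q(1)] by simp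
  show ?thesis using hilbert_function_ge[OF Iv fm ind] by simp
qed

text \<open>Up to degree \<open>M\<close> the Hilbert function grows by at least \<open>d\<close> in
  each step, because slower growth would persist up to \<open>M\<close>, where the growth is known
  to be \<open>d\<close>. Starting from at least 1 in degree 0, it reaches \<open>d * M + 1\<close>
  only if every step is sharp.\<close>

lemma hilbert_function_exact:
  fixes I :: "'v::finite mpoly set"
  assumes I: "homogeneous_ideal I" "saturated I" and d: "d = 1 \<or> d = 2"
    and ev: "\<forall>\<^sub>F m in sequentially. hilbert_function I m = d * m + 1"
  shows "hilbert_function I l = d * l + 1"
proof -
  have Ii: "mpoly_ideal.subspace I" using I(1) by (simp add: homogeneous_ideal_def)
  have Iv: "mpoly_vs.subspace I" using Ii by (rule ideal_imp_subspace)
  obtain M0 where M0: "\<And>m. m \<ge> M0 \<Longrightarrow> hilbert_function I m = d * m + 1"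
    using ev by (auto simp: eventually_sequentially)
  \<comment> \<open>Large enough for the polynomial formula to hold at \<open>M\<close> and for
    degree \<open>l\<close> to lie below.\<close>
  define M where "M = max M0 l"
  have HM: "hilbert_function I M = d * M + 1" "hilbert_function I (Suc M) = d * Suc M + 1"
    using M0 by (simp_all add: M_def)
  obtain g where g: "g \<in> forms 1" and reg: "\<And>k f. k \<le> M \<Longrightarrow> f \<in> forms k \<Longrightarrow> g * f \<in> I \<Longrightarrow> f \<in> I"
    using exists_regular_linear_form[OF Ii saturated_Var[OF Ii I(2)]] by blast
  have no_span: "\<not> spans_next I g k e" if "k \<le> M" "e \<in> forms (Suc k)" "d = 1 \<longrightarrow> e = 0" for k e
  proof
    assume sp: "spans_next I g k e"
    have "\<exists>e'\<in>forms (Suc k'). spans_next I g k' e' \<and> (e = 0 \<longrightarrow> e' = 0)" if "k \<le> k'" for k'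
      using that
    proof (induction k' rule: dec_induct)
      case base then show ?case using sp \<open>e \<in> forms (Suc k)\<close> by blast
    next
      case (step n)
      then obtain e' where e': "e' \<in> forms (Suc n)" "spans_next I g n e'" "e = 0 \<longrightarrow> e' = 0" by blast
      from spans_next_propagates[OF Ii e'(1,2)] e'(3) show ?case by metis
    qed
    from this[OF \<open>k \<le> M\<close>] obtain e' where e': "spans_next I g M e'" "e = 0 \<longrightarrow> e' = 0" by blast
    from hilbert_function_step_le[OF Ii e'(1)] HM d that(3) e'(2) show False
      by (auto split: if_splits)
  qed
  have step: "hilbert_function I k + d \<le> hilbert_function I (Suc k)" if "k \<le> M" for k
    using d
  proof
    assume "d = 1"
    then show ?thesis
      using hilbert_function_step_ge1[OF Ii g reg[OF that]] no_span[OF that, of 0] by simp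
  next
    assume "d = 2"
    then show ?thesis
      using hilbert_function_step_ge2[OF Ii g reg[OF that]] no_span[OF that] by simp
  qed
  have "1 \<notin> I"
  proof
    assume "1 \<in> I"
    then have all: "f \<in> I" for f using mpoly_ideal.subspace_scale[OF Ii, of 1 f] by simp
    have "hilbert_function I M \<le> card ({} :: nat set)"
      by (rule hilbert_function_le[OF Iv]) (auto simp: all)
    then show False using HM by simp
  qed
  then have "indep_mod I 1 (\<lambda>_. 1)"
    unfolding indep_mod_def
    by (auto simp: poly_scale_def)
      (metis Ii add.right_neutral divide_self_if mpoly_ideal.subspace_scale mult_single nonzero_divide_eq_eq single_one times_divide_eq_left)
  moreover have "(1 :: 'v mpoly) \<in> forms 0" by (simp flip: single_one)
  ultimately have H0: "1 \<le> hilbert_function I 0"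
    using hilbert_function_ge[OF Iv, of 1 "\<lambda>_. 1" 0] by simp
  have lower: "hilbert_function I k + d * (k' - k) \<le> hilbert_function I k'" if "k \<le> k'" "k' \<le> M" for k k'
    using that
  proof (induction k' rule: dec_induct)
    case (step n)
    then show ?case using \<open>\<And>k. k \<le> M \<Longrightarrow> _ k\<close>[of n] by (auto simp: Suc_diff_le)
  qed simp
  have "l \<le> M" by (simp add: M_def)
  then have "d * l + 1 \<le> hilbert_function I l" using lower[of 0 l] H0 by simp
  moreover have "hilbert_function I l + d * (M - l) \<le> d * M + 1" using lower[of l M] \<open>l \<le> M\<close> HM by simp
  moreover have "d * M = d * l + d * (M - l)" using \<open>l \<le> M\<close> by (simp flip: distrib_left)
  ultimately show ?thesis by linarith
qed

section \<open>Double lines in projective space\<close>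

declare mpoly_ideal.scale_scale [simp del]

definition line_point :: "('v \<Rightarrow> complex) \<Rightarrow> ('v \<Rightarrow> complex) \<Rightarrow> complex \<Rightarrow> complex \<Rightarrow> 'v \<Rightarrow> complex" where
  "line_point a b s t = (\<lambda>i. s * a i + t * b i)"

definition line_ideal :: "('v \<Rightarrow> complex) \<Rightarrow> ('v \<Rightarrow> complex) \<Rightarrow> 'v mpoly set" where
  "line_ideal a b = {f. \<forall>s t. eval_poly f (line_point a b s t) = 0}"

text \<open>The double structure in direction \<open>c\<close> on the line through \<open>a\<close> and \<open>b\<close>.\<close>

definition double_line_ideal ::
  "('v \<Rightarrow> complex) \<Rightarrow> ('v \<Rightarrow> complex) \<Rightarrow> ('v \<Rightarrow> complex) \<Rightarrow> 'v mpoly set" where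
  "double_line_ideal a b c =
     {f. \<forall>s t. eval_poly f (line_point a b s t) = 0 \<and> pdir f (line_point a b s t) c = 0}"

lemma double_line_subset_line: "double_line_ideal a b c \<subseteq> line_ideal a b"
  by (auto simp: double_line_ideal_def line_ideal_def)

lemma line_ideal_subspace: "mpoly_ideal.subspace (line_ideal a b)"
  by (auto simp: mpoly_ideal.subspace_def line_ideal_def eval_poly_simps)

lemma double_line_ideal_subspace: "mpoly_ideal.subspace (double_line_ideal a b c)"
  by (auto simp: mpoly_ideal.subspace_def double_line_ideal_def eval_poly_simps pdir_add pdir_mult)

text \<open>Homogeneity of the derivative, multiplied by \<open>r\<close> so that the exponent
  \<open>m - 1\<close> does not occur and degree 0 and \<open>r = 0\<close> are included.\<close>

lemma pdir_form_scale:
  assumes "f \<in> forms m"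
  shows "r * pdir f (\<lambda>i. r * x i) v = r ^ m * pdir f x v"
proof -
  have "((\<lambda>t. eval_poly f (\<lambda>i. r * x i + t * (r * v i))) has_field_derivative pdir f (\<lambda>i. r * x i) (\<lambda>i. r * v i)) (at 0)"
    by (rule pdir_line_derivative)
  moreover have "eval_poly f (\<lambda>i. r * x i + t * (r * v i)) = r ^ m * eval_poly f (\<lambda>i. x i + t * v i)" for t
    using eval_form_scale[OF assms, of r "\<lambda>i. x i + t * v i"] by (simp add: algebra_simps)
  ultimately have "((\<lambda>t. r ^ m * eval_poly f (\<lambda>i. x i + t * v i)) has_field_derivative pdir f (\<lambda>i. r * x i) (\<lambda>i. r * v i)) (at 0)"
    by simp
  then have "pdir f (\<lambda>i. r * x i) (\<lambda>i. r * v i) = r ^ m * pdir f x v"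
    using DERIV_unique DERIV_cmult[OF pdir_line_derivative] by blast
  moreover have "pdir f (\<lambda>i. r * x i) (\<lambda>i. r * v i) = r * pdir f (\<lambda>i. r * x i) v"
    using pdir_linear[of f "\<lambda>i. r * x i" r v 0 v] by simp
  ultimately show ?thesis by simp
qed

lemma hom_component_vanishes:
  assumes f: "f = (\<Sum>m\<le>N. hom_component m f)" and "m > N"
  shows "hom_component m f = 0"
proof (rule poly_mapping_eqI)
  fix \<mu>
  have "Poly_Mapping.lookup f \<mu> = 0" if "mdeg \<mu> = m"
    using assms(2) that by (subst f) (simp add: lookup_sum lookup_hom_component)
  then show "Poly_Mapping.lookup (hom_component m f) \<mu> = Poly_Mapping.lookup 0 \<mu>"
    by (simp add: lookup_hom_component)
qed

text \<open>Rescaling keeps a point on the line, so the values of the homogeneous components are the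
  coefficients of a polynomial in \<open>r\<close> that vanishes identically.\<close>

lemma hom_component_line:
  assumes "\<And>s t. eval_poly f (line_point a b s t) = 0"
  shows "eval_poly (hom_component m f) (line_point a b s t) = 0"
proof -
  obtain N where N: "f = (\<Sum>m\<le>N. hom_component m f)" using sum_hom_components by blast
  let ?x = "line_point a b s t"
  have "(\<Sum>m\<le>N. eval_poly (hom_component m f) ?x * r ^ m) = 0" for r
  proof -
    have "0 = eval_poly f (\<lambda>i. r * ?x i)"
      using assms[of "r * s" "r * t"] by (simp add: line_point_def algebra_simps)
    also have "\<dots> = (\<Sum>m\<le>N. eval_poly (hom_component m f) (\<lambda>i. r * ?x i))"
      by (subst N) (simp add: eval_poly_sum)
    also have "\<dots> = (\<Sum>m\<le>N. eval_poly (hom_component m f) ?x * r ^ m)"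
      by (intro sum.cong refl) (simp add: eval_form_scale[OF hom_component_forms])
    finally show ?thesis by simp
  qed
  from polynomial_sum_zero[OF this] show ?thesis
    using hom_component_vanishes[OF N, of m] by (cases "m \<le> N") auto
qed

lemma hom_component_double_line:
  assumes "\<And>s t. pdir f (line_point a b s t) c = 0"
  shows "pdir (hom_component m f) (line_point a b s t) c = 0"
proof -
  obtain N where N: "f = (\<Sum>m\<le>N. hom_component m f)" using sum_hom_components by blast
  let ?x = "line_point a b s t"
  have "(\<Sum>m\<le>N. pdir (hom_component m f) ?x c * r ^ m) = 0" for r
  proof -
    have "0 = r * pdir f (\<lambda>i. r * ?x i) c"
      using assms[of "r * s" "r * t"] by (simp add: line_point_def algebra_simps)
    also have "\<dots> = (\<Sum>m\<le>N. r * pdir (hom_component m f) (\<lambda>i. r * ?x i) c)"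
      by (subst N) (simp add: pdir_sum sum_distrib_left)
    also have "\<dots> = (\<Sum>m\<le>N. pdir (hom_component m f) ?x c * r ^ m)"
      by (intro sum.cong refl) (simp add: pdir_form_scale[OF hom_component_forms])
    finally show ?thesis by simp
  qed
  from polynomial_sum_zero[OF this] show ?thesis
    using hom_component_vanishes[OF N, of m] by (cases "m \<le> N") auto
qed

lemma line_ideal_homogeneous: "homogeneous_ideal (line_ideal a b)"
  unfolding homogeneous_ideal_def
  using line_ideal_subspace hom_component_line[of _ a b] by (auto simp: line_ideal_def)

lemma double_line_ideal_homogeneous: "homogeneous_ideal (double_line_ideal a b c)"
  unfolding homogeneous_ideal_def
  using double_line_ideal_subspace hom_component_line[of _ a b] hom_component_double_line[of _ a b c]
  by (auto simp: double_line_ideal_def)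

lemma polyfun_pdir: "polyfun (\<lambda>x. pdir f x v)"
proof (induction f rule: mpoly_induct)
  case (mult f g)
  then show ?case unfolding pdir_mult by (intro polyfun_add polyfun_mult polyfun_eval)
qed (simp_all add: pdir_add polyfun_add)

lemma polyfun_punctured_zero:
  assumes "polyfun F" "\<And>s. s \<noteq> 0 \<Longrightarrow> F (\<lambda>i. s * a i) = 0"
  shows "F (\<lambda>i. 0) = 0"
proof -
  obtain q where q: "\<And>s. F (\<lambda>i. 0 + s * a i) = poly q s"
    using polyfun_line[OF assms(1), of "\<lambda>_. 0" a] by blast
  have "poly q s = 0" if "s \<noteq> 0" for s using q[of s] assms(2)[OF that] by simp
  then have "UNIV - {0} \<subseteq> {s. poly q s = 0}" by auto
  moreover have "infinite (UNIV - {0 :: complex})" by (simp add: infinite_UNIV_char_0)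
  ultimately have "infinite {s. poly q s = 0}" using finite_subset by blast
  then have "q = 0" using poly_roots_finite by blast
  then show ?thesis using q[of 0] by simp
qed

text \<open>At a nonzero point a power of some coordinate is a multiplier that does not vanish
  there; the origin is reached from the nonzero multiples of \<open>a\<close>.\<close>

lemma vanish_of_multiples:
  assumes "a \<noteq> (\<lambda>_. 0)" and fg: "\<And>g s t. g \<in> forms n \<Longrightarrow> eval_poly (g * f) (line_point a b s t) = 0"
  shows "eval_poly f (line_point a b s t) = 0"
proof -
  have nz: "eval_poly f (line_point a b s t) = 0" if "line_point a b s t \<noteq> (\<lambda>_. 0)" for s t
  proof -
    obtain i where "line_point a b s t i \<noteq> 0" using \<open>line_point a b s t \<noteq> (\<lambda>_. 0)\<close> by blast
    moreover have "Var i ^ n \<in> forms n"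
      by (induction n) (use forms_mult[OF forms_Var] in \<open>auto simp flip: single_one\<close>)
    ultimately show ?thesis using fg[of "Var i ^ n" s t] by (simp add: eval_poly_simps)
  qed
  show ?thesis
  proof (cases "line_point a b s t = (\<lambda>_. 0)")
    case True
    have "eval_poly f (\<lambda>i. 0) = 0"
    proof (rule polyfun_punctured_zero[OF polyfun_eval])
      fix r :: complex assume "r \<noteq> 0"
      then have "line_point a b r 0 \<noteq> (\<lambda>_. 0)" using assms(1) by (auto simp: line_point_def fun_eq_iff)
      from nz[OF this] show "eval_poly f (\<lambda>i. r * a i) = 0" by (simp add: line_point_def)
    qed
    then show ?thesis using True by simp
  qed (rule nz)
qed

lemma line_ideal_saturated:
  assumes "a \<noteq> (\<lambda>_. 0)"
  shows "saturated (line_ideal a b)"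
  unfolding saturated_def
proof (intro allI impI)
  fix f assume "\<exists>n. \<forall>g\<in>forms n. g * f \<in> line_ideal a b"
  then obtain n where "\<And>g s t. g \<in> forms n \<Longrightarrow> eval_poly (g * f) (line_point a b s t) = 0"
    by (auto simp: line_ideal_def)
  from vanish_of_multiples[OF assms this] show "f \<in> line_ideal a b" by (simp add: line_ideal_def)
qed

lemma double_line_ideal_saturated:
  assumes a: "a \<noteq> (\<lambda>_. 0)"
  shows "saturated (double_line_ideal a b c)"
  unfolding saturated_def
proof (intro allI impI)
  fix f assume "\<exists>n. \<forall>g\<in>forms n. g * f \<in> double_line_ideal a b c"
  then obtain n where n: "\<And>g s t. g \<in> forms n \<Longrightarrow> eval_poly (g * f) (line_point a b s t) = 0"
    "\<And>g s t. g \<in> forms n \<Longrightarrow> pdir (g * f) (line_point a b s t) c = 0"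
    by (auto simp: double_line_ideal_def)
  have ev: "eval_poly f (line_point a b s t) = 0" for s t
    by (rule vanish_of_multiples[OF a n(1)])
  obtain p where p: "\<And>x. pdir f x c = eval_poly p x"
    using polyfun_pdir[of f c] by (auto simp: polyfun_def)
  have "eval_poly (g * p) (line_point a b s t) = 0" if "g \<in> forms n" for g s t
    using n(2)[OF that, of s t] by (simp add: pdir_mult ev eval_poly_mult p)
  from vanish_of_multiples[OF a this] have "pdir f (line_point a b s t) c = 0" for s t by (simp add: p)
  then show "f \<in> double_line_ideal a b c" by (simp add: double_line_ideal_def ev)
qed

text \<open>A reparametrization of the line and a change of direction modulo its span impose no new
  condition: derivatives along the line vanish because the values do.\<close>

lemma double_line_ideal_mono:
  assumes f: "f \<in> double_line_ideal a b c"
  shows "f \<in> double_line_ideal (line_point a b p q) (line_point a b p' q')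
    (\<lambda>i. r * c i + line_point a b u v i)"
proof -
  have pt: "line_point (line_point a b p q) (line_point a b p' q') s t
    = line_point a b (s * p + t * p') (s * q + t * q')" for s t
    by (simp add: line_point_def fun_eq_iff algebra_simps)
  have ev: "eval_poly f (line_point a b s t) = 0" and pd: "pdir f (line_point a b s t) c = 0" for s t
    using f by (auto simp: double_line_ideal_def)
  have "pdir f (line_point a b s t) (line_point a b u v) = 0" for s t
  proof (rule pdir_eqI)
    have "eval_poly f (\<lambda>i. line_point a b s t i + \<tau> * line_point a b u v i) = 0" for \<tau>
      using ev[of "s + \<tau> * u" "t + \<tau> * v"] by (simp add: line_point_def algebra_simps)
    then show "((\<lambda>\<tau>. eval_poly f (\<lambda>i. line_point a b s t i + \<tau> * line_point a b u v i)) has_field_derivative 0) (at 0)"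
      by simp
  qed
  then have "pdir f (line_point a b s t) (\<lambda>i. r * c i + line_point a b u v i) = 0" for s t
    using pdir_linear[of f "line_point a b s t" r c 1 "line_point a b u v"] pd by simp
  then show ?thesis by (simp add: double_line_ideal_def pt ev)
qed

lemma Var_power: "Var i ^ n = Poly_Mapping.single (Poly_Mapping.single i n) 1"
proof (induction n)
  case (Suc n)
  have "Poly_Mapping.single i 1 + Poly_Mapping.single i n = Poly_Mapping.single i (Suc n)"
    by (simp flip: single_add)
  then show ?case by (simp add: Suc) (simp add: Var_def mult_single)
qed simp

section \<open>Monomial bases and families of conics\<close>

definition mon2 :: "'v \<Rightarrow> 'v \<Rightarrow> nat \<Rightarrow> nat \<Rightarrow> 'v \<Rightarrow>\<^sub>0 nat" where
  "mon2 i j r s = Poly_Mapping.single i r + Poly_Mapping.single j s"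

lemma single_mon2: "Poly_Mapping.single (mon2 i j r s) 1 = Var i ^ r * Var j ^ s"
  by (simp add: mon2_def Var_power mult_single)

lemma single_mon2_mult: "Poly_Mapping.single (Poly_Mapping.single k 1 + mon2 i j r s) 1 = Var k * (Var i ^ r * Var j ^ s)"
proof -
  have "Poly_Mapping.single (Poly_Mapping.single k 1 + mon2 i j r s) 1
    = Var k * Poly_Mapping.single (mon2 i j r s) (1 :: complex)"
    by (simp add: Var_def mult_single)
  then show ?thesis unfolding single_mon2 .
qed

lemma mdeg_mon2 [simp]: "mdeg (mon2 i j r s) = r + s"
  by (simp add: mon2_def)

definition line_basis :: "'v \<Rightarrow> 'v \<Rightarrow> nat \<Rightarrow> ('v \<Rightarrow>\<^sub>0 nat) set" where
  "line_basis i j m = (\<lambda>r. mon2 i j r (m - r)) ` {..m}"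

text \<open>Standard monomials of a plane conic whose equation is monic of degree two in
  \<open>x_k\<close>: powers of \<open>x_k\<close> beyond the first are eliminated.\<close>

definition double_line_basis :: "'v \<Rightarrow> 'v \<Rightarrow> 'v \<Rightarrow> nat \<Rightarrow> ('v \<Rightarrow>\<^sub>0 nat) set" where
  "double_line_basis i j k m = line_basis i j m \<union>
     (\<lambda>r. Poly_Mapping.single k 1 + mon2 i j r (m - 1 - r)) ` {..<m}"

lemma double_line_basis_monomials: "double_line_basis i j k m \<subseteq> monomials m"
  by (auto simp: double_line_basis_def line_basis_def mem_monomials)

lemma line_basis_monomials: "line_basis i j m \<subseteq> monomials m"
  by (auto simp: line_basis_def mem_monomials)

lemma line_basis_mem: "r + s = m \<Longrightarrow> mon2 i j r s \<in> line_basis i j m"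
  unfolding line_basis_def by (rule image_eqI[of _ _ r]) auto

lemma double_line_basis_mem1: "r + s = m \<Longrightarrow> mon2 i j r s \<in> double_line_basis i j k m"
  by (simp add: double_line_basis_def line_basis_mem)

lemma double_line_basis_mem2: "Suc (r + s) = m \<Longrightarrow> Poly_Mapping.single k 1 + mon2 i j r s \<in> double_line_basis i j k m"
  unfolding double_line_basis_def by (rule UnI2, rule image_eqI[of _ _ r]) auto

lemma mon2_lookup:
  assumes "i \<noteq> j"
  shows "Poly_Mapping.lookup (mon2 i j r s) i = r" "Poly_Mapping.lookup (mon2 i j r s) j = s"
    "k \<noteq> i \<Longrightarrow> k \<noteq> j \<Longrightarrow> Poly_Mapping.lookup (mon2 i j r s) k = 0"
  using assms by (simp_all add: mon2_def lookup_add lookup_single when_def)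

lemma sum_line_basis:
  assumes "i \<noteq> j"
  shows "(\<Sum>\<mu>\<in>line_basis i j m. h \<mu>) = (\<Sum>r\<le>m. h (mon2 i j r (m - r)))"
  unfolding line_basis_def
  by (rule sum.reindex[unfolded o_def], rule inj_onI) (metis mon2_lookup(1)[OF assms])

lemma sum_double_line_basis:
  assumes ij: "i \<noteq> j" and k: "k \<noteq> i" "k \<noteq> j"
  shows "(\<Sum>\<mu>\<in>double_line_basis i j k m. h \<mu>) = (\<Sum>r\<le>m. h (mon2 i j r (m - r)))
    + (\<Sum>r<m. h (Poly_Mapping.single k 1 + mon2 i j r (m - 1 - r)))"
proof -
  let ?n = "\<lambda>r. Poly_Mapping.single k (1::nat) + mon2 i j r (m - 1 - r)"
  have 1: "Poly_Mapping.lookup (?n r) i = r" "Poly_Mapping.lookup (?n r) k = 1" for r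
    using mon2_lookup[OF ij] k by (simp_all add: lookup_add lookup_single when_def)
  have inj: "inj_on ?n {..<m}" by (rule inj_onI) (metis 1(1))
  have "line_basis i j m \<inter> ?n ` {..<m} = {}"
  proof (intro equals0I)
    fix \<mu> assume \<mu>: "\<mu> \<in> line_basis i j m \<inter> ?n ` {..<m}"
    then have "Poly_Mapping.lookup \<mu> k = 0" using mon2_lookup(3)[OF ij k] by (auto simp: line_basis_def)
    moreover have "Poly_Mapping.lookup \<mu> k = 1" using \<mu> 1(2) by blast
    ultimately show False by simp
  qed
  then have "(\<Sum>\<mu>\<in>double_line_basis i j k m. h \<mu>) = sum h (line_basis i j m) + sum h (?n ` {..<m})"
    unfolding double_line_basis_def by (intro sum.union_disjoint) (auto simp: line_basis_def)
  then show ?thesis unfolding sum_line_basis[OF ij] sum.reindex[OF inj] o_def .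
qed

lemma card_line_basis: "i \<noteq> j \<Longrightarrow> card (line_basis i j m) = m + 1"
  using sum_line_basis[of i j "\<lambda>_. 1::nat" m] by simp

lemma card_double_line_basis: "i \<noteq> j \<Longrightarrow> k \<noteq> i \<Longrightarrow> k \<noteq> j \<Longrightarrow> card (double_line_basis i j k m) = 2 * m + 1"
  using sum_double_line_basis[of i j k "\<lambda>_. 1::nat" m] by simp

locale ideal_family =
  fixes I :: "('n \<Rightarrow> complex) \<Rightarrow> 'v::finite mpoly set" and bas :: "nat \<Rightarrow> ('v \<Rightarrow>\<^sub>0 nat) set"
  assumes ideal: "mpoly_ideal.subspace (I z)" and basis: "bas m \<subseteq> monomials m"
begin

text \<open>The coefficients are functions of the parameter, chosen before it is fixed and
  polynomial in it; this is what makes the chart coordinates of a family polynomial.\<close>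

definition reducible :: "nat \<Rightarrow> (('n \<Rightarrow> complex) \<Rightarrow> 'v mpoly) \<Rightarrow> bool" where
  "reducible m f \<longleftrightarrow> (\<exists>C. (\<forall>b. polyfun (C b)) \<and>
     (\<forall>z. f z - (\<Sum>b\<in>bas m. Poly_Mapping.single b (C b z)) \<in> I z))"

lemma subsp: "mpoly_vs.subspace (I z)"
  using ideal by (rule ideal_imp_subspace)

lemma reducible_add:
  assumes "reducible m f" "reducible m g"
  shows "reducible m (\<lambda>z. f z + g z)"
proof -
  obtain C D where C: "\<And>b. polyfun (C b)" "\<And>z. f z - (\<Sum>b\<in>bas m. Poly_Mapping.single b (C b z)) \<in> I z"
    and D: "\<And>b. polyfun (D b)" "\<And>z. g z - (\<Sum>b\<in>bas m. Poly_Mapping.single b (D b z)) \<in> I z"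
    using assms unfolding reducible_def by blast
  have "f z + g z - (\<Sum>b\<in>bas m. Poly_Mapping.single b (C b z + D b z)) \<in> I z" for z
    using mpoly_vs.subspace_add[OF subsp C(2) D(2), of z]
    by (simp add: single_add sum.distrib algebra_simps)
  then show ?thesis
    unfolding reducible_def using C(1) D(1) by (intro exI[of _ "\<lambda>b z. C b z + D b z"]) auto
qed

lemma reducible_scale:
  assumes "reducible m f" "polyfun c"
  shows "reducible m (\<lambda>z. poly_scale (c z) (f z))"
proof -
  obtain C where C: "\<And>b. polyfun (C b)" "\<And>z. f z - (\<Sum>b\<in>bas m. Poly_Mapping.single b (C b z)) \<in> I z"
    using assms(1) unfolding reducible_def by blast
  have "poly_scale (c z) (f z) - (\<Sum>b\<in>bas m. Poly_Mapping.single b (c z * C b z)) \<in> I z" for z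
    using mpoly_vs.subspace_scale[OF subsp C(2), of "c z" z]
    by (simp add: mpoly_vs.scale_right_diff_distrib mpoly_vs.scale_sum_right)
  then show ?thesis
    unfolding reducible_def using C(1) assms(2) by (intro exI[of _ "\<lambda>b z. c z * C b z"]) auto
qed

lemma reducible_cong:
  assumes "reducible m f" "\<And>z. g z - f z \<in> I z"
  shows "reducible m g"
proof -
  obtain C where C: "\<And>b. polyfun (C b)" "\<And>z. f z - (\<Sum>b\<in>bas m. Poly_Mapping.single b (C b z)) \<in> I z"
    using assms(1) unfolding reducible_def by blast
  have "g z - (\<Sum>b\<in>bas m. Poly_Mapping.single b (C b z)) \<in> I z" for z
    using mpoly_vs.subspace_add[OF subsp assms(2) C(2), of z] by simp
  then show ?thesis unfolding reducible_def using C(1) by blast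
qed

lemma reducible_0: "reducible m (\<lambda>z. 0)"
  unfolding reducible_def using mpoly_vs.subspace_0[OF subsp] by (intro exI[of _ "\<lambda>_ _. 0"]) auto

lemma reducible_sum: "(\<And>x. x \<in> A \<Longrightarrow> reducible m (f x)) \<Longrightarrow> reducible m (\<lambda>z. \<Sum>x\<in>A. f x z)"
  by (induction A rule: infinite_finite_induct) (auto intro: reducible_0 reducible_add)

lemma reducible_basis:
  assumes "b \<in> bas m"
  shows "reducible m (\<lambda>z. Poly_Mapping.single b 1)"
proof -
  have fin: "finite (bas m)" by (rule finite_monomial_subset[OF basis])
  show ?thesis
    unfolding reducible_def
  proof (intro exI[of _ "\<lambda>b' z. if b' = b then 1 else 0"] conjI allI)
    show "Poly_Mapping.single b 1 - (\<Sum>b'\<in>bas m. Poly_Mapping.single b' (if b' = b then 1 else 0)) \<in> I z" for z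
      using expands_basis[OF fin assms subsp] unfolding expands_def by (rule conjunct2)
  qed (rule polyfun_const)
qed

lemma reducible_Var:
  assumes lin: "\<And>z. Var l - poly_scale (\<alpha> z) (Var i) - poly_scale (\<beta> z) (Var j) - poly_scale (\<gamma> z) (Var k) \<in> I z"
    and poly: "polyfun \<alpha>" "polyfun \<beta>" "polyfun \<gamma>"
    and R: "reducible m (\<lambda>z. Var i * f)" "reducible m (\<lambda>z. Var j * f)" "reducible m (\<lambda>z. Var k * f)"
  shows "reducible m (\<lambda>z. Var l * f)"
proof -
  let ?R = "\<lambda>z. poly_scale (\<alpha> z) (Var i * f) + poly_scale (\<beta> z) (Var j * f) + poly_scale (\<gamma> z) (Var k * f)"
  have "reducible m ?R" by (intro reducible_add reducible_scale poly R)
  then show ?thesis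
  proof (rule reducible_cong)
    fix z
    have "(Var l - poly_scale (\<alpha> z) (Var i) - poly_scale (\<beta> z) (Var j) - poly_scale (\<gamma> z) (Var k)) * f \<in> I z"
      using mpoly_ideal.subspace_scale[OF ideal lin[of z], of f] by (simp add: mult.commute)
    then show "Var l * f - ?R z \<in> I z"
      by (simp add: left_diff_distrib distrib_right poly_scale_mult diff_diff_eq add.assoc)
  qed
qed

lemma reducible_monomial:
  assumes "0 \<in> bas 0"
    and step: "\<And>m l b. b \<in> bas m \<Longrightarrow> reducible (Suc m) (\<lambda>z. Var l * Poly_Mapping.single b 1)"
  shows "\<mu> \<in> monomials m \<Longrightarrow> reducible m (\<lambda>z. Poly_Mapping.single \<mu> 1)"
proof (induction m arbitrary: \<mu>)
  case 0
  then have "\<mu> = 0" by (simp add: mem_monomials mdeg_eq_0_iff)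
  then show ?case using reducible_basis[OF assms(1)] by simp
next
  case (Suc m)
  obtain l \<nu> where l: "\<nu> \<in> monomials m" "\<mu> = Poly_Mapping.single l 1 + \<nu>"
    using Suc.prems by (rule monomial_decomp)
  have ml: "Poly_Mapping.single \<mu> 1 = Var l * Poly_Mapping.single \<nu> (1::complex)"
    by (simp add: l(2) Var_def mult_single)
  obtain C where C: "\<And>b. polyfun (C b)" "\<And>z. Poly_Mapping.single \<nu> 1 - (\<Sum>b\<in>bas m. Poly_Mapping.single b (C b z)) \<in> I z"
    using Suc.IH[OF l(1)] unfolding reducible_def by blast
  have "reducible (Suc m) (\<lambda>z. \<Sum>b\<in>bas m. poly_scale (C b z) (Var l * Poly_Mapping.single b 1))"
    by (intro reducible_sum reducible_scale step C(1))
  then show ?case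
  proof (rule reducible_cong)
    fix z
    have "Var l * (\<Sum>b\<in>bas m. Poly_Mapping.single b (C b z)) = (\<Sum>b\<in>bas m. poly_scale (C b z) (Var l * Poly_Mapping.single b 1))"
      unfolding sum_distrib_left by (intro sum.cong refl, subst single_eq_scale) (rule mult_poly_scale)
    then show "Poly_Mapping.single \<mu> 1 - (\<Sum>b\<in>bas m. poly_scale (C b z) (Var l * Poly_Mapping.single b 1)) \<in> I z"
      using mpoly_ideal.subspace_scale[OF ideal C(2), of "Var l" z] by (simp add: ml right_diff_distrib)
  qed
qed

lemma polynomial_expansion:
  assumes "0 \<in> bas 0" "\<And>m l b. b \<in> bas m \<Longrightarrow> reducible (Suc m) (\<lambda>z. Var l * Poly_Mapping.single b 1)"
    and "\<mu> \<in> monomials m"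
  obtains C where "\<And>b. polyfun (C b)" "\<And>z. expands (bas m) (I z) \<mu> (\<lambda>b. C b z)"
proof -
  obtain C where C: "\<And>b. polyfun (C b)" "\<And>z. Poly_Mapping.single \<mu> 1 - (\<Sum>b\<in>bas m. Poly_Mapping.single b (C b z)) \<in> I z"
    using reducible_monomial[OF assms] unfolding reducible_def by blast
  show ?thesis
  proof (rule that)
    show "polyfun (\<lambda>z. if b \<in> bas m then C b z else 0)" for b
      using C(1) by (cases "b \<in> bas m") auto
    have "(\<Sum>b\<in>bas m. Poly_Mapping.single b (if b \<in> bas m then C b z else 0)) = (\<Sum>b\<in>bas m. Poly_Mapping.single b (C b z))" for z
      by (intro sum.cong) auto
    then show "expands (bas m) (I z) \<mu> (\<lambda>b. if b \<in> bas m then C b z else 0)" for z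
      using C(2) by (simp add: expands_def)
  qed
qed

end

lemma mult_reorder:
  fixes x w A B :: "'a::comm_monoid_mult"
  shows "x * (A * B) = x * A * B" "x * (A * B) = A * (x * B)"
    "x * (w * (A * B)) = w * (x * A * B)" "x * (w * (A * B)) = w * (A * (x * B))"
  by (simp_all add: mult_ac)

text \<open>Stated in an arbitrary commutative ring with scalars as ring elements; it applies to
  polynomials once \<open>poly_scale\<close> is unfolded.\<close>

lemma quadric_expansion:
  fixes x y w A B :: "'a::comm_ring_1"
  shows "(A * B) * (w * w - (q1 * (x * x) + q2 * (x * y) + q3 * (y * y) + q4 * (w * x) + q5 * (w * y)))
    = w * (w * (A * B)) - (q4 * (w * (x * A * B)) + q5 * (w * (A * (y * B)))
      + q1 * (x * (x * A) * B) + q2 * (x * A * (y * B)) + q3 * (A * (y * (y * B))))"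
  by (simp add: algebra_simps)

definition quadric :: "'v \<Rightarrow> 'v \<Rightarrow> 'v \<Rightarrow> complex \<Rightarrow> complex \<Rightarrow> complex \<Rightarrow> complex \<Rightarrow> complex \<Rightarrow> 'v mpoly" where
  "quadric i j k q1 q2 q3 q4 q5 = Var k * Var k - (poly_scale q1 (Var i * Var i) + poly_scale q2 (Var i * Var j)
     + poly_scale q3 (Var j * Var j) + poly_scale q4 (Var k * Var i) + poly_scale q5 (Var k * Var j))"

text \<open>Conics in planes with coordinates \<open>x_i\<close>, \<open>x_j\<close>,
  \<open>x_k\<close>, varying with a parameter: linear relations eliminate the remaining variables,
  and one quadric eliminates \<open>x_k * x_k\<close>. A single conic is treated as a constant
  family over \<open>unit\<close>.\<close>

locale conic_family =
  fixes I :: "('n \<Rightarrow> complex) \<Rightarrow> 'v::finite mpoly set" and i j k :: 'v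
    and \<alpha> \<beta> \<gamma> :: "'v \<Rightarrow> ('n \<Rightarrow> complex) \<Rightarrow> complex" and q1 q2 q3 q4 q5 :: "('n \<Rightarrow> complex) \<Rightarrow> complex"
  assumes ideal_I: "mpoly_ideal.subspace (I z)"
    and poly: "polyfun (\<alpha> l)" "polyfun (\<beta> l)" "polyfun (\<gamma> l)" "polyfun q1" "polyfun q2" "polyfun q3" "polyfun q4" "polyfun q5"
    and linear: "Var l - poly_scale (\<alpha> l z) (Var i) - poly_scale (\<beta> l z) (Var j) - poly_scale (\<gamma> l z) (Var k) \<in> I z"
    and quad: "quadric i j k (q1 z) (q2 z) (q3 z) (q4 z) (q5 z) \<in> I z"
begin

sublocale ideal_family I "double_line_basis i j k"
  by unfold_locales (rule ideal_I, rule double_line_basis_monomials)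

abbreviation "bas m \<equiv> double_line_basis i j k m"

lemma reducible_mon2: "r + s = m \<Longrightarrow> reducible m (\<lambda>z. Var i ^ r * Var j ^ s)"
  using reducible_basis[OF double_line_basis_mem1[of r s m i j k]] by (simp add: single_mon2)

lemma reducible_mon2k: "Suc (r + s) = m \<Longrightarrow> reducible m (\<lambda>z. Var k * (Var i ^ r * Var j ^ s))"
  using reducible_basis[OF double_line_basis_mem2[of r s m k i j]] by (simp only: single_mon2_mult)

lemma reducible_k2:
  assumes "r + s + 2 = m"
  shows "reducible m (\<lambda>z. Var k * (Var k * (Var i ^ r * Var j ^ s)))"
proof -
  let ?N = "Var i ^ r * Var j ^ s"
  let ?R = "\<lambda>z. poly_scale (q4 z) (Var k * (Var i ^ Suc r * Var j ^ s))
    + poly_scale (q5 z) (Var k * (Var i ^ r * Var j ^ Suc s))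
    + poly_scale (q1 z) (Var i ^ Suc (Suc r) * Var j ^ s)
    + poly_scale (q2 z) (Var i ^ Suc r * Var j ^ Suc s)
    + poly_scale (q3 z) (Var i ^ r * Var j ^ Suc (Suc s))"
  have "reducible m ?R"
    using assms
    by (intro reducible_add reducible_scale reducible_mon2 reducible_mon2k poly) simp_all
  then show ?thesis
  proof (rule reducible_cong)
    fix z
    have "?N * quadric i j k (q1 z) (q2 z) (q3 z) (q4 z) (q5 z) \<in> I z"
      by (rule mpoly_ideal.subspace_scale[OF ideal quad])
    \<comment> \<open>Each term of \<open>?R\<close> has at most one factor \<open>x_k\<close>, so
      it is a multiple of a basis monomial of degree \<open>m\<close>.\<close>
    also have "?N * quadric i j k (q1 z) (q2 z) (q3 z) (q4 z) (q5 z) = Var k * (Var k * ?N) - ?R z"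
      unfolding quadric_def poly_scale_def power_Suc by (rule quadric_expansion)
    finally show "Var k * (Var k * ?N) - ?R z \<in> I z" .
  qed
qed

lemma reducible_Var_basis:
  assumes b: "b \<in> bas m"
  shows "reducible (Suc m) (\<lambda>z. Var l * Poly_Mapping.single b 1)"
proof -
  let ?f = "Poly_Mapping.single b (1::complex)"
  have R: "reducible (Suc m) (\<lambda>z. Var i * ?f) \<and> reducible (Suc m) (\<lambda>z. Var j * ?f) \<and> reducible (Suc m) (\<lambda>z. Var k * ?f)"
  proof -
    consider r s where "b = mon2 i j r s" "r + s = m" | r s where "b = Poly_Mapping.single k 1 + mon2 i j r s" "Suc (r + s) = m"
      using b by (force simp: double_line_basis_def line_basis_def)
    then show ?thesis
    proof cases
      case 1
      have eqs: "Var i * (Var i ^ r * Var j ^ s) = Var i ^ Suc r * Var j ^ s"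
        "Var j * (Var i ^ r * Var j ^ s) = Var i ^ r * Var j ^ Suc s"
        unfolding power_Suc by (rule mult_reorder)+
      then show ?thesis
        using 1 reducible_mon2[of "Suc r" s "Suc m"] reducible_mon2[of r "Suc s" "Suc m"]
          reducible_mon2k[of r s "Suc m"] unfolding 1(1) single_mon2 eqs by simp
    next
      case 2
      have eqs: "Var i * (Var k * (Var i ^ r * Var j ^ s)) = Var k * (Var i ^ Suc r * Var j ^ s)"
        "Var j * (Var k * (Var i ^ r * Var j ^ s)) = Var k * (Var i ^ r * Var j ^ Suc s)"
        unfolding power_Suc by (rule mult_reorder)+
      show ?thesis
        using 2 reducible_mon2k[of "Suc r" s "Suc m"] reducible_mon2k[of r "Suc s" "Suc m"]
          reducible_k2[of r s "Suc m"] unfolding 2(1) single_mon2_mult eqs by simp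
    qed
  qed
  show ?thesis
    by (rule reducible_Var[OF linear poly(1) poly(2) poly(3) R[THEN conjunct1]
          R[THEN conjunct2, THEN conjunct1] R[THEN conjunct2, THEN conjunct2]])
qed

lemma conic_expansion:
  assumes "\<mu> \<in> monomials m"
  obtains C where "\<And>b. polyfun (C b)" "\<And>z. expands (bas m) (I z) \<mu> (\<lambda>b. C b z)"
proof -
  have "0 \<in> bas 0" using double_line_basis_mem1[of 0 0 0 i j k] by (simp add: mon2_def)
  from polynomial_expansion[OF this reducible_Var_basis assms] show ?thesis using that by blast
qed

end

section \<open>Double lines in row-reduced form\<close>

text \<open>Row-reduced data of a double line. The direction \<open>c\<close> is reduced modulo
  \<open>a\<close> and \<open>b\<close>, but the entries \<open>a k\<close> and \<open>b k\<close>
  stay free: subtracting multiples of \<open>c\<close> from \<open>a\<close> or \<open>b\<close>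
  would move the line.\<close>

definition pivot :: "'v \<Rightarrow> 'v \<Rightarrow> 'v \<Rightarrow> ('v \<Rightarrow> complex) \<Rightarrow> ('v \<Rightarrow> complex) \<Rightarrow> ('v \<Rightarrow> complex) \<Rightarrow> bool" where
  "pivot i j k a b c \<longleftrightarrow> a i = 1 \<and> a j = 0 \<and> b i = 0 \<and> b j = 1 \<and> c i = 0 \<and> c j = 0 \<and> c k = 1"

lemma pivot_distinct:
  assumes "pivot i j k a b c"
  shows "i \<noteq> j" "k \<noteq> i" "k \<noteq> j"
  using assms by (auto simp: pivot_def)

text \<open>On the plane spanned by \<open>a\<close>, \<open>b\<close>, \<open>c\<close> the basis
  dual to \<open>x_i\<close>, \<open>x_j\<close>, \<open>x_k\<close> consists of \<open>a\<close>
  and \<open>b\<close> with their \<open>k\<close>-entries removed by multiples of \<open>c\<close>,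
  and \<open>c\<close> itself; its entries are the coefficients here.\<close>

lemma pivot_linear:
  assumes "pivot i j k a b c"
  shows "Var l - poly_scale (a l - a k * c l) (Var i) - poly_scale (b l - b k * c l) (Var j)
    - poly_scale (c l) (Var k) \<in> double_line_ideal a b c"
  using assms
  by (simp add: double_line_ideal_def pivot_def eval_poly_diff eval_poly_add pdir_diff pdir_add line_point_def algebra_simps)

text \<open>This linear form is the equation of the line inside the plane, normalized to have
  derivative 1 in the direction \<open>c\<close>.\<close>

lemma pivot_normal:
  assumes "pivot i j k a b c"
  shows "eval_poly (Var k - poly_scale (a k) (Var i) - poly_scale (b k) (Var j)) (line_point a b s t) = 0"
    and "pdir (Var k - poly_scale (a k) (Var i) - poly_scale (b k) (Var j)) x c = 1"
  using assms
  by (simp_all add: pivot_def eval_poly_diff eval_poly_add pdir_diff pdir_add line_point_def algebra_simps)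

lemma square_expansion:
  fixes x y w P Q A B :: "'a::comm_ring_1"
  shows "(w - P * x - Q * y) ^ 2 = w * w - (- (P * P) * (x * x) + - (2 * P * Q) * (x * y) + - (Q * Q) * (y * y)
    + 2 * P * (w * x) + 2 * Q * (w * y))"
  by (simp add: power2_eq_square algebra_simps)

lemma quadric_square:
  fixes i j k :: 'v
  shows "quadric i j k (- (p * p)) (- (2 * p * q)) (- (q * q)) (2 * p) (2 * q)
    = (Var k - poly_scale p (Var i) - poly_scale q (Var j)) ^ 2"
proof -
  have two: "Poly_Mapping.single 0 2 = (2 :: 'v mpoly)" by (simp add: single_numeral)
  have cm: "Poly_Mapping.single (0 :: 'v \<Rightarrow>\<^sub>0 nat) (x * y :: complex) = Poly_Mapping.single 0 x * Poly_Mapping.single 0 y" for x y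
    by (simp add: mult_single)
  show ?thesis
    unfolding quadric_def poly_scale_def cm two single_uminus square_expansion ..
qed

lemma pivot_square:
  assumes "pivot i j k a b c"
  shows "(Var k - poly_scale (a k) (Var i) - poly_scale (b k) (Var j)) ^ 2 \<in> double_line_ideal a b c"
  unfolding double_line_ideal_def power2_eq_square
  by (simp add: eval_poly_mult pdir_mult pivot_normal[OF assms])

lemma pdir_power_0: "pdir f x v = 0 \<Longrightarrow> pdir (f ^ n) x v = 0"
  using pdir_const[of 1 x v] by (induction n) (simp_all add: pdir_mult)

text \<open>The derivative along \<open>c\<close> sees only the monomials containing
  \<open>x_k\<close>, because \<open>c\<close> vanishes at \<open>i\<close> and \<open>j\<close>.
  Once these are gone, values at the points with parameters \<open>(s, 1)\<close> isolate the other
  coefficients as those of a polynomial in \<open>s\<close>.\<close>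

lemma double_line_independent:
  assumes piv: "pivot i j k a b c"
    and f: "(\<Sum>\<mu>\<in>double_line_basis i j k m. Poly_Mapping.single \<mu> (d \<mu>)) \<in> double_line_ideal a b c"
    and \<mu>: "\<mu> \<in> double_line_basis i j k m"
  shows "d \<mu> = 0"
proof -
  note dist = pivot_distinct[OF piv]
  let ?f = "(\<Sum>r\<le>m. poly_scale (d (mon2 i j r (m - r))) (Var i ^ r * Var j ^ (m - r)))
    + (\<Sum>r<m. poly_scale (d (Poly_Mapping.single k 1 + mon2 i j r (m - 1 - r))) (Var k * (Var i ^ r * Var j ^ (m - 1 - r))))"
  have "(\<Sum>\<mu>\<in>double_line_basis i j k m. Poly_Mapping.single \<mu> (d \<mu>)) = ?f"
    unfolding sum_double_line_basis[OF dist]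
    by (intro arg_cong2[where f = "(+)"] sum.cong refl; subst single_eq_scale)
      (simp_all only: single_mon2 single_mon2_mult)
  with f have f: "?f \<in> double_line_ideal a b c" by simp
  have coords: "line_point a b s 1 i = s" "line_point a b s 1 j = 1" for s
    using piv by (simp_all add: line_point_def pivot_def)
  have p0: "pdir (Var i ^ r * Var j ^ s) x c = 0" for r s x
    using piv by (simp add: pdir_mult pdir_power_0 pivot_def)
  have ck: "c k = 1" using piv by (simp add: pivot_def)
  have "(\<Sum>r<m. d (Poly_Mapping.single k 1 + mon2 i j r (m - 1 - r)) * s ^ r) = 0" for s
  proof -
    have "pdir ?f (line_point a b s 1) c = 0" using f by (simp add: double_line_ideal_def)
    then show ?thesis
      by (simp add: pdir_add pdir_sum p0 pdir_mult[of "Var k"] ck eval_poly_simps coords)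
  qed
  then have d2: "d (Poly_Mapping.single k 1 + mon2 i j r (m - 1 - r)) = 0" if "r < m" for r
    using that polynomial_sum_zero[of "\<lambda>r. d (Poly_Mapping.single k 1 + mon2 i j r (m - 1 - r))" "m - 1" r]
    by (cases m) (simp_all add: lessThan_Suc_atMost)
  have "(\<Sum>r\<le>m. d (mon2 i j r (m - r)) * s ^ r) = 0" for s
  proof -
    have "eval_poly ?f (line_point a b s 1) = 0" using f by (simp add: double_line_ideal_def)
    then show ?thesis
      using d2 by (simp add: eval_poly_simps coords)
  qed
  from polynomial_sum_zero[OF this] have d1: "d (mon2 i j r (m - r)) = 0" if "r \<le> m" for r
    using that by blast
  show ?thesis using \<mu> d1 d2 by (auto simp: double_line_basis_def line_basis_def)
qed

lemma double_line_chart_and_coords: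
  fixes a b c :: "('n \<Rightarrow> complex) \<Rightarrow> 'v::finite \<Rightarrow> complex"
  assumes piv: "\<And>z. pivot i j k (a z) (b z) (c z)"
    and poly: "\<And>l. polyfun (\<lambda>z. a z l)" "\<And>l. polyfun (\<lambda>z. b z l)" "\<And>l. polyfun (\<lambda>z. c z l)"
  shows "double_line_ideal (a z) (b z) (c z) \<in> chart m (double_line_basis i j k m)"
    and "polyfun (\<lambda>z. chart_coord m (double_line_basis i j k m) (double_line_ideal (a z) (b z) (c z)) \<kappa>)"
proof -
  \<comment> \<open>The five quadric coefficients come from the square of the equation of the line,
    solved for \<open>x_k * x_k\<close>.\<close>
  interpret conic_family "\<lambda>z. double_line_ideal (a z) (b z) (c z)" i j k
    "\<lambda>l z. a z l - a z k * c z l" "\<lambda>l z. b z l - b z k * c z l" "\<lambda>l z. c z l"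
    "\<lambda>z. - (a z k * a z k)" "\<lambda>z. - (2 * a z k * b z k)" "\<lambda>z. - (b z k * b z k)" "\<lambda>z. 2 * a z k" "\<lambda>z. 2 * b z k"
    using double_line_ideal_subspace pivot_linear[OF piv] pivot_square[OF piv] poly
    by unfold_locales (auto simp: quadric_square intro!: polyfun_diff polyfun_mult polyfun_uminus)
  have chart: "double_line_ideal (a z) (b z) (c z) \<in> chart m (bas m)" for z
    using conic_expansion double_line_independent[OF piv]
    by (intro chart_intro[OF subsp]) metis+
  then show "double_line_ideal (a z) (b z) (c z) \<in> chart m (bas m)" .
  obtain \<mu> \<nu> where \<kappa>: "\<kappa> = (\<mu>, \<nu>)" by (cases \<kappa>)
  show "polyfun (\<lambda>z. chart_coord m (bas m) (double_line_ideal (a z) (b z) (c z)) \<kappa>)"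
  proof (cases "\<mu> \<in> monomials m")
    case True
    obtain C where C: "\<And>b. polyfun (C b)"
      "\<And>z. expands (bas m) (double_line_ideal (a z) (b z) (c z)) \<mu> (\<lambda>b. C b z)"
      using conic_expansion[OF True] by blast
    have "chart_coord m (bas m) (double_line_ideal (a z) (b z) (c z)) \<kappa> = C \<nu> z" for z
      unfolding \<kappa> by (rule chart_coord_unique[OF chart True C(2)])
    then show ?thesis using C(1) by simp
  qed (simp add: \<kappa>)
qed

lemma double_line_chart:
  assumes "pivot i j k a b c"
  shows "double_line_ideal a b (c :: 'v::finite \<Rightarrow> complex) \<in> chart m (double_line_basis i j k m)"
  using double_line_chart_and_coords(1)[of i j k "\<lambda>z :: unit \<Rightarrow> complex. a" "\<lambda>_. b" "\<lambda>_. c"] assms by simp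

lemma double_line_hilbert_function:
  assumes "pivot i j k a b c"
  shows "hilbert_function (double_line_ideal a b (c :: 'v::finite \<Rightarrow> complex)) m = 2 * m + 1"
  using hilbert_function_chart[OF double_line_basis_monomials double_line_chart[OF assms]
      ideal_imp_subspace[OF double_line_ideal_subspace]] card_double_line_basis pivot_distinct[OF assms]
  by metis

section \<open>Reading a conic off its chart coordinates\<close>

lemma chart_coord_subset:
  assumes I: "I \<in> chart m B" "mpoly_vs.subspace I" and "finite B" "A \<subseteq> B" and \<mu>: "\<mu> \<in> monomials m"
    and d: "Poly_Mapping.single \<mu> 1 - (\<Sum>\<beta>\<in>A. Poly_Mapping.single \<beta> (d \<beta>)) \<in> I" and \<beta>: "\<beta> \<in> A"
  shows "chart_coord m B I (\<mu>, \<beta>) = d \<beta>"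
proof -
  have "(\<Sum>\<beta>\<in>B. Poly_Mapping.single \<beta> (if \<beta> \<in> A then d \<beta> else 0)) = (\<Sum>\<beta>\<in>A. Poly_Mapping.single \<beta> (d \<beta>))"
    using assms(3,4) by (intro sum.mono_neutral_cong_right) auto
  then have "expands B I \<mu> (\<lambda>\<beta>. if \<beta> \<in> A then d \<beta> else 0)"
    using d assms(4) by (auto simp: expands_def)
  from chart_coord_unique[OF I(1) \<mu> this, of \<beta>] \<beta> show ?thesis by simp
qed

lemma sum_triple:
  "distinct [x, y, z] \<Longrightarrow> (\<Sum>t\<in>{x, y, z}. f t) = f x + (f y + f z)"
  for f :: "'a \<Rightarrow> 'b::comm_monoid_add"
  by simp

lemma sum_quintuple:
  "distinct [x, y, z, u, v] \<Longrightarrow> (\<Sum>t\<in>{x, y, z, u, v}. f t) = f x + f y + f z + f u + f v"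
  for f :: "'a \<Rightarrow> 'b::comm_monoid_add"
  by (simp add: add.assoc)

lemma linear_expansion:
  fixes w x y u A P Q R :: "'a::comm_ring_1"
  shows "w * (A * 1) - (P * (x * A) + (Q * (y * A) + R * (u * A))) = A * (w - P * x - Q * y - R * u)"
  by (simp add: algebra_simps)

text \<open>A linear relation times \<open>x_i ^ (n + 1)\<close>, or a quadric times
  \<open>x_i ^ n\<close>, expresses one monomial through basis monomials, so its coefficients are
  chart coordinates. Degree \<open>m = n + 2\<close> leaves room for the quadric.\<close>

lemma conic_coordinates:
  fixes I :: "'v::finite mpoly set"
  assumes I: "I \<in> chart m (double_line_basis i j k m)" "mpoly_ideal.subspace I"
    and dist: "i \<noteq> j" "k \<noteq> i" "k \<noteq> j" and m: "m = Suc (Suc n)"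
  defines "y \<equiv> chart_coord m (double_line_basis i j k m) I"
  shows "Var l - poly_scale \<alpha> (Var i) - poly_scale \<beta> (Var j) - poly_scale \<gamma> (Var k) \<in> I \<Longrightarrow>
      y (Poly_Mapping.single l 1 + mon2 i j (Suc n) 0, mon2 i j m 0) = \<alpha> \<and>
      y (Poly_Mapping.single l 1 + mon2 i j (Suc n) 0, mon2 i j (Suc n) 1) = \<beta> \<and>
      y (Poly_Mapping.single l 1 + mon2 i j (Suc n) 0, Poly_Mapping.single k 1 + mon2 i j (Suc n) 0) = \<gamma>"
    and "quadric i j k q1 q2 q3 q4 q5 \<in> I \<Longrightarrow>
      y (Poly_Mapping.single k 2 + mon2 i j n 0, mon2 i j m 0) = q1 \<and>
      y (Poly_Mapping.single k 2 + mon2 i j n 0, mon2 i j (Suc n) 1) = q2 \<and>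
      y (Poly_Mapping.single k 2 + mon2 i j n 0, mon2 i j n 2) = q3 \<and>
      y (Poly_Mapping.single k 2 + mon2 i j n 0, Poly_Mapping.single k 1 + mon2 i j (Suc n) 0) = q4 \<and>
      y (Poly_Mapping.single k 2 + mon2 i j n 0, Poly_Mapping.single k 1 + mon2 i j n 1) = q5"
proof -
  let ?B = "double_line_basis i j k m"
  note sub = ideal_imp_subspace[OF I(2)]
  have finB: "finite ?B" by (rule finite_monomial_subset[OF double_line_basis_monomials])
  note coord = chart_coord_subset[OF I(1) sub finB]
  let ?ki = "Poly_Mapping.single k 1 + mon2 i j (Suc n) 0" and ?kj = "Poly_Mapping.single k 1 + mon2 i j n 1"
    and ?ii = "mon2 i j m 0" and ?ij = "mon2 i j (Suc n) 1" and ?jj = "mon2 i j n 2"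
  have mem: "?ki \<in> ?B" "?kj \<in> ?B" "?ii \<in> ?B" "?ij \<in> ?B" "?jj \<in> ?B"
    using m double_line_basis_mem2[of "Suc n" 0 m k i j] double_line_basis_mem2[of n 1 m k i j]
    by (auto intro!: double_line_basis_mem1)
  have lk: "Poly_Mapping.lookup ?ki k = 1" "Poly_Mapping.lookup ?kj k = 1"
    "Poly_Mapping.lookup ?ii k = 0" "Poly_Mapping.lookup ?ij k = 0" "Poly_Mapping.lookup ?jj k = 0"
    and lj: "Poly_Mapping.lookup ?ki j = 0" "Poly_Mapping.lookup ?kj j = 1"
    "Poly_Mapping.lookup ?ii j = 0" "Poly_Mapping.lookup ?ij j = 1" "Poly_Mapping.lookup ?jj j = 2"
    using mon2_lookup[OF dist(1)] dist by (simp_all add: lookup_add lookup_single when_def)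
  have ne: "?ki \<noteq> ?kj" "?ki \<noteq> ?ii" "?ki \<noteq> ?ij" "?ki \<noteq> ?jj" "?kj \<noteq> ?ii" "?kj \<noteq> ?ij" "?kj \<noteq> ?jj"
    "?ii \<noteq> ?ij" "?ii \<noteq> ?jj" "?ij \<noteq> ?jj"
    using lk lj by (metis zero_neq_one one_neq_zero numeral_One num.distinct(1) numeral_eq_iff zero_neq_numeral)+
  have s: "Poly_Mapping.single ?ki x = poly_scale x (Var k * (Var i ^ Suc n))"
    "Poly_Mapping.single ?kj x = poly_scale x (Var k * (Var i ^ n * Var j))"
    "Poly_Mapping.single ?ii x = poly_scale x (Var i * Var i ^ Suc n)"
    "Poly_Mapping.single ?ij x = poly_scale x (Var j * Var i ^ Suc n)"
    "Poly_Mapping.single ?jj x = poly_scale x (Var i ^ n * (Var j * Var j))" for x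
    by (subst single_eq_scale, simp only: single_mon2 single_mon2_mult,
        simp add: m power2_eq_square mult_ac)+
  {
    assume lin: "Var l - poly_scale \<alpha> (Var i) - poly_scale \<beta> (Var j) - poly_scale \<gamma> (Var k) \<in> I"
    let ?L = "Poly_Mapping.single (Poly_Mapping.single l 1 + mon2 i j (Suc n) 0) (1::complex)"
    define d where "d x = (if x = ?ii then \<alpha> else if x = ?ij then \<beta> else \<gamma>)" for x
    have d: "d ?ii = \<alpha>" "d ?ij = \<beta>" "d ?ki = \<gamma>" using ne by (simp_all add: d_def)
    have "(\<Sum>x\<in>{?ii, ?ij, ?ki}. Poly_Mapping.single x (d x))
      = Poly_Mapping.single ?ii (d ?ii) + (Poly_Mapping.single ?ij (d ?ij) + Poly_Mapping.single ?ki (d ?ki))"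
      using ne by (intro sum_triple) auto
    then have "?L - (\<Sum>x\<in>{?ii, ?ij, ?ki}. Poly_Mapping.single x (d x))
      = Var l * (Var i ^ Suc n * 1) - (poly_scale \<alpha> (Var i * Var i ^ Suc n)
        + (poly_scale \<beta> (Var j * Var i ^ Suc n) + poly_scale \<gamma> (Var k * Var i ^ Suc n)))"
      unfolding d s single_mon2_mult power_0 by (simp only:)
    also have "\<dots> = Var i ^ Suc n * (Var l - poly_scale \<alpha> (Var i) - poly_scale \<beta> (Var j) - poly_scale \<gamma> (Var k))"
      unfolding poly_scale_def by (rule linear_expansion)
    also have "\<dots> \<in> I" by (rule mpoly_ideal.subspace_scale[OF I(2) lin])
    finally have in_I: "?L - (\<Sum>x\<in>{?ii, ?ij, ?ki}. Poly_Mapping.single x (d x)) \<in> I" .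
    have mon: "Poly_Mapping.single l 1 + mon2 i j (Suc n) 0 \<in> monomials m" using m by (simp add: mem_monomials)
    have A: "{?ii, ?ij, ?ki} \<subseteq> ?B" using mem by blast
    note c = coord[OF A mon in_I]
    show "y (Poly_Mapping.single l 1 + mon2 i j (Suc n) 0, ?ii) = \<alpha> \<and>
      y (Poly_Mapping.single l 1 + mon2 i j (Suc n) 0, ?ij) = \<beta> \<and>
      y (Poly_Mapping.single l 1 + mon2 i j (Suc n) 0, ?ki) = \<gamma>"
      unfolding y_def using c[of ?ii] c[of ?ij] c[of ?ki] unfolding d by blast
  }
  {
    assume quad: "quadric i j k q1 q2 q3 q4 q5 \<in> I"
    let ?Q = "Poly_Mapping.single (Poly_Mapping.single k 2 + mon2 i j n 0) (1::complex)"
    have k2: "?Q = Var k * (Var k * (Var i ^ n * 1))"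
    proof -
      have "Poly_Mapping.single k (2 :: nat) = Poly_Mapping.single k 1 + Poly_Mapping.single k 1"
        by (simp add: numeral_2_eq_2 flip: single_add)
      then have "?Q = Var k * Poly_Mapping.single (Poly_Mapping.single k 1 + mon2 i j n 0) 1"
        by (simp add: Var_def mult_single add.assoc)
      then show ?thesis by (simp only: single_mon2_mult power_0)
    qed
    define d where "d x = (if x = ?ki then q4 else if x = ?kj then q5
      else if x = ?ii then q1 else if x = ?ij then q2 else q3)" for x
    have d: "d ?ki = q4" "d ?kj = q5" "d ?ii = q1" "d ?ij = q2" "d ?jj = q3"
      unfolding d_def using ne ne[symmetric] by (simp_all only: if_True if_False refl)
    have "(\<Sum>x\<in>{?ki, ?kj, ?ii, ?ij, ?jj}. Poly_Mapping.single x (d x))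
      = Poly_Mapping.single ?ki (d ?ki) + Poly_Mapping.single ?kj (d ?kj) + Poly_Mapping.single ?ii (d ?ii)
        + Poly_Mapping.single ?ij (d ?ij) + Poly_Mapping.single ?jj (d ?jj)"
      using ne by (intro sum_quintuple) auto
    also have "\<dots> = poly_scale q4 (Var k * (Var i * Var i ^ n * 1)) + poly_scale q5 (Var k * (Var i ^ n * (Var j * 1)))
        + poly_scale q1 (Var i * (Var i * Var i ^ n) * 1) + poly_scale q2 (Var i * Var i ^ n * (Var j * 1))
        + poly_scale q3 (Var i ^ n * (Var j * (Var j * 1)))"
      unfolding d s power_Suc by (simp only: mult_1_right mult.commute[of "Var j" "Var i * Var i ^ n"] mult.assoc)
    finally have "?Q - (\<Sum>x\<in>{?ki, ?kj, ?ii, ?ij, ?jj}. Poly_Mapping.single x (d x))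
      = (Var i ^ n * 1) * quadric i j k q1 q2 q3 q4 q5"
      unfolding k2 quadric_def poly_scale_def quadric_expansion by (simp only:)
    also have "\<dots> \<in> I" by (rule mpoly_ideal.subspace_scale[OF I(2) quad])
    finally have in_I: "?Q - (\<Sum>x\<in>{?ki, ?kj, ?ii, ?ij, ?jj}. Poly_Mapping.single x (d x)) \<in> I" .
    have mon: "Poly_Mapping.single k 2 + mon2 i j n 0 \<in> monomials m" using m by (simp add: mem_monomials)
    have A: "{?ki, ?kj, ?ii, ?ij, ?jj} \<subseteq> ?B" using mem by blast
    note c = coord[OF A mon in_I]
    show "y (Poly_Mapping.single k 2 + mon2 i j n 0, ?ii) = q1 \<and> y (Poly_Mapping.single k 2 + mon2 i j n 0, ?ij) = q2 \<and>
      y (Poly_Mapping.single k 2 + mon2 i j n 0, ?jj) = q3 \<and> y (Poly_Mapping.single k 2 + mon2 i j n 0, ?ki) = q4 \<and>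
      y (Poly_Mapping.single k 2 + mon2 i j n 0, ?kj) = q5"
      unfolding y_def using c[of ?ki] c[of ?kj] c[of ?ii] c[of ?ij] c[of ?jj] unfolding d by blast
  }
qed

lemma double_line_coordinates:
  fixes a b c :: "'v::finite \<Rightarrow> complex"
  assumes piv: "pivot i j k a b c" and m: "m = Suc (Suc n)"
  defines "y \<equiv> chart_coord m (double_line_basis i j k m) (double_line_ideal a b c)"
  shows "c l = y (Poly_Mapping.single l 1 + mon2 i j (Suc n) 0, Poly_Mapping.single k 1 + mon2 i j (Suc n) 0)"
    and "a l - a k * c l = y (Poly_Mapping.single l 1 + mon2 i j (Suc n) 0, mon2 i j m 0)"
    and "b l - b k * c l = y (Poly_Mapping.single l 1 + mon2 i j (Suc n) 0, mon2 i j (Suc n) 1)"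
    and "2 * a k = y (Poly_Mapping.single k 2 + mon2 i j n 0, Poly_Mapping.single k 1 + mon2 i j (Suc n) 0)"
    and "2 * b k = y (Poly_Mapping.single k 2 + mon2 i j n 0, Poly_Mapping.single k 1 + mon2 i j n 1)"
  using conic_coordinates[OF double_line_chart[OF piv] double_line_ideal_subspace pivot_distinct[OF piv] m]
    pivot_linear[OF piv] pivot_square[OF piv, folded quadric_square]
  unfolding y_def by metis+

text \<open>The direction is read off directly. The cross terms of the square give
  \<open>2 * a k\<close> and \<open>2 * b k\<close>, whence the factor 1/2, and these values restore
  \<open>a\<close> and \<open>b\<close> from their reductions modulo \<open>c\<close>.\<close>

lemma double_line_components:
  assumes "m \<ge> 2"
  obtains pa pb pc :: "'v::finite \<Rightarrow> (('v \<Rightarrow>\<^sub>0 nat) \<times> ('v \<Rightarrow>\<^sub>0 nat) \<Rightarrow> complex) \<Rightarrow> complex"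
  where "\<And>l. polyfun (pa l)" "\<And>l. polyfun (pb l)" "\<And>l. polyfun (pc l)"
    "\<And>a b c l. pivot i j k a b c \<Longrightarrow>
       pa l (chart_coord m (double_line_basis i j k m) (double_line_ideal a b c)) = a l \<and>
       pb l (chart_coord m (double_line_basis i j k m) (double_line_ideal a b c)) = b l \<and>
       pc l (chart_coord m (double_line_basis i j k m) (double_line_ideal a b c)) = c l"
proof -
  obtain n where n: "m = Suc (Suc n)" using assms by (metis add_2_eq_Suc le_Suc_ex)
  let ?l = "\<lambda>l. Poly_Mapping.single l 1 + mon2 i j (Suc n) 0"
  let ?k2 = "Poly_Mapping.single k 2 + mon2 i j n 0"
  define pc where "pc l y = y (?l l, Poly_Mapping.single k 1 + mon2 i j (Suc n) 0)"
    for l and y :: "('v \<Rightarrow>\<^sub>0 nat) \<times> ('v \<Rightarrow>\<^sub>0 nat) \<Rightarrow> complex"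
  define pa where "pa l y = y (?l l, mon2 i j m 0) + 1/2 * y (?k2, Poly_Mapping.single k 1 + mon2 i j (Suc n) 0) * pc l y"
    for l and y :: "('v \<Rightarrow>\<^sub>0 nat) \<times> ('v \<Rightarrow>\<^sub>0 nat) \<Rightarrow> complex"
  define pb where "pb l y = y (?l l, mon2 i j (Suc n) 1) + 1/2 * y (?k2, Poly_Mapping.single k 1 + mon2 i j n 1) * pc l y"
    for l and y :: "('v \<Rightarrow>\<^sub>0 nat) \<times> ('v \<Rightarrow>\<^sub>0 nat) \<Rightarrow> complex"
  show ?thesis
  proof (rule that[of pa pb pc])
    show "polyfun (pc l)" for l unfolding pc_def by (rule polyfun_coord)
    then show "polyfun (pa l)" "polyfun (pb l)" for l
      unfolding pa_def pb_def by (intro polyfun_add polyfun_mult polyfun_const polyfun_coord; blast)+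
    fix a b c :: "'v \<Rightarrow> complex" and l assume piv: "pivot i j k a b c"
    show "pa l (chart_coord m (double_line_basis i j k m) (double_line_ideal a b c)) = a l \<and>
       pb l (chart_coord m (double_line_basis i j k m) (double_line_ideal a b c)) = b l \<and>
       pc l (chart_coord m (double_line_basis i j k m) (double_line_ideal a b c)) = c l"
      unfolding pa_def pb_def pc_def double_line_coordinates[OF piv n, symmetric] by simp
  qed
qed

section \<open>A double line is determined by its linear relations and its square\<close>

text \<open>A spanning set no larger than the dimension is a basis: a relation would allow one
  monomial to be dropped, leaving too few.\<close>

lemma chart_of_spanning:
  fixes I :: "'v::finite mpoly set"
  assumes I: "mpoly_vs.subspace I" and B: "B \<subseteq> monomials m" and h: "card B \<le> hilbert_function I m"
    and sp: "\<And>\<mu>. \<mu> \<in> monomials m \<Longrightarrow> \<exists>c. expands B I \<mu> c"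
  shows "I \<in> chart m B"
proof (rule chart_intro[OF I sp])
  have finB: "finite B" using B by (rule finite_monomial_subset)
  fix c b0 assume c: "(\<Sum>b\<in>B. Poly_Mapping.single b (c b)) \<in> I" and b0: "b0 \<in> B"
  show "c b0 = 0"
  proof (rule ccontr)
    assume nz: "c b0 \<noteq> 0"
    obtain e where e: "\<And>\<mu>. \<mu> \<in> monomials m \<Longrightarrow> expands B I \<mu> (e \<mu>)" using sp by metis
    have "hilbert_function I m \<le> card (B - {b0})"
    proof (rule hilbert_function_le[OF I, of _ m "\<lambda>b. Poly_Mapping.single b 1"])
      fix f :: "'v mpoly" assume f: "f \<in> forms m"
      define d where "d b = (\<Sum>\<mu>\<in>monomials m. Poly_Mapping.lookup f \<mu> * e \<mu> b)" for b
      have "(\<Sum>\<mu>\<in>monomials m. poly_scale (Poly_Mapping.lookup f \<mu>)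
        (Poly_Mapping.single \<mu> 1 - (\<Sum>b\<in>B. poly_scale (e \<mu> b) (Poly_Mapping.single b 1)))) \<in> I"
        using e by (intro mpoly_vs.subspace_sum[OF I] mpoly_vs.subspace_scale[OF I]) (simp add: expands_def)
      also have "(\<Sum>\<mu>\<in>monomials m. poly_scale (Poly_Mapping.lookup f \<mu>)
        (Poly_Mapping.single \<mu> 1 - (\<Sum>b\<in>B. poly_scale (e \<mu> b) (Poly_Mapping.single b 1))))
        = f - (\<Sum>b\<in>B. poly_scale (d b) (Poly_Mapping.single b 1))"
        unfolding d_def mpoly_vs.scale_sum_left mpoly_vs.scale_right_diff_distrib mpoly_vs.scale_sum_right
          mpoly_vs.scale_scale sum_subtractf
        by (subst sum.swap) (simp only: forms_expand[OF f, symmetric])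
      finally have fd: "f - (\<Sum>b\<in>B. poly_scale (d b) (Poly_Mapping.single b 1)) \<in> I" .
      let ?r = "d b0 / c b0"
      have "(f - (\<Sum>b\<in>B. poly_scale (d b) (Poly_Mapping.single b 1))) + poly_scale ?r (\<Sum>b\<in>B. Poly_Mapping.single b (c b)) \<in> I"
        by (rule mpoly_vs.subspace_add[OF I fd mpoly_vs.subspace_scale[OF I c]])
      also have "(f - (\<Sum>b\<in>B. poly_scale (d b) (Poly_Mapping.single b 1))) + poly_scale ?r (\<Sum>b\<in>B. Poly_Mapping.single b (c b))
        = f - (\<Sum>b\<in>B. Poly_Mapping.single b (d b - ?r * c b))"
        by (simp add: mpoly_vs.scale_sum_right single_diff sum_subtractf)
      also have "(\<Sum>b\<in>B. Poly_Mapping.single b (d b - ?r * c b)) = (\<Sum>b\<in>B - {b0}. Poly_Mapping.single b (d b - ?r * c b))"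
        using nz finB b0 by (subst sum.remove[of B b0]) auto
      finally show "\<exists>c. f - (\<Sum>b\<in>B - {b0}. poly_scale (c b) (Poly_Mapping.single b 1)) \<in> I"
        by (intro exI[of _ "\<lambda>b. d b - ?r * c b"]) simp
    qed (use finB in simp)
    then show False using h b0 finB by (metis card_Diff1_less leD order_trans)
  qed
qed

lemma homogeneous_ideal_subset:
  assumes I: "homogeneous_ideal I" and J: "homogeneous_ideal J"
    and sub: "\<And>m f. f \<in> forms m \<Longrightarrow> f \<in> I \<Longrightarrow> f \<in> J"
  shows "I \<subseteq> J"
proof
  fix f assume "f \<in> I"
  then have "hom_component m f \<in> J" for m
    using I sub[OF hom_component_forms] by (simp add: homogeneous_ideal_def)
  moreover obtain N where "f = (\<Sum>m\<le>N. hom_component m f)" using sum_hom_components by blast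
  ultimately show "f \<in> J"
    using J mpoly_ideal.subspace_sum[of J "{..N}" "\<lambda>m. hom_component m f"] by (auto simp: homogeneous_ideal_def)
qed

text \<open>The relations shared by \<open>I\<close> and the explicit double line already make the
  basis monomials span modulo the intersection of the two ideals. Hence both ideals and their
  intersection have the same monomial basis in each degree, and they coincide.\<close>

lemma double_line_classification:
  fixes I :: "'v::finite mpoly set"
  assumes I: "homogeneous_ideal I" and h: "\<And>m. hilbert_function I m = 2 * m + 1"
    and dist: "i \<noteq> j" "k \<noteq> i" "k \<noteq> j"
    and lin: "\<And>l. Var l - poly_scale (\<alpha> l) (Var i) - poly_scale (\<beta> l) (Var j) - poly_scale (\<gamma> l) (Var k) \<in> I"
    and sq: "(Var k - poly_scale p (Var i) - poly_scale q (Var j)) ^ 2 \<in> I"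
  obtains a b c where "pivot i j k a b c" "I = double_line_ideal a b c"
proof -
  have Ii: "mpoly_ideal.subspace I" using I by (simp add: homogeneous_ideal_def)
  have Iv: "mpoly_vs.subspace I" using Ii by (rule ideal_imp_subspace)
  \<comment> \<open>The relations supplied for the three plane coordinates themselves are replaced
    by the trivial ones, as row reduction demands.\<close>
  define \<alpha>' where "\<alpha>' l = (if l = i then 1 else if l = j \<or> l = k then 0 else \<alpha> l)" for l
  define \<beta>' where "\<beta>' l = (if l = j then 1 else if l = i \<or> l = k then 0 else \<beta> l)" for l
  define \<gamma>' where "\<gamma>' l = (if l = k then 1 else if l = i \<or> l = j then 0 else \<gamma> l)" for l
  have lin': "Var l - poly_scale (\<alpha>' l) (Var i) - poly_scale (\<beta>' l) (Var j) - poly_scale (\<gamma>' l) (Var k) \<in> I" for l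
    using lin[of l] dist mpoly_vs.subspace_0[OF Iv] by (auto simp: \<alpha>'_def \<beta>'_def \<gamma>'_def)
  \<comment> \<open>Arranged so that \<open>a k = p\<close> and \<open>b k = q\<close>, which makes
    the given square that of the equation of the line through \<open>a\<close> and
    \<open>b\<close>.\<close>
  define a where "a l = \<alpha>' l + p * \<gamma>' l" for l
  define b where "b l = \<beta>' l + q * \<gamma>' l" for l
  have piv: "pivot i j k a b \<gamma>'"
    using dist by (auto simp: pivot_def a_def b_def \<alpha>'_def \<beta>'_def \<gamma>'_def)
  have ak: "a k = p" "b k = q" using dist by (auto simp: a_def b_def \<alpha>'_def \<beta>'_def \<gamma>'_def)
  let ?J = "double_line_ideal a b \<gamma>'"
  have J: "homogeneous_ideal ?J" by (rule double_line_ideal_homogeneous)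
  have Ji: "mpoly_ideal.subspace ?J" by (rule double_line_ideal_subspace)
  have KI: "mpoly_ideal.subspace (I \<inter> ?J)" using Ii Ji by (rule mpoly_ideal.subspace_inter)
  have linJ: "Var l - poly_scale (\<alpha>' l) (Var i) - poly_scale (\<beta>' l) (Var j) - poly_scale (\<gamma>' l) (Var k) \<in> ?J" for l
    using pivot_linear[OF piv, of l] unfolding ak by (simp add: a_def b_def)
  interpret conic_family "\<lambda>z :: unit \<Rightarrow> complex. I \<inter> ?J" i j k "\<lambda>l _. \<alpha>' l" "\<lambda>l _. \<beta>' l" "\<lambda>l _. \<gamma>' l"
    "\<lambda>_. - (p * p)" "\<lambda>_. - (2 * p * q)" "\<lambda>_. - (q * q)" "\<lambda>_. 2 * p" "\<lambda>_. 2 * q"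
    using KI lin' linJ sq pivot_square[OF piv] unfolding ak by unfold_locales (auto simp: quadric_square)
  have sub: "mpoly_vs.subspace (I \<inter> ?J)" by (rule ideal_imp_subspace[OF KI])
  have exK: "\<exists>C. expands (bas m) (I \<inter> ?J) \<mu> C" if "\<mu> \<in> monomials m" for \<mu> m
    using conic_expansion[OF that] by metis
  have chI: "I \<in> chart m (bas m)" for m
  proof (rule chart_of_spanning[OF Iv double_line_basis_monomials])
    show "card (bas m) \<le> hilbert_function I m" using h card_double_line_basis[OF dist] by simp
    show "\<exists>c. expands (bas m) I \<mu> c" if "\<mu> \<in> monomials m" for \<mu>
      using exK[OF that] by (auto simp: expands_def)
  qed
  have chJ: "?J \<in> chart m (bas m)" for m by (rule double_line_chart[OF piv])
  have chK: "I \<inter> ?J \<in> chart m (bas m)" for m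
  proof (rule chart_intro[OF sub exK])
    fix d b assume d: "(\<Sum>b\<in>bas m. Poly_Mapping.single b (d b)) \<in> I \<inter> ?J" "b \<in> bas m"
    show "d b = 0" by (rule chart_independent[OF chI Iv IntD1[OF d(1)] d(2)])
  qed
  have eqm: "f \<in> I \<longleftrightarrow> f \<in> ?J" if f: "f \<in> forms m" for f m
  proof -
    let ?g = "\<Sum>b\<in>bas m. Poly_Mapping.single b (\<Sum>\<mu>\<in>monomials m. Poly_Mapping.lookup f \<mu> * chart_coord m (bas m) (I \<inter> ?J) (\<mu>, b))"
    have red: "f - ?g \<in> I \<inter> ?J" by (rule chart_reduce[OF chK sub f])
    have zero: "?g = 0" if "?g \<in> M" "M \<in> chart m (bas m)" "mpoly_vs.subspace M" for M
      using chart_independent[OF that(2,3,1)] by simp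
    show ?thesis
    proof
      assume "f \<in> I"
      have "?g = 0"
        by (rule zero[OF _ chI Iv]) (use subspace_sub[OF Iv \<open>f \<in> I\<close>, of "f - ?g"] red in simp)
      then show "f \<in> ?J" using red by simp
    next
      assume "f \<in> ?J"
      have "?g = 0"
        by (rule zero[OF _ chJ ideal_imp_subspace[OF Ji]])
          (use subspace_sub[OF ideal_imp_subspace[OF Ji] \<open>f \<in> ?J\<close>, of "f - ?g"] red in simp)
      then show "f \<in> I" using red by simp
    qed
  qed
  have "I = ?J"
    using homogeneous_ideal_subset[OF I J] homogeneous_ideal_subset[OF J I] eqm by blast
  then show ?thesis using that piv by blast
qed

section \<open>Double lines as extensions\<close>

text \<open>Homogeneous functions of the two line parameters, that is, sections over the line of the
  twist by \<open>m\<close>.\<close>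

definition binary_form :: "nat \<Rightarrow> (complex \<Rightarrow> complex \<Rightarrow> complex) \<Rightarrow> bool" where
  "binary_form m F \<longleftrightarrow> (\<exists>d. \<forall>s t. F s t = (\<Sum>r\<le>m. d r * s ^ r * t ^ (m - r)))"

lemma binary_form_add: "binary_form m F \<Longrightarrow> binary_form m G \<Longrightarrow> binary_form m (\<lambda>s t. F s t + G s t)"
proof -
  assume "binary_form m F" "binary_form m G"
  then obtain d e where "\<And>s t. F s t = (\<Sum>r\<le>m. d r * s ^ r * t ^ (m - r))"
    "\<And>s t. G s t = (\<Sum>r\<le>m. e r * s ^ r * t ^ (m - r))" unfolding binary_form_def by blast
  then show ?thesis
    unfolding binary_form_def by (intro exI[of _ "\<lambda>r. d r + e r"]) (simp add: sum.distrib algebra_simps)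
qed

lemma binary_form_scale: "binary_form m F \<Longrightarrow> binary_form m (\<lambda>s t. c * F s t)"
proof -
  assume "binary_form m F"
  then obtain d where "\<And>s t. F s t = (\<Sum>r\<le>m. d r * s ^ r * t ^ (m - r))" unfolding binary_form_def by blast
  then show ?thesis
    unfolding binary_form_def by (intro exI[of _ "\<lambda>r. c * d r"]) (simp add: sum_distrib_left mult.assoc)
qed

lemma binary_form_0: "binary_form m (\<lambda>s t. 0)"
  unfolding binary_form_def by (intro exI[of _ "\<lambda>_. 0"]) simp

lemma binary_form_sum: "(\<And>x. x \<in> A \<Longrightarrow> binary_form m (F x)) \<Longrightarrow> binary_form m (\<lambda>s t. \<Sum>x\<in>A. F x s t)"
  by (induction A rule: infinite_finite_induct) (auto intro: binary_form_0 binary_form_add)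

lemma binary_form_mult_linear:
  assumes "binary_form m F"
  shows "binary_form (Suc m) (\<lambda>s t. (s * \<alpha> + t * \<beta>) * F s t)"
proof -
  obtain d where d: "\<And>s t. F s t = (\<Sum>r\<le>m. d r * s ^ r * t ^ (m - r))"
    using assms unfolding binary_form_def by blast
  define e1 where "e1 r = (if r = 0 then 0 else \<alpha> * d (r - 1))" for r
  define e2 where "e2 r = (if r \<le> m then \<beta> * d r else 0)" for r
  have 1: "(\<Sum>r\<le>Suc m. e1 r * s ^ r * t ^ (Suc m - r)) = s * \<alpha> * F s t" for s t
    unfolding d sum.atMost_Suc_shift by (simp add: e1_def sum_distrib_left mult_ac)
  have 2: "(\<Sum>r\<le>Suc m. e2 r * s ^ r * t ^ (Suc m - r)) = t * \<beta> * F s t" for s t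
    unfolding d by (simp add: e2_def sum_distrib_left mult_ac Suc_diff_le)
  have "(s * \<alpha> + t * \<beta>) * F s t = (\<Sum>r\<le>Suc m. (e1 r + e2 r) * s ^ r * t ^ (Suc m - r))" for s t
    unfolding distrib_right sum.distrib 1 2 ..
  then show ?thesis unfolding binary_form_def by (intro exI[of _ "\<lambda>r. e1 r + e2 r"] allI)
qed

lemma binary_form_eval:
  fixes f :: "'v::finite mpoly"
  assumes "f \<in> forms m"
  shows "binary_form m (\<lambda>s t. eval_poly f (line_point a b s t))"
proof -
  have mon: "binary_form m (\<lambda>s t. eval_poly (Poly_Mapping.single \<mu> 1) (line_point a b s t))"
    if "\<mu> \<in> monomials m" for \<mu> :: "'v \<Rightarrow>\<^sub>0 nat" and m
    using that
  proof (induction m arbitrary: \<mu>)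
    case 0
    then have "\<mu> = 0" by (simp add: mem_monomials mdeg_eq_0_iff)
    then show ?case unfolding binary_form_def by (intro exI[of _ "\<lambda>_. 1"]) simp
  next
    case (Suc m)
    obtain l \<nu> where l: "\<nu> \<in> monomials m" "\<mu> = Poly_Mapping.single l 1 + \<nu>"
      using Suc.prems by (rule monomial_decomp)
    have "eval_poly (Poly_Mapping.single \<mu> 1) (line_point a b s t)
      = (s * a l + t * b l) * eval_poly (Poly_Mapping.single \<nu> 1) (line_point a b s t)" for s t
      by (simp add: l(2) eval_poly_single eval_monomial_add line_point_def)
    then show ?case using binary_form_mult_linear[OF Suc.IH[OF l(1)]] by simp
  qed
  have "binary_form m (\<lambda>s t. \<Sum>\<mu>\<in>monomials m. Poly_Mapping.lookup f \<mu> * eval_poly (Poly_Mapping.single \<mu> 1) (line_point a b s t))"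
    by (intro binary_form_sum binary_form_scale mon)
  then show ?thesis by (subst forms_expand[OF assms]) (simp only: eval_poly_sum eval_poly_scale)
qed

lemma binary_form_pdir:
  fixes f :: "'v::finite mpoly"
  assumes "f \<in> forms (Suc m)"
  shows "binary_form m (\<lambda>s t. pdir f (line_point a b s t) c)"
proof -
  have mon: "binary_form m (\<lambda>s t. pdir (Poly_Mapping.single \<mu> 1) (line_point a b s t) c)"
    if "\<mu> \<in> monomials (Suc m)" for \<mu> :: "'v \<Rightarrow>\<^sub>0 nat" and m
    using that
  proof (induction m arbitrary: \<mu>)
    case 0
    obtain l \<nu> where l: "\<nu> \<in> monomials 0" "\<mu> = Poly_Mapping.single l 1 + \<nu>"
      using 0 by (rule monomial_decomp)
    then have "Poly_Mapping.single \<mu> 1 = Var l" by (simp add: mem_monomials mdeg_eq_0_iff Var_def)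
    then show ?case unfolding binary_form_def by (intro exI[of _ "\<lambda>_. c l"]) simp
  next
    case (Suc m)
    obtain l \<nu> where l: "\<nu> \<in> monomials (Suc m)" "\<mu> = Poly_Mapping.single l 1 + \<nu>"
      using Suc.prems by (rule monomial_decomp)
    have "Poly_Mapping.single \<mu> 1 = Var l * Poly_Mapping.single \<nu> (1::complex)"
      by (simp add: l(2) Var_def mult_single)
    then have eq: "pdir (Poly_Mapping.single \<mu> 1) (line_point a b s t) c
      = c l * eval_poly (Poly_Mapping.single \<nu> 1) (line_point a b s t)
        + (s * a l + t * b l) * pdir (Poly_Mapping.single \<nu> 1) (line_point a b s t) c" for s t
      by (simp add: pdir_mult) (simp add: line_point_def)
    have \<nu>: "Poly_Mapping.single \<nu> (1::complex) \<in> forms (Suc m)" using l(1) by (simp add: mem_monomials)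
    show ?case
      unfolding eq
      by (rule binary_form_add[OF binary_form_scale[OF binary_form_eval[OF \<nu>]] binary_form_mult_linear[OF Suc.IH[OF l(1)]]])
  qed
  have "binary_form m (\<lambda>s t. \<Sum>\<mu>\<in>monomials (Suc m). Poly_Mapping.lookup f \<mu> * pdir (Poly_Mapping.single \<mu> 1) (line_point a b s t) c)"
    by (intro binary_form_sum binary_form_scale mon)
  then show ?thesis by (subst forms_expand[OF assms]) (simp only: pdir_sum pdir_scale)
qed

text \<open>The variables \<open>x_i\<close> and \<open>x_j\<close> restrict to the two parameters
  of the line, so every binary form is the restriction of a form in these variables.\<close>

lemma binary_form_lift:
  assumes piv: "pivot i j k a b c" and F: "binary_form m F"
  obtains g d where "g \<in> forms m" "\<And>s t. eval_poly g (line_point a b s t) = F s t"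
    "g = (\<Sum>r\<le>m. poly_scale (d r) (Var i ^ r * Var j ^ (m - r)))"
proof -
  obtain d where d: "\<And>s t. F s t = (\<Sum>r\<le>m. d r * s ^ r * t ^ (m - r))"
    using F unfolding binary_form_def by blast
  let ?g = "\<Sum>r\<le>m. poly_scale (d r) (Var i ^ r * Var j ^ (m - r))"
  have "?g \<in> forms m"
    by (intro forms_sum forms_scale) (simp flip: single_mon2)
  moreover have "eval_poly ?g (line_point a b s t) = F s t" for s t
    using piv by (simp add: eval_poly_simps d line_point_def pivot_def mult.assoc)
  ultimately show ?thesis using that by blast
qed

lemma line_chart:
  fixes a b c :: "'v::finite \<Rightarrow> complex"
  assumes piv: "pivot i j k a b c"
  shows "line_ideal a b \<in> chart m (line_basis i j m)"
proof (rule chart_intro[OF ideal_imp_subspace[OF line_ideal_subspace]])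
  note ij = pivot_distinct(1)[OF piv]
  have sum: "(\<Sum>\<mu>\<in>line_basis i j m. Poly_Mapping.single \<mu> (e \<mu>)) = (\<Sum>r\<le>m. poly_scale (e (mon2 i j r (m - r))) (Var i ^ r * Var j ^ (m - r)))"
    for e
    unfolding sum_line_basis[OF ij] by (intro sum.cong refl, subst single_eq_scale) (simp only: single_mon2)
  {
    fix \<mu> :: "'v \<Rightarrow>\<^sub>0 nat" assume \<mu>: "\<mu> \<in> monomials m"
    then have "Poly_Mapping.single \<mu> (1::complex) \<in> forms m" by (simp add: mem_monomials)
    then obtain g d where "g \<in> forms m"
      and g: "\<And>s t. eval_poly g (line_point a b s t) = eval_poly (Poly_Mapping.single \<mu> 1) (line_point a b s t)"
        "g = (\<Sum>r\<le>m. poly_scale (d r) (Var i ^ r * Var j ^ (m - r)))"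
      by (rule binary_form_lift[OF piv binary_form_eval[where a = a and b = b]]) blast
    let ?e = "\<lambda>\<beta>. if \<beta> \<in> line_basis i j m then d (Poly_Mapping.lookup \<beta> i) else 0"
    have "(\<Sum>\<mu>\<in>line_basis i j m. Poly_Mapping.single \<mu> (?e \<mu>)) = g"
      unfolding sum g(2) by (intro sum.cong refl) (simp add: line_basis_mem mon2_lookup(1)[OF ij])
    then have "expands (line_basis i j m) (line_ideal a b) \<mu> ?e"
      using g(1) by (simp add: expands_def line_ideal_def eval_poly_diff)
    then show "\<exists>c. expands (line_basis i j m) (line_ideal a b) \<mu> c" by blast
  }
  fix e \<beta> assume e: "(\<Sum>b\<in>line_basis i j m. Poly_Mapping.single b (e b)) \<in> line_ideal a b" and \<beta>: "\<beta> \<in> line_basis i j m"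
  have "(\<Sum>r\<le>m. e (mon2 i j r (m - r)) * s ^ r) = 0" for s
  proof -
    have "eval_poly (\<Sum>r\<le>m. poly_scale (e (mon2 i j r (m - r))) (Var i ^ r * Var j ^ (m - r))) (line_point a b s 1) = 0"
      using e unfolding sum by (simp add: line_ideal_def)
    then show ?thesis using piv by (simp add: eval_poly_simps line_point_def pivot_def)
  qed
  from polynomial_sum_zero[OF this] show "e \<beta> = 0" using \<beta> by (auto simp: line_basis_def)
qed

lemma line_hilbert_function:
  fixes a b c :: "'v::finite \<Rightarrow> complex"
  assumes piv: "pivot i j k a b c"
  shows "hilbert_function (line_ideal a b) m = m + 1"
  using hilbert_function_chart[OF line_basis_monomials line_chart[OF piv]
      ideal_imp_subspace[OF line_ideal_subspace]] card_line_basis pivot_distinct(1)[OF piv] by metis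

lemma pivot_nonzero: "pivot i j k a b c \<Longrightarrow> a \<noteq> (\<lambda>_. 0)"
  by (auto simp: pivot_def)

lemma line_in_Hilb:
  fixes a b c :: "'v::finite \<Rightarrow> complex"
  assumes piv: "pivot i j k a b c" and "J \<subseteq> line_ideal a b"
  shows "line_ideal a b \<in> Hilb J 1"
  using assms line_ideal_homogeneous line_ideal_saturated[OF pivot_nonzero[OF piv]] line_hilbert_function[OF piv]
  by (simp add: Hilb_def)

lemma double_line_in_Hilb:
  fixes a b c :: "'v::finite \<Rightarrow> complex"
  assumes piv: "pivot i j k a b c" and "J \<subseteq> double_line_ideal a b c"
  shows "double_line_ideal a b c \<in> Hilb J 2"
  using assms double_line_ideal_homogeneous double_line_ideal_saturated[OF pivot_nonzero[OF piv]]
    double_line_hilbert_function[OF piv]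
  by (simp add: Hilb_def)

text \<open>Multiplication by the equation of the line in its plane embeds the twisted structure
  sheaf of the line: the product with \<open>f\<close> lies in the double line ideal exactly when
  \<open>f\<close> vanishes on the line. The quotient map is the identity on
  representatives.\<close>

lemma double_line_is_extension:
  fixes a b c :: "'v::finite \<Rightarrow> complex"
  assumes piv: "pivot i j k a b c"
  shows "line_extension (line_ideal a b) (double_line_ideal a b c)
    (\<lambda>f. (Var k - poly_scale (a k) (Var i) - poly_scale (b k) (Var j)) * f) (\<lambda>f. f)"
proof -
  let ?h = "Var k - poly_scale (a k) (Var i) - poly_scale (b k) (Var j)"
  note ideal = double_line_ideal_subspace[of a b c] and Li = line_ideal_subspace[of a b]
  have h1: "?h \<in> forms 1" by (intro forms_diff forms_scale forms_Var)
  have hf: "?h * f \<in> double_line_ideal a b c \<longleftrightarrow> f \<in> line_ideal a b" for f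
    by (simp add: double_line_ideal_def line_ideal_def eval_poly_mult pdir_mult pivot_normal[OF piv])
  have 1: "sheaf_hom 0 1 (line_ideal a b) (double_line_ideal a b c) (\<lambda>f. ?h * f)"
    unfolding sheaf_hom_def
  proof (intro allI impI conjI ballI)
    fix l and f :: "'v mpoly" assume "f \<in> forms l"
    then show "?h * f \<in> forms (l + 1)" using forms_mult[OF h1] by (simp add: add.commute)
  next
    fix l and f :: "'v mpoly" assume "f \<in> forms l \<inter> line_ideal a b"
    then show "?h * f \<in> double_line_ideal a b c" by (simp only: hf Int_iff)
  next
    fix f g :: "'v mpoly" show "?h * (f + g) - (?h * f + ?h * g) \<in> double_line_ideal a b c"
      using mpoly_ideal.subspace_0[OF ideal] by (simp add: distrib_left)
  next
    fix f g :: "'v mpoly" show "?h * (g * f) - g * (?h * f) \<in> double_line_ideal a b c"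
      using mpoly_ideal.subspace_0[OF ideal] by (simp add: mult.left_commute)
  qed
  have 2: "sheaf_hom 0 0 (double_line_ideal a b c) (line_ideal a b) (\<lambda>f. f)"
    unfolding sheaf_hom_def using double_line_subset_line[of a b c] mpoly_ideal.subspace_0[OF Li] by auto
  have exact: "f \<in> line_ideal a b \<longleftrightarrow> (\<exists>g\<in>forms l. f - ?h * g \<in> double_line_ideal a b c)"
    if f: "f \<in> forms (l + 1)" for f l
  proof
    assume fL: "f \<in> line_ideal a b"
    have "f \<in> forms (Suc l)" using f by simp
    \<comment> \<open>On the line the derivative of \<open>f\<close> along \<open>c\<close> has
      degree \<open>l\<close>. Subtracting \<open>?h\<close> times a lift of it cancels the
      derivative and does not change the values.\<close>
    then obtain g d where g: "g \<in> forms l" "\<And>s t. eval_poly g (line_point a b s t) = pdir f (line_point a b s t) c"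
      "g = (\<Sum>r\<le>l. poly_scale (d r) (Var i ^ r * Var j ^ (l - r)))"
      by (rule binary_form_lift[OF piv binary_form_pdir[where a = a and b = b and c = c]]) blast
    have "f - ?h * g \<in> double_line_ideal a b c"
      using fL by (simp add: double_line_ideal_def line_ideal_def eval_poly_mult pdir_mult pivot_normal[OF piv]
          eval_poly_diff[of f] pdir_diff[of f] g(2))
    then show "\<exists>g\<in>forms l. f - ?h * g \<in> double_line_ideal a b c" using g(1) by blast
  next
    assume "\<exists>g\<in>forms l. f - ?h * g \<in> double_line_ideal a b c"
    then obtain g where g: "f - ?h * g \<in> line_ideal a b" using double_line_subset_line by blast
    have "?h * g \<in> line_ideal a b"
      by (simp add: line_ideal_def eval_poly_mult pivot_normal[OF piv])
    from mpoly_ideal.subspace_add[OF Li g this] show "f \<in> line_ideal a b" by simp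
  qed
  show ?thesis
    unfolding line_extension_def
  proof (intro exI[of _ 0] conjI allI impI ballI)
    fix l and f :: "'v mpoly" assume "f \<in> forms l" "?h * f \<in> double_line_ideal a b c"
    then show "f \<in> line_ideal a b" by (simp only: hf)
  next
    fix l and f :: "'v mpoly" assume "f \<in> forms (l + 1)"
    then show "f \<in> line_ideal a b \<longleftrightarrow> (\<exists>g\<in>forms l. f - ?h * g \<in> double_line_ideal a b c)" by (rule exact)
  next
    fix l and g :: "'v mpoly" assume "g \<in> forms l"
    then show "\<exists>f\<in>forms l. f - g \<in> line_ideal a b"
      using mpoly_ideal.subspace_0[OF Li] by (intro bexI[of _ g]) auto
  qed (rule 1, rule 2)
qed

section \<open>Extensions and linear forms with vanishing square\<close>

text \<open>Otherwise the degree \<open>m\<close> part of \<open>L\<close> would lie in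
  \<open>C\<close>, and monomials independent modulo \<open>C\<close> would remain independent
  modulo \<open>L\<close>.\<close>

lemma exists_form_of_gap:
  fixes C L :: "'v::finite mpoly set"
  assumes C: "mpoly_vs.subspace C" and L: "mpoly_vs.subspace L" and "hilbert_function L m < hilbert_function C m"
  obtains h where "h \<in> forms m" "h \<in> L" "h \<notin> C"
proof (rule ccontr)
  note found = that
  assume "\<not> thesis"
  then have sub: "h \<in> C" if "h \<in> forms m" "h \<in> L" for h using found that by blast
  obtain B where B: "B \<subseteq> monomials m" "C \<in> chart m B" by (rule exists_chart[OF C])
  have finB: "finite B" using B(1) by (rule finite_monomial_subset)
  have "card B \<le> hilbert_function L m"
  proof -
    obtain B' where B': "B' \<subseteq> monomials m" "L \<in> chart m B'" by (rule exists_chart[OF L])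
    have "card B \<le> card B'"
    proof (rule ccontr)
      assume less: "\<not> ?thesis"
      have finB': "finite B'" using B'(1) by (rule finite_monomial_subset)
      let ?r = "\<lambda>b. \<Sum>b'\<in>B'. Poly_Mapping.single b' (chart_coord m B' L (b, b'))"
      have "?r b \<in> mpoly_vs.span ((\<lambda>b'. Poly_Mapping.single b' 1) ` B')" for b
        by (intro mpoly_vs.span_sum, subst single_eq_scale) (intro mpoly_vs.span_scale mpoly_vs.span_base imageI)
      moreover have "card ((\<lambda>b'. Poly_Mapping.single b' (1::complex)) ` B') < card B"
        using less card_image_le[OF finB', of "\<lambda>b'. Poly_Mapping.single b' (1::complex)"] by simp
      ultimately obtain d where d: "\<exists>b\<in>B. d b \<noteq> 0" "(\<Sum>b\<in>B. poly_scale (d b) (?r b)) = 0"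
        using linear_relation_exists[of "(\<lambda>b'. Poly_Mapping.single b' (1::complex)) ` B'" B ?r] finB finB' by blast
      have "(\<Sum>b\<in>B. poly_scale (d b) (Poly_Mapping.single b 1 - ?r b)) \<in> L"
        using chart_expands[OF B'(2)] B(1)
        by (intro mpoly_vs.subspace_sum[OF L] mpoly_vs.subspace_scale[OF L]) (auto simp: expands_def)
      moreover have "(\<Sum>b\<in>B. poly_scale (d b) (Poly_Mapping.single b 1 - ?r b)) = (\<Sum>b\<in>B. Poly_Mapping.single b (d b))"
        unfolding mpoly_vs.scale_right_diff_distrib sum_subtractf d(2) by simp
      ultimately have inL: "(\<Sum>b\<in>B. Poly_Mapping.single b (d b)) \<in> L" by simp
      moreover have "(\<Sum>b\<in>B. Poly_Mapping.single b (d b)) \<in> forms m"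
        using B(1) by (intro forms_sum) (auto simp: mem_monomials)
      ultimately have inC: "(\<Sum>b\<in>B. Poly_Mapping.single b (d b)) \<in> C" using sub by blast
      have "d b = 0" if "b \<in> B" for b by (rule chart_independent[OF B(2) C inC that])
      then show False using d(1) by blast
    qed
    then show ?thesis using hilbert_function_chart[OF B' L] by simp
  qed
  then show False using assms(3) hilbert_function_chart[OF B C] by simp
qed

text \<open>A splitting writes every form as a sum of one part from the subsheaf and one from the
  quotient sheaf. A linear form vanishing on the line kills both parts, so it annihilates the
  structure sheaf of the curve and lies in \<open>C\<close> by saturation.\<close>

lemma extension_not_split:
  fixes L C :: "'v::finite mpoly set"
  assumes L: "mpoly_ideal.subspace L" and C: "mpoly_ideal.subspace C" "saturated C"
    and gap: "hilbert_function L 1 < hilbert_function C 1"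
    and ext: "line_extension L C \<alpha> \<beta>"
  shows "\<not> line_extension_splits L C \<beta>"
proof
  assume "line_extension_splits L C \<beta>"
  then obtain n' \<sigma> where \<sigma>: "sheaf_hom n' 0 L C \<sigma>" and split: "\<And>l f. l \<ge> n' \<Longrightarrow> f \<in> forms l \<Longrightarrow> \<beta> (\<sigma> f) - f \<in> L"
    unfolding line_extension_splits_def by blast
  obtain n where \<alpha>: "sheaf_hom n 1 L C \<alpha>" and \<beta>: "sheaf_hom n 0 C L \<beta>"
    and ex: "\<And>l f. l \<ge> n \<Longrightarrow> f \<in> forms (l + 1) \<Longrightarrow> \<beta> f \<in> L \<longleftrightarrow> (\<exists>g\<in>forms l. f - \<alpha> g \<in> C)"
    using ext unfolding line_extension_def by blast
  obtain h where h: "h \<in> forms 1" "h \<in> L" "h \<notin> C"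
    using exists_form_of_gap[OF ideal_imp_subspace[OF C(1)] ideal_imp_subspace[OF L] gap] by blast
  define N where "N = max n n'"
  have "f * h \<in> C" if f: "f \<in> forms (Suc N)" for f
  proof -
    have le: "n \<le> N" "n \<le> Suc N" "n' \<le> Suc N" "n \<le> Suc (Suc N)" "n' \<le> Suc (Suc N)" by (auto simp: N_def)
    have \<beta>f: "\<beta> f \<in> forms (Suc N)" using \<beta> f le unfolding sheaf_hom_def by (metis add_0_right)
    have \<sigma>f: "\<sigma> (\<beta> f) \<in> forms (Suc N)" using \<sigma> \<beta>f le unfolding sheaf_hom_def by (metis add_0_right)
    \<comment> \<open>The component of \<open>f\<close> in the kernel of \<open>\<beta>\<close>;
      exactness replaces it by some \<open>\<alpha> g\<close> modulo \<open>C\<close>.\<close>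
    define u where "u = f - \<sigma> (\<beta> f)"
    have u: "u \<in> forms (Suc N)" unfolding u_def by (rule forms_diff[OF f \<sigma>f])
    have "\<beta> (u + \<sigma> (\<beta> f)) - (\<beta> u + \<beta> (\<sigma> (\<beta> f))) \<in> L"
      using \<beta> u \<sigma>f le unfolding sheaf_hom_def by blast
    then have "\<beta> f - (\<beta> u + \<beta> (\<sigma> (\<beta> f))) \<in> L" by (simp add: u_def)
    moreover have "\<beta> (\<sigma> (\<beta> f)) - \<beta> f \<in> L" using split[OF le(3) \<beta>f] .
    ultimately have "- ((\<beta> f - (\<beta> u + \<beta> (\<sigma> (\<beta> f)))) + (\<beta> (\<sigma> (\<beta> f)) - \<beta> f)) \<in> L"
      by (intro mpoly_ideal.subspace_neg[OF L] mpoly_ideal.subspace_add[OF L])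
    then have "\<beta> u \<in> L" by simp
    moreover have "u \<in> forms (N + 1)" using u by simp
    ultimately obtain g where g: "g \<in> forms N" "u - \<alpha> g \<in> C" using ex[OF le(1)] by blast
    have hg: "h * g \<in> forms (Suc N) \<inter> L"
      using forms_mult[OF h(1) g(1)] mpoly_ideal.subspace_scale[OF L h(2), of g] by (simp add: mult.commute)
    have "\<alpha> (h * g) \<in> C" using \<alpha> hg le unfolding sheaf_hom_def by blast
    moreover have "\<alpha> (h * g) - h * \<alpha> g \<in> C" using \<alpha> g(1) h(1) le unfolding sheaf_hom_def by blast
    ultimately have "\<alpha> (h * g) - (\<alpha> (h * g) - h * \<alpha> g) \<in> C" by (rule mpoly_ideal.subspace_diff[OF C(1)])
    then have 1: "h * \<alpha> g \<in> C" by simp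
    have h\<beta>: "h * \<beta> f \<in> forms (Suc (Suc N)) \<inter> L"
      using forms_mult[OF h(1) \<beta>f] mpoly_ideal.subspace_scale[OF L h(2), of "\<beta> f"] by (simp add: mult.commute)
    have "\<sigma> (h * \<beta> f) \<in> C" using \<sigma> h\<beta> le unfolding sheaf_hom_def by blast
    moreover have "\<sigma> (h * \<beta> f) - h * \<sigma> (\<beta> f) \<in> C" using \<sigma> \<beta>f h(1) le unfolding sheaf_hom_def by blast
    ultimately have "\<sigma> (h * \<beta> f) - (\<sigma> (h * \<beta> f) - h * \<sigma> (\<beta> f)) \<in> C" by (rule mpoly_ideal.subspace_diff[OF C(1)])
    then have 2: "h * \<sigma> (\<beta> f) \<in> C" by simp
    have "h * (u - \<alpha> g) + (h * \<alpha> g + h * \<sigma> (\<beta> f)) \<in> C"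
      by (rule mpoly_ideal.subspace_add[OF C(1) mpoly_ideal.subspace_scale[OF C(1) g(2)]
            mpoly_ideal.subspace_add[OF C(1) 1 2]])
    moreover have "h * (u - \<alpha> g) + (h * \<alpha> g + h * \<sigma> (\<beta> f)) = f * h"
      unfolding u_def by (simp add: algebra_simps)
    ultimately show ?thesis by simp
  qed
  then have "h \<in> C" using C(2) unfolding saturated_def by blast
  then show False using h(3) by contradiction
qed

text \<open>For a linear form \<open>h\<close> vanishing on the line, \<open>h * f\<close> lies in
  the kernel of \<open>\<beta>\<close>, hence in the image of \<open>\<alpha>\<close>, and there a
  second factor \<open>h\<close> gives zero. Saturation removes the test form
  \<open>f\<close>.\<close>

lemma extension_square_zero:
  fixes L C :: "'v::finite mpoly set"
  assumes L: "mpoly_ideal.subspace L" and C: "mpoly_ideal.subspace C" "saturated C"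
    and gap: "hilbert_function L 1 < hilbert_function C 1"
    and ext: "line_extension L C \<alpha> \<beta>"
  obtains h where "h \<in> forms 1" "h \<notin> C" "h * h \<in> C"
proof -
  obtain n where \<alpha>: "sheaf_hom n 1 L C \<alpha>" and \<beta>: "sheaf_hom n 0 C L \<beta>"
    and ex: "\<And>l f. l \<ge> n \<Longrightarrow> f \<in> forms (l + 1) \<Longrightarrow> \<beta> f \<in> L \<longleftrightarrow> (\<exists>g\<in>forms l. f - \<alpha> g \<in> C)"
    using ext unfolding line_extension_def by blast
  obtain h where h: "h \<in> forms 1" "h \<in> L" "h \<notin> C"
    using exists_form_of_gap[OF ideal_imp_subspace[OF C(1)] ideal_imp_subspace[OF L] gap] by blast
  have "f * (h * h) \<in> C" if f: "f \<in> forms n" for f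
  proof -
    have hf: "h * f \<in> forms (n + 1)" using forms_mult[OF h(1) f] by (simp add: add.commute)
    have "\<beta> (h * f) - h * \<beta> f \<in> L" using \<beta> f h(1) unfolding sheaf_hom_def by blast
    moreover have "h * \<beta> f \<in> L" using mpoly_ideal.subspace_scale[OF L h(2), of "\<beta> f"] by (simp add: mult.commute)
    ultimately have "(\<beta> (h * f) - h * \<beta> f) + h * \<beta> f \<in> L" by (rule mpoly_ideal.subspace_add[OF L])
    then have "\<beta> (h * f) \<in> L" by simp
    then obtain g where g: "g \<in> forms n" "h * f - \<alpha> g \<in> C" using ex[OF order_refl hf] by blast
    have hg: "h * g \<in> forms (Suc n) \<inter> L"
      using forms_mult[OF h(1) g(1)] mpoly_ideal.subspace_scale[OF L h(2), of g] by (simp add: mult.commute)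
    have "\<alpha> (h * g) \<in> C" using \<alpha> hg unfolding sheaf_hom_def by (metis le_Suc_eq order_refl)
    moreover have "\<alpha> (h * g) - h * \<alpha> g \<in> C" using \<alpha> g(1) h(1) unfolding sheaf_hom_def by blast
    ultimately have "\<alpha> (h * g) - (\<alpha> (h * g) - h * \<alpha> g) \<in> C" by (rule mpoly_ideal.subspace_diff[OF C(1)])
    then have "h * (h * f - \<alpha> g) + h * \<alpha> g \<in> C"
      by (intro mpoly_ideal.subspace_add[OF C(1) mpoly_ideal.subspace_scale[OF C(1) g(2)]]) simp
    moreover have "h * (h * f - \<alpha> g) + h * \<alpha> g = f * (h * h)" by (simp add: algebra_simps)
    ultimately show ?thesis by simp
  qed
  then have "h * h \<in> C" using C(2) unfolding saturated_def by blast
  then show ?thesis using that h by blast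
qed

lemma Hilb_ideal: "I \<in> Hilb J d \<Longrightarrow> mpoly_ideal.subspace I"
  by (simp add: Hilb_def homogeneous_ideal_def)

lemma Hilb_subspace: "I \<in> Hilb J d \<Longrightarrow> mpoly_vs.subspace I"
  by (rule ideal_imp_subspace[OF Hilb_ideal])

lemma Hilb_hilbert_function:
  fixes I :: "'v::finite mpoly set"
  assumes "I \<in> Hilb J d" "d = 1 \<or> d = 2"
  shows "hilbert_function I l = d * l + 1"
  using assms by (intro hilbert_function_exact) (auto simp: Hilb_def)

section \<open>Conics in coordinates of their plane\<close>

definition lin3 :: "'v \<Rightarrow> 'v \<Rightarrow> 'v \<Rightarrow> complex \<Rightarrow> complex \<Rightarrow> complex \<Rightarrow> 'v mpoly" where
  "lin3 i j k p q r = poly_scale p (Var i) + poly_scale q (Var j) + poly_scale r (Var k)"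

text \<open>The three variables restrict to coordinates of the plane spanned by the conic: they form
  a basis of the degree one part of the quotient.\<close>

definition plane_coordinates :: "'v mpoly set \<Rightarrow> 'v \<Rightarrow> 'v \<Rightarrow> 'v \<Rightarrow> bool" where
  "plane_coordinates I i j k \<longleftrightarrow> i \<noteq> j \<and> k \<noteq> i \<and> k \<noteq> j \<and>
     (\<forall>l. \<exists>\<alpha> \<beta> \<gamma>. Var l - poly_scale \<alpha> (Var i) - poly_scale \<beta> (Var j) - poly_scale \<gamma> (Var k) \<in> I) \<and>
     (\<forall>p q r. lin3 i j k p q r \<in> I \<longrightarrow> p = 0 \<and> q = 0 \<and> r = 0)"

lemma lin3_perm: "lin3 j k i q r p = lin3 i j k p q r" "lin3 j i k q p r = lin3 i j k p q r"
  by (simp_all add: lin3_def algebra_simps)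

lemma plane_coordinates_rotate:
  assumes "plane_coordinates I i j k"
  shows "plane_coordinates I j k i"
  unfolding plane_coordinates_def
proof (intro conjI allI impI)
  fix l
  obtain \<alpha> \<beta> \<gamma> where "Var l - poly_scale \<alpha> (Var i) - poly_scale \<beta> (Var j) - poly_scale \<gamma> (Var k) \<in> I"
    using assms unfolding plane_coordinates_def by blast
  also have "Var l - poly_scale \<alpha> (Var i) - poly_scale \<beta> (Var j) - poly_scale \<gamma> (Var k)
    = Var l - poly_scale \<beta> (Var j) - poly_scale \<gamma> (Var k) - poly_scale \<alpha> (Var i)" by (simp add: algebra_simps)
  finally show "\<exists>\<alpha> \<beta> \<gamma>. Var l - poly_scale \<alpha> (Var j) - poly_scale \<beta> (Var k) - poly_scale \<gamma> (Var i) \<in> I" by blast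
next
  fix p q r assume "lin3 j k i p q r \<in> I"
  then have "lin3 i j k r p q \<in> I" by (subst (asm) lin3_perm(1))
  then have "r = 0 \<and> p = 0 \<and> q = 0" using assms unfolding plane_coordinates_def by blast
  then show "p = 0" "q = 0" "r = 0" by blast+
qed (use assms in \<open>auto simp: plane_coordinates_def\<close>)

lemma monomials_1:
  fixes \<mu> :: "'v::finite \<Rightarrow>\<^sub>0 nat"
  assumes "\<mu> \<in> monomials (Suc 0)"
  obtains i where "Poly_Mapping.single \<mu> 1 = (Var i :: 'v mpoly)"
proof -
  obtain l \<nu> where "\<nu> \<in> monomials 0" "\<mu> = Poly_Mapping.single l 1 + \<nu>"
    using assms by (rule monomial_decomp)
  then show ?thesis using that[of l] by (simp add: mem_monomials mdeg_eq_0_iff Var_def)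
qed

lemma exists_plane_coordinates:
  fixes I :: "'v::finite mpoly set"
  assumes I: "mpoly_vs.subspace I" and h: "hilbert_function I 1 = 3"
  obtains i j k where "plane_coordinates I i j k"
proof -
  obtain B where B: "B \<subseteq> monomials (Suc 0)" "I \<in> chart (Suc 0) B" by (rule exists_chart[OF I])
  have "card B = 3" using hilbert_function_chart[OF B I] h by simp
  then obtain x y z where xyz: "B = {x, y, z}" "x \<noteq> y" "x \<noteq> z" "y \<noteq> z" by (auto simp: card_3_iff)
  obtain i where i: "Poly_Mapping.single x 1 = (Var i :: 'v mpoly)" using monomials_1 B(1) xyz(1) by blast
  obtain j where j: "Poly_Mapping.single y 1 = (Var j :: 'v mpoly)" using monomials_1 B(1) xyz(1) by blast
  obtain k where k: "Poly_Mapping.single z 1 = (Var k :: 'v mpoly)" using monomials_1 B(1) xyz(1) by blast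
  have sum: "(\<Sum>b\<in>B. Poly_Mapping.single b (c b)) = lin3 i j k (c x) (c y) (c z)" for c
    unfolding xyz(1) lin3_def i[symmetric] j[symmetric] k[symmetric] using xyz by (simp add: add.assoc)
  have inj: "Poly_Mapping.single b (1::complex) = Poly_Mapping.single b' 1 \<longleftrightarrow> b = b'" for b b' :: "'v \<Rightarrow>\<^sub>0 nat"
    by (metis lookup_single_eq lookup_single_not_eq zero_neq_one)
  have "i \<noteq> j" "k \<noteq> i" "k \<noteq> j" using xyz i j k inj by metis+
  moreover have "\<exists>\<alpha> \<beta> \<gamma>. Var l - poly_scale \<alpha> (Var i) - poly_scale \<beta> (Var j) - poly_scale \<gamma> (Var k) \<in> I" for l
  proof -
    have "Poly_Mapping.single l 1 \<in> monomials (Suc 0)" by (simp add: mem_monomials)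
    from chart_expands[OF B(2) this]
    show ?thesis unfolding expands_def sum lin3_def by (auto simp: Var_def[of l] diff_diff_eq add.assoc)
  qed
  moreover have "p = 0 \<and> q = 0 \<and> r = 0" if pqr: "lin3 i j k p q r \<in> I" for p q r
  proof -
    define c where "c b = (if b = x then p else if b = y then q else r)" for b
    have "(\<Sum>b\<in>B. Poly_Mapping.single b (c b)) \<in> I"
      unfolding sum using pqr xyz by (simp add: c_def)
    note z = chart_independent[OF B(2) I this]
    have "c x = 0" "c y = 0" "c z = 0" using z xyz(1) by blast+
    then show ?thesis using xyz by (simp add: c_def)
  qed
  ultimately show ?thesis using that unfolding plane_coordinates_def by blast
qed

text \<open>Any four variables are dependent modulo \<open>I\<close>, and independence of the given
  three lets the fourth be solved for.\<close>

lemma plane_coordinates_of_independent: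
  fixes I :: "'v::finite mpoly set"
  assumes I: "mpoly_vs.subspace I" and h: "hilbert_function I 1 = 3"
    and ind: "\<And>p q r. lin3 i j k p q r \<in> I \<Longrightarrow> p = 0 \<and> q = 0 \<and> r = 0" and dist: "i \<noteq> j" "k \<noteq> i" "k \<noteq> j"
  shows "plane_coordinates I i j k"
proof -
  have "\<exists>\<alpha> \<beta> \<gamma>. Var l - poly_scale \<alpha> (Var i) - poly_scale \<beta> (Var j) - poly_scale \<gamma> (Var k) \<in> I" for l
  proof -
    define p where "p = (\<lambda>n::nat. if n = 0 then Var i else if n = 1 then Var j else if n = 2 then Var k else Var l)"
    have "p n \<in> forms 1" for n by (simp add: p_def)
    then have "\<not> indep_mod I 4 p"
      using hilbert_function_ge[OF I, of 4 p 1] h by auto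
    then obtain c where c: "(\<Sum>n<4. poly_scale (c n) (p n)) \<in> I" "\<exists>n<4. c n \<noteq> 0" unfolding indep_mod_def by blast
    have "(\<Sum>n<4. poly_scale (c n) (p n)) = lin3 i j k (c 0) (c 1) (c 2) + poly_scale (c 3) (Var l)"
      by (simp add: numeral_eq_Suc p_def lin3_def)
    with c(1) have rel: "lin3 i j k (c 0) (c 1) (c 2) + poly_scale (c 3) (Var l) \<in> I" by simp
    have c3: "c 3 \<noteq> 0"
    proof
      assume "c 3 = 0"
      then have "c 0 = 0 \<and> c 1 = 0 \<and> c 2 = 0" using rel ind by simp
      then have "\<forall>n<4. c n = 0" using \<open>c 3 = 0\<close> by (auto simp: numeral_eq_Suc less_Suc_eq)
      then show False using c(2) by blast
    qed
    have "poly_scale (1 / c 3) (lin3 i j k (c 0) (c 1) (c 2) + poly_scale (c 3) (Var l))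
      = Var l - poly_scale (- c 0 / c 3) (Var i) - poly_scale (- c 1 / c 3) (Var j) - poly_scale (- c 2 / c 3) (Var k)"
      using c3 by (simp add: lin3_def mpoly_vs.scale_right_distrib add.commute add.left_commute)
    then show ?thesis using mpoly_vs.subspace_scale[OF I rel, of "1 / c 3"] by metis
  qed
  then show ?thesis using ind dist unfolding plane_coordinates_def by blast
qed

text \<open>The linear relations replace \<open>h\<close> by a form \<open>u\<close> in the plane
  coordinates, and \<open>h * h - (h + u) * (h - u)\<close> equals \<open>u * u\<close>.\<close>

lemma square_zero_lin3:
  fixes I :: "'v::finite mpoly set"
  assumes I: "mpoly_ideal.subspace I" and pc: "plane_coordinates I i j k"
    and h: "h \<in> forms 1" "h \<notin> I" "h * h \<in> I"
  obtains p q r where "lin3 i j k p q r * lin3 i j k p q r \<in> I" "p \<noteq> 0 \<or> q \<noteq> 0 \<or> r \<noteq> 0"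
proof -
  note Iv = ideal_imp_subspace[OF I]
  obtain \<alpha> \<beta> \<gamma> where lin: "\<And>l. Var l - poly_scale (\<alpha> l) (Var i) - poly_scale (\<beta> l) (Var j) - poly_scale (\<gamma> l) (Var k) \<in> I"
    using pc unfolding plane_coordinates_def by metis
  define e where "e l = Poly_Mapping.lookup h (Poly_Mapping.single l 1)" for l
  let ?u = "lin3 i j k (\<Sum>l\<in>UNIV. e l * \<alpha> l) (\<Sum>l\<in>UNIV. e l * \<beta> l) (\<Sum>l\<in>UNIV. e l * \<gamma> l)"
  have "(\<Sum>l\<in>UNIV. poly_scale (e l) (Var l - poly_scale (\<alpha> l) (Var i) - poly_scale (\<beta> l) (Var j) - poly_scale (\<gamma> l) (Var k))) \<in> I"
    by (intro mpoly_vs.subspace_sum[OF Iv] mpoly_vs.subspace_scale[OF Iv] lin)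
  also have "(\<Sum>l\<in>UNIV. poly_scale (e l) (Var l - poly_scale (\<alpha> l) (Var i) - poly_scale (\<beta> l) (Var j) - poly_scale (\<gamma> l) (Var k)))
    = (\<Sum>l\<in>UNIV. poly_scale (e l) (Var l)) - ?u"
    by (simp add: lin3_def mpoly_vs.scale_sum_left algebra_simps sum_subtractf sum.distrib)
  also have "(\<Sum>l\<in>UNIV. poly_scale (e l) (Var l)) = h" unfolding e_def using forms_1_expand[OF h(1)] by simp
  finally have hu: "h - ?u \<in> I" .
  have "h * h - (h + ?u) * (h - ?u) \<in> I"
    by (rule mpoly_ideal.subspace_diff[OF I h(3) mpoly_ideal.subspace_scale[OF I hu]])
  moreover have "h * h - (h + ?u) * (h - ?u) = ?u * ?u" by (simp add: algebra_simps)
  ultimately have "?u * ?u \<in> I" by simp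
  moreover have "?u \<noteq> 0" using hu h(2) by auto
  then have "(\<Sum>l\<in>UNIV. e l * \<alpha> l) \<noteq> 0 \<or> (\<Sum>l\<in>UNIV. e l * \<beta> l) \<noteq> 0 \<or> (\<Sum>l\<in>UNIV. e l * \<gamma> l) \<noteq> 0"
    by (auto simp: lin3_def)
  ultimately show ?thesis using that by blast
qed

lemma square_zero_normalize:
  assumes I: "mpoly_ideal.subspace I" and u: "lin3 i j k p q r * lin3 i j k p q r \<in> I" and "r \<noteq> 0"
  shows "(Var k - poly_scale (- p / r) (Var i) - poly_scale (- q / r) (Var j)) ^ 2 \<in> I"
proof -
  have eq: "poly_scale (1 / r) (lin3 i j k p q r) = Var k - poly_scale (- p / r) (Var i) - poly_scale (- q / r) (Var j)"
    using \<open>r \<noteq> 0\<close> by (simp add: lin3_def mpoly_vs.scale_right_distrib add.commute)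
  have "poly_scale (1 / r) (poly_scale (1 / r) (lin3 i j k p q r * lin3 i j k p q r)) \<in> I"
    by (intro mpoly_vs.subspace_scale[OF ideal_imp_subspace[OF I]] u)
  then show ?thesis unfolding eq[symmetric] power2_eq_square mult_poly_scale poly_scale_mult .
qed

text \<open>A nonzero coefficient of the linear form is rotated into the last position; division by
  it gives the normalized square that the classification requires.\<close>

lemma Hilb_square_zero_normal_form:
  fixes I :: "'v::finite mpoly set"
  assumes I: "I \<in> Hilb J 2" and h: "h \<in> forms 1" "h \<notin> I" "h * h \<in> I"
  obtains i j k a b c where "pivot i j k a b c" "I = double_line_ideal a b c"
proof -
  note Ii = Hilb_ideal[OF I]
  have H: "hilbert_function I m = 2 * m + 1" for m using Hilb_hilbert_function[OF I] by simp
  have hom: "homogeneous_ideal I" using I by (simp add: Hilb_def)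
  have final: "\<exists>i j k a b c. pivot i j k a b c \<and> I = double_line_ideal a b c"
    if pc: "plane_coordinates I i j k" and u: "lin3 i j k p q r * lin3 i j k p q r \<in> I" and "r \<noteq> 0" for i j k p q r
  proof -
    obtain \<alpha> \<beta> \<gamma> where lin: "\<And>l. Var l - poly_scale (\<alpha> l) (Var i) - poly_scale (\<beta> l) (Var j) - poly_scale (\<gamma> l) (Var k) \<in> I"
      and dist: "i \<noteq> j" "k \<noteq> i" "k \<noteq> j"
      using pc unfolding plane_coordinates_def by metis
    show ?thesis
      by (rule double_line_classification[OF hom H dist lin square_zero_normalize[OF Ii u \<open>r \<noteq> 0\<close>]]) blast
  qed
  obtain i j k where pc: "plane_coordinates I i j k"
    using exists_plane_coordinates[OF Hilb_subspace[OF I]] H[of 1] by auto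
  obtain p q r where u: "lin3 i j k p q r * lin3 i j k p q r \<in> I" and nz: "p \<noteq> 0 \<or> q \<noteq> 0 \<or> r \<noteq> 0"
    using square_zero_lin3[OF Ii pc h] by blast
  have "\<exists>i j k a b c. pivot i j k a b c \<and> I = double_line_ideal a b c"
    using nz
  proof (elim disjE)
    assume "r \<noteq> 0" then show ?thesis by (rule final[OF pc u])
  next
    assume "p \<noteq> 0"
    show ?thesis
      by (rule final[OF plane_coordinates_rotate[OF pc] _ \<open>p \<noteq> 0\<close>, of q r]) (subst (1 2) lin3_perm(1), rule u)
  next
    assume "q \<noteq> 0"
    have "lin3 k i j r p q = lin3 i j k p q r" by (simp add: lin3_def algebra_simps)
    then show ?thesis
      by (intro final[OF plane_coordinates_rotate[OF plane_coordinates_rotate[OF pc]] _ \<open>q \<noteq> 0\<close>, of r p]) (simp only: u)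
  qed
  then show ?thesis using that by blast
qed

lemma double_lines_iff_square_zero:
  fixes J :: "'v::finite mpoly set"
  shows "C \<in> double_lines J \<longleftrightarrow> C \<in> Hilb J 2 \<and> (\<exists>h\<in>forms 1. h \<notin> C \<and> h * h \<in> C)"
proof
  assume "C \<in> double_lines J"
  then obtain L \<alpha> \<beta> where C: "C \<in> Hilb J 2" and L: "L \<in> Hilb J 1" and ext: "line_extension L C \<alpha> \<beta>"
    unfolding double_lines_def by blast
  have "hilbert_function L 1 < hilbert_function C 1"
    using Hilb_hilbert_function[OF C] Hilb_hilbert_function[OF L] by simp
  moreover have "saturated C" using C by (simp add: Hilb_def)
  ultimately obtain h where "h \<in> forms 1" "h \<notin> C" "h * h \<in> C"
    using extension_square_zero[OF Hilb_ideal[OF L] Hilb_ideal[OF C] _ _ ext] by blast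
  then show "C \<in> Hilb J 2 \<and> (\<exists>h\<in>forms 1. h \<notin> C \<and> h * h \<in> C)" using C by blast
next
  assume "C \<in> Hilb J 2 \<and> (\<exists>h\<in>forms 1. h \<notin> C \<and> h * h \<in> C)"
  then obtain h where C: "C \<in> Hilb J 2" and h: "h \<in> forms 1" "h \<notin> C" "h * h \<in> C" by blast
  obtain i j k a b c where piv: "pivot i j k a b c" and eq: "C = double_line_ideal a b c"
    by (rule Hilb_square_zero_normal_form[OF C h])
  have "J \<subseteq> C" using C by (simp add: Hilb_def)
  then have L: "line_ideal a b \<in> Hilb J 1"
    using line_in_Hilb[OF piv] double_line_subset_line eq by blast
  have gap: "hilbert_function (line_ideal a b) 1 < hilbert_function C 1"
    using Hilb_hilbert_function[OF C] Hilb_hilbert_function[OF L] by simp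
  have sat: "saturated C" using C by (simp add: Hilb_def)
  note ext = double_line_is_extension[OF piv, folded eq]
  show "C \<in> double_lines J"
    unfolding double_lines_def
    using C L ext extension_not_split[OF Hilb_ideal[OF L] Hilb_ideal[OF C] sat gap ext] by blast
qed

lemma double_lines_eq:
  fixes J :: "'v::finite mpoly set"
  shows "C \<in> double_lines J \<longleftrightarrow> (\<exists>i j k a b c. pivot i j k a b c \<and> J \<subseteq> C \<and> C = double_line_ideal a b c)"
proof
  assume "C \<in> double_lines J"
  then obtain h where C: "C \<in> Hilb J 2" and h: "h \<in> forms 1" "h \<notin> C" "h * h \<in> C"
    unfolding double_lines_iff_square_zero by blast
  obtain i j k a b c where piv: "pivot i j k a b c" and eq: "C = double_line_ideal a b c"
    by (rule Hilb_square_zero_normal_form[OF C h])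
  have "J \<subseteq> C" using C by (simp add: Hilb_def)
  then show "\<exists>i j k a b c. pivot i j k a b c \<and> J \<subseteq> C \<and> C = double_line_ideal a b c"
    using piv eq by blast
next
  assume "\<exists>i j k a b c. pivot i j k a b c \<and> J \<subseteq> C \<and> C = double_line_ideal a b c"
  then obtain i j k a b c where piv: "pivot i j k a b c" and J: "J \<subseteq> C" and C: "C = double_line_ideal a b c" by blast
  let ?h = "Var k - poly_scale (a k) (Var i) - poly_scale (b k) (Var j)"
  have "?h \<in> forms 1" by (intro forms_diff forms_scale forms_Var)
  moreover have "?h \<notin> C" unfolding C double_line_ideal_def by (simp add: pivot_normal(2)[OF piv])
  moreover have "?h * ?h \<in> C" using pivot_square[OF piv] by (simp add: C power2_eq_square)
  ultimately show "C \<in> double_lines J"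
    unfolding double_lines_iff_square_zero using double_line_in_Hilb[OF piv] J C by blast
qed

lemma chart_independent_subset:
  assumes I: "I \<in> chart m B" "mpoly_vs.subspace I" and "finite B" "A \<subseteq> B"
    and d: "(\<Sum>\<beta>\<in>A. Poly_Mapping.single \<beta> (d \<beta>)) \<in> I" and \<beta>: "\<beta> \<in> A"
  shows "d \<beta> = 0"
proof -
  have "(\<Sum>\<beta>\<in>B. Poly_Mapping.single \<beta> (if \<beta> \<in> A then d \<beta> else 0)) = (\<Sum>\<beta>\<in>A. Poly_Mapping.single \<beta> (d \<beta>))"
    using assms(3,4) by (intro sum.mono_neutral_cong_right) auto
  then have "(\<Sum>\<beta>\<in>B. Poly_Mapping.single \<beta> (if \<beta> \<in> A then d \<beta> else 0)) \<in> I" using d by simp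
  from chart_independent[OF I this, of \<beta>] \<beta> assms(4) show ?thesis by auto
qed

text \<open>The square of a form in \<open>x_i\<close> and \<open>x_j\<close>, times
  \<open>x_i ^ n\<close>, is a combination of three basis monomials. So in this chart a nonzero
  linear form with vanishing square must involve \<open>x_k\<close>.\<close>

lemma double_line_chart_independent:
  fixes I :: "'v::finite mpoly set"
  assumes I: "I \<in> chart m (double_line_basis i j k m)" "mpoly_ideal.subspace I"
    and dist: "i \<noteq> j" "k \<noteq> i" "k \<noteq> j" and m: "m = Suc (Suc n)"
  shows "lin3 i j k p q r \<in> I \<Longrightarrow> p = 0 \<and> q = 0 \<and> r = 0"
    and "lin3 i j k p q 0 * lin3 i j k p q 0 \<in> I \<Longrightarrow> p = 0 \<and> q = 0"
proof -
  let ?B = "double_line_basis i j k m"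
  note sub = ideal_imp_subspace[OF I(2)]
  have finB: "finite ?B" by (rule finite_monomial_subset[OF double_line_basis_monomials])
  note ind = chart_independent_subset[OF I(1) sub finB]
  let ?ki = "Poly_Mapping.single k 1 + mon2 i j (Suc n) 0"
    and ?ii = "mon2 i j m 0" and ?ij = "mon2 i j (Suc n) 1" and ?jj = "mon2 i j n 2"
  have mem: "?ki \<in> ?B" "?ii \<in> ?B" "?ij \<in> ?B" "?jj \<in> ?B"
    using m double_line_basis_mem2[of "Suc n" 0 m k i j] by (auto intro!: double_line_basis_mem1)
  have lk: "Poly_Mapping.lookup ?ki k = 1" "Poly_Mapping.lookup ?ii k = 0" "Poly_Mapping.lookup ?ij k = 0"
    and lj: "Poly_Mapping.lookup ?ii j = 0" "Poly_Mapping.lookup ?ij j = 1" "Poly_Mapping.lookup ?jj j = 2"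
    using mon2_lookup[OF dist(1)] dist by (simp_all add: lookup_add lookup_single when_def)
  have ne: "?ii \<noteq> ?ij" "?ii \<noteq> ?ki" "?ij \<noteq> ?ki" "?ii \<noteq> ?jj" "?ij \<noteq> ?jj"
    using lk lj by (metis zero_neq_one one_neq_zero numeral_One num.distinct(1) numeral_eq_iff zero_neq_numeral)+
  have s: "Poly_Mapping.single ?ki x = poly_scale x (Var k * Var i ^ Suc n)"
    "Poly_Mapping.single ?ii x = poly_scale x (Var i * Var i ^ Suc n)"
    "Poly_Mapping.single ?ij x = poly_scale x (Var j * Var i ^ Suc n)"
    "Poly_Mapping.single ?jj x = poly_scale x (Var i ^ n * (Var j * Var j))" for x
    by (subst single_eq_scale, simp only: single_mon2 single_mon2_mult,
        simp add: m power2_eq_square mult_ac)+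
  {
    assume u: "lin3 i j k p q r \<in> I"
    define d where "d x = (if x = ?ii then p else if x = ?ij then q else r)" for x
    have d: "d ?ii = p" "d ?ij = q" "d ?ki = r" using ne by (simp_all add: d_def)
    have "(\<Sum>x\<in>{?ii, ?ij, ?ki}. Poly_Mapping.single x (d x))
      = Poly_Mapping.single ?ii (d ?ii) + (Poly_Mapping.single ?ij (d ?ij) + Poly_Mapping.single ?ki (d ?ki))"
      using ne by (intro sum_triple) auto
    also have "\<dots> = Var i ^ Suc n * lin3 i j k p q r"
      unfolding d s lin3_def distrib_left mult_poly_scale
      by (simp only: add.assoc mult.commute[of "Var i ^ Suc n"])
    also have "\<dots> \<in> I" by (rule mpoly_ideal.subspace_scale[OF I(2) u])
    finally have in_I: "(\<Sum>x\<in>{?ii, ?ij, ?ki}. Poly_Mapping.single x (d x)) \<in> I" .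
    have A: "{?ii, ?ij, ?ki} \<subseteq> ?B" using mem by blast
    note c = ind[OF A in_I]
    show "p = 0 \<and> q = 0 \<and> r = 0" using c[of ?ii] c[of ?ij] c[of ?ki] unfolding d by blast
  }
  {
    assume u: "lin3 i j k p q 0 * lin3 i j k p q 0 \<in> I"
    define d where "d x = (if x = ?ii then p * p else if x = ?ij then 2 * p * q else q * q)" for x
    have d: "d ?ii = p * p" "d ?ij = 2 * p * q" "d ?jj = q * q" using ne by (simp_all add: d_def)
    have two: "Poly_Mapping.single 0 2 = (2 :: 'v mpoly)" by (simp add: single_numeral)
    have cm: "Poly_Mapping.single (0 :: 'v \<Rightarrow>\<^sub>0 nat) (x * y :: complex) = Poly_Mapping.single 0 x * Poly_Mapping.single 0 y" for x y
      by (simp add: mult_single)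
    have exp: "P * P * (x * (x * A)) + (2 * P * Q * (y * (x * A)) + Q * Q * (A * (y * y))) = A * ((P * x + Q * y) * (P * x + Q * y))"
      for P Q x y A :: "'v mpoly" by (simp add: algebra_simps)
    have "(\<Sum>x\<in>{?ii, ?ij, ?jj}. Poly_Mapping.single x (d x))
      = Poly_Mapping.single ?ii (d ?ii) + (Poly_Mapping.single ?ij (d ?ij) + Poly_Mapping.single ?jj (d ?jj))"
      using ne by (intro sum_triple) auto
    also have "\<dots> = Var i ^ n * (lin3 i j k p q 0 * lin3 i j k p q 0)"
      unfolding d s lin3_def poly_scale_def cm two power_Suc single_zero mult_zero_left add_0_right by (rule exp)
    also have "\<dots> \<in> I" by (rule mpoly_ideal.subspace_scale[OF I(2) u])
    finally have in_I: "(\<Sum>x\<in>{?ii, ?ij, ?jj}. Poly_Mapping.single x (d x)) \<in> I" .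
    have A: "{?ii, ?ij, ?jj} \<subseteq> ?B" using mem by blast
    note c = ind[OF A in_I]
    show "p = 0 \<and> q = 0" using c[of ?ii] c[of ?jj] unfolding d by auto
  }
qed

section \<open>The double lines form a closed set\<close>

lemma chart_of_quadric:
  fixes I :: "'v::finite mpoly set"
  assumes I: "mpoly_ideal.subspace I" and h: "hilbert_function I m = 2 * m + 1"
    and pc: "plane_coordinates I i j k" and q: "quadric i j k q1 q2 q3 q4 q5 \<in> I"
  shows "I \<in> chart m (double_line_basis i j k m)"
proof -
  obtain \<alpha> \<beta> \<gamma> where lin: "\<And>l. Var l - poly_scale (\<alpha> l) (Var i) - poly_scale (\<beta> l) (Var j) - poly_scale (\<gamma> l) (Var k) \<in> I"
    and dist: "i \<noteq> j" "k \<noteq> i" "k \<noteq> j"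
    using pc unfolding plane_coordinates_def by metis
  interpret conic_family "\<lambda>z :: unit \<Rightarrow> complex. I" i j k "\<lambda>l _. \<alpha> l" "\<lambda>l _. \<beta> l" "\<lambda>l _. \<gamma> l"
    "\<lambda>_. q1" "\<lambda>_. q2" "\<lambda>_. q3" "\<lambda>_. q4" "\<lambda>_. q5"
    using I lin q by unfold_locales auto
  show ?thesis
  proof (rule chart_of_spanning[OF ideal_imp_subspace[OF I] double_line_basis_monomials])
    show "card (bas m) \<le> hilbert_function I m" using h card_double_line_basis[OF dist] by simp
    show "\<exists>c. expands (bas m) I \<mu> c" if "\<mu> \<in> monomials m" for \<mu>
      using conic_expansion[OF that] by metis
  qed
qed

lemma lin3_square: "lin3 i j k (- p) (- q) 1 * lin3 i j k (- p) (- q) 1 = (Var k - poly_scale p (Var i) - poly_scale q (Var j)) ^ 2"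
  by (simp add: lin3_def power2_eq_square algebra_simps)

lemma lin3_form: "lin3 i j k p q r \<in> forms 1"
  unfolding lin3_def by (intro forms_add forms_scale forms_Var)

text \<open>When the conic is monic in \<open>x_k\<close>, being a double line amounts to three
  polynomial equations in its coefficients, found by completing the square. Away from the double
  lines one of them fails and serves as separating function.\<close>

lemma double_lines_separated_square:
  fixes J :: "'v::finite mpoly set"
  assumes I0: "I0 \<in> Hilb J 2" "I0 \<notin> double_lines J" and pc: "plane_coordinates I0 i j k"
    and q: "quadric i j k q1 q2 q3 q4 q5 \<in> I0" and m: "m = Suc (Suc n)"
  shows "\<exists>B f. B \<subseteq> monomials m \<and> I0 \<in> chart m B \<and> eval_poly f (chart_coord m B I0) \<noteq> 0 \<and>
    (\<forall>I\<in>Hilb J 2 \<inter> chart m B. eval_poly f (chart_coord m B I) \<noteq> 0 \<longrightarrow> I \<in> Hilb J 2 - double_lines J)"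
proof -
  let ?B = "double_line_basis i j k m"
  have dist: "i \<noteq> j" "k \<noteq> i" "k \<noteq> j" using pc by (auto simp: plane_coordinates_def)
  have H: "hilbert_function I l = 2 * l + 1" if "I \<in> Hilb J 2" for I :: "'v mpoly set" and l
    using Hilb_hilbert_function[OF that] by simp
  have ch: "I0 \<in> chart m ?B" by (rule chart_of_quadric[OF Hilb_ideal[OF I0(1)] H[OF I0(1)] pc q])
  let ?\<mu> = "Poly_Mapping.single k 2 + mon2 i j n 0"
  define Q1 where "Q1 = Var (?\<mu>, mon2 i j m 0)"
  define Q2 where "Q2 = Var (?\<mu>, mon2 i j (Suc n) 1)"
  define Q3 where "Q3 = Var (?\<mu>, mon2 i j n 2)"
  define Q4 where "Q4 = Var (?\<mu>, Poly_Mapping.single k 1 + mon2 i j (Suc n) 0)"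
  define Q5 where "Q5 = Var (?\<mu>, Poly_Mapping.single k 1 + mon2 i j n 1)"
  \<comment> \<open>The cross terms force \<open>p = q4 / 2\<close> and \<open>q = q5 / 2\<close>;
    the three expressions compare \<open>q1\<close>, \<open>q2\<close>, \<open>q3\<close> with the
    other coefficients of the square of \<open>x_k - p x_i - q x_j\<close>.\<close>
  define F where "F = {poly_scale 4 Q1 + Q4 * Q4, poly_scale 2 Q2 + Q4 * Q5, poly_scale 4 Q3 + Q5 * Q5}"
  have coord: "eval_poly Q1 (chart_coord m ?B I) = x1 \<and> eval_poly Q2 (chart_coord m ?B I) = x2 \<and>
      eval_poly Q3 (chart_coord m ?B I) = x3 \<and> eval_poly Q4 (chart_coord m ?B I) = x4 \<and> eval_poly Q5 (chart_coord m ?B I) = x5"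
    if "I \<in> Hilb J 2" "I \<in> chart m ?B" "quadric i j k x1 x2 x3 x4 x5 \<in> I" for I x1 x2 x3 x4 x5
    using conic_coordinates(2)[OF that(2) Hilb_ideal[OF that(1)] dist m that(3)]
    by (simp add: Q1_def Q2_def Q3_def Q4_def Q5_def)
  have vanish: "eval_poly f (chart_coord m ?B I) = 0"
    if I: "I \<in> double_lines J" "I \<in> chart m ?B" and f: "f \<in> F" for I f
  proof -
    obtain h where IH: "I \<in> Hilb J 2" and h: "h \<in> forms 1" "h \<notin> I" "h * h \<in> I"
      using I(1) unfolding double_lines_iff_square_zero by blast
    note Ii = Hilb_ideal[OF IH]
    note ind = double_line_chart_independent[OF I(2) Ii dist m]
    have pcI: "plane_coordinates I i j k"
      by (rule plane_coordinates_of_independent[OF Hilb_subspace[OF IH] _ ind(1) dist]) (simp_all add: H[OF IH])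
    obtain p q r where u: "lin3 i j k p q r * lin3 i j k p q r \<in> I" and nz: "p \<noteq> 0 \<or> q \<noteq> 0 \<or> r \<noteq> 0"
      using square_zero_lin3[OF Ii pcI h] by blast
    have "r \<noteq> 0" using ind(2)[of p q] u nz by metis
    from square_zero_normalize[OF Ii u this]
    have "quadric i j k (- ((- p / r) * (- p / r))) (- (2 * (- p / r) * (- q / r))) (- ((- q / r) * (- q / r))) (2 * (- p / r)) (2 * (- q / r)) \<in> I"
      unfolding quadric_square .
    from coord[OF IH I(2) this] f show ?thesis
      by (auto simp: F_def eval_poly_add eval_poly_mult)
  qed
  have "\<exists>f\<in>F. eval_poly f (chart_coord m ?B I0) \<noteq> 0"
  proof (rule ccontr)
    assume "\<not> ?thesis"
    then have rel: "4 * q1 + q4 * q4 = 0" "2 * q2 + q4 * q5 = 0" "4 * q3 + q5 * q5 = 0"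
      using coord[OF I0(1) ch q] by (auto simp: F_def eval_poly_add eval_poly_mult)
    let ?p = "q4 / 2" and ?q = "q5 / 2"
    have "4 * q1 = - (q4 * q4)" "2 * q2 = - (q4 * q5)" "4 * q3 = - (q5 * q5)"
      using rel by (simp_all add: eq_neg_iff_add_eq_0)
    then have eqs: "q1 = - (?p * ?p)" "q2 = - (2 * ?p * ?q)" "q3 = - (?q * ?q)" "q4 = 2 * ?p" "q5 = 2 * ?q"
      by (simp_all add: field_simps)
    have "quadric i j k (- (?p * ?p)) (- (2 * ?p * ?q)) (- (?q * ?q)) (2 * ?p) (2 * ?q) \<in> I0"
      using q eqs by metis
    then have "lin3 i j k (- ?p) (- ?q) 1 * lin3 i j k (- ?p) (- ?q) 1 \<in> I0"
      unfolding quadric_square lin3_square .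
    moreover have "lin3 i j k (- ?p) (- ?q) 1 \<notin> I0"
      using pc unfolding plane_coordinates_def by (metis zero_neq_one)
    ultimately show False
      using I0 lin3_form[of i j k "- ?p" "- ?q" 1] unfolding double_lines_iff_square_zero
      by (metis (no_types))
  qed
  then obtain f where f: "f \<in> F" "eval_poly f (chart_coord m ?B I0) \<noteq> 0" by blast
  show ?thesis
    by (intro exI[of _ ?B] exI[of _ f] conjI double_line_basis_monomials ch f(2))
      (use vanish f(1) in blast)
qed

section \<open>Conics whose equation has no square terms\<close>

text \<open>Standard monomials of a conic from which \<open>x_i * x_j\<close> can be eliminated; the
  two sets share the pure power of \<open>x_k\<close>.\<close>

definition crossed_basis :: "'v \<Rightarrow> 'v \<Rightarrow> 'v \<Rightarrow> nat \<Rightarrow> ('v \<Rightarrow>\<^sub>0 nat) set" where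
  "crossed_basis i j k m = line_basis i k m \<union> line_basis j k m"

lemma crossed_basis_monomials: "crossed_basis i j k m \<subseteq> monomials m"
  unfolding crossed_basis_def by (intro Un_least line_basis_monomials)

lemma card_crossed_basis:
  fixes i j k :: "'v::finite"
  assumes "i \<noteq> j" "k \<noteq> i" "k \<noteq> j"
  shows "card (crossed_basis i j k m) \<le> 2 * m + 1"
proof -
  have fin: "finite (line_basis i k m)" "finite (line_basis j k m)" by (simp_all add: line_basis_def)
  have "mon2 i k 0 m = mon2 j k 0 m" by (simp add: mon2_def)
  moreover have "mon2 i k 0 m \<in> line_basis i k m" "mon2 j k 0 m \<in> line_basis j k m"
    by (simp_all add: line_basis_mem)
  ultimately have "mon2 i k 0 m \<in> line_basis i k m \<inter> line_basis j k m" by simp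
  then have "card (line_basis i k m \<inter> line_basis j k m) \<ge> 1"
    using fin by (metis card_0_eq empty_iff finite_Int less_one not_le)
  then show ?thesis
    using card_Un_Int[OF fin] card_line_basis[of i k m] card_line_basis[of j k m] assms
    by (simp add: crossed_basis_def)
qed

text \<open>The relation trades \<open>x_i * x_j\<close> for products with \<open>x_k\<close>, and
  in a mixed monomial this lowers the exponent \<open>r\<close> of the repeated variable.\<close>

lemma chart_of_crossed:
  fixes I :: "'v::finite mpoly set"
  assumes I: "mpoly_ideal.subspace I" and h: "hilbert_function I m = 2 * m + 1"
    and pc: "plane_coordinates I i j k"
    and q: "Var i * Var j - poly_scale e1 (Var i * Var k) - poly_scale e2 (Var j * Var k) \<in> I"
  shows "I \<in> chart m (crossed_basis i j k m)"
proof -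
  obtain \<alpha> \<beta> \<gamma> where lin: "\<And>l. Var l - poly_scale (\<alpha> l) (Var i) - poly_scale (\<beta> l) (Var j) - poly_scale (\<gamma> l) (Var k) \<in> I"
    and dist: "i \<noteq> j" "k \<noteq> i" "k \<noteq> j"
    using pc unfolding plane_coordinates_def by metis
  interpret ideal_family "\<lambda>z :: unit \<Rightarrow> complex. I" "crossed_basis i j k"
    by unfold_locales (rule I, rule crossed_basis_monomials)
  have Ri: "reducible m (\<lambda>z. Var i ^ r * Var k ^ s)" if "r + s = m" for r s m
    using reducible_basis[of "mon2 i k r s" m] line_basis_mem[OF that, of i k]
    by (simp add: crossed_basis_def single_mon2)
  have Rj: "reducible m (\<lambda>z. Var j ^ r * Var k ^ s)" if "r + s = m" for r s m
    using reducible_basis[of "mon2 j k r s" m] line_basis_mem[OF that, of j k]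
    by (simp add: crossed_basis_def single_mon2)
  have swap: "reducible m (\<lambda>z. Var i * (Var j * N))"
    if "reducible m (\<lambda>z. Var i * (Var k * N))" "reducible m (\<lambda>z. Var j * (Var k * N))" for N m
  proof (rule reducible_cong)
    show "reducible m (\<lambda>z. poly_scale e1 (Var i * (Var k * N)) + poly_scale e2 (Var j * (Var k * N)))"
      by (intro reducible_add reducible_scale that polyfun_const)
    have "N * (Var i * Var j - poly_scale e1 (Var i * Var k) - poly_scale e2 (Var j * Var k)) \<in> I"
      by (rule mpoly_ideal.subspace_scale[OF I q])
    then show "Var i * (Var j * N) - (poly_scale e1 (Var i * (Var k * N)) + poly_scale e2 (Var j * (Var k * N))) \<in> I"
      by (simp add: poly_scale_def algebra_simps)
  qed
  have Rij: "reducible (Suc (Suc (r + s))) (\<lambda>z. Var i * (Var j * (Var j ^ r * Var k ^ s)))" for r s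
  proof (induction r arbitrary: s)
    case 0
    show ?case
      using Ri[of 1 "Suc s"] Rj[of 1 "Suc s"] by (intro swap) simp_all
  next
    case (Suc r)
    have "Var k * (Var j ^ Suc r * Var k ^ s) = Var j * (Var j ^ r * Var k ^ Suc s)" by (simp add: mult_ac)
    then show ?case
      using Suc.IH[of "Suc s"] Rj[of "Suc (Suc r)" "Suc s"] by (intro swap) (simp_all add: mult_ac)
  qed
  have Rji: "reducible (Suc (Suc (r + s))) (\<lambda>z. Var i * (Var j * (Var i ^ r * Var k ^ s)))" for r s
  proof (induction r arbitrary: s)
    case 0
    show ?case
      using Ri[of 1 "Suc s"] Rj[of 1 "Suc s"] by (intro swap) simp_all
  next
    case (Suc r)
    have "Var j * (Var k * (Var i ^ Suc r * Var k ^ s)) = Var i * (Var j * (Var i ^ r * Var k ^ Suc s))" by (simp add: mult_ac)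
    then show ?case
      using Suc.IH[of "Suc s"] Ri[of "Suc (Suc r)" "Suc s"] by (intro swap) (simp_all add: mult_ac)
  qed
  have step: "reducible (Suc m) (\<lambda>z. Var l * Poly_Mapping.single b 1)" if b: "b \<in> crossed_basis i j k m" for m l b
  proof (rule reducible_Var[OF lin polyfun_const polyfun_const polyfun_const])
    consider r s where "b = mon2 i k r s" "r + s = m" | r s where "b = mon2 j k r s" "r + s = m"
      using b by (force simp: crossed_basis_def line_basis_def)
    then have "reducible (Suc m) (\<lambda>z. Var i * Poly_Mapping.single b 1) \<and>
      reducible (Suc m) (\<lambda>z. Var j * Poly_Mapping.single b 1) \<and> reducible (Suc m) (\<lambda>z. Var k * Poly_Mapping.single b 1)"
    proof cases
      case 1
      have "reducible (Suc m) (\<lambda>z. Var j * (Var i ^ r * Var k ^ s))"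
      proof (cases r)
        case 0 then show ?thesis using Rj[of 1 s "Suc m"] 1(2) by simp
      next
        case (Suc r')
        then show ?thesis using Rji[of r' s] 1(2) by (simp add: mult_ac)
      qed
      then show ?thesis
        using Ri[of "Suc r" s "Suc m"] Ri[of r "Suc s" "Suc m"] 1 by (simp add: single_mon2 mult_ac)
    next
      case 2
      have "reducible (Suc m) (\<lambda>z. Var i * (Var j ^ r * Var k ^ s))"
      proof (cases r)
        case 0 then show ?thesis using Ri[of 1 s "Suc m"] 2(2) by simp
      next
        case (Suc r')
        then show ?thesis using Rij[of r' s] 2(2) by (simp add: mult_ac)
      qed
      then show ?thesis
        using Rj[of "Suc r" s "Suc m"] Rj[of r "Suc s" "Suc m"] 2 by (simp add: single_mon2 mult_ac)
    qed
    then show "reducible (Suc m) (\<lambda>z. Var i * Poly_Mapping.single b 1)"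
      "reducible (Suc m) (\<lambda>z. Var j * Poly_Mapping.single b 1)" "reducible (Suc m) (\<lambda>z. Var k * Poly_Mapping.single b 1)"
      by blast+
  qed
  have zero: "0 \<in> crossed_basis i j k 0"
    using line_basis_mem[of 0 0 0 i k] by (simp add: crossed_basis_def mon2_def)
  show ?thesis
  proof (rule chart_of_spanning[OF ideal_imp_subspace[OF I] crossed_basis_monomials])
    show "card (crossed_basis i j k m) \<le> hilbert_function I m" using h card_crossed_basis[OF dist] by simp
    show "\<exists>c. expands (crossed_basis i j k m) I \<mu> c" if "\<mu> \<in> monomials m" for \<mu>
      using polynomial_expansion[OF zero step that] by metis
  qed
qed

text \<open>If \<open>p\<close>, \<open>q\<close>, \<open>r\<close> are the coefficients of the
  linear form of a double line, then \<open>x_i * x_j\<close> expands with coefficients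
  \<open>- (p / (2 * q))\<close> and \<open>- (q / (2 * p))\<close> at the squares of
  \<open>x_i\<close> and \<open>x_j\<close>, whose product is 1/4. For \<open>I0\<close> both
  coefficients are 0.\<close>

lemma double_lines_separated_crossed:
  fixes J :: "'v::finite mpoly set"
  assumes I0: "I0 \<in> Hilb J 2" and pc: "plane_coordinates I0 i j k"
    and q: "Var i * Var j - poly_scale e1 (Var i * Var k) - poly_scale e2 (Var j * Var k) \<in> I0"
    and m: "m = Suc (Suc n)"
  shows "\<exists>B f. B \<subseteq> monomials m \<and> I0 \<in> chart m B \<and> eval_poly f (chart_coord m B I0) \<noteq> 0 \<and>
    (\<forall>I\<in>Hilb J 2 \<inter> chart m B. eval_poly f (chart_coord m B I) \<noteq> 0 \<longrightarrow> I \<in> Hilb J 2 - double_lines J)"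
proof -
  let ?B = "crossed_basis i j k m"
  have dist: "i \<noteq> j" "k \<noteq> i" "k \<noteq> j" using pc by (auto simp: plane_coordinates_def)
  have H: "hilbert_function I l = 2 * l + 1" if "I \<in> Hilb J 2" for I :: "'v mpoly set" and l
    using Hilb_hilbert_function[OF that] by simp
  have ch: "I0 \<in> chart m ?B" by (rule chart_of_crossed[OF Hilb_ideal[OF I0] H[OF I0] pc q])
  have finB: "finite ?B" by (rule finite_monomial_subset[OF crossed_basis_monomials])
  let ?ii = "mon2 i k 2 n" and ?jj = "mon2 j k 2 n" and ?kk = "mon2 i k 0 m"
    and ?ik = "mon2 i k 1 (Suc n)" and ?jk = "mon2 j k 1 (Suc n)"
  let ?\<mu> = "Poly_Mapping.single i 1 + mon2 j k 1 n"
  have mem: "{?ii, ?jj, ?kk, ?ik, ?jk} \<subseteq> ?B"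
    using m by (auto simp: crossed_basis_def intro!: line_basis_mem)
  have \<mu>: "?\<mu> \<in> monomials m" using m by (simp add: mem_monomials)
  have li: "Poly_Mapping.lookup ?ii i = 2" "Poly_Mapping.lookup ?jj i = 0" "Poly_Mapping.lookup ?kk i = 0"
    "Poly_Mapping.lookup ?ik i = 1" "Poly_Mapping.lookup ?jk i = 0"
    and lj: "Poly_Mapping.lookup ?jj j = 2" "Poly_Mapping.lookup ?kk j = 0" "Poly_Mapping.lookup ?jk j = 1"
    using dist by (auto simp: mon2_def lookup_add lookup_single when_def)
  have ne: "?ii \<noteq> ?jj" "?ii \<noteq> ?kk" "?ii \<noteq> ?ik" "?ii \<noteq> ?jk" "?jj \<noteq> ?kk" "?jj \<noteq> ?ik" "?jj \<noteq> ?jk"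
    "?kk \<noteq> ?ik" "?kk \<noteq> ?jk" "?ik \<noteq> ?jk"
    using li lj by (metis zero_neq_one one_neq_zero numeral_One num.distinct(1) numeral_eq_iff zero_neq_numeral)+
  have s: "Poly_Mapping.single ?ii x = poly_scale x (Var i * Var i * Var k ^ n)"
    "Poly_Mapping.single ?jj x = poly_scale x (Var j * Var j * Var k ^ n)"
    "Poly_Mapping.single ?kk x = poly_scale x (Var k * Var k * Var k ^ n)"
    "Poly_Mapping.single ?ik x = poly_scale x (Var i * Var k * Var k ^ n)"
    "Poly_Mapping.single ?jk x = poly_scale x (Var j * Var k * Var k ^ n)"
    "Poly_Mapping.single ?\<mu> x = poly_scale x (Var i * Var j * Var k ^ n)" for x
    by (subst single_eq_scale, simp only: single_mon2 single_mon2_mult,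
        simp add: m power2_eq_square mult_ac)+
  define d where "d x1 x2 x3 x4 x5 x = (if x = ?ii then x1 else if x = ?jj then x2
    else if x = ?kk then x3 else if x = ?ik then x4 else x5)" for x1 x2 x3 x4 x5 :: complex and x
  have d: "d x1 x2 x3 x4 x5 ?ii = x1" "d x1 x2 x3 x4 x5 ?jj = x2" "d x1 x2 x3 x4 x5 ?kk = x3"
    "d x1 x2 x3 x4 x5 ?ik = x4" "d x1 x2 x3 x4 x5 ?jk = x5" for x1 x2 x3 x4 x5
    unfolding d_def using ne ne[symmetric] by (simp_all only: if_True if_False refl)
  have sum: "(\<Sum>x\<in>{?ii, ?jj, ?kk, ?ik, ?jk}. Poly_Mapping.single x (d x1 x2 x3 x4 x5 x))
    = Var k ^ n * (poly_scale x1 (Var i * Var i) + poly_scale x2 (Var j * Var j) + poly_scale x3 (Var k * Var k)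
      + poly_scale x4 (Var i * Var k) + poly_scale x5 (Var j * Var k))" for x1 x2 x3 x4 x5
  proof -
    have "(\<Sum>x\<in>{?ii, ?jj, ?kk, ?ik, ?jk}. Poly_Mapping.single x (d x1 x2 x3 x4 x5 x))
      = Poly_Mapping.single ?ii x1 + Poly_Mapping.single ?jj x2 + Poly_Mapping.single ?kk x3
        + Poly_Mapping.single ?ik x4 + Poly_Mapping.single ?jk x5"
      using sum_quintuple[of ?ii ?jj ?kk ?ik ?jk "\<lambda>x. Poly_Mapping.single x (d x1 x2 x3 x4 x5 x)"] ne
      unfolding d by auto
    then show ?thesis
      unfolding s distrib_left mult_poly_scale by (simp only: mult.commute[of "Var k ^ n"])
  qed
  have coord: "chart_coord m ?B I (?\<mu>, ?ii) = x1 \<and> chart_coord m ?B I (?\<mu>, ?jj) = x2"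
    if I: "I \<in> Hilb J 2" "I \<in> chart m ?B"
      and rel: "Var i * Var j - (poly_scale x1 (Var i * Var i) + poly_scale x2 (Var j * Var j) + poly_scale x3 (Var k * Var k)
        + poly_scale x4 (Var i * Var k) + poly_scale x5 (Var j * Var k)) \<in> I" for I x1 x2 x3 x4 x5
  proof -
    have "Var k ^ n * (Var i * Var j - (poly_scale x1 (Var i * Var i) + poly_scale x2 (Var j * Var j) + poly_scale x3 (Var k * Var k)
        + poly_scale x4 (Var i * Var k) + poly_scale x5 (Var j * Var k))) \<in> I"
      by (rule mpoly_ideal.subspace_scale[OF Hilb_ideal[OF I(1)] rel])
    then have "Poly_Mapping.single ?\<mu> 1 - (\<Sum>x\<in>{?ii, ?jj, ?kk, ?ik, ?jk}. Poly_Mapping.single x (d x1 x2 x3 x4 x5 x)) \<in> I"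
      unfolding sum s right_diff_distrib[of "Var k ^ n"] by (simp only: mpoly_vs.scale_one mult.commute[of "Var k ^ n" "Var i * Var j"])
    note c = chart_coord_subset[OF I(2) Hilb_subspace[OF I(1)] finB mem \<mu> this]
    show ?thesis using c[of ?ii] c[of ?jj] unfolding d by simp
  qed
  define f where "f = Var (?\<mu>, ?ii) * Var (?\<mu>, ?jj) - Poly_Mapping.single 0 (1/4)"
  have f: "eval_poly f (chart_coord m ?B I) = chart_coord m ?B I (?\<mu>, ?ii) * chart_coord m ?B I (?\<mu>, ?jj) - 1/4" for I
    by (simp add: f_def eval_poly_diff eval_poly_mult eval_poly_single)
  have "eval_poly f (chart_coord m ?B I0) \<noteq> 0"
  proof -
    have "Var i * Var j - (poly_scale 0 (Var i * Var i) + poly_scale 0 (Var j * Var j) + poly_scale 0 (Var k * Var k)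
        + poly_scale e1 (Var i * Var k) + poly_scale e2 (Var j * Var k)) \<in> I0"
      using q by (simp add: diff_diff_eq)
    from coord[OF I0 ch this] show ?thesis by (simp add: f)
  qed
  moreover have "eval_poly f (chart_coord m ?B I) = 0" if I: "I \<in> double_lines J" "I \<in> chart m ?B" for I
  proof -
    obtain h where IH: "I \<in> Hilb J 2" and h: "h \<in> forms 1" "h \<notin> I" "h * h \<in> I"
      using I(1) unfolding double_lines_iff_square_zero by blast
    note Ii = Hilb_ideal[OF IH]
    have ind5: "x1 = 0 \<and> x2 = 0 \<and> x3 = 0 \<and> x4 = 0 \<and> x5 = 0"
      if rel: "poly_scale x1 (Var i * Var i) + poly_scale x2 (Var j * Var j) + poly_scale x3 (Var k * Var k)
        + poly_scale x4 (Var i * Var k) + poly_scale x5 (Var j * Var k) \<in> I" for x1 x2 x3 x4 x5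
    proof -
      have "(\<Sum>x\<in>{?ii, ?jj, ?kk, ?ik, ?jk}. Poly_Mapping.single x (d x1 x2 x3 x4 x5 x)) \<in> I"
        unfolding sum by (rule mpoly_ideal.subspace_scale[OF Ii rel])
      note c = chart_independent_subset[OF I(2) Hilb_subspace[OF IH] finB mem this]
      show ?thesis using c[of ?ii] c[of ?jj] c[of ?kk] c[of ?ik] c[of ?jk] unfolding d by blast
    qed
    have ind: "p = 0 \<and> q = 0 \<and> r = 0" if "lin3 i j k p q r \<in> I" for p q r
    proof -
      have "Var k * lin3 i j k p q r \<in> I" by (rule mpoly_ideal.subspace_scale[OF Ii that])
      then have "poly_scale 0 (Var i * Var i) + poly_scale 0 (Var j * Var j) + poly_scale r (Var k * Var k)
        + poly_scale p (Var i * Var k) + poly_scale q (Var j * Var k) \<in> I"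
        by (simp add: lin3_def poly_scale_def algebra_simps)
      from ind5[OF this] show ?thesis by blast
    qed
    have pcI: "plane_coordinates I i j k"
      by (rule plane_coordinates_of_independent[OF Hilb_subspace[OF IH] _ ind dist]) (simp_all add: H[OF IH])
    obtain p q r where u: "lin3 i j k p q r * lin3 i j k p q r \<in> I" and nz: "p \<noteq> 0 \<or> q \<noteq> 0 \<or> r \<noteq> 0"
      using square_zero_lin3[OF Ii pcI h] by blast
    let ?c = "\<lambda>x. Poly_Mapping.single (0 :: 'v \<Rightarrow>\<^sub>0 nat) (x :: complex)"
    have two: "?c 2 = 2" by (simp add: single_numeral)
    have cm: "?c (x * y) = ?c x * ?c y" for x y by (simp add: mult_single)
    have gen: "(P * x + Q * y + R * z) * (P * x + Q * y + R * z) = 2 * P * Q * (x * y)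
      + (P * P * (x * x) + Q * Q * (y * y) + R * R * (z * z) + 2 * P * R * (x * z) + 2 * Q * R * (y * z))"
      for P Q R x y z :: "'v mpoly" by (simp add: algebra_simps)
    have "lin3 i j k p q r * lin3 i j k p q r = poly_scale (2 * p * q) (Var i * Var j)
      + (poly_scale (p * p) (Var i * Var i) + poly_scale (q * q) (Var j * Var j) + poly_scale (r * r) (Var k * Var k)
        + poly_scale (2 * p * r) (Var i * Var k) + poly_scale (2 * q * r) (Var j * Var k))"
      unfolding lin3_def poly_scale_def cm two by (rule gen)
    with u have u': "poly_scale (2 * p * q) (Var i * Var j)
      + (poly_scale (p * p) (Var i * Var i) + poly_scale (q * q) (Var j * Var j) + poly_scale (r * r) (Var k * Var k)
        + poly_scale (2 * p * r) (Var i * Var k) + poly_scale (2 * q * r) (Var j * Var k)) \<in> I" by simp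
    \<comment> \<open>If \<open>p * q\<close> were zero, the square would be a relation between the
      five independent monomials, which forces all three coefficients to vanish.\<close>
    have pq: "p * q \<noteq> 0"
    proof
      assume "p * q = 0"
      then have pq0: "2 * p * q = 0" by simp
      have "p * p = 0 \<and> q * q = 0 \<and> r * r = 0"
        using ind5[OF u'[unfolded pq0 mpoly_vs.scale_zero_left add_0_left]] by blast
      then show False using nz by simp
    qed
    have "poly_scale (1 / (2 * p * q)) (poly_scale (2 * p * q) (Var i * Var j)
      + (poly_scale (p * p) (Var i * Var i) + poly_scale (q * q) (Var j * Var j) + poly_scale (r * r) (Var k * Var k)
        + poly_scale (2 * p * r) (Var i * Var k) + poly_scale (2 * q * r) (Var j * Var k))) \<in> I"
      by (rule mpoly_vs.subspace_scale[OF Hilb_subspace[OF IH] u'])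
    moreover have "poly_scale (1 / (2 * p * q)) (poly_scale (2 * p * q) (Var i * Var j)
      + (poly_scale (p * p) (Var i * Var i) + poly_scale (q * q) (Var j * Var j) + poly_scale (r * r) (Var k * Var k)
        + poly_scale (2 * p * r) (Var i * Var k) + poly_scale (2 * q * r) (Var j * Var k)))
      = Var i * Var j - (poly_scale (- (p / (2 * q))) (Var i * Var i) + poly_scale (- (q / (2 * p))) (Var j * Var j)
        + poly_scale (- (r * r / (2 * p * q))) (Var k * Var k)
        + poly_scale (- (r / q)) (Var i * Var k) + poly_scale (- (r / p)) (Var j * Var k))"
      using pq by (simp add: mpoly_vs.scale_right_distrib)
    ultimately have "Var i * Var j - (poly_scale (- (p / (2 * q))) (Var i * Var i) + poly_scale (- (q / (2 * p))) (Var j * Var j)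
        + poly_scale (- (r * r / (2 * p * q))) (Var k * Var k)
        + poly_scale (- (r / q)) (Var i * Var k) + poly_scale (- (r / p)) (Var j * Var k)) \<in> I" by simp
    from coord[OF IH I(2) this] show ?thesis using pq by (simp add: f)
  qed
  ultimately show ?thesis
    by (intro exI[of _ ?B] exI[of _ f] conjI crossed_basis_monomials ch) blast+
qed

text \<open>The quotient has dimension 5 in degree two, so the six quadratic monomials of the plane
  satisfy a relation, the equation of the conic. Up to rotation it contains the square of
  \<open>x_k\<close> or, if it has no squares, the product \<open>x_i * x_j\<close>; each case has
  its separating function.\<close>

lemma double_lines_closed:
  fixes J :: "'v::finite mpoly set"
  assumes m: "m \<ge> 2"
  shows "closedin (zariski_topology m (Hilb J 2)) (double_lines J)"
proof -
  obtain n where n: "m = Suc (Suc n)" using m by (metis add_2_eq_Suc le_Suc_ex)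
  have "zariski_open m (Hilb J 2) (Hilb J 2 - double_lines J)"
  proof (rule zariski_open_local)
    show "mpoly_vs.subspace I" if "I \<in> Hilb J 2" for I :: "'v mpoly set" using that by (rule Hilb_subspace)
    fix I0 assume "I0 \<in> Hilb J 2 - double_lines J"
    then have I0: "I0 \<in> Hilb J 2" "I0 \<notin> double_lines J" by auto
    note Iv = Hilb_subspace[OF I0(1)]
    have H: "hilbert_function I0 l = 2 * l + 1" for l using Hilb_hilbert_function[OF I0(1)] by simp
    let ?goal = "\<exists>B f. B \<subseteq> monomials m \<and> I0 \<in> chart m B \<and> eval_poly f (chart_coord m B I0) \<noteq> 0 \<and>
      (\<forall>I\<in>Hilb J 2 \<inter> chart m B. eval_poly f (chart_coord m B I) \<noteq> 0 \<longrightarrow> I \<in> Hilb J 2 - double_lines J)"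
    obtain i j k where pc: "plane_coordinates I0 i j k"
      using exists_plane_coordinates[OF Iv] H[of 1] by auto
    define Q where "Q i j k xx yy zz xy yz zx = poly_scale xx (Var i * Var i) + poly_scale yy (Var j * Var j)
      + poly_scale zz (Var k * Var k) + poly_scale xy (Var i * Var j) + poly_scale yz (Var j * Var k) + poly_scale zx (Var k * Var i)"
      for i j k :: 'v and xx yy zz xy yz zx
    have rot: "Q j k i yy zz xx yz zx xy = Q i j k xx yy zz xy yz zx" for i j k xx yy zz xy yz zx
      by (simp add: Q_def algebra_simps)
    define p where "p = (\<lambda>n::nat. if n = 0 then Var i * Var i else if n = 1 then Var j * Var j else if n = 2 then Var k * Var k
      else if n = 3 then Var i * Var j else if n = 4 then Var j * Var k else Var k * Var i)"
    have "Var x * Var y \<in> forms 2" for x y :: 'v using forms_mult[OF forms_Var forms_Var, of x y] by (simp add: numeral_2_eq_2)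
    then have "p n \<in> forms 2" for n by (simp add: p_def)
    then have "\<not> indep_mod I0 6 p" using hilbert_function_ge[OF Iv, of 6 p 2] H[of 2] by auto
    then obtain c where c: "(\<Sum>n<6. poly_scale (c n) (p n)) \<in> I0" "\<exists>n<6. c n \<noteq> 0" unfolding indep_mod_def by blast
    have "(\<Sum>n<6. poly_scale (c n) (p n)) = Q i j k (c 0) (c 1) (c 2) (c 3) (c 4) (c 5)"
      by (simp add: numeral_eq_Suc p_def Q_def)
    with c(1) have rel: "Q i j k (c 0) (c 1) (c 2) (c 3) (c 4) (c 5) \<in> I0" by simp
    have square: ?goal
      if pc: "plane_coordinates I0 i j k" and q: "Q i j k xx yy zz xy yz zx \<in> I0" and zz: "zz \<noteq> 0"
      for i j k xx yy zz xy yz zx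
    proof (rule double_lines_separated_square[OF I0 pc _ n])
      have "poly_scale (1 / zz) (Q i j k xx yy zz xy yz zx) = quadric i j k (- xx / zz) (- xy / zz) (- yy / zz) (- zx / zz) (- yz / zz)"
        using zz by (simp add: Q_def quadric_def mpoly_vs.scale_right_distrib mult.commute[of "Var j" "Var k"] add_ac)
      then show "quadric i j k (- xx / zz) (- xy / zz) (- yy / zz) (- zx / zz) (- yz / zz) \<in> I0"
        using mpoly_vs.subspace_scale[OF Iv q, of "1 / zz"] by simp
    qed
    have crossed: ?goal
      if pc: "plane_coordinates I0 i j k" and q: "Q i j k 0 0 0 xy yz zx \<in> I0" and xy: "xy \<noteq> 0"
      for i j k xy yz zx
    proof (rule double_lines_separated_crossed[OF I0(1) pc _ n])
      have "poly_scale (1 / xy) (Q i j k 0 0 0 xy yz zx) = Var i * Var j - poly_scale (- zx / xy) (Var i * Var k) - poly_scale (- yz / xy) (Var j * Var k)"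
        using xy by (simp add: Q_def mpoly_vs.scale_right_distrib mult.commute[of "Var k" "Var i"] add_ac)
      then show "Var i * Var j - poly_scale (- zx / xy) (Var i * Var k) - poly_scale (- yz / xy) (Var j * Var k) \<in> I0"
        using mpoly_vs.subspace_scale[OF Iv q, of "1 / xy"] by simp
    qed
    note pc2 = plane_coordinates_rotate[OF pc] and pc3 = plane_coordinates_rotate[OF plane_coordinates_rotate[OF pc]]
    have rel2: "Q j k i (c 1) (c 2) (c 0) (c 4) (c 5) (c 3) \<in> I0" using rel by (simp only: rot[of j k i])
    have rel3: "Q k i j (c 2) (c 0) (c 1) (c 5) (c 3) (c 4) \<in> I0" using rel2 by (simp only: rot[of k i j])
    show ?goal
    proof (cases "c 0 = 0 \<and> c 1 = 0 \<and> c 2 = 0")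
      case False
      then show ?thesis using square[OF pc rel] square[OF pc2 rel2] square[OF pc3 rel3] by blast
    next
      case True
      then have "c 3 \<noteq> 0 \<or> c 4 \<noteq> 0 \<or> c 5 \<noteq> 0"
        using c(2) by (auto simp: numeral_eq_Suc less_Suc_eq)
      moreover have r: "Q i j k 0 0 0 (c 3) (c 4) (c 5) \<in> I0" "Q j k i 0 0 0 (c 4) (c 5) (c 3) \<in> I0"
        "Q k i j 0 0 0 (c 5) (c 3) (c 4) \<in> I0" using True rel rel2 rel3 by simp_all
      ultimately show ?thesis
        using crossed[OF pc r(1)] crossed[OF pc2 r(2)] crossed[OF pc3 r(3)] by (elim disjE)
    qed
  qed blast
  moreover have "double_lines J \<subseteq> Hilb J 2" by (auto simp: double_lines_def)
  ultimately show ?thesis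
    by (simp add: closedin_def topspace_zariski_topology openin_zariski_topology)
qed

section \<open>Pluecker coordinates\<close>

definition plucker_sign :: "5 \<Rightarrow> 5 \<Rightarrow> complex" where
  "plucker_sign i j = (if i < j then 1 else - 1)"

definition plucker_pair :: "5 \<Rightarrow> 5 \<Rightarrow> plucker_index" where
  "plucker_pair i j = Abs_plucker_index (if i < j then (i, j) else (j, i))"

text \<open>Extends the ten coordinates to a skew-symmetric array over all pairs of indices, so that
  wedges, Pluecker relations and hyperplanes are written without ordering the indices.\<close>

definition alt :: "(plucker_index \<Rightarrow> complex) \<Rightarrow> 5 \<Rightarrow> 5 \<Rightarrow> complex" where
  "alt p i j = (if i = j then 0 else plucker_sign i j * p (plucker_pair i j))"

definition alt_coord :: "5 \<Rightarrow> 5 \<Rightarrow> plucker_index mpoly" where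
  "alt_coord i j = (if i = j then 0 else poly_scale (plucker_sign i j) (Var (plucker_pair i j)))"

lemma Rep_plucker_pair: "i \<noteq> j \<Longrightarrow> Rep_plucker_index (plucker_pair i j) = (if i < j then (i, j) else (j, i))"
  unfolding plucker_pair_def by (rule Abs_plucker_index_inverse) auto

lemma plucker_pair_cases: "\<exists>i j. i < j \<and> k = plucker_pair i j"
proof -
  obtain i j where "Rep_plucker_index k = (i, j)" "i < j" using Rep_plucker_index[of k] by auto
  then have "k = plucker_pair i j" unfolding plucker_pair_def by (metis Rep_plucker_index_inverse)
  then show ?thesis using \<open>i < j\<close> by blast
qed

lemma alt_eqI:
  assumes "\<And>i j. alt p i j = alt q i j"
  shows "p = q"
proof
  fix k
  obtain i j where "i < j" "k = plucker_pair i j" using plucker_pair_cases by blast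
  then show "p k = q k" using assms[of i j] by (simp add: alt_def plucker_sign_def less_imp_neq)
qed

lemma alt_pair: "i \<noteq> j \<Longrightarrow> p (plucker_pair i j) = plucker_sign i j * alt p i j"
  by (auto simp: alt_def plucker_sign_def)

lemma alt_linear: "alt (\<lambda>k. r * p k + s * q k) i j = r * alt p i j + s * alt q i j"
  by (simp add: alt_def algebra_simps)

lemma alt_add: "alt (\<lambda>k. p k + q k) i j = alt p i j + alt q i j"
  using alt_linear[of 1 p 1 q] by simp

lemma alt_scale: "alt (\<lambda>k. r * p k) i j = r * alt p i j"
  using alt_linear[of r p 0 p] by simp

lemma alt_line_point: "alt (line_point a b s t) i j = s * alt a i j + t * alt b i j"
  unfolding line_point_def by (rule alt_linear)

lemma alt_wedge: "alt (wedge u w) i j = u $ i * w $ j - u $ j * w $ i"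
  by (auto simp: alt_def wedge_def Rep_plucker_pair plucker_sign_def)

lemma alt_swap: "alt p j i = - alt p i j"
proof (cases "i = j")
  case False
  then have "plucker_pair j i = plucker_pair i j" by (auto simp: plucker_pair_def)
  then show ?thesis using False by (auto simp: alt_def plucker_sign_def)
qed (simp add: alt_def)

lemma eval_alt_coord: "eval_poly (alt_coord i j) p = alt p i j"
  by (simp add: alt_coord_def alt_def)

lemma pdir_alt_coord: "pdir (alt_coord i j) p c = alt c i j"
  by (simp add: alt_coord_def alt_def)

lemma plucker_coord_alt: "i < j \<Longrightarrow> plucker_coord i j = alt_coord i j"
  by (simp add: plucker_coord_def alt_coord_def plucker_pair_def plucker_sign_def)

lemma UNIV_5: "(UNIV :: 5 set) = {0, 1, 2, 3, 4}"
proof -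
  have "distinct [0, 1, 2, 3, 4 :: 5]" by simp
  then have "card {0, 1, 2, 3, 4 :: 5} = 5" by simp
  then show ?thesis by (intro card_subset_eq[symmetric]) auto
qed

lemma forall_5: "(\<forall>i::5. P i) \<longleftrightarrow> P 0 \<and> P 1 \<and> P 2 \<and> P 3 \<and> P 4"
proof -
  have "(\<forall>i::5. P i) \<longleftrightarrow> (\<forall>i\<in>{0, 1, 2, 3, 4 :: 5}. P i)" unfolding UNIV_5[symmetric] by simp
  then show ?thesis by simp
qed

lemma less_5: "(0::5) < 1" "(0::5) < 2" "(0::5) < 3" "(0::5) < 4" "(1::5) < 2" "(1::5) < 3" "(1::5) < 4"
  "(2::5) < 3" "(2::5) < 4" "(3::5) < 4"
  by (simp_all add: less_bit1_def bit1.Rep_numeral bit1.Rep_0 bit1.Rep_1)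

lemma not_less_5: "\<not> (1::5) < 0" "\<not> (2::5) < 0" "\<not> (3::5) < 0" "\<not> (4::5) < 0" "\<not> (2::5) < 1" "\<not> (3::5) < 1"
  "\<not> (4::5) < 1" "\<not> (3::5) < 2" "\<not> (4::5) < 2" "\<not> (4::5) < 3"
  using less_5 by (simp_all add: not_less)

text \<open>The two hyperplane equations of the fourfold as alternating forms.\<close>

definition om1 :: "complex ^ 5 \<Rightarrow> complex ^ 5 \<Rightarrow> complex" where
  "om1 u y = u $ 1 * y $ 2 - u $ 2 * y $ 1 - u $ 0 * y $ 3 + u $ 3 * y $ 0"

definition om2 :: "complex ^ 5 \<Rightarrow> complex ^ 5 \<Rightarrow> complex" where
  "om2 u y = u $ 1 * y $ 3 - u $ 3 * y $ 1 - u $ 2 * y $ 4 + u $ 4 * y $ 2"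

text \<open>Both hyperplane forms vanish at the two spanning points of the line and on the
  direction, hence on the whole double line.\<close>

definition admissible :: "complex ^ 5 \<Rightarrow> complex ^ 5 \<Rightarrow> complex ^ 5 \<Rightarrow> complex ^ 5 \<Rightarrow> complex \<Rightarrow> bool" where
  "admissible u v w x l \<longleftrightarrow> om1 u v = 0 \<and> om2 u v = 0 \<and> om1 u w = 0 \<and> om2 u w = 0 \<and>
     om1 u x + l * om1 v w = 0 \<and> om2 u x + l * om2 v w = 0"

definition direction :: "complex ^ 5 \<Rightarrow> complex ^ 5 \<Rightarrow> complex ^ 5 \<Rightarrow> complex ^ 5 \<Rightarrow> complex \<Rightarrow> plucker_index \<Rightarrow> complex" where
  "direction u v w x l = (\<lambda>k. wedge u x k + l * wedge v w k)"

text \<open>A line of the Grassmannian is spanned by \<open>u \<and> v\<close> and \<open>u \<and> w\<close>, and up to multiples of these two the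
  tangent directions along which it can be doubled inside the Grassmannian are the
  \<open>u \<and> x + l v \<and> w\<close>.\<close>

definition wedge_double_line :: "complex ^ 5 \<Rightarrow> complex ^ 5 \<Rightarrow> complex ^ 5 \<Rightarrow> complex ^ 5 \<Rightarrow> complex \<Rightarrow> plucker_index mpoly set" where
  "wedge_double_line u v w x l = double_line_ideal (wedge u v) (wedge u w) (direction u v w x l)"

section \<open>Changes of frame\<close>

definition independent3 :: "('v \<Rightarrow> complex) \<Rightarrow> ('v \<Rightarrow> complex) \<Rightarrow> ('v \<Rightarrow> complex) \<Rightarrow> bool" where
  "independent3 a b c \<longleftrightarrow> (\<forall>r s t. (\<forall>i. r * a i + s * b i + t * c i = 0) \<longrightarrow> r = 0 \<and> s = 0 \<and> t = 0)"

definition nondegenerate :: "complex ^ 5 \<Rightarrow> complex ^ 5 \<Rightarrow> complex ^ 5 \<Rightarrow> complex ^ 5 \<Rightarrow> complex \<Rightarrow> bool" where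
  "nondegenerate u v w x l \<longleftrightarrow> independent3 (wedge u v) (wedge u w) (direction u v w x l)"

lemma alt_direction: "alt (direction u v w x l) i j = u $ i * x $ j - u $ j * x $ i + l * (v $ i * w $ j - v $ j * w $ i)"
  unfolding direction_def by (simp add: alt_add alt_scale alt_wedge)

lemma pivot_independent3:
  assumes "pivot i j k a b c"
  shows "independent3 a b c"
  unfolding independent3_def
proof (intro allI impI)
  fix r s t assume 0: "\<forall>i. r * a i + s * b i + t * c i = 0"
  then have "r = 0" "s = 0" using assms spec[OF 0, of i] spec[OF 0, of j] by (auto simp: pivot_def)
  then show "r = 0 \<and> s = 0 \<and> t = 0" using assms spec[OF 0, of k] by (auto simp: pivot_def)
qed

text \<open>Both inclusions are instances of \<open>double_line_ideal_mono\<close>; the second uses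
  the inverse matrix on the line and undoes the scaling and the shift of the direction.\<close>

lemma double_line_ideal_change:
  assumes d: "p * q' - q * p' \<noteq> 0" and r: "r \<noteq> 0"
  shows "double_line_ideal (line_point a b p q) (line_point a b p' q') (\<lambda>i. r * c i + line_point a b \<mu> \<nu> i)
    = double_line_ideal a b c" (is "double_line_ideal ?a ?b ?c = _")
proof
  show "double_line_ideal a b c \<subseteq> double_line_ideal ?a ?b ?c"
    using double_line_ideal_mono by blast
  define D where "D = p * q' - q * p'"
  have D: "D \<noteq> 0" using d by (simp add: D_def)
  have a: "a = line_point ?a ?b (q' / D) (- q / D)"
  proof
    fix i
    have "line_point ?a ?b (q' / D) (- q / D) i = (p * q' - q * p') * a i / D"
      using D by (simp add: line_point_def field_simps)
    then show "a i = line_point ?a ?b (q' / D) (- q / D) i" using D by (simp add: D_def)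
  qed
  have b: "b = line_point ?a ?b (- p' / D) (p / D)"
  proof
    fix i
    have "line_point ?a ?b (- p' / D) (p / D) i = (p * q' - q * p') * b i / D"
      using D by (simp add: line_point_def field_simps)
    then show "b i = line_point ?a ?b (- p' / D) (p / D) i" using D by (simp add: D_def)
  qed
  let ?s = "- (\<mu> * q' - \<nu> * p') / (D * r)" and ?t = "- (\<nu> * p - \<mu> * q) / (D * r)"
  have c: "c = (\<lambda>i. 1 / r * ?c i + line_point ?a ?b ?s ?t i)"
  proof
    fix i
    have "1 / r * ?c i + line_point ?a ?b ?s ?t i
      = c i + (\<mu> * a i + \<nu> * b i) / r - (p * q' - q * p') * (\<mu> * a i + \<nu> * b i) / (D * r)"
      using D r by (simp add: line_point_def field_simps)
    then show "c i = 1 / r * ?c i + line_point ?a ?b ?s ?t i" using D by (simp add: D_def)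
  qed
  show "double_line_ideal ?a ?b ?c \<subseteq> double_line_ideal a b c"
  proof
    fix f assume "f \<in> double_line_ideal ?a ?b ?c"
    from double_line_ideal_mono[OF this, of "q' / D" "- q / D" "- p' / D" "p / D" "1 / r" ?s ?t]
    show "f \<in> double_line_ideal a b c" by (simp only: a[symmetric] b[symmetric] c[symmetric])
  qed
qed

text \<open>The substitutions that preserve a double line. Since \<open>v \<and> w\<close> is scaled
  by the determinant, \<open>l\<close> changes by \<open>\<kappa>\<close> over it; since
  \<open>u\<close> is scaled by \<open>r\<close>, \<open>x\<close> changes by
  \<open>\<kappa> / r\<close>. All other terms are multiples of \<open>u \<and> v\<close> and
  \<open>u \<and> w\<close> and lie in the span of the line.\<close>

lemma wedge_double_line_change:
  fixes u v w x :: "complex ^ 5"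
  assumes r: "r \<noteq> 0" and d: "p * q' - q * p' \<noteq> 0" and k: "\<kappa> \<noteq> 0"
    and u': "\<And>i. u' $ i = r * u $ i"
    and v': "\<And>i. v' $ i = p * v $ i + q * w $ i + s * u $ i"
    and w': "\<And>i. w' $ i = p' * v $ i + q' * w $ i + s' * u $ i"
    and x': "\<And>i. x' $ i = \<kappa> / r * x $ i + e1 * v $ i + e2 * w $ i + e3 * u $ i"
    and l': "l' = \<kappa> * l / (p * q' - q * p')"
  shows "wedge_double_line u' v' w' x' l' = wedge_double_line u v w x l"
    and "admissible u v w x l \<Longrightarrow> admissible u' v' w' x' l'"
    and "nondegenerate u v w x l \<Longrightarrow> nondegenerate u' v' w' x' l'"
proof -
  let ?a = "wedge u v" and ?b = "wedge u w" and ?c = "direction u v w x l"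
  define D where "D = p * q' - q * p'"
  have D: "D \<noteq> 0" using d by (simp add: D_def)
  define \<mu> where "\<mu> = r * e1 + l' * (s * p' - s' * p)"
  define \<nu> where "\<nu> = r * e2 + l' * (s * q' - s' * q)"
  have lD: "l' * D = \<kappa> * l" using D by (simp add: l' D_def)
  have a: "wedge u' v' = line_point ?a ?b (r * p) (r * q)"
    by (rule alt_eqI) (simp add: alt_wedge alt_line_point u' v' algebra_simps)
  have b: "wedge u' w' = line_point ?a ?b (r * p') (r * q')"
    by (rule alt_eqI) (simp add: alt_wedge alt_line_point u' w' algebra_simps)
  have c: "direction u' v' w' x' l' = (\<lambda>k. \<kappa> * ?c k + line_point ?a ?b \<mu> \<nu> k)"
  proof (rule alt_eqI)
    fix i j
    have rx: "r * x' $ i = \<kappa> * x $ i + r * (e1 * v $ i + e2 * w $ i + e3 * u $ i)" for i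
      using r by (simp add: x' field_simps)
    have vw: "v' $ i * w' $ j - v' $ j * w' $ i = D * (v $ i * w $ j - v $ j * w $ i)
      + (s * p' - s' * p) * (u $ i * v $ j - u $ j * v $ i) + (s * q' - s' * q) * (u $ i * w $ j - u $ j * w $ i)"
      by (simp add: v' w' D_def algebra_simps)
    have "alt (direction u' v' w' x' l') i j = u $ i * (r * x' $ j) - u $ j * (r * x' $ i) + l' * (v' $ i * w' $ j - v' $ j * w' $ i)"
      by (simp add: alt_direction u' algebra_simps)
    also have "\<dots> = \<kappa> * (u $ i * x $ j - u $ j * x $ i) + (l' * D) * (v $ i * w $ j - v $ j * w $ i)
      + \<mu> * (u $ i * v $ j - u $ j * v $ i) + \<nu> * (u $ i * w $ j - u $ j * w $ i)"
      unfolding rx vw by (simp add: \<mu>_def \<nu>_def algebra_simps)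
    also have "\<dots> = \<kappa> * (u $ i * x $ j - u $ j * x $ i) + (\<kappa> * l) * (v $ i * w $ j - v $ j * w $ i)
      + \<mu> * (u $ i * v $ j - u $ j * v $ i) + \<nu> * (u $ i * w $ j - u $ j * w $ i)" by (simp only: lD)
    finally show "alt (direction u' v' w' x' l') i j = alt (\<lambda>k. \<kappa> * ?c k + line_point ?a ?b \<mu> \<nu> k) i j"
      by (simp add: alt_add alt_scale alt_direction alt_line_point alt_wedge algebra_simps)
  qed
  have rd: "(r * p) * (r * q') - (r * q) * (r * p') \<noteq> 0"
  proof -
    have "(r * p) * (r * q') - (r * q) * (r * p') = r * r * D" by (simp add: D_def algebra_simps)
    then show ?thesis using r D by simp
  qed
  show "wedge_double_line u' v' w' x' l' = wedge_double_line u v w x l"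
    unfolding wedge_double_line_def a b c by (rule double_line_ideal_change[OF rd k])
  have om: "om u' v' = r * (p * om u v + q * om u w)" "om u' w' = r * (p' * om u v + q' * om u w)"
    "om u' x' + l' * om v' w' = \<kappa> * (om u x + l * om v w) + \<mu> * om u v + \<nu> * om u w"
    if "om = om1 \<or> om = om2" for om
  proof -
    show "om u' v' = r * (p * om u v + q * om u w)" "om u' w' = r * (p' * om u v + q' * om u w)"
      using that by (auto simp: om1_def om2_def u' v' w' algebra_simps)
    have rx: "r * x' $ i = \<kappa> * x $ i + r * (e1 * v $ i + e2 * w $ i + e3 * u $ i)" for i
      using r by (simp add: x' field_simps)
    have 1: "om u' x' = \<kappa> * om u x + r * e1 * om u v + r * e2 * om u w"
    proof -
      have "om u' x' = om u (r *s x')" using that by (auto simp: om1_def om2_def u' algebra_simps)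
      also have "\<dots> = \<kappa> * om u x + r * e1 * om u v + r * e2 * om u w"
        using that by (auto simp: om1_def om2_def rx algebra_simps)
      finally show ?thesis .
    qed
    have 2: "om v' w' = D * om v w + (s * p' - s' * p) * om u v + (s * q' - s' * q) * om u w"
      using that by (auto simp: om1_def om2_def v' w' D_def algebra_simps)
    have "om u' x' + l' * om v' w' = \<kappa> * om u x + (l' * D) * om v w + \<mu> * om u v + \<nu> * om u w"
      unfolding 1 2 by (simp add: \<mu>_def \<nu>_def algebra_simps)
    then show "om u' x' + l' * om v' w' = \<kappa> * (om u x + l * om v w) + \<mu> * om u v + \<nu> * om u w"
      unfolding lD by (simp add: algebra_simps)
  qed
  show "admissible u' v' w' x' l'" if "admissible u v w x l"
    using that by (simp add: admissible_def om)
  show "nondegenerate u' v' w' x' l'" if nd: "nondegenerate u v w x l"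
    unfolding nondegenerate_def independent3_def a b c
  proof (intro allI impI)
    fix R S T
    assume 0: "\<forall>i. R * line_point ?a ?b (r * p) (r * q) i + S * line_point ?a ?b (r * p') (r * q') i
      + T * (\<kappa> * ?c i + line_point ?a ?b \<mu> \<nu> i) = 0"
    have "\<forall>i. (r * (R * p + S * p') + T * \<mu>) * ?a i + (r * (R * q + S * q') + T * \<nu>) * ?b i + (T * \<kappa>) * ?c i = 0"
    proof
      fix i show "(r * (R * p + S * p') + T * \<mu>) * ?a i + (r * (R * q + S * q') + T * \<nu>) * ?b i + (T * \<kappa>) * ?c i = 0"
        using spec[OF 0, of i] by (simp add: line_point_def algebra_simps)
    qed
    then have z: "r * (R * p + S * p') + T * \<mu> = 0 \<and> r * (R * q + S * q') + T * \<nu> = 0 \<and> T * \<kappa> = 0"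
      using nd unfolding nondegenerate_def independent3_def by blast
    then have T: "T = 0" and 1: "R * p + S * p' = 0" and 2: "R * q + S * q' = 0" using k r by auto
    have "R * D = (R * p + S * p') * q' - (R * q + S * q') * p'" "S * D = (R * q + S * q') * p - (R * p + S * p') * q"
      by (simp_all add: D_def algebra_simps)
    then have "R * D = 0" "S * D = 0" unfolding 1 2 by simp_all
    then show "R = 0 \<and> S = 0 \<and> T = 0" using D T by simp
  qed
qed

section \<open>Equations of the Grassmannian on its double lines\<close>

lemma Gr25_of_wedge_nonzero:
  assumes "wedge y y' \<noteq> (\<lambda>_. 0)"
  shows "vec.span {y, y'} \<in> Gr25"
proof -
  have no_rel: "\<alpha> = 0 \<and> \<beta> = 0" if rel: "\<alpha> *s y + \<beta> *s y' = 0" for \<alpha> \<beta>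
  proof -
    have c: "\<alpha> * y $ i + \<beta> * y' $ i = 0" for i using arg_cong[OF rel, of "\<lambda>z. z $ i"] by simp
    have "\<alpha> * alt (wedge y y') i j = 0" "\<beta> * alt (wedge y y') i j = 0" for i j
    proof -
      have "\<alpha> * alt (wedge y y') i j = (\<alpha> * y $ i + \<beta> * y' $ i) * y' $ j - (\<alpha> * y $ j + \<beta> * y' $ j) * y' $ i"
        "\<beta> * alt (wedge y y') i j = (\<alpha> * y $ j + \<beta> * y' $ j) * y $ i - (\<alpha> * y $ i + \<beta> * y' $ i) * y $ j"
        by (simp_all add: alt_wedge algebra_simps)
      then show "\<alpha> * alt (wedge y y') i j = 0" "\<beta> * alt (wedge y y') i j = 0" by (simp_all add: c)
    qed
    moreover have "\<exists>i j. alt (wedge y y') i j \<noteq> 0"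
    proof (rule ccontr)
      assume "\<not> ?thesis"
      then have "wedge y y' = (\<lambda>_. 0)" by (intro alt_eqI) (simp add: alt_def)
      then show False using assms by contradiction
    qed
    ultimately show ?thesis by (meson mult_eq_0_iff)
  qed
  have ne: "y \<noteq> y'" using no_rel[of 1 "-1"] by auto
  have "vec.independent {y, y'}"
  proof (rule vec.independent_if_scalars_zero)
    fix f z assume "(\<Sum>x\<in>{y, y'}. f x *s x) = 0" "z \<in> {y, y'}"
    then show "f z = 0" using no_rel[of "f y" "f y'"] ne by auto
  qed simp
  then have "vec.dim (vec.span {y, y'}) = 2"
    using ne vec.dim_span_eq_card_independent[of "{y, y'}"] by simp
  then show ?thesis by (simp add: Gr25_def vec.subspace_span)
qed

abbreviation grassmannian_cone :: "(plucker_index \<Rightarrow> complex) set" where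
  "grassmannian_cone \<equiv> \<Union>U\<in>Gr25. plucker_vectors U"

text \<open>A degenerate pair gives the zero vector, which represents no plane; the value there is
  obtained from the punctured line through one nonzero wedge.\<close>

lemma vanishing_on_wedge:
  assumes f: "f \<in> vanishing_ideal grassmannian_cone"
  shows "eval_poly f (wedge y y') = 0"
proof -
  have nz: "eval_poly f (wedge y y') = 0" if "wedge y y' \<noteq> (\<lambda>_. 0)" for y y'
    using Gr25_of_wedge_nonzero[OF that] f unfolding vanishing_ideal_def plucker_vectors_def by blast
  show ?thesis
  proof (cases "wedge y y' = (\<lambda>_. 0)")
    case True
    let ?e = "\<lambda>n. axis n (1::complex) :: complex ^ 5"
    have "eval_poly f (\<lambda>_. 0) = 0"
    proof (rule polyfun_punctured_zero[OF polyfun_eval])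
      fix s :: complex assume s: "s \<noteq> 0"
      have "wedge (s *s ?e 0) (?e 1) = (\<lambda>k. s * wedge (?e 0) (?e 1) k)"
        by (rule alt_eqI) (simp add: alt_scale alt_wedge algebra_simps)
      moreover have "alt (wedge (s *s ?e 0) (?e 1)) 0 1 = s" by (simp add: alt_wedge axis_def)
      then have "wedge (s *s ?e 0) (?e 1) \<noteq> (\<lambda>_. 0)" using s by (auto simp: alt_def)
      ultimately show "eval_poly f (\<lambda>k. s * wedge (?e 0) (?e 1) k) = 0" using nz by metis
    qed
    then show ?thesis using True by simp
  qed (rule nz)
qed

lemma poly_zero_of_punctured:
  fixes q :: "complex poly"
  assumes "\<And>t. t \<noteq> 0 \<Longrightarrow> poly q t = 0"
  shows "poly q t = 0"
proof -
  have "UNIV - {0} \<subseteq> {s. poly q s = 0}" using assms by auto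
  moreover have "infinite (UNIV - {0 :: complex})" by (simp add: infinite_UNIV_char_0)
  ultimately have "infinite {s. poly q s = 0}" using finite_subset by blast
  then have "q = 0" using poly_roots_finite by blast
  then show ?thesis by simp
qed

text \<open>Away from \<open>t = 0\<close> the double line is tangent to the curve \<open>(u + \<epsilon>(l/t)v) \<and> (sv + tw + \<epsilon>x)\<close>.\<close>

lemma grassmannian_contains_wedge_double_line:
  assumes f: "f \<in> vanishing_ideal grassmannian_cone"
  shows "f \<in> wedge_double_line u v w x l"
proof -
  let ?a = "wedge u v" and ?b = "wedge u w" and ?c = "direction u v w x l"
  have ev: "eval_poly f (line_point ?a ?b s t) = 0" for s t
  proof -
    have "line_point ?a ?b s t = wedge u (s *s v + t *s w)"
      by (rule alt_eqI) (simp add: alt_line_point alt_wedge algebra_simps)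
    then show ?thesis using vanishing_on_wedge[OF f] by simp
  qed
  have nz: "pdir f (line_point ?a ?b s t) ?c = 0" if t: "t \<noteq> 0" for s t
  proof -
    \<comment> \<open>The term of second order, invisible to the derivative. To first order the
      wedge of \<open>(l / t) v\<close> with \<open>s v + t w\<close> contributes
      \<open>l v \<and> w\<close>, as the direction requires.\<close>
    define E where "E = wedge ((l / t) *s v) x"
    have curve: "wedge (u + \<epsilon> *s ((l / t) *s v)) (s *s v + t *s w + \<epsilon> *s x) = (\<lambda>k. line_point ?a ?b s t k + \<epsilon> * ?c k + \<epsilon> * \<epsilon> * E k)"
      for \<epsilon>
    proof (rule alt_eqI)
      fix i j
      have lt: "(l / t) * v $ i * (t * w $ j) = l * (v $ i * w $ j)" for i j using t by simp
      show "alt (wedge (u + \<epsilon> *s ((l / t) *s v)) (s *s v + t *s w + \<epsilon> *s x)) i j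
        = alt (\<lambda>k. line_point ?a ?b s t k + \<epsilon> * ?c k + \<epsilon> * \<epsilon> * E k) i j"
        using t by (simp add: alt_add alt_scale alt_wedge alt_line_point alt_direction E_def field_simps)
    qed
    have "((\<lambda>\<epsilon>. line_point ?a ?b s t k + \<epsilon> * ?c k + \<epsilon> * \<epsilon> * E k) has_field_derivative ?c k) (at 0)" for k
      by (auto intro!: derivative_eq_intros)
    from eval_poly_curve_derivative[where f = f, OF this]
    have "((\<lambda>\<epsilon>. eval_poly f (\<lambda>k. line_point ?a ?b s t k + \<epsilon> * ?c k + \<epsilon> * \<epsilon> * E k)) has_field_derivative
      pdir f (line_point ?a ?b s t) ?c) (at 0)" by simp
    then have "((\<lambda>\<epsilon>. 0) has_field_derivative pdir f (line_point ?a ?b s t) ?c) (at (0::complex))"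
      unfolding curve[symmetric] by (simp add: vanishing_on_wedge[OF f])
    from DERIV_unique[OF this DERIV_const] show ?thesis .
  qed
  \<comment> \<open>The derivative is a polynomial in \<open>t\<close>, so vanishing for
    \<open>t \<noteq> 0\<close> extends to \<open>t = 0\<close>.\<close>
  have "pdir f (line_point ?a ?b s t) ?c = 0" for s t
  proof -
    have "\<exists>q. \<forall>t. pdir f (\<lambda>k. s * ?a k + t * ?b k) ?c = poly q t"
      by (rule polyfun_line[OF polyfun_pdir])
    then obtain q where "\<forall>t. pdir f (\<lambda>k. s * ?a k + t * ?b k) ?c = poly q t" ..
    then have q: "pdir f (line_point ?a ?b s t) ?c = poly q t" for t by (simp add: line_point_def)
    have "poly q t = 0"
    proof (rule poly_zero_of_punctured)
      fix t :: complex assume "t \<noteq> 0"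
      from nz[OF this, of s] show "poly q t = 0" unfolding q .
    qed
    then show ?thesis unfolding q .
  qed
  then show ?thesis by (simp add: wedge_double_line_def double_line_ideal_def ev)
qed

definition hyperplane_forms :: "plucker_index mpoly set" where
  "hyperplane_forms = {plucker_coord 1 2 - plucker_coord 0 3, plucker_coord 1 3 - plucker_coord 2 4}"

lemma eval_hyperplane_forms:
  "eval_poly (plucker_coord 1 2 - plucker_coord 0 3) p = alt p 1 2 - alt p 0 3"
  "eval_poly (plucker_coord 1 3 - plucker_coord 2 4) p = alt p 1 3 - alt p 2 4"
  "pdir (plucker_coord 1 2 - plucker_coord 0 3) p c = alt c 1 2 - alt c 0 3"
  "pdir (plucker_coord 1 3 - plucker_coord 2 4) p c = alt c 1 3 - alt c 2 4"
  using plucker_coord_alt less_5 by (simp_all add: eval_poly_diff pdir_diff eval_alt_coord pdir_alt_coord)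

lemma admissible_imp_subset:
  assumes "admissible u v w x l"
  shows "quintic_del_pezzo \<subseteq> wedge_double_line u v w x l"
  unfolding quintic_del_pezzo_def
proof (rule mpoly_ideal.span_minimal)
  show "mpoly_ideal.subspace (wedge_double_line u v w x l)"
    unfolding wedge_double_line_def by (rule double_line_ideal_subspace)
  have lin: "alt (wedge u v) 1 2 - alt (wedge u v) 0 3 = 0" "alt (wedge u w) 1 2 - alt (wedge u w) 0 3 = 0"
    "alt (wedge u v) 1 3 - alt (wedge u v) 2 4 = 0" "alt (wedge u w) 1 3 - alt (wedge u w) 2 4 = 0"
    "alt (direction u v w x l) 1 2 - alt (direction u v w x l) 0 3 = 0"
    "alt (direction u v w x l) 1 3 - alt (direction u v w x l) 2 4 = 0"
    using assms by (simp_all add: admissible_def alt_wedge alt_direction om1_def om2_def algebra_simps)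
  have "hyperplane_forms \<subseteq> wedge_double_line u v w x l"
    unfolding hyperplane_forms_def wedge_double_line_def double_line_ideal_def
  proof (intro insert_subsetI empty_subsetI CollectI allI conjI)
    fix s t
    have "alt (line_point (wedge u v) (wedge u w) s t) 1 2 - alt (line_point (wedge u v) (wedge u w) s t) 0 3
      = s * (alt (wedge u v) 1 2 - alt (wedge u v) 0 3) + t * (alt (wedge u w) 1 2 - alt (wedge u w) 0 3)"
      "alt (line_point (wedge u v) (wedge u w) s t) 1 3 - alt (line_point (wedge u v) (wedge u w) s t) 2 4
      = s * (alt (wedge u v) 1 3 - alt (wedge u v) 2 4) + t * (alt (wedge u w) 1 3 - alt (wedge u w) 2 4)"
      by (simp_all add: alt_line_point algebra_simps)
    then show "eval_poly (plucker_coord 1 2 - plucker_coord 0 3) (line_point (wedge u v) (wedge u w) s t) = 0"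
      "eval_poly (plucker_coord 1 3 - plucker_coord 2 4) (line_point (wedge u v) (wedge u w) s t) = 0"
      by (simp_all add: eval_hyperplane_forms lin)
  qed (simp_all add: eval_hyperplane_forms lin)
  then show "vanishing_ideal grassmannian_cone \<union> {plucker_coord 1 2 - plucker_coord 0 3, plucker_coord 1 3 - plucker_coord 2 4}
    \<subseteq> wedge_double_line u v w x l"
    using grassmannian_contains_wedge_double_line unfolding hyperplane_forms_def by blast
qed

section \<open>Double lines in the quintic del Pezzo fourfold\<close>

text \<open>Three of the six terms of the polarized Pluecker relation: symmetrized in
  \<open>p\<close> and \<open>q\<close> it is a coordinate of their product in the fourth exterior
  power.\<close>

definition plucker_form :: "(plucker_index \<Rightarrow> complex) \<Rightarrow> (plucker_index \<Rightarrow> complex) \<Rightarrow> 5 \<Rightarrow> 5 \<Rightarrow> 5 \<Rightarrow> 5 \<Rightarrow> complex" where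
  "plucker_form p q i j k l = alt p i j * alt q k l - alt p i k * alt q j l + alt p i l * alt q j k"

definition plucker_quadric :: "5 \<Rightarrow> 5 \<Rightarrow> 5 \<Rightarrow> 5 \<Rightarrow> plucker_index mpoly" where
  "plucker_quadric i j k l =
     alt_coord i j * alt_coord k l - alt_coord i k * alt_coord j l + alt_coord i l * alt_coord j k"

lemma eval_plucker_quadric: "eval_poly (plucker_quadric i j k l) p = plucker_form p p i j k l"
  by (simp add: plucker_quadric_def plucker_form_def eval_poly_add eval_poly_diff eval_poly_mult eval_alt_coord)

lemma pdir_plucker_quadric:
  "pdir (plucker_quadric i j k l) p c = plucker_form p c i j k l + plucker_form c p i j k l"
  by (simp add: plucker_quadric_def plucker_form_def pdir_add pdir_diff pdir_mult eval_alt_coord pdir_alt_coord)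

lemma plucker_quadric_in_quintic: "plucker_quadric i j k l \<in> quintic_del_pezzo"
proof -
  have "plucker_quadric i j k l \<in> vanishing_ideal grassmannian_cone"
    by (auto simp: vanishing_ideal_def plucker_vectors_def eval_plucker_quadric plucker_form_def alt_wedge algebra_simps)
  then show ?thesis unfolding quintic_del_pezzo_def by (intro mpoly_ideal.span_base) blast
qed

lemma hyperplanes_in_quintic:
  "plucker_coord 1 2 - plucker_coord 0 3 \<in> quintic_del_pezzo"
  "plucker_coord 1 3 - plucker_coord 2 4 \<in> quintic_del_pezzo"
  unfolding quintic_del_pezzo_def by (rule mpoly_ideal.span_base; simp)+

lemma plucker_form_line_point:
  "plucker_form (line_point a b s t) (line_point a b s t) i j k l =
    s * s * plucker_form a a i j k l + s * t * (plucker_form a b i j k l + plucker_form b a i j k l)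
    + t * t * plucker_form b b i j k l"
  by (simp add: plucker_form_def alt_line_point algebra_simps)

text \<open>Values and derivatives at the parameters \<open>(1, 0)\<close>, \<open>(0, 1)\<close>
  and \<open>(1, 1)\<close> yield the quadratic relations and their polarizations.\<close>

lemma quintic_double_line_relations:
  assumes sub: "quintic_del_pezzo \<subseteq> double_line_ideal a b c"
  shows "plucker_form a a i j k l = 0" "plucker_form b b i j k l = 0"
    "plucker_form a b i j k l + plucker_form b a i j k l = 0"
    "plucker_form a c i j k l + plucker_form c a i j k l = 0"
    "plucker_form b c i j k l + plucker_form c b i j k l = 0"
    "p = a \<or> p = b \<or> p = c \<Longrightarrow> alt p 1 2 = alt p 0 3 \<and> alt p 1 3 = alt p 2 4"
proof -
  have Q: "plucker_form (line_point a b s t) (line_point a b s t) i j k l = 0"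
    "plucker_form (line_point a b s t) c i j k l + plucker_form c (line_point a b s t) i j k l = 0" for s t
    using subsetD[OF sub plucker_quadric_in_quintic[of i j k l]]
    by (auto simp: double_line_ideal_def eval_plucker_quadric pdir_plucker_quadric)
  have lp: "line_point a b 1 0 = a" "line_point a b 0 1 = b" by (simp_all add: line_point_def)
  show a: "plucker_form a a i j k l = 0" and b: "plucker_form b b i j k l = 0" using Q(1)[of 1 0] Q(1)[of 0 1] by (simp_all add: lp)
  show "plucker_form a b i j k l + plucker_form b a i j k l = 0"
    using Q(1)[of 1 1] by (simp add: plucker_form_line_point a b)
  show "plucker_form a c i j k l + plucker_form c a i j k l = 0"
    "plucker_form b c i j k l + plucker_form c b i j k l = 0" using Q(2)[of 1 0] Q(2)[of 0 1] by (simp_all add: lp)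
  have h: "alt (line_point a b s t) 1 2 - alt (line_point a b s t) 0 3 = 0" "alt c 1 2 - alt c 0 3 = 0"
    "alt (line_point a b s t) 1 3 - alt (line_point a b s t) 2 4 = 0" "alt c 1 3 - alt c 2 4 = 0" for s t
    using subsetD[OF sub hyperplanes_in_quintic(1)] subsetD[OF sub hyperplanes_in_quintic(2)]
    by (auto simp: double_line_ideal_def eval_hyperplane_forms)
  show "alt p 1 2 = alt p 0 3 \<and> alt p 1 3 = alt p 2 4" if "p = a \<or> p = b \<or> p = c"
    using that h(2,4) h(1,3)[of 1 0] h(1,3)[of 0 1] by (auto simp: lp)
qed

text \<open>A pencil of decomposable bivectors has a common factor. The rows of \<open>a\<close> at
  \<open>\<alpha>\<close> and \<open>\<beta>\<close> span its plane; after a multiple of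
  \<open>a\<close> is subtracted from \<open>b\<close>, the corresponding rows of the difference are
  proportional, and the common factor is a combination of the two rows of \<open>a\<close>.\<close>

lemma wedge_decomposition:
  assumes aa: "\<And>i j k l. plucker_form a a i j k l = 0" and bb: "\<And>i j k l. plucker_form b b i j k l = 0"
    and ab: "\<And>i j k l. plucker_form a b i j k l + plucker_form b a i j k l = 0"
    and nz: "alt a \<alpha> \<beta> \<noteq> 0"
  obtains u v w where "a = wedge u v" "b = wedge u w"
proof -
  define A where "A = alt a"
  define \<pi> where "\<pi> = A \<alpha> \<beta>"
  have \<pi>: "\<pi> \<noteq> 0" using nz by (simp add: \<pi>_def A_def)
  define \<kappa> where "\<kappa> = alt b \<alpha> \<beta> / \<pi>"
  \<comment> \<open>The entry at \<open>(\<alpha>, \<beta>)\<close> is cleared; the relations of the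
    pencil then express \<open>B\<close> by its two rows (\<open>B1\<close>) and make these
    proportional (\<open>B2\<close>).\<close>
  define B where "B i j = alt b i j - \<kappa> * A i j" for i j
  have B0: "B \<alpha> \<beta> = 0" using \<pi> by (simp add: B_def \<kappa>_def \<pi>_def)
  have A1: "\<pi> * A i j = A \<alpha> i * A \<beta> j - A \<alpha> j * A \<beta> i" for i j
    using aa[of \<alpha> \<beta> i j] by (simp add: plucker_form_def A_def \<pi>_def add_eq_0_iff algebra_simps)
  have "B \<alpha> \<beta> * A i j + \<pi> * B i j - (A \<alpha> i * B \<beta> j + B \<alpha> i * A \<beta> j) + (A \<alpha> j * B \<beta> i + B \<alpha> j * A \<beta> i)
    = (plucker_form a b \<alpha> \<beta> i j + plucker_form b a \<alpha> \<beta> i j) - 2 * \<kappa> * plucker_form a a \<alpha> \<beta> i j" for i j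
    by (simp add: plucker_form_def B_def A_def \<pi>_def algebra_simps)
  then have B1: "\<pi> * B i j = A \<alpha> i * B \<beta> j + B \<alpha> i * A \<beta> j - (A \<alpha> j * B \<beta> i + B \<alpha> j * A \<beta> i)" for i j
    using ab aa B0 by (simp add: algebra_simps)
  have "B \<alpha> \<beta> * B i j - B \<alpha> i * B \<beta> j + B \<alpha> j * B \<beta> i = plucker_form b b \<alpha> \<beta> i j
    - \<kappa> * (plucker_form a b \<alpha> \<beta> i j + plucker_form b a \<alpha> \<beta> i j) + \<kappa> * \<kappa> * plucker_form a a \<alpha> \<beta> i j" for i j
    by (simp add: plucker_form_def B_def A_def algebra_simps)
  then have B2: "B \<alpha> j * B \<beta> i = B \<alpha> i * B \<beta> j" for i j using ab aa bb B0 by (simp add: algebra_simps)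
  obtain \<sigma> \<tau> y where y: "\<And>i. B \<alpha> i = \<sigma> * y i" "\<And>i. B \<beta> i = \<tau> * y i" and st: "\<sigma> \<noteq> 0 \<or> \<tau> \<noteq> 0"
  proof (cases "\<exists>j. B \<beta> j \<noteq> 0")
    case True
    then obtain j where j: "B \<beta> j \<noteq> 0" by blast
    then have "B \<alpha> i = B \<alpha> j / B \<beta> j * B \<beta> i" for i using B2[of j i] by (simp add: field_simps)
    from that[OF this, of 1] show thesis by simp
  next
    case False
    then show thesis using that[of 1 "B \<alpha>" 0] by simp
  qed
  \<comment> \<open>With rows \<open>\<sigma> y\<close> and \<open>\<tau> y\<close>, the right-hand
    side of \<open>B1\<close> factors as the wedge of this vector with \<open>y\<close>.\<close>
  define u :: "complex ^ 5" where "u = (\<chi> i. \<tau> * A \<alpha> i - \<sigma> * A \<beta> i)"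
  obtain v where v: "a = wedge u v"
  proof (cases "\<tau> = 0")
    case False
    have "a = wedge u (\<chi> i. A \<beta> i / (\<tau> * \<pi>))"
    proof (rule alt_eqI)
      fix i j
      have "\<tau> * \<pi> * alt (wedge u (\<chi> i. A \<beta> i / (\<tau> * \<pi>))) i j = \<tau> * (A \<alpha> i * A \<beta> j - A \<alpha> j * A \<beta> i)"
        using False \<pi> by (simp add: alt_wedge u_def field_simps)
      also have "\<dots> = \<tau> * \<pi> * alt a i j" by (simp add: A1[symmetric]) (simp add: A_def)
      finally show "alt a i j = alt (wedge u (\<chi> i. A \<beta> i / (\<tau> * \<pi>))) i j" using False \<pi> by simp
    qed
    then show thesis by (rule that)
  next
    case True
    then have s: "\<sigma> \<noteq> 0" using st by simp
    have "a = wedge u (\<chi> i. A \<alpha> i / (\<sigma> * \<pi>))"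
    proof (rule alt_eqI)
      fix i j
      have "\<sigma> * \<pi> * alt (wedge u (\<chi> i. A \<alpha> i / (\<sigma> * \<pi>))) i j = \<sigma> * (A \<alpha> i * A \<beta> j - A \<alpha> j * A \<beta> i)"
        using s \<pi> True by (simp add: alt_wedge u_def field_simps)
      also have "\<dots> = \<sigma> * \<pi> * alt a i j" by (simp add: A1[symmetric]) (simp add: A_def)
      finally show "alt a i j = alt (wedge u (\<chi> i. A \<alpha> i / (\<sigma> * \<pi>))) i j" using s \<pi> by simp
    qed
    then show thesis by (rule that)
  qed
  have "b = wedge u (\<chi> i. y i / \<pi> + \<kappa> * v $ i)"
  proof (rule alt_eqI)
    fix i j
    have "alt (wedge u (\<chi> i. y i / \<pi> + \<kappa> * v $ i)) i j = (u $ i * y j - u $ j * y i) / \<pi> + \<kappa> * alt (wedge u v) i j"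
      by (simp add: alt_wedge algebra_simps diff_divide_distrib)
    also have "u $ i * y j - u $ j * y i = \<pi> * B i j"
      unfolding B1 y by (simp add: u_def algebra_simps)
    finally show "alt b i j = alt (wedge u (\<chi> i. y i / \<pi> + \<kappa> * v $ i)) i j"
      using \<pi> by (simp add: v[symmetric] B_def A_def)
  qed
  then show thesis by (rule that[OF v])
qed

lemma independent3D:
  assumes "independent3 a b c" "\<And>i. r * a i + s * b i + t * c i = 0"
  shows "r = 0" "s = 0" "t = 0"
  using assms unfolding independent3_def by blast+

text \<open>The argument works modulo \<open>u\<close>: with an entry
  \<open>u $ \<rho> \<noteq> 0\<close>, subtracting \<open>u \<and> x\<close> clears row
  \<open>\<rho>\<close> of \<open>c\<close>. The remainder \<open>d\<close> has zero product with
  the reductions \<open>V\<close> and \<open>W\<close> of \<open>v\<close> and \<open>w\<close>, so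
  it is a multiple of \<open>V \<and> W\<close>.\<close>

lemma direction_decomposition:
  assumes ac: "\<And>i j k l. plucker_form (wedge u v) c i j k l + plucker_form c (wedge u v) i j k l = 0"
    and bc: "\<And>i j k l. plucker_form (wedge u w) c i j k l + plucker_form c (wedge u w) i j k l = 0"
    and ind: "independent3 (wedge u v) (wedge u w) c"
  obtains x l where "c = direction u v w x l"
proof -
  have "\<exists>\<rho>. u $ \<rho> \<noteq> 0"
  proof (rule ccontr)
    assume "\<not> ?thesis"
    then have "wedge u v = (\<lambda>_. 0)" by (intro alt_eqI) (simp add: alt_wedge, simp add: alt_def)
    then show False using independent3D(1)[OF ind, of 1 0 0] by simp
  qed
  then obtain \<rho> where \<rho>: "u $ \<rho> \<noteq> 0" by blast
  define V where "V i = u $ \<rho> * v $ i - v $ \<rho> * u $ i" for i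
  define W where "W i = u $ \<rho> * w $ i - w $ \<rho> * u $ i" for i
  define x :: "complex ^ 5" where "x = (\<chi> i. alt c \<rho> i / u $ \<rho>)"
  define d where "d = (\<lambda>k. c k - wedge u x k)"
  have x: "x $ \<rho> = 0" by (simp add: x_def alt_def)
  have V0: "V \<rho> = 0" "W \<rho> = 0" by (simp_all add: V_def W_def)
  have d: "alt d i j = alt c i j - (u $ i * x $ j - u $ j * x $ i)" for i j
    using alt_linear[of 1 c "-1" "wedge u x" i j] by (simp add: d_def alt_wedge)
  have d0: "alt d \<rho> j = 0" "alt d j \<rho> = 0" for j
  proof -
    show "alt d \<rho> j = 0" unfolding d using \<rho> x by (simp add: x_def)
    then show "alt d j \<rho> = 0" using alt_swap[of d \<rho> j] by simp
  qed
  have rel: "V' i * alt d j k - V' j * alt d i k + V' k * alt d i j = 0"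
    if c: "\<And>i j k l. plucker_form (wedge u v') c i j k l + plucker_form c (wedge u v') i j k l = 0"
      and V': "\<And>i. V' i = u $ \<rho> * v' $ i - v' $ \<rho> * u $ i" for v' V' i j k
  proof -
    have sp: "alt c i j = alt d i j + (u $ i * x $ j - u $ j * x $ i)" for i j by (simp add: d)
    have "V' i * alt d j k - V' j * alt d i k + V' k * alt d i j
      = plucker_form (wedge u v') c \<rho> i j k + plucker_form c (wedge u v') \<rho> i j k"
      unfolding plucker_form_def sp alt_wedge d0 V' by (simp add: x algebra_simps)
    then show ?thesis using c by simp
  qed
  note relV = rel[OF ac V_def] and relW = rel[OF bc W_def]
  have dep: "r = 0 \<and> s = 0" if z: "\<And>i. r * V i + s * W i = 0" for r s
  proof -
    have e: "alt (\<lambda>k. r * wedge u v k + s * wedge u w k) i j = 0" for i j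
    proof -
      have "u $ \<rho> * alt (\<lambda>k. r * wedge u v k + s * wedge u w k) i j
        = u $ i * (r * V j + s * W j) - u $ j * (r * V i + s * W i)"
        by (simp add: alt_linear alt_wedge V_def W_def algebra_simps)
      then show ?thesis using \<rho> z by simp
    qed
    have "(\<lambda>k. r * wedge u v k + s * wedge u w k) = (\<lambda>_. 0)"
      by (rule alt_eqI) (simp add: e, simp add: alt_def)
    then have "r * wedge u v k + s * wedge u w k + 0 * c k = 0" for k by (simp add: fun_eq_iff)
    from independent3D(1,2)[OF ind this] show ?thesis by simp
  qed
  obtain \<beta> where \<beta>: "V \<beta> \<noteq> 0" using dep[of 1 0] by auto
  obtain \<gamma> where m: "V \<beta> * W \<gamma> - V \<gamma> * W \<beta> \<noteq> 0"
  proof (rule ccontr)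
    assume no: "\<not> thesis"
    have "W \<beta> * V i + - V \<beta> * W i = 0" for i using no that[of i] by (cases "V \<beta> * W i = V i * W \<beta>") (simp_all add: mult.commute)
    from dep[OF this] \<beta> show False by simp
  qed
  \<comment> \<open>A nonzero minor of \<open>V\<close> and \<open>W\<close>; combining the two
    product relations fixes row \<open>\<beta>\<close> of \<open>d\<close>, and through it every
    row.\<close>
  define D where "D = V \<beta> * W \<gamma> - V \<gamma> * W \<beta>"
  define \<delta> where "\<delta> = alt d \<beta> \<gamma>"
  have D: "D \<noteq> 0" using m by (simp add: D_def)
  have row: "D * alt d \<beta> k = \<delta> * (V \<beta> * W k - W \<beta> * V k)" for k
  proof -
    have "D * alt d \<beta> k - \<delta> * (V \<beta> * W k - W \<beta> * V k)
      = W \<beta> * (V \<beta> * alt d \<gamma> k - V \<gamma> * alt d \<beta> k + V k * alt d \<beta> \<gamma>)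
      - V \<beta> * (W \<beta> * alt d \<gamma> k - W \<gamma> * alt d \<beta> k + W k * alt d \<beta> \<gamma>)"
      by (simp add: D_def \<delta>_def algebra_simps)
    then show ?thesis unfolding relV relW by simp
  qed
  have full: "D * alt d j k = \<delta> * (V j * W k - V k * W j)" for j k
  proof -
    have "V \<beta> * (D * alt d j k - \<delta> * (V j * W k - V k * W j)) = D * (V \<beta> * alt d j k - V j * alt d \<beta> k + V k * alt d \<beta> j)
      + V j * (D * alt d \<beta> k - \<delta> * (V \<beta> * W k - W \<beta> * V k)) - V k * (D * alt d \<beta> j - \<delta> * (V \<beta> * W j - W \<beta> * V j))"
      by (simp add: algebra_simps)
    then show ?thesis using \<beta> unfolding relV row by simp
  qed
  \<comment> \<open>The way back from \<open>V \<and> W\<close> to \<open>v \<and> w\<close>: the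
    reductions carry two factors \<open>u $ \<rho>\<close>, and the terms containing
    \<open>u\<close> are moved into \<open>x'\<close>.\<close>
  define l where "l = u $ \<rho> * u $ \<rho> * \<delta> / D"
  define x' :: "complex ^ 5" where "x' = (\<chi> i. x $ i + \<delta> / D * (u $ \<rho> * w $ \<rho> * v $ i - u $ \<rho> * v $ \<rho> * w $ i))"
  have "c = direction u v w x' l"
  proof (rule alt_eqI)
    fix i j
    have "D * alt c i j = D * alt (direction u v w x' l) i j"
    proof -
      have "D * alt (direction u v w x' l) i j = D * (u $ i * x $ j - u $ j * x $ i) + \<delta> * (V i * W j - V j * W i)"
        using D by (simp add: alt_direction l_def x'_def V_def W_def field_simps)
      also have "\<dots> = D * alt c i j" unfolding full[symmetric] d by (simp add: algebra_simps)
      finally show ?thesis ..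
    qed
    then show "alt c i j = alt (direction u v w x' l) i j" using D by simp
  qed
  then show thesis by (rule that)
qed

lemma quintic_double_line_cases:
  assumes "C \<in> double_lines quintic_del_pezzo"
  obtains u v w x l where "admissible u v w x l" "nondegenerate u v w x l" "C = wedge_double_line u v w x l"
proof -
  from assms obtain i j k a b c where piv: "pivot i j k a b c" and sub: "quintic_del_pezzo \<subseteq> double_line_ideal a b c"
    and C: "C = double_line_ideal a b c" unfolding double_lines_eq by blast
  note ind = pivot_independent3[OF piv] and rel = quintic_double_line_relations[OF sub]
  obtain \<alpha> \<beta> where "i = plucker_pair \<alpha> \<beta>" "\<alpha> < \<beta>" using plucker_pair_cases by blast
  then have "alt a \<alpha> \<beta> \<noteq> 0" using piv by (auto simp: pivot_def alt_def plucker_sign_def)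
  from wedge_decomposition[OF rel(1,2,3) this] obtain u v w where uvw: "a = wedge u v" "b = wedge u w" by blast
  from direction_decomposition[OF rel(4,5)[unfolded uvw] ind[unfolded uvw]]
  obtain x l where c: "c = direction u v w x l" by blast
  have "admissible u v w x l"
    using rel(6)[of a] rel(6)[of b] rel(6)[of c] unfolding uvw c
    by (simp add: admissible_def alt_wedge alt_direction om1_def om2_def algebra_simps)
  moreover have "nondegenerate u v w x l" using ind by (simp add: nondegenerate_def uvw c)
  ultimately show thesis by (intro that) (simp_all add: C wedge_double_line_def uvw c)
qed

section \<open>Normal forms\<close>

definition double_line_data ::
  "plucker_index mpoly set \<Rightarrow> complex ^ 5 \<Rightarrow> complex ^ 5 \<Rightarrow> complex ^ 5 \<Rightarrow> complex ^ 5 \<Rightarrow> complex \<Rightarrow> bool" where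
  "double_line_data C u v w x l \<longleftrightarrow> admissible u v w x l \<and> nondegenerate u v w x l \<and> C = wedge_double_line u v w x l"

text \<open>The signs make the Pluecker coordinates of the two spanning points equal to 1 at their
  pivots, whatever the order of \<open>\<rho>\<close>, \<open>\<beta>\<close> and
  \<open>\<gamma>\<close>.\<close>

definition normal_frame :: "5 \<Rightarrow> 5 \<Rightarrow> 5 \<Rightarrow> complex ^ 5 \<Rightarrow> complex ^ 5 \<Rightarrow> complex ^ 5 \<Rightarrow> complex ^ 5 \<Rightarrow> bool" where
  "normal_frame \<rho> \<beta> \<gamma> u v w x \<longleftrightarrow> u $ \<rho> = 1 \<and> v $ \<rho> = 0 \<and> w $ \<rho> = 0 \<and> x $ \<rho> = 0 \<and>
     v $ \<beta> = plucker_sign \<rho> \<beta> \<and> v $ \<gamma> = 0 \<and> w $ \<beta> = 0 \<and> w $ \<gamma> = plucker_sign \<rho> \<gamma> \<and> x $ \<beta> = 0 \<and> x $ \<gamma> = 0"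

definition frame_minor :: "5 \<Rightarrow> 5 \<Rightarrow> 5 \<Rightarrow> complex ^ 5 \<Rightarrow> complex ^ 5 \<Rightarrow> complex ^ 5 \<Rightarrow> complex" where
  "frame_minor \<rho> \<beta> \<gamma> u v w =
     alt (wedge u v) \<rho> \<beta> * alt (wedge u w) \<rho> \<gamma> - alt (wedge u v) \<rho> \<gamma> * alt (wedge u w) \<rho> \<beta>"

lemma plucker_sign_square [simp]: "plucker_sign i j * plucker_sign i j = 1"
  and plucker_sign_nonzero [simp]: "plucker_sign i j \<noteq> 0"
  by (simp_all add: plucker_sign_def)

lemma plucker_sign_square_left [simp]: "plucker_sign i j * (plucker_sign i j * y) = y"
  by (simp add: plucker_sign_def)

lemma normal_frame_distinct:
  assumes "normal_frame \<rho> \<beta> \<gamma> u v w x"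
  shows "\<rho> \<noteq> \<beta>" "\<rho> \<noteq> \<gamma>" "\<beta> \<noteq> \<gamma>"
  using assms plucker_sign_nonzero unfolding normal_frame_def by metis+

lemma frame_minor_swap: "frame_minor \<rho> \<gamma> \<beta> u v w = - frame_minor \<rho> \<beta> \<gamma> u v w"
  by (simp add: frame_minor_def)

lemma double_line_data_change:
  assumes "double_line_data C u v w x l" "r \<noteq> 0" "p * q' - q * p' \<noteq> 0" "\<kappa> \<noteq> 0"
    and "\<And>i. u' $ i = r * u $ i"
    and "\<And>i. v' $ i = p * v $ i + q * w $ i + s * u $ i"
    and "\<And>i. w' $ i = p' * v $ i + q' * w $ i + s' * u $ i"
    and "\<And>i. x' $ i = \<kappa> / r * x $ i + e1 * v $ i + e2 * w $ i + e3 * u $ i"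
    and "l' = \<kappa> * l / (p * q' - q * p')"
  shows "double_line_data C u' v' w' x' l'"
  using assms(1) wedge_double_line_change[OF assms(2-)] unfolding double_line_data_def by simp

text \<open>Multiples of \<open>u\<close> clear the entries at \<open>\<rho>\<close>; Cramer's rule
  then inverts the 2 by 2 block of \<open>v\<close> and \<open>w\<close> at \<open>\<beta>\<close>,
  \<open>\<gamma>\<close> and clears these entries of \<open>x\<close>. Proportionality of
  \<open>u'\<close> and \<open>u\<close> is recorded because the covering argument distinguishes
  cases by the entries of \<open>u\<close>.\<close>

lemma normal_frame_exists:
  assumes data: "double_line_data C u v w x l" and m: "frame_minor \<rho> \<beta> \<gamma> u v w \<noteq> 0"
  obtains r u' v' w' x' l' where "r \<noteq> 0" "\<And>i. u' $ i = r * u $ i"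
    "normal_frame \<rho> \<beta> \<gamma> u' v' w' x'" "double_line_data C u' v' w' x' l'"
proof -
  \<comment> \<open>The minor is divisible by \<open>u $ \<rho>\<close>, which is therefore
    nonzero.\<close>
  have fm: "frame_minor \<rho> \<beta> \<gamma> u v w = u $ \<rho> * (u $ \<rho> * (v $ \<beta> * w $ \<gamma> - v $ \<gamma> * w $ \<beta>)
      + v $ \<rho> * (u $ \<gamma> * w $ \<beta> - u $ \<beta> * w $ \<gamma>) + w $ \<rho> * (u $ \<beta> * v $ \<gamma> - u $ \<gamma> * v $ \<beta>))"
    by (simp add: frame_minor_def alt_wedge algebra_simps)
  have u0: "u $ \<rho> \<noteq> 0" using m fm by auto
  define U :: "complex ^ 5" where "U = (\<chi> i. 1 / u $ \<rho> * u $ i)"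
  define V :: "complex ^ 5" where "V = (\<chi> i. v $ i - v $ \<rho> / u $ \<rho> * u $ i)"
  define W :: "complex ^ 5" where "W = (\<chi> i. w $ i - w $ \<rho> / u $ \<rho> * u $ i)"
  define X :: "complex ^ 5" where "X = (\<chi> i. u $ \<rho> * x $ i - x $ \<rho> * u $ i)"
  have 1: "double_line_data C U V W X l"
    by (rule double_line_data_change[OF data, where r = "1 / u $ \<rho>" and p = 1 and q = 0 and p' = 0 and q' = 1
          and \<kappa> = 1 and s = "- (v $ \<rho> / u $ \<rho>)" and s' = "- (w $ \<rho> / u $ \<rho>)" and ?e1.0 = 0 and ?e2.0 = 0 and ?e3.0 = "- x $ \<rho>"])
      (use u0 in \<open>simp_all add: U_def V_def W_def X_def\<close>)
  have z: "U $ \<rho> = 1" "V $ \<rho> = 0" "W $ \<rho> = 0" "X $ \<rho> = 0" using u0 by (simp_all add: U_def V_def W_def X_def)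
  define D where "D = V $ \<beta> * W $ \<gamma> - V $ \<gamma> * W $ \<beta>"
  have "u $ \<rho> * u $ \<rho> * D = frame_minor \<rho> \<beta> \<gamma> u v w"
    using u0 unfolding fm by (simp add: D_def V_def W_def field_simps)
  then have D: "D \<noteq> 0" using m by auto
  define e where "e = plucker_sign \<rho> \<beta>"
  define f where "f = plucker_sign \<rho> \<gamma>"
  define p where "p = e * W $ \<gamma> / D"
  define q where "q = - (e * V $ \<gamma> / D)"
  define p' where "p' = - (f * W $ \<beta> / D)"
  define q' where "q' = f * V $ \<beta> / D"
  define e1 where "e1 = - ((X $ \<beta> * W $ \<gamma> - X $ \<gamma> * W $ \<beta>) / D)"
  define e2 where "e2 = - ((V $ \<beta> * X $ \<gamma> - V $ \<gamma> * X $ \<beta>) / D)"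
  define V' :: "complex ^ 5" where "V' = (\<chi> i. p * V $ i + q * W $ i)"
  define W' :: "complex ^ 5" where "W' = (\<chi> i. p' * V $ i + q' * W $ i)"
  define X' :: "complex ^ 5" where "X' = (\<chi> i. X $ i + e1 * V $ i + e2 * W $ i)"
  have det: "p * q' - q * p' = e * f / D"
  proof -
    have "p * q' - q * p' = e * f * (V $ \<beta> * W $ \<gamma> - V $ \<gamma> * W $ \<beta>) / (D * D)"
      using D by (simp add: p_def q_def p'_def q'_def field_simps)
    then show ?thesis using D by (simp add: D_def[symmetric])
  qed
  have ef: "e \<noteq> 0" "f \<noteq> 0" by (simp_all add: e_def f_def)
  have 2: "double_line_data C U V' W' X' (l / (e * f / D))"
    by (rule double_line_data_change[OF 1, where r = 1 and p = p and q = q and p' = p' and q' = q'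
          and \<kappa> = 1 and s = 0 and s' = 0 and ?e1.0 = e1 and ?e2.0 = e2 and ?e3.0 = 0])
      (use D ef in \<open>simp_all add: det V'_def W'_def X'_def\<close>)
  have scaled: "D * V' $ i = e * (W $ \<gamma> * V $ i - V $ \<gamma> * W $ i)" "D * W' $ i = f * (V $ \<beta> * W $ i - W $ \<beta> * V $ i)"
    "D * X' $ i = D * X $ i - (X $ \<beta> * W $ \<gamma> - X $ \<gamma> * W $ \<beta>) * V $ i - (V $ \<beta> * X $ \<gamma> - V $ \<gamma> * X $ \<beta>) * W $ i" for i
    using D by (simp_all add: V'_def W'_def X'_def p_def q_def p'_def q'_def e1_def e2_def field_simps)
  have "D * V' $ \<beta> = D * e" "D * V' $ \<gamma> = 0" "D * W' $ \<beta> = 0" "D * W' $ \<gamma> = D * f" "D * X' $ \<beta> = 0" "D * X' $ \<gamma> = 0"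
    "D * V' $ \<rho> = 0" "D * W' $ \<rho> = 0" "D * X' $ \<rho> = 0"
    unfolding scaled by (simp_all add: z) (simp_all add: D_def algebra_simps)
  then have "normal_frame \<rho> \<beta> \<gamma> U V' W' X'" unfolding normal_frame_def using D z by (simp add: e_def f_def)
  then show thesis using that[of "1 / u $ \<rho>" U V' W' X' "l / (e * f / D)"] 2 u0 by (simp add: U_def)
qed

text \<open>If all minors vanished, a nontrivial combination of \<open>u \<and> v\<close> and
  \<open>u \<and> w\<close> would have a row at \<open>\<rho>\<close> that vanishes on
  \<open>S\<close>. This row satisfies both hyperplane equations relative to \<open>u\<close>, so
  the condition on \<open>S\<close> makes it zero, and with it the combination.\<close>

lemma frame_minor_exists:
  assumes data: "double_line_data C u v w x l" and u: "u $ \<rho> \<noteq> 0"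
    and S: "\<And>y. \<lbrakk>y $ \<rho> = 0; \<And>i. i \<in> S \<Longrightarrow> y $ i = 0; om1 u y = 0; om2 u y = 0\<rbrakk> \<Longrightarrow> \<forall>i. y $ i = 0"
  shows "\<exists>\<beta>\<in>S. \<exists>\<gamma>\<in>S. frame_minor \<rho> \<beta> \<gamma> u v w \<noteq> 0"
proof (rule ccontr)
  assume no: "\<not> ?thesis"
  define V where "V i = alt (wedge u v) \<rho> i" for i
  define W where "W i = alt (wedge u w) \<rho> i" for i
  have zero: "V \<beta> * W \<gamma> = V \<gamma> * W \<beta>" if "\<beta> \<in> S" "\<gamma> \<in> S" for \<beta> \<gamma>
    using no that by (auto simp: frame_minor_def V_def W_def)
  obtain s t where st: "s \<noteq> 0 \<or> t \<noteq> 0" "\<And>i. i \<in> S \<Longrightarrow> s * V i + t * W i = 0"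
  proof (cases "\<exists>j\<in>S. V j \<noteq> 0")
    case True
    then obtain j where "j \<in> S" "V j \<noteq> 0" by blast
    then show thesis using that[of "W j" "- V j"] zero[of _ j] by (simp add: mult.commute)
  next
    case False
    then show thesis using that[of 1 0] by simp
  qed
  define y :: "complex ^ 5" where "y = (\<chi> i. s * V i + t * W i)"
  have om: "om u y = u $ \<rho> * (s * om u v + t * om u w)" if "om = om1 \<or> om = om2" for om
    using that by (auto simp: om1_def om2_def y_def V_def W_def alt_wedge algebra_simps)
  have y: "y $ i = 0" for i
  proof -
    have "\<forall>i. y $ i = 0"
    proof (rule S)
      show "y $ \<rho> = 0" by (simp add: y_def V_def W_def alt_def)
      show "om1 u y = 0" "om2 u y = 0" using data by (simp_all add: om double_line_data_def admissible_def)
    qed (simp add: y_def st(2))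
    then show ?thesis ..
  qed
  have e: "alt (\<lambda>k. s * wedge u v k + t * wedge u w k) i j = 0" for i j
  proof -
    have "u $ \<rho> * alt (\<lambda>k. s * wedge u v k + t * wedge u w k) i j = u $ i * y $ j - u $ j * y $ i"
      by (simp add: alt_linear alt_wedge y_def V_def W_def algebra_simps)
    then show ?thesis using u y by simp
  qed
  have "(\<lambda>k. s * wedge u v k + t * wedge u w k) = (\<lambda>_. 0)"
    by (rule alt_eqI) (simp add: e, simp add: alt_def)
  then have 0: "s * wedge u v k + t * wedge u w k + 0 * direction u v w x l k = 0" for k by (simp add: fun_eq_iff)
  have "nondegenerate u v w x l" using data by (simp add: double_line_data_def)
  from independent3D(1,2)[OF this[unfolded nondegenerate_def] 0] show False using st(1) by simp
qed

lemma direction_nonzero: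
  assumes "double_line_data C u v w x l"
  shows "\<not> (l = 0 \<and> (\<forall>i. x $ i = 0))"
proof
  assume 0: "l = 0 \<and> (\<forall>i. x $ i = 0)"
  have "direction u v w x l = (\<lambda>_. 0)"
    by (rule alt_eqI) (simp add: alt_direction 0, simp add: alt_def)
  then have "0 * wedge u v k + 0 * wedge u w k + 1 * direction u v w x l k = 0" for k by (simp add: fun_eq_iff)
  moreover have "independent3 (wedge u v) (wedge u w) (direction u v w x l)"
    using assms by (simp add: double_line_data_def nondegenerate_def)
  ultimately show False using independent3D(3) by (metis zero_neq_one)
qed

lemma normal_pivot:
  assumes n: "normal_frame \<rho> \<beta> \<gamma> u v w x" and c: "alt (direction u v w x l) \<sigma> \<tau> = 1" and "\<sigma> < \<tau>"
  shows "pivot (plucker_pair \<rho> \<beta>) (plucker_pair \<rho> \<gamma>) (plucker_pair \<sigma> \<tau>) (wedge u v) (wedge u w) (direction u v w x l)"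
  using n c normal_frame_distinct[OF n] \<open>\<sigma> < \<tau>\<close>
  unfolding pivot_def by (auto simp: alt_pair alt_wedge alt_direction normal_frame_def plucker_sign_def)

lemma normal_pivot_data:
  assumes "normal_frame \<rho> \<beta> \<gamma> u v w x" "alt (direction u v w x l) \<sigma> \<tau> = 1" "\<sigma> < \<tau>" "admissible u v w x l"
  shows "double_line_data (wedge_double_line u v w x l) u v w x l"
    and "wedge_double_line u v w x l \<in> double_lines quintic_del_pezzo"
proof -
  note piv = normal_pivot[OF assms(1-3)]
  show "double_line_data (wedge_double_line u v w x l) u v w x l"
    using pivot_independent3[OF piv] assms(4) by (simp add: double_line_data_def nondegenerate_def)
  show "wedge_double_line u v w x l \<in> double_lines quintic_del_pezzo"
    unfolding double_lines_eq using piv admissible_imp_subset[OF assms(4)]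
    by (intro exI conjI) (simp_all add: wedge_double_line_def)
qed

lemma scale_direction:
  assumes n: "normal_frame \<rho> \<beta> \<gamma> u v w x" and data: "double_line_data C u v w x l"
    and c: "alt (direction u v w x l) \<sigma> \<tau> \<noteq> 0"
  obtains x' l' where "normal_frame \<rho> \<beta> \<gamma> u v w x'" "double_line_data C u v w x' l'"
    "alt (direction u v w x' l') \<sigma> \<tau> = 1"
proof -
  define \<kappa> where "\<kappa> = 1 / alt (direction u v w x l) \<sigma> \<tau>"
  have \<kappa>: "\<kappa> \<noteq> 0" "\<kappa> * alt (direction u v w x l) \<sigma> \<tau> = 1" using c by (simp_all add: \<kappa>_def)
  define x' :: "complex ^ 5" where "x' = (\<chi> i. \<kappa> * x $ i)"
  have "double_line_data C u v w x' (\<kappa> * l)"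
    by (rule double_line_data_change[OF data, where r = 1 and p = 1 and q = 0 and p' = 0 and q' = 1
          and \<kappa> = \<kappa> and s = 0 and s' = 0 and ?e1.0 = 0 and ?e2.0 = 0 and ?e3.0 = 0])
      (use \<kappa> in \<open>simp_all add: x'_def\<close>)
  moreover have "normal_frame \<rho> \<beta> \<gamma> u v w x'" using n by (simp add: normal_frame_def x'_def)
  moreover have "alt (direction u v w x' (\<kappa> * l)) \<sigma> \<tau> = 1"
    unfolding \<kappa>(2)[symmetric] by (simp add: alt_direction x'_def algebra_simps)
  ultimately show thesis by (intro that)
qed

lemma eval_lin3: "eval_poly (lin3 i j k p q r) y = p * y i + q * y j + r * y k"
  and pdir_lin3: "pdir (lin3 i j k p q r) y c = p * c i + q * c j + r * c k"
  by (simp_all add: lin3_def eval_poly_add pdir_add)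

text \<open>A vanishing minor yields a linear form in the two pivot variables that is zero on the
  line. Its square then lies in the ideal of the double line, which this chart does not
  allow.\<close>

lemma chart_imp_frame_minor:
  assumes C: "C = wedge_double_line u v w x l" "C \<in> chart m (double_line_basis (plucker_pair \<rho> \<beta>) (plucker_pair \<rho> \<gamma>) k m)"
    and dist: "plucker_pair \<rho> \<beta> \<noteq> plucker_pair \<rho> \<gamma>" "k \<noteq> plucker_pair \<rho> \<beta>" "k \<noteq> plucker_pair \<rho> \<gamma>"
    and r: "\<rho> \<noteq> \<beta>" "\<rho> \<noteq> \<gamma>" and m: "m \<ge> 2"
  shows "frame_minor \<rho> \<beta> \<gamma> u v w \<noteq> 0"
proof
  let ?i = "plucker_pair \<rho> \<beta>" and ?j = "plucker_pair \<rho> \<gamma>"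
  let ?a = "wedge u v" and ?b = "wedge u w"
  obtain n where n: "m = Suc (Suc n)" using m by (metis add_2_eq_Suc le_Suc_ex)
  assume "frame_minor \<rho> \<beta> \<gamma> u v w = 0"
  then have det: "?a ?i * ?b ?j = ?a ?j * ?b ?i"
    using r by (simp add: frame_minor_def alt_pair)
  obtain p q where pq: "p \<noteq> 0 \<or> q \<noteq> 0" "p * ?a ?i + q * ?a ?j = 0" "p * ?b ?i + q * ?b ?j = 0"
  proof (cases "?a ?i = 0 \<and> ?a ?j = 0")
    case True
    show thesis
    proof (cases "?b ?i = 0 \<and> ?b ?j = 0")
      case True then show thesis using \<open>?a ?i = 0 \<and> ?a ?j = 0\<close> that[of 1 0] by simp
    next
      case False then show thesis using True that[of "?b ?j" "- ?b ?i"] by auto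
    qed
  next
    case False then show thesis using det that[of "?a ?j" "- ?a ?i"] by (auto simp: mult.commute)
  qed
  have "lin3 ?i ?j k p q 0 * lin3 ?i ?j k p q 0 \<in> C"
  proof -
    have "eval_poly (lin3 ?i ?j k p q 0) (line_point ?a ?b s t) = s * (p * ?a ?i + q * ?a ?j) + t * (p * ?b ?i + q * ?b ?j)" for s t
      by (simp add: eval_lin3 line_point_def algebra_simps)
    then show ?thesis unfolding C(1) wedge_double_line_def double_line_ideal_def
      by (simp add: eval_poly_mult pdir_mult pq)
  qed
  moreover have "mpoly_ideal.subspace C" unfolding C(1) wedge_double_line_def by (rule double_line_ideal_subspace)
  ultimately show False using double_line_chart_independent(2)[OF C(2) _ dist n] pq(1) by blast
qed

text \<open>With \<open>c k = 0\<close> the form \<open>x_k - a_k x_i - b_k x_j\<close> would vanish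
  on the whole double line, a linear relation between variables that are independent in this
  chart.\<close>

lemma chart_imp_direction:
  assumes C: "C = double_line_ideal a b c" "C \<in> chart m (double_line_basis i j k m)"
    and piv: "a i = 1" "a j = 0" "b i = 0" "b j = 1" "c i = 0" "c j = 0"
    and dist: "i \<noteq> j" "k \<noteq> i" "k \<noteq> (j :: 'v::finite)" and m: "m \<ge> 2"
  shows "c k \<noteq> 0"
proof
  assume c: "c k = 0"
  obtain n where n: "m = Suc (Suc n)" using m by (metis add_2_eq_Suc le_Suc_ex)
  have "lin3 i j k (- a k) (- b k) 1 \<in> C"
    unfolding C(1) double_line_ideal_def by (simp add: eval_lin3 pdir_lin3 line_point_def piv c)
  moreover have "mpoly_ideal.subspace C" unfolding C(1) by (rule double_line_ideal_subspace)
  ultimately show False using double_line_chart_independent(1)[OF C(2) _ dist n] by (metis one_neq_zero)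
qed

section \<open>Polynomial parametrizations of normal forms\<close>

text \<open>All normalized admissible data with given pivots, parametrized by affine 4-space:
  \<open>onto\<close> gives surjectivity, and \<open>param\<close> makes each parameter one of the
  entries, so that it can be recovered from the frame.\<close>

locale frame_chart =
  fixes \<rho> \<beta> \<gamma> \<sigma> \<tau> :: 5 and U V W X :: "(4 \<Rightarrow> complex) \<Rightarrow> complex ^ 5" and L :: "(4 \<Rightarrow> complex) \<Rightarrow> complex"
  assumes less: "\<sigma> < \<tau>"
    and poly: "polyfun (\<lambda>z. U z $ i)" "polyfun (\<lambda>z. V z $ i)" "polyfun (\<lambda>z. W z $ i)" "polyfun (\<lambda>z. X z $ i)" "polyfun L"
    and frame: "normal_frame \<rho> \<beta> \<gamma> (U z) (V z) (W z) (X z)"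
    and admissible: "admissible (U z) (V z) (W z) (X z) (L z)"
    and unit: "alt (direction (U z) (V z) (W z) (X z) (L z)) \<sigma> \<tau> = 1"
    and onto: "\<lbrakk>normal_frame \<rho> \<beta> \<gamma> u v w x; admissible u v w x l; alt (direction u v w x l) \<sigma> \<tau> = 1\<rbrakk>
      \<Longrightarrow> \<exists>z. u = U z \<and> v = V z \<and> w = W z \<and> x = X z \<and> l = L z"
    and param: "\<exists>s. (\<forall>z. z n = U z $ s) \<or> (\<forall>z. z n = V z $ s) \<or> (\<forall>z. z n = W z $ s) \<or> (\<forall>z. z n = X z $ s) \<or> (\<forall>z. z n = L z)"
    \<comment> \<open>The charts all meet the one with \<open>u $ 2 \<noteq> 0\<close>, whence irreducibility.\<close>
    and meets_base: "\<exists>z. U z $ 2 \<noteq> 0"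
begin

definition \<phi> :: "(4 \<Rightarrow> complex) \<Rightarrow> plucker_index mpoly set" where
  "\<phi> z = wedge_double_line (U z) (V z) (W z) (X z) (L z)"

abbreviation "i0 \<equiv> plucker_pair \<rho> \<beta>"
abbreviation "j0 \<equiv> plucker_pair \<rho> \<gamma>"
abbreviation "k0 \<equiv> plucker_pair \<sigma> \<tau>"

lemma piv: "pivot i0 j0 k0 (wedge (U z) (V z)) (wedge (U z) (W z)) (direction (U z) (V z) (W z) (X z) (L z))"
  by (rule normal_pivot[OF frame unit less])

lemma polyfun_wedge: "(\<And>i. polyfun (\<lambda>z. F z $ i)) \<Longrightarrow> (\<And>i. polyfun (\<lambda>z. G z $ i)) \<Longrightarrow> polyfun (\<lambda>z. wedge (F z) (G z) k)"
  unfolding wedge_def by (cases "Rep_plucker_index k") (simp add: polyfun_diff polyfun_mult)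

lemma polyfun_pivot:
  "polyfun (\<lambda>z. wedge (U z) (V z) k)" "polyfun (\<lambda>z. wedge (U z) (W z) k)" "polyfun (\<lambda>z. direction (U z) (V z) (W z) (X z) (L z) k)"
  unfolding direction_def by (intro polyfun_add polyfun_mult polyfun_wedge poly)+

lemma coordinates: "polyfun (\<lambda>z. chart_coord m (double_line_basis i0 j0 k0 m) (\<phi> z) k)"
  unfolding \<phi>_def wedge_double_line_def by (rule double_line_chart_and_coords(2)[OF piv polyfun_pivot])

lemma range_of_data:
  assumes data: "double_line_data C u v w x l" and n: "normal_frame \<rho> \<beta> \<gamma> u v w x"
    and c: "alt (direction u v w x l) \<sigma> \<tau> \<noteq> 0"
  shows "C \<in> range \<phi>"
proof -
  obtain x' l' where n': "normal_frame \<rho> \<beta> \<gamma> u v w x'" and d': "double_line_data C u v w x' l'"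
    and c': "alt (direction u v w x' l') \<sigma> \<tau> = 1" by (rule scale_direction[OF n data c])
  have "admissible u v w x' l'" using d' by (simp add: double_line_data_def)
  from onto[OF n' this c'] obtain z where "u = U z \<and> v = V z \<and> w = W z \<and> x' = X z \<and> l' = L z" by blast
  then have "C = \<phi> z" using d' by (simp add: double_line_data_def \<phi>_def)
  then show ?thesis by blast
qed

lemma \<phi>_data: "double_line_data (\<phi> z) (U z) (V z) (W z) (X z) (L z)"
  and \<phi>_double_line: "\<phi> z \<in> double_lines quintic_del_pezzo"
  unfolding \<phi>_def using normal_pivot_data[OF frame unit less admissible] by simp_all

lemma image:
  assumes m: "m \<ge> 2"
  shows "double_lines quintic_del_pezzo \<inter> chart m (double_line_basis i0 j0 k0 m) = range \<phi>"
proof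
  show "range \<phi> \<subseteq> double_lines quintic_del_pezzo \<inter> chart m (double_line_basis i0 j0 k0 m)"
  proof (clarify, intro IntI)
    fix z show "\<phi> z \<in> chart m (double_line_basis i0 j0 k0 m)"
      unfolding \<phi>_def wedge_double_line_def by (rule double_line_chart[OF piv])
  qed (rule \<phi>_double_line)
  note dist = pivot_distinct[OF piv] and r = normal_frame_distinct[OF frame]
  show "double_lines quintic_del_pezzo \<inter> chart m (double_line_basis i0 j0 k0 m) \<subseteq> range \<phi>"
  proof
    fix C assume "C \<in> double_lines quintic_del_pezzo \<inter> chart m (double_line_basis i0 j0 k0 m)"
    then have D: "C \<in> double_lines quintic_del_pezzo" and chart: "C \<in> chart m (double_line_basis i0 j0 k0 m)" by auto
    obtain u v w x l where data: "double_line_data C u v w x l"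
      using quintic_double_line_cases[OF D] unfolding double_line_data_def by metis
    then have "C = wedge_double_line u v w x l" by (simp add: double_line_data_def)
    from chart_imp_frame_minor[OF this chart dist r(1,2) m] have "frame_minor \<rho> \<beta> \<gamma> u v w \<noteq> 0" .
    then obtain u' v' w' x' l' where n: "normal_frame \<rho> \<beta> \<gamma> u' v' w' x'" and data': "double_line_data C u' v' w' x' l'"
      by (rule normal_frame_exists[OF data])
    have C: "C = double_line_ideal (wedge u' v') (wedge u' w') (direction u' v' w' x' l')"
      using data' by (simp add: double_line_data_def wedge_double_line_def)
    have "direction u' v' w' x' l' k0 \<noteq> 0"
      by (rule chart_imp_direction[OF C chart _ _ _ _ _ _ dist m])
        (use n r in \<open>simp_all add: alt_pair alt_wedge alt_direction normal_frame_def\<close>)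
    then have "alt (direction u' v' w' x' l') \<sigma> \<tau> \<noteq> 0" using less by (auto simp: alt_pair)
    then show "C \<in> range \<phi>" by (rule range_of_data[OF data' n])
  qed
qed

lemma polyfun_alt: "(\<And>k. polyfun (\<lambda>y. p k y)) \<Longrightarrow> polyfun (\<lambda>y. alt (\<lambda>k. p k y) i j)"
  unfolding alt_def by (cases "i = j") (auto intro!: polyfun_mult)

lemma frame_components:
  assumes m: "m \<ge> 2"
  shows "\<exists>F. polyfun F \<and> (\<forall>z. F (chart_coord m (double_line_basis i0 j0 k0 m) (\<phi> z)) = z n)"
proof -
  let ?Y = "\<lambda>z. chart_coord m (double_line_basis i0 j0 k0 m) (\<phi> z)"
  obtain pa pb pc where pp: "\<And>l. polyfun (pa l)" "\<And>l. polyfun (pb l)" "\<And>l. polyfun (pc l)"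
    and rec: "\<And>a b c l. pivot i0 j0 k0 a b c \<Longrightarrow>
       pa l (chart_coord m (double_line_basis i0 j0 k0 m) (double_line_ideal a b c)) = a l \<and>
       pb l (chart_coord m (double_line_basis i0 j0 k0 m) (double_line_ideal a b c)) = b l \<and>
       pc l (chart_coord m (double_line_basis i0 j0 k0 m) (double_line_ideal a b c)) = c l"
    using double_line_components[OF m, of i0 j0 k0] by metis
  define A where "A y = alt (\<lambda>l. pa l y)" for y
  define B where "B y = alt (\<lambda>l. pb l y)" for y
  define C where "C y = alt (\<lambda>l. pc l y)" for y
  have pABC: "polyfun (\<lambda>y. A y i j)" "polyfun (\<lambda>y. B y i j)" "polyfun (\<lambda>y. C y i j)" for i j
    unfolding A_def B_def C_def by (intro polyfun_alt pp)+
  have ABC: "A (?Y z) = alt (wedge (U z) (V z))" "B (?Y z) = alt (wedge (U z) (W z))"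
    "C (?Y z) = alt (direction (U z) (V z) (W z) (X z) (L z))" for z
    using rec[OF piv[of z]] by (simp_all add: A_def B_def C_def \<phi>_def wedge_double_line_def)
  let ?s = "plucker_sign \<rho> \<beta>" and ?t = "plucker_sign \<rho> \<gamma>"
  \<comment> \<open>In normal form row \<open>\<rho>\<close> of \<open>u \<and> v\<close> is
    \<open>v\<close>, and row \<open>\<beta>\<close> is \<open>u $ \<beta>\<close> times
    \<open>v\<close> minus a sign times \<open>u\<close>. As \<open>u $ \<beta>\<close> is, up to
    sign, the entry of \<open>u \<and> w\<close> at \<open>(\<beta>, \<gamma>)\<close>, this
    recovers \<open>u\<close> polynomially.\<close>
  define Fu where "Fu s y = ?s * (?t * B y \<beta> \<gamma> * A y \<rho> s - A y \<beta> s)" for s y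
  have Fu: "Fu s (?Y z) = U z $ s" "A (?Y z) \<rho> s = V z $ s" "B (?Y z) \<rho> s = W z $ s" "C (?Y z) \<rho> s = X z $ s"
    "?s * ?t * C (?Y z) \<beta> \<gamma> = L z" for s z
    using frame[of z] unfolding Fu_def ABC by (simp_all add: alt_wedge alt_direction normal_frame_def algebra_simps)
  have "polyfun (\<lambda>y. Fu s y)" "polyfun (\<lambda>y. ?s * ?t * C y \<beta> \<gamma>)" for s
    unfolding Fu_def by (intro polyfun_mult polyfun_diff polyfun_const pABC)+
  note pf = this pABC
  obtain s where "(\<forall>z. z n = U z $ s) \<or> (\<forall>z. z n = V z $ s) \<or> (\<forall>z. z n = W z $ s) \<or> (\<forall>z. z n = X z $ s) \<or> (\<forall>z. z n = L z)"
    using param[of n] by blast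
  then show ?thesis
  proof (elim disjE)
    assume "\<forall>z. z n = U z $ s" then show ?thesis using pf(1)[of s] Fu(1)[of s] by (intro exI[of _ "\<lambda>y. Fu s y"]) simp
  next
    assume "\<forall>z. z n = V z $ s" then show ?thesis using pf(3)[of \<rho> s] Fu(2)[of _ s] by (intro exI[of _ "\<lambda>y. A y \<rho> s"]) simp
  next
    assume "\<forall>z. z n = W z $ s" then show ?thesis using pf(4)[of \<rho> s] Fu(3)[of _ s] by (intro exI[of _ "\<lambda>y. B y \<rho> s"]) simp
  next
    assume "\<forall>z. z n = X z $ s" then show ?thesis using pf(5)[of \<rho> s] Fu(4)[of _ s] by (intro exI[of _ "\<lambda>y. C y \<rho> s"]) simp
  next
    assume "\<forall>z. z n = L z" then show ?thesis using pf(2) Fu(5) by (intro exI[of _ "\<lambda>y. ?s * ?t * C y \<beta> \<gamma>"]) simp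
  qed
qed

lemma inverse:
  assumes m: "m \<ge> 2"
  shows "\<exists>h. \<forall>z n. eval_poly (h n) (chart_coord m (double_line_basis i0 j0 k0 m) (\<phi> z)) = z n"
proof -
  have "\<forall>n. \<exists>f. \<forall>z. eval_poly f (chart_coord m (double_line_basis i0 j0 k0 m) (\<phi> z)) = z n"
    using frame_components[OF m] unfolding polyfun_def by metis
  then show ?thesis by metis
qed

end

section \<open>The affine charts\<close>

definition vec5 :: "complex \<Rightarrow> complex \<Rightarrow> complex \<Rightarrow> complex \<Rightarrow> complex \<Rightarrow> complex ^ 5" where
  "vec5 a b c d e = (\<chi> i. if i = 0 then a else if i = 1 then b else if i = 2 then c else if i = 3 then d else e)"

definition point4 :: "complex \<Rightarrow> complex \<Rightarrow> complex \<Rightarrow> complex \<Rightarrow> 4 \<Rightarrow> complex" where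
  "point4 p q r s = (\<lambda>n. if n = 0 then p else if n = 1 then q else if n = 2 then r else s)"

lemma vec5_simps [simp]: "vec5 a b c d e $ 0 = a" "vec5 a b c d e $ 1 = b" "vec5 a b c d e $ 2 = c"
  "vec5 a b c d e $ 3 = d" "vec5 a b c d e $ 4 = e"
  by (simp_all add: vec5_def)

lemma point4_simps [simp]: "point4 p q r s 0 = p" "point4 p q r s 1 = q" "point4 p q r s 2 = r" "point4 p q r s 3 = s"
  by (simp_all add: point4_def)

lemma vec5_eq_iff: "u = vec5 a b c d e \<longleftrightarrow> u $ 0 = a \<and> u $ 1 = b \<and> u $ 2 = c \<and> u $ 3 = d \<and> u $ 4 = e"
  by (simp add: vec_eq_iff forall_5)

lemma polyfun_vec5:
  assumes "polyfun a" "polyfun b" "polyfun c" "polyfun d" "polyfun e"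
  shows "polyfun (\<lambda>z. vec5 (a z) (b z) (c z) (d z) (e z) $ i)"
proof -
  have "\<forall>i. polyfun (\<lambda>z. vec5 (a z) (b z) (c z) (d z) (e z) $ i)"
    unfolding forall_5 using assms by simp
  then show ?thesis ..
qed

lemma UNIV_4: "(UNIV :: 4 set) = {0, 1, 2, 3}"
proof -
  have "distinct [0, 1, 2, 3 :: 4]" by simp
  then have "card {0, 1, 2, 3 :: 4} = 4" by simp
  then show ?thesis by (intro card_subset_eq[symmetric]) auto
qed

lemma forall_4: "(\<forall>n::4. P n) \<longleftrightarrow> P 0 \<and> P 1 \<and> P 2 \<and> P 3"
proof -
  have "(\<forall>n::4. P n) \<longleftrightarrow> (\<forall>n\<in>{0, 1, 2, 3 :: 4}. P n)" unfolding UNIV_4[symmetric] by simp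
  then show ?thesis by simp
qed

lemma exists_5: "(\<exists>i::5. P i) \<longleftrightarrow> P 0 \<or> P 1 \<or> P 2 \<or> P 3 \<or> P 4"
  using forall_5[of "\<lambda>i. \<not> P i"] by blast

lemmas frame_simps = less_5 not_less_5 plucker_sign_def

lemma frame_chart_intro:
  fixes U V W X :: "(4 \<Rightarrow> complex) \<Rightarrow> complex ^ 5" and L :: "(4 \<Rightarrow> complex) \<Rightarrow> complex"
  assumes "\<And>u v w x l. \<lbrakk>normal_frame \<rho> \<beta> \<gamma> u v w x; admissible u v w x l; alt (direction u v w x l) \<sigma> \<tau> = 1\<rbrakk>
      \<Longrightarrow> \<exists>z. u = U z \<and> v = V z \<and> w = W z \<and> x = X z \<and> l = L z"
    and "\<exists>z. U z $ 2 \<noteq> 0"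
    and "\<And>i. polyfun (\<lambda>z. U z $ i)" "\<And>i. polyfun (\<lambda>z. V z $ i)" "\<And>i. polyfun (\<lambda>z. W z $ i)"
      "\<And>i. polyfun (\<lambda>z. X z $ i)" "polyfun L"
    and "\<forall>n. \<exists>s. (\<forall>z. z n = U z $ s) \<or> (\<forall>z. z n = V z $ s) \<or> (\<forall>z. z n = W z $ s) \<or> (\<forall>z. z n = X z $ s) \<or> (\<forall>z. z n = L z)"
    and "\<forall>z. \<sigma> < \<tau> \<and> normal_frame \<rho> \<beta> \<gamma> (U z) (V z) (W z) (X z) \<and> admissible (U z) (V z) (W z) (X z) (L z) \<and>
      alt (direction (U z) (V z) (W z) (X z) (L z)) \<sigma> \<tau> = 1"
  shows "frame_chart \<rho> \<beta> \<gamma> \<sigma> \<tau> U V W X L"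
  using assms by unfold_locales blast+

lemmas frame_chart_rules = polyfun_vec5 polyfun_add polyfun_diff polyfun_mult polyfun_uminus polyfun_const polyfun_coord

lemmas frame_chart_simps = forall_4 exists_5 less_5 not_less_5 plucker_sign_def normal_frame_def admissible_def om1_def om2_def
  alt_direction algebra_simps

text \<open>In normal form, admissibility and the normalization of the direction are seven equations for the
  eleven free entries of \<open>(u, v, w, x, l)\<close>; in each of the following charts they are triangular and
  leave four parameters.\<close>

lemma frame_chart_1:
  "frame_chart 0 1 2 0 4
    (\<lambda>z. vec5 1 (z 0) (z 3 * (2 * z 0 + z 1)) (-z 0 * (z 3 * (2 * z 0 + z 1)) - (z 3 * (2 * z 0 + z 1)) * z 1) ((z 3 * (2 * z 0 + z 1)) * z 2 - z 0 * z 0))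
    (\<lambda>z. vec5 0 1 0 (-(z 3 * (2 * z 0 + z 1))) (z 1))
    (\<lambda>z. vec5 0 0 1 (z 0) (z 2))
    (\<lambda>z. vec5 0 0 0 (z 3) 1)
    (\<lambda>z. z 3)"
proof (rule frame_chart_intro, goal_cases)
  case (1 u v w x l)
  \<comment> \<open>The solution of the seven equations; substituting these formulas into each other
    gives the entries of the parametrization.\<close>
  have "x $ 4 = 1 \<and> x $ 3 = l \<and> w $ 3 = u $ 1 \<and> u $ 2 = l * (2 * u $ 1 + v $ 4) \<and> v $ 3 = -u $ 2 \<and> u $ 3 = -u $ 1 * u $ 2 - u $ 2 * v $ 4 \<and> u $ 4 = u $ 2 * w $ 4 - u $ 1 * u $ 1"
    using 1(2,3)[unfolded admissible_def om1_def om2_def alt_direction, simplified 1(1)[unfolded normal_frame_def frame_simps] frame_simps, simplified]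
    by - (elim conjE, intro conjI; algebra)
  with 1(1) show ?case
    by (intro exI[of _ "point4 (u $ 1) (v $ 4) (w $ 4) (l)"]) (simp add: vec5_eq_iff normal_frame_def frame_simps)
next
  case 2
  show ?case by (rule exI[of _ "point4 0 1 0 1"]) simp
qed (rule frame_chart_rules | simp add: frame_chart_simps)+

text \<open>The direction is normalized at the pair \<open>\<beta>\<close>, \<open>\<gamma>\<close>
  of the frame, where its coordinate is \<open>l\<close> up to sign; so \<open>l\<close> becomes a
  constant. Charts normalized at another pair fix an entry of \<open>x\<close> and keep
  \<open>l\<close> as a parameter.\<close>

lemma frame_chart_2:
  "frame_chart 0 1 2 1 2
    (\<lambda>z. vec5 1 (z 0) (z 1) (-z 0 * z 1 - z 1 * (z 1 * z 3 - 2 * z 0)) (z 1 * z 2 - z 0 * z 0))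
    (\<lambda>z. vec5 0 1 0 (-z 1) (z 1 * z 3 - 2 * z 0))
    (\<lambda>z. vec5 0 0 1 (z 0) (z 2))
    (\<lambda>z. vec5 0 0 0 1 (z 3))
    (\<lambda>z. 1)"
proof (rule frame_chart_intro, goal_cases)
  case (1 u v w x l)
  have "l = 1 \<and> x $ 3 = 1 \<and> w $ 3 = u $ 1 \<and> v $ 4 = u $ 2 * x $ 4 - 2 * u $ 1 \<and> v $ 3 = -u $ 2 \<and> u $ 3 = -u $ 1 * u $ 2 - u $ 2 * v $ 4 \<and> u $ 4 = u $ 2 * w $ 4 - u $ 1 * u $ 1"
    using 1(2,3)[unfolded admissible_def om1_def om2_def alt_direction, simplified 1(1)[unfolded normal_frame_def frame_simps] frame_simps, simplified]
    by - (elim conjE, intro conjI; algebra)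
  with 1(1) show ?case
    by (intro exI[of _ "point4 (u $ 1) (u $ 2) (w $ 4) (x $ 4)"]) (simp add: vec5_eq_iff normal_frame_def frame_simps)
next
  case 2
  show ?case by (rule exI[of _ "point4 0 1 0 0"]) simp
qed (rule frame_chart_rules | simp add: frame_chart_simps)+

lemma frame_chart_3:
  "frame_chart 0 1 4 0 2
    (\<lambda>z. vec5 1 (z 0) ((z 0 * z 0 + (z 3 * (z 1 - 2 * z 0 * z 2) - z 0 * z 0)) * z 2) (z 0 * (z 0 * z 1 - ((z 0 * z 0 + (z 3 * (z 1 - 2 * z 0 * z 2) - z 0 * z 0)) * z 2)) + (z 3 * (z 1 - 2 * z 0 * z 2) - z 0 * z 0) * z 1) (z 3 * (z 1 - 2 * z 0 * z 2) - z 0 * z 0))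
    (\<lambda>z. vec5 0 1 (z 1) (z 0 * z 1 - ((z 0 * z 0 + (z 3 * (z 1 - 2 * z 0 * z 2) - z 0 * z 0)) * z 2)) 0)
    (\<lambda>z. vec5 0 0 (z 2) (z 0 * z 2) 1)
    (\<lambda>z. vec5 0 0 1 (z 0 + z 3 * z 2) 0)
    (\<lambda>z. z 3)"
proof (rule frame_chart_intro, goal_cases)
  case (1 u v w x l)
  have "x $ 2 = 1 \<and> w $ 3 = u $ 1 * w $ 2 \<and> x $ 3 = u $ 1 + l * w $ 2 \<and> u $ 4 = l * (v $ 2 - 2 * u $ 1 * w $ 2) - u $ 1 * u $ 1 \<and> u $ 2 = (u $ 1 * u $ 1 + u $ 4) * w $ 2 \<and> v $ 3 = u $ 1 * v $ 2 - u $ 2 \<and> u $ 3 = u $ 1 * v $ 3 + u $ 4 * v $ 2"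
    using 1(2,3)[unfolded admissible_def om1_def om2_def alt_direction, simplified 1(1)[unfolded normal_frame_def frame_simps] frame_simps, simplified]
    by - (elim conjE, intro conjI; algebra)
  with 1(1) show ?case
    by (intro exI[of _ "point4 (u $ 1) (v $ 2) (w $ 2) (l)"]) (simp add: vec5_eq_iff normal_frame_def frame_simps)
next
  case 2
  show ?case by (rule exI[of _ "point4 0 1 1 1"]) simp
qed (rule frame_chart_rules | simp add: frame_chart_simps)+

lemma frame_chart_4:
  "frame_chart 0 1 4 1 4
    (\<lambda>z. vec5 1 (z 0) ((z 0 * z 0 + z 1) * z 2) (z 0 * (z 0 * (z 0 * (z 0 * z 3 + z 2) + z 1 * z 3 + z 0 * z 2) - ((z 0 * z 0 + z 1) * z 2)) + z 1 * (z 0 * (z 0 * z 3 + z 2) + z 1 * z 3 + z 0 * z 2)) (z 1))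
    (\<lambda>z. vec5 0 1 (z 0 * (z 0 * z 3 + z 2) + z 1 * z 3 + z 0 * z 2) (z 0 * (z 0 * (z 0 * z 3 + z 2) + z 1 * z 3 + z 0 * z 2) - ((z 0 * z 0 + z 1) * z 2)) 0)
    (\<lambda>z. vec5 0 0 (z 2) (z 0 * z 2) 1)
    (\<lambda>z. vec5 0 0 (z 3) (z 0 * z 3 + z 2) 0)
    (\<lambda>z. 1)"
proof (rule frame_chart_intro, goal_cases)
  case (1 u v w x l)
  have "l = 1 \<and> w $ 3 = u $ 1 * w $ 2 \<and> x $ 3 = u $ 1 * x $ 2 + w $ 2 \<and> v $ 2 = u $ 1 * x $ 3 + u $ 4 * x $ 2 + u $ 1 * w $ 2 \<and> u $ 2 = (u $ 1 * u $ 1 + u $ 4) * w $ 2 \<and> v $ 3 = u $ 1 * v $ 2 - u $ 2 \<and> u $ 3 = u $ 1 * v $ 3 + u $ 4 * v $ 2"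
    using 1(2,3)[unfolded admissible_def om1_def om2_def alt_direction, simplified 1(1)[unfolded normal_frame_def frame_simps] frame_simps, simplified]
    by - (elim conjE, intro conjI; algebra)
  with 1(1) show ?case
    by (intro exI[of _ "point4 (u $ 1) (u $ 4) (w $ 2) (x $ 2)"]) (simp add: vec5_eq_iff normal_frame_def frame_simps)
next
  case 2
  show ?case by (rule exI[of _ "point4 0 1 1 0"]) simp
qed (rule frame_chart_rules | simp add: frame_chart_simps)+

lemma frame_chart_5:
  "frame_chart 0 2 4 0 1
    (\<lambda>z. vec5 1 (z 0) (z 2 * (z 3 * (1 + 2 * z 0 * z 2))) (-(z 3 * (1 + 2 * z 0 * z 2)) - z 0 * (z 2 * (z 3 * (1 + 2 * z 0 * z 2)))) ((-(z 3 * (1 + 2 * z 0 * z 2)) - z 0 * (z 2 * (z 3 * (1 + 2 * z 0 * z 2)))) * z 1 - z 0 * (z 0 - (z 2 * (z 3 * (1 + 2 * z 0 * z 2))) * z 1)))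
    (\<lambda>z. vec5 0 (z 1) 1 (z 0 - (z 2 * (z 3 * (1 + 2 * z 0 * z 2))) * z 1) 0)
    (\<lambda>z. vec5 0 (z 2) 0 (-(z 2 * (z 3 * (1 + 2 * z 0 * z 2))) * z 2) 1)
    (\<lambda>z. vec5 0 1 0 (-(z 2 * (z 3 * (1 + 2 * z 0 * z 2))) - z 3 * z 2) 0)
    (\<lambda>z. z 3)"
proof (rule frame_chart_intro, goal_cases)
  case (1 u v w x l)
  have "x $ 1 = 1 \<and> u $ 2 = w $ 1 * (l * (1 + 2 * u $ 1 * w $ 1)) \<and> u $ 3 = -(l * (1 + 2 * u $ 1 * w $ 1)) - u $ 1 * u $ 2 \<and> v $ 3 = u $ 1 - u $ 2 * v $ 1 \<and> w $ 3 = -u $ 2 * w $ 1 \<and> u $ 4 = u $ 3 * v $ 1 - u $ 1 * v $ 3 \<and> x $ 3 = -u $ 2 - l * w $ 1"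
    using 1(2,3)[unfolded admissible_def om1_def om2_def alt_direction, simplified 1(1)[unfolded normal_frame_def frame_simps] frame_simps, simplified]
    by - (elim conjE, intro conjI; algebra)
  with 1(1) show ?case
    by (intro exI[of _ "point4 (u $ 1) (v $ 1) (w $ 1) (l)"]) (simp add: vec5_eq_iff normal_frame_def frame_simps)
next
  case 2
  show ?case by (rule exI[of _ "point4 0 0 1 1"]) simp
qed (rule frame_chart_rules | simp add: frame_chart_simps)+

text \<open>The only one of these charts with pivot 1 for \<open>u\<close>; it is needed for
  \<open>u\<close> proportional to the basis vector with index 1.\<close>

lemma frame_chart_6:
  "frame_chart 1 0 4 0 4
    (\<lambda>z. vec5 (z 0) 1 (z 2 + z 1 * (z 0 * z 2)) ((-z 3 - z 1 * (z 0 * z 3 + z 2)) - z 0 * (-z 1 * (-z 3 - z 1 * (z 0 * z 3 + z 2)))) (z 1))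
    (\<lambda>z. vec5 (-1) 0 (-z 3 - z 1 * (z 0 * z 3 + z 2)) (-z 1 * (-z 3 - z 1 * (z 0 * z 3 + z 2))) 0)
    (\<lambda>z. vec5 0 0 (z 0 * z 2) (z 2) 1)
    (\<lambda>z. vec5 0 0 (z 0 * z 3 + z 2) (z 3) 0)
    (\<lambda>z. -1)"
proof (rule frame_chart_intro, goal_cases)
  case (1 u v w x l)
  have "l = -1 \<and> x $ 2 = u $ 0 * x $ 3 + w $ 3 \<and> v $ 2 = -x $ 3 - u $ 4 * x $ 2 \<and> v $ 3 = -u $ 4 * v $ 2 \<and> u $ 3 = v $ 2 - u $ 0 * v $ 3 \<and> w $ 2 = u $ 0 * w $ 3 \<and> u $ 2 = w $ 3 + u $ 4 * w $ 2"
    using 1(2,3)[unfolded admissible_def om1_def om2_def alt_direction, simplified 1(1)[unfolded normal_frame_def frame_simps] frame_simps, simplified]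
    by - (elim conjE, intro conjI; algebra)
  with 1(1) show ?case
    by (intro exI[of _ "point4 (u $ 0) (u $ 4) (w $ 3) (x $ 3)"]) (simp add: vec5_eq_iff normal_frame_def frame_simps)
next
  case 2
  show ?case by (rule exI[of _ "point4 0 0 1 0"]) simp
qed (rule frame_chart_rules | simp add: frame_chart_simps)+

text \<open>The common chart. With \<open>u $ 2 = 1\<close> the equations determine
  \<open>v\<close>, \<open>w\<close>, \<open>x\<close> and \<open>l\<close> from \<open>u\<close>,
  so the four parameters are the other entries of \<open>u\<close>. The value \<open>l = -1\<close>
  comes from the sign of \<open>v $ 0\<close>.\<close>

lemma frame_chart_7:
  "frame_chart 2 0 3 0 3
    (\<lambda>z. vec5 (z 0) (z 1) 1 (z 2) (z 3))
    (\<lambda>z. vec5 (-1) (-z 2) 0 0 (-z 2 * (-z 2)))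
    (\<lambda>z. vec5 0 (-z 0) 0 1 (z 1 - z 2 * (-z 0)))
    (\<lambda>z. vec5 0 (-1) 0 0 (2 * z 2))
    (\<lambda>z. -1)"
proof (rule frame_chart_intro, goal_cases)
  case (1 u v w x l)
  have "l = -1 \<and> v $ 1 = -u $ 3 \<and> v $ 4 = -u $ 3 * v $ 1 \<and> w $ 1 = -u $ 0 \<and> w $ 4 = u $ 1 - u $ 3 * w $ 1 \<and> x $ 1 = -1 \<and> x $ 4 = 2 * u $ 3"
    using 1(2,3)[unfolded admissible_def om1_def om2_def alt_direction, simplified 1(1)[unfolded normal_frame_def frame_simps] frame_simps, simplified]
    by - (elim conjE, intro conjI; algebra)
  with 1(1) show ?case
    by (intro exI[of _ "point4 (u $ 0) (u $ 1) (u $ 3) (u $ 4)"]) (simp add: vec5_eq_iff normal_frame_def frame_simps)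
next
  case 2
  show ?case by (rule exI[of _ "point4 0 0 0 0"]) simp
qed (rule frame_chart_rules | simp add: frame_chart_simps)+

text \<open>This chart and the five after it mirror \<open>frame_chart_1\<close> to
  \<open>frame_chart_5\<close> and \<open>frame_chart_7\<close>: exchanging the indices 0 and 4 with
  a change of sign, and the indices 2 and 3, interchanges \<open>om1\<close> and
  \<open>om2\<close>.\<close>

lemma frame_chart_8:
  "frame_chart 4 1 3 0 4
    (\<lambda>z. vec5 (-z 0 * z 0 - (z 3 * (z 1 - 2 * z 0)) * z 2) (z 0) (z 0 * (z 3 * (z 1 - 2 * z 0)) - (z 3 * (z 1 - 2 * z 0)) * z 1) (z 3 * (z 1 - 2 * z 0)) 1)
    (\<lambda>z. vec5 (z 1) (-1) (-(z 3 * (z 1 - 2 * z 0))) 0 0)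
    (\<lambda>z. vec5 (z 2) 0 (z 0) (-1) 0)
    (\<lambda>z. vec5 (-1) 0 (-z 3) 0 0)
    (\<lambda>z. z 3)"
proof (rule frame_chart_intro, goal_cases)
  case (1 u v w x l)
  have "x $ 0 = -1 \<and> u $ 3 = l * (v $ 0 - 2 * u $ 1) \<and> v $ 2 = -u $ 3 \<and> w $ 2 = u $ 1 \<and> u $ 2 = u $ 1 * u $ 3 - u $ 3 * v $ 0 \<and> u $ 0 = -u $ 1 * u $ 1 - u $ 3 * w $ 0 \<and> x $ 2 = -l"
    using 1(2,3)[unfolded admissible_def om1_def om2_def alt_direction, simplified 1(1)[unfolded normal_frame_def frame_simps] frame_simps, simplified]
    by - (elim conjE, intro conjI; algebra)
  with 1(1) show ?case
    by (intro exI[of _ "point4 (u $ 1) (v $ 0) (w $ 0) (l)"]) (simp add: vec5_eq_iff normal_frame_def frame_simps)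
next
  case 2
  show ?case by (rule exI[of _ "point4 1 0 0 1"]) simp
qed (rule frame_chart_rules | simp add: frame_chart_simps)+

lemma frame_chart_9:
  "frame_chart 4 1 3 1 3
    (\<lambda>z. vec5 (-z 0 * z 0 - z 1 * z 2) (z 0) (z 0 * z 1 - z 1 * (2 * z 0 - z 1 * z 3)) (z 1) 1)
    (\<lambda>z. vec5 (2 * z 0 - z 1 * z 3) (-1) (-z 1) 0 0)
    (\<lambda>z. vec5 (z 2) 0 (z 0) (-1) 0)
    (\<lambda>z. vec5 (z 3) 0 (-1) 0 0)
    (\<lambda>z. 1)"
proof (rule frame_chart_intro, goal_cases)
  case (1 u v w x l)
  have "l = 1 \<and> x $ 2 = -1 \<and> v $ 0 = 2 * u $ 1 - u $ 3 * x $ 0 \<and> v $ 2 = -u $ 3 \<and> w $ 2 = u $ 1 \<and> u $ 2 = u $ 1 * u $ 3 - u $ 3 * v $ 0 \<and> u $ 0 = -u $ 1 * u $ 1 - u $ 3 * w $ 0"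
    using 1(2,3)[unfolded admissible_def om1_def om2_def alt_direction, simplified 1(1)[unfolded normal_frame_def frame_simps] frame_simps, simplified]
    by - (elim conjE, intro conjI; algebra)
  with 1(1) show ?case
    by (intro exI[of _ "point4 (u $ 1) (u $ 3) (w $ 0) (x $ 0)"]) (simp add: vec5_eq_iff normal_frame_def frame_simps)
next
  case 2
  show ?case by (rule exI[of _ "point4 1 1 0 0"]) simp
qed (rule frame_chart_rules | simp add: frame_chart_simps)+

lemma frame_chart_10:
  "frame_chart 4 1 0 3 4
    (\<lambda>z. vec5 (z 3 * (z 1 - 2 * z 0 * z 2) - z 0 * z 0) (z 0) ((z 3 * (z 1 - 2 * z 0 * z 2) - z 0 * z 0) * z 1 - z 0 * (-z 0 * z 1 - (-(z 0 * z 0 + (z 3 * (z 1 - 2 * z 0 * z 2) - z 0 * z 0)) * z 2))) (-(z 0 * z 0 + (z 3 * (z 1 - 2 * z 0 * z 2) - z 0 * z 0)) * z 2) 1)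
    (\<lambda>z. vec5 0 (-1) (-z 0 * z 1 - (-(z 0 * z 0 + (z 3 * (z 1 - 2 * z 0 * z 2) - z 0 * z 0)) * z 2)) (z 1) 0)
    (\<lambda>z. vec5 (-1) 0 (-z 0 * z 2) (z 2) 0)
    (\<lambda>z. vec5 0 0 (z 0 + z 3 * z 2) (-1) 0)
    (\<lambda>z. z 3)"
proof (rule frame_chart_intro, goal_cases)
  case (1 u v w x l)
  have "x $ 3 = -1 \<and> x $ 2 = u $ 1 + l * w $ 3 \<and> u $ 0 = l * (v $ 3 - 2 * u $ 1 * w $ 3) - u $ 1 * u $ 1 \<and> u $ 3 = -(u $ 1 * u $ 1 + u $ 0) * w $ 3 \<and> w $ 2 = -u $ 1 * w $ 3 \<and> v $ 2 = -u $ 1 * v $ 3 - u $ 3 \<and> u $ 2 = u $ 0 * v $ 3 - u $ 1 * v $ 2"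
    using 1(2,3)[unfolded admissible_def om1_def om2_def alt_direction, simplified 1(1)[unfolded normal_frame_def frame_simps] frame_simps, simplified]
    by - (elim conjE, intro conjI; algebra)
  with 1(1) show ?case
    by (intro exI[of _ "point4 (u $ 1) (v $ 3) (w $ 3) (l)"]) (simp add: vec5_eq_iff normal_frame_def frame_simps)
next
  case 2
  show ?case by (rule exI[of _ "point4 0 1 0 1"]) simp
qed (rule frame_chart_rules | simp add: frame_chart_simps)+

lemma frame_chart_11:
  "frame_chart 4 1 0 0 1
    (\<lambda>z. vec5 (z 0) (z 1) (z 0 * (z 0 * z 3 - z 1 * (-z 1 * z 3 - z 2) - (-z 1 * z 2)) - z 1 * (-z 1 * (z 0 * z 3 - z 1 * (-z 1 * z 3 - z 2) - (-z 1 * z 2)) - (-(z 1 * z 1 + z 0) * z 2))) (-(z 1 * z 1 + z 0) * z 2) 1)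
    (\<lambda>z. vec5 0 (-1) (-z 1 * (z 0 * z 3 - z 1 * (-z 1 * z 3 - z 2) - (-z 1 * z 2)) - (-(z 1 * z 1 + z 0) * z 2)) (z 0 * z 3 - z 1 * (-z 1 * z 3 - z 2) - (-z 1 * z 2)) 0)
    (\<lambda>z. vec5 (-1) 0 (-z 1 * z 2) (z 2) 0)
    (\<lambda>z. vec5 0 0 (-z 1 * z 3 - z 2) (z 3) 0)
    (\<lambda>z. -1)"
proof (rule frame_chart_intro, goal_cases)
  case (1 u v w x l)
  have "l = -1 \<and> x $ 2 = -u $ 1 * x $ 3 - w $ 3 \<and> w $ 2 = -u $ 1 * w $ 3 \<and> v $ 3 = u $ 0 * x $ 3 - u $ 1 * x $ 2 - w $ 2 \<and> u $ 3 = -(u $ 1 * u $ 1 + u $ 0) * w $ 3 \<and> v $ 2 = -u $ 1 * v $ 3 - u $ 3 \<and> u $ 2 = u $ 0 * v $ 3 - u $ 1 * v $ 2"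
    using 1(2,3)[unfolded admissible_def om1_def om2_def alt_direction, simplified 1(1)[unfolded normal_frame_def frame_simps] frame_simps, simplified]
    by - (elim conjE, intro conjI; algebra)
  with 1(1) show ?case
    by (intro exI[of _ "point4 (u $ 0) (u $ 1) (w $ 3) (x $ 3)"]) (simp add: vec5_eq_iff normal_frame_def frame_simps)
next
  case 2
  show ?case by (rule exI[of _ "point4 1 0 0 1"]) simp
qed (rule frame_chart_rules | simp add: frame_chart_simps)+

lemma frame_chart_12:
  "frame_chart 4 3 0 1 4
    (\<lambda>z. vec5 ((z 0 * (z 2 * (z 3 * (1 - 2 * z 0 * z 2))) - z 3 * (1 - 2 * z 0 * z 2)) * z 1 - z 0 * (z 0 + (z 2 * (z 3 * (1 - 2 * z 0 * z 2))) * z 1)) (z 0) (z 0 * (z 2 * (z 3 * (1 - 2 * z 0 * z 2))) - z 3 * (1 - 2 * z 0 * z 2)) (z 2 * (z 3 * (1 - 2 * z 0 * z 2))) 1)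
    (\<lambda>z. vec5 0 (z 1) (z 0 + (z 2 * (z 3 * (1 - 2 * z 0 * z 2))) * z 1) (-1) 0)
    (\<lambda>z. vec5 (-1) (z 2) ((z 2 * (z 3 * (1 - 2 * z 0 * z 2))) * z 2) 0 0)
    (\<lambda>z. vec5 0 (-1) (-(z 2 * (z 3 * (1 - 2 * z 0 * z 2))) - z 3 * z 2) 0 0)
    (\<lambda>z. z 3)"
proof (rule frame_chart_intro, goal_cases)
  case (1 u v w x l)
  have "x $ 1 = -1 \<and> u $ 3 = w $ 1 * (l * (1 - 2 * u $ 1 * w $ 1)) \<and> u $ 2 = u $ 1 * u $ 3 - l * (1 - 2 * u $ 1 * w $ 1) \<and> v $ 2 = u $ 1 + u $ 3 * v $ 1 \<and> w $ 2 = u $ 3 * w $ 1 \<and> u $ 0 = u $ 2 * v $ 1 - u $ 1 * v $ 2 \<and> x $ 2 = -u $ 3 - l * w $ 1"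
    using 1(2,3)[unfolded admissible_def om1_def om2_def alt_direction, simplified 1(1)[unfolded normal_frame_def frame_simps] frame_simps, simplified]
    by - (elim conjE, intro conjI; algebra)
  with 1(1) show ?case
    by (intro exI[of _ "point4 (u $ 1) (v $ 1) (w $ 1) (l)"]) (simp add: vec5_eq_iff normal_frame_def frame_simps)
next
  case 2
  show ?case by (rule exI[of _ "point4 0 0 0 1"]) simp
qed (rule frame_chart_rules | simp add: frame_chart_simps)+

lemma frame_chart_13:
  "frame_chart 3 4 2 2 4
    (\<lambda>z. vec5 (z 0) (z 1) (z 2) 1 (z 3))
    (\<lambda>z. vec5 (z 2 * (-z 2)) (-z 2) 0 0 1)
    (\<lambda>z. vec5 (z 1 + z 2 * (-z 3)) (-z 3) (-1) 0 0)
    (\<lambda>z. vec5 (-2 * z 2) (-1) 0 0 0)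
    (\<lambda>z. 1)"
proof (rule frame_chart_intro, goal_cases)
  case (1 u v w x l)
  have "l = 1 \<and> v $ 1 = -u $ 2 \<and> v $ 0 = u $ 2 * v $ 1 \<and> w $ 1 = -u $ 4 \<and> w $ 0 = u $ 1 + u $ 2 * w $ 1 \<and> x $ 1 = -1 \<and> x $ 0 = -2 * u $ 2"
    using 1(2,3)[unfolded admissible_def om1_def om2_def alt_direction, simplified 1(1)[unfolded normal_frame_def frame_simps] frame_simps, simplified]
    by - (elim conjE, intro conjI; algebra)
  with 1(1) show ?case
    by (intro exI[of _ "point4 (u $ 0) (u $ 1) (u $ 2) (u $ 4)"]) (simp add: vec5_eq_iff normal_frame_def frame_simps)
next
  case 2
  show ?case by (rule exI[of _ "point4 0 0 1 0"]) simp
qed (rule frame_chart_rules | simp add: frame_chart_simps)+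

section \<open>Covering by charts\<close>

definition covered :: "plucker_index mpoly set \<Rightarrow> bool" where
  "covered C \<longleftrightarrow> (\<exists>\<rho> \<beta> \<gamma> \<sigma> \<tau> U V W X L. frame_chart \<rho> \<beta> \<gamma> \<sigma> \<tau> U V W X L \<and> C \<in> range (frame_chart.\<phi> U V W X L))"

lemma covered_intro:
  assumes "frame_chart \<rho> \<beta> \<gamma> \<sigma> \<tau> U V W X L" "double_line_data C u v w x l" "normal_frame \<rho> \<beta> \<gamma> u v w x"
    "alt (direction u v w x l) \<sigma> \<tau> \<noteq> 0"
  shows "covered C"
  unfolding covered_def using assms(1) frame_chart.range_of_data[OF assms] by blast

lemma frame_minor_pair:
  assumes "double_line_data C u v w x l" "u $ \<rho> \<noteq> 0"
    and "\<And>y. \<lbrakk>y $ \<rho> = 0; y $ \<beta> = 0; y $ \<gamma> = 0; om1 u y = 0; om2 u y = 0\<rbrakk> \<Longrightarrow> \<forall>i. y $ i = 0"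
  shows "frame_minor \<rho> \<beta> \<gamma> u v w \<noteq> 0"
proof -
  have "\<exists>\<beta>'\<in>{\<beta>, \<gamma>}. \<exists>\<gamma>'\<in>{\<beta>, \<gamma>}. frame_minor \<rho> \<beta>' \<gamma>' u v w \<noteq> 0"
  proof (rule frame_minor_exists[OF assms(1,2)])
    fix y :: "complex ^ 5"
    assume y: "y $ \<rho> = 0" "\<And>i. i \<in> {\<beta>, \<gamma>} \<Longrightarrow> y $ i = 0" "om1 u y = 0" "om2 u y = 0"
    show "\<forall>i. y $ i = 0" by (rule assms(3)) (simp_all add: y)
  qed
  then show ?thesis using frame_minor_swap[of \<rho> \<gamma> \<beta> u v w] by (auto simp: frame_minor_def)
qed

text \<open>In this frame the direction has the entries \<open>x $ 3\<close>, \<open>x $ 4\<close>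
  and \<open>l\<close>, and a hyperplane equation makes \<open>x $ 3\<close> equal to
  \<open>l\<close>. A nonzero direction is therefore detected by one of the two coordinates
  \<open>x $ 4\<close> and \<open>l\<close>, the normalizations of two charts.\<close>

lemma covered_012:
  assumes data: "double_line_data C u v w x l" and m: "frame_minor 0 1 2 u v w \<noteq> 0"
  shows "covered C"
proof -
  obtain r u' v' w' x' l' where n: "normal_frame 0 1 2 u' v' w' x'" and d: "double_line_data C u' v' w' x' l'"
    by (rule normal_frame_exists[OF data m])
  have "\<not> (alt (direction u' v' w' x' l') 0 4 = 0 \<and> alt (direction u' v' w' x' l') 1 2 = 0)"
  proof
    assume "alt (direction u' v' w' x' l') 0 4 = 0 \<and> alt (direction u' v' w' x' l') 1 2 = 0"
    then have "l' = 0 \<and> (\<forall>i. x' $ i = 0)"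
      using n d by (auto simp: frame_simps normal_frame_def double_line_data_def admissible_def om1_def om2_def alt_direction forall_5)
    then show False using direction_nonzero[OF d] by contradiction
  qed
  then show ?thesis using covered_intro[OF frame_chart_1 d n] covered_intro[OF frame_chart_2 d n] by blast
qed

lemma covered_014:
  assumes data: "double_line_data C u v w x l" and m: "frame_minor 0 1 4 u v w \<noteq> 0"
  shows "covered C"
proof -
  obtain r u' v' w' x' l' where n: "normal_frame 0 1 4 u' v' w' x'" and d: "double_line_data C u' v' w' x' l'"
    by (rule normal_frame_exists[OF data m])
  have "\<not> (alt (direction u' v' w' x' l') 0 2 = 0 \<and> alt (direction u' v' w' x' l') 1 4 = 0)"
  proof
    assume "alt (direction u' v' w' x' l') 0 2 = 0 \<and> alt (direction u' v' w' x' l') 1 4 = 0"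
    then have "l' = 0 \<and> (\<forall>i. x' $ i = 0)"
      using n d by (auto simp: frame_simps normal_frame_def double_line_data_def admissible_def om1_def om2_def alt_direction forall_5)
    then show False using direction_nonzero[OF d] by contradiction
  qed
  then show ?thesis using covered_intro[OF frame_chart_3 d n] covered_intro[OF frame_chart_4 d n] by blast
qed

lemma covered_413:
  assumes data: "double_line_data C u v w x l" and m: "frame_minor 4 1 3 u v w \<noteq> 0"
  shows "covered C"
proof -
  obtain r u' v' w' x' l' where n: "normal_frame 4 1 3 u' v' w' x'" and d: "double_line_data C u' v' w' x' l'"
    by (rule normal_frame_exists[OF data m])
  have "\<not> (alt (direction u' v' w' x' l') 0 4 = 0 \<and> alt (direction u' v' w' x' l') 1 3 = 0)"
  proof
    assume "alt (direction u' v' w' x' l') 0 4 = 0 \<and> alt (direction u' v' w' x' l') 1 3 = 0"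
    then have "l' = 0 \<and> (\<forall>i. x' $ i = 0)"
      using n d by (auto simp: frame_simps normal_frame_def double_line_data_def admissible_def om1_def om2_def alt_direction forall_5)
    then show False using direction_nonzero[OF d] by contradiction
  qed
  then show ?thesis using covered_intro[OF frame_chart_8 d n] covered_intro[OF frame_chart_9 d n] by blast
qed

lemma covered_410:
  assumes data: "double_line_data C u v w x l" and m: "frame_minor 4 1 0 u v w \<noteq> 0"
  shows "covered C"
proof -
  obtain r u' v' w' x' l' where n: "normal_frame 4 1 0 u' v' w' x'" and d: "double_line_data C u' v' w' x' l'"
    by (rule normal_frame_exists[OF data m])
  have "\<not> (alt (direction u' v' w' x' l') 3 4 = 0 \<and> alt (direction u' v' w' x' l') 0 1 = 0)"
  proof
    assume "alt (direction u' v' w' x' l') 3 4 = 0 \<and> alt (direction u' v' w' x' l') 0 1 = 0"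
    then have "l' = 0 \<and> (\<forall>i. x' $ i = 0)"
      using n d by (auto simp: frame_simps normal_frame_def double_line_data_def admissible_def om1_def om2_def alt_direction forall_5)
    then show False using direction_nonzero[OF d] by contradiction
  qed
  then show ?thesis using covered_intro[OF frame_chart_10 d n] covered_intro[OF frame_chart_11 d n] by blast
qed

text \<open>With \<open>u $ 2 \<noteq> 0\<close> as pivot, the hyperplane equations determine the
  entries 1 and 4 of a vector from the others. This forces both the minor and the direction
  coordinate to be nonzero, so one chart contains the whole open set.\<close>

lemma range_base:
  assumes base: "frame_chart 2 0 3 0 3 U V W X L"
    and data: "double_line_data C u v w x l" and u: "u $ 2 \<noteq> 0"
  shows "C \<in> range (frame_chart.\<phi> U V W X L)"
proof -
  have "frame_minor 2 0 3 u v w \<noteq> 0"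
    by (rule frame_minor_pair[OF data]) (use u in \<open>auto simp: om1_def om2_def forall_5\<close>)
  from normal_frame_exists[OF data this] obtain r u' v' w' x' l' where u': "\<And>i. u' $ i = r * u $ i"
    and n: "normal_frame 2 0 3 u' v' w' x'" and d: "double_line_data C u' v' w' x' l'" by metis
  have "alt (direction u' v' w' x' l') 0 3 \<noteq> 0"
  proof
    assume "alt (direction u' v' w' x' l') 0 3 = 0"
    then have "l' = 0 \<and> (\<forall>i. x' $ i = 0)"
      using n d u by (auto simp: u' frame_simps normal_frame_def double_line_data_def admissible_def om1_def om2_def alt_direction forall_5)
    then show False using direction_nonzero[OF d] by contradiction
  qed
  then show ?thesis by (rule frame_chart.range_of_data[OF base d n])
qed

lemma covered_u3:
  assumes data: "double_line_data C u v w x l" and u: "u $ 3 \<noteq> 0"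
  shows "covered C"
proof -
  have "frame_minor 3 4 2 u v w \<noteq> 0"
    by (rule frame_minor_pair[OF data]) (use u in \<open>auto simp: om1_def om2_def forall_5\<close>)
  from normal_frame_exists[OF data this] obtain r u' v' w' x' l' where u': "\<And>i. u' $ i = r * u $ i"
    and n: "normal_frame 3 4 2 u' v' w' x'" and d: "double_line_data C u' v' w' x' l'" by metis
  have "alt (direction u' v' w' x' l') 2 4 \<noteq> 0"
  proof
    assume "alt (direction u' v' w' x' l') 2 4 = 0"
    then have "l' = 0 \<and> (\<forall>i. x' $ i = 0)"
      using n d u by (auto simp: u' frame_simps normal_frame_def double_line_data_def admissible_def om1_def om2_def alt_direction forall_5)
    then show False using direction_nonzero[OF d] by contradiction
  qed
  then show ?thesis by (rule covered_intro[OF frame_chart_13 d n])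
qed

text \<open>The case left over by the other pivots: \<open>u\<close> is proportional to the basis
  vector with index 1.\<close>

lemma covered_u1:
  assumes data: "double_line_data C u v w x l" and u: "u $ 1 \<noteq> 0" "u $ 0 = 0" "u $ 2 = 0" "u $ 3 = 0" "u $ 4 = 0"
  shows "covered C"
proof -
  have "frame_minor 1 0 4 u v w \<noteq> 0"
    by (rule frame_minor_pair[OF data]) (use u in \<open>auto simp: om1_def om2_def forall_5\<close>)
  from normal_frame_exists[OF data this] obtain r u' v' w' x' l' where u': "\<And>i. u' $ i = r * u $ i"
    and n: "normal_frame 1 0 4 u' v' w' x'" and d: "double_line_data C u' v' w' x' l'" by metis
  have "alt (direction u' v' w' x' l') 0 4 \<noteq> 0"
  proof
    assume "alt (direction u' v' w' x' l') 0 4 = 0"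
    then have "l' = 0 \<and> (\<forall>i. x' $ i = 0)"
      using n d u by (auto simp: u' frame_simps normal_frame_def double_line_data_def admissible_def om1_def om2_def alt_direction forall_5)
    then show False using direction_nonzero[OF d] by contradiction
  qed
  then show ?thesis by (rule covered_intro[OF frame_chart_6 d n])
qed

text \<open>If \<open>w $ 1 = 0\<close> in the normalized frame, the equations leave only the
  direction coordinate at the pair 0, 1. Otherwise the minor for the pivots 0, 1, 2 equals
  \<open>w $ 1\<close> up to sign, and that frame takes over.\<close>

lemma covered_024:
  assumes data: "double_line_data C u v w x l" and u: "u $ 2 = 0" "u $ 3 = 0" and m: "frame_minor 0 2 4 u v w \<noteq> 0"
  shows "covered C"
proof -
  from normal_frame_exists[OF data m] obtain r u' v' w' x' l' where u': "\<And>i. u' $ i = r * u $ i"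
    and n: "normal_frame 0 2 4 u' v' w' x'" and d: "double_line_data C u' v' w' x' l'" by metis
  have z: "u' $ 2 = 0" "u' $ 3 = 0" by (simp_all add: u' u)
  show ?thesis
  proof (cases "w' $ 1 = 0")
    case True
    have "alt (direction u' v' w' x' l') 0 1 \<noteq> 0"
    proof
      assume "alt (direction u' v' w' x' l') 0 1 = 0"
      then have "l' = 0 \<and> (\<forall>i. x' $ i = 0)"
        using n d z True by (auto simp: frame_simps normal_frame_def double_line_data_def admissible_def om1_def om2_def alt_direction forall_5)
      then show False using direction_nonzero[OF d] by contradiction
    qed
    then show ?thesis by (rule covered_intro[OF frame_chart_5 d n])
  next
    case False
    have "frame_minor 0 1 2 u' v' w' \<noteq> 0"
      using n False by (simp add: frame_minor_def alt_wedge normal_frame_def frame_simps)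
    then show ?thesis by (rule covered_012[OF d])
  qed
qed

lemma covered_430:
  assumes data: "double_line_data C u v w x l" and u: "u $ 2 = 0" "u $ 3 = 0" and m: "frame_minor 4 3 0 u v w \<noteq> 0"
  shows "covered C"
proof -
  from normal_frame_exists[OF data m] obtain r u' v' w' x' l' where u': "\<And>i. u' $ i = r * u $ i"
    and n: "normal_frame 4 3 0 u' v' w' x'" and d: "double_line_data C u' v' w' x' l'" by metis
  have z: "u' $ 2 = 0" "u' $ 3 = 0" by (simp_all add: u' u)
  show ?thesis
  proof (cases "w' $ 1 = 0")
    case True
    have "alt (direction u' v' w' x' l') 1 4 \<noteq> 0"
    proof
      assume "alt (direction u' v' w' x' l') 1 4 = 0"
      then have "l' = 0 \<and> (\<forall>i. x' $ i = 0)"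
        using n d z True by (auto simp: frame_simps normal_frame_def double_line_data_def admissible_def om1_def om2_def alt_direction forall_5)
      then show False using direction_nonzero[OF d] by contradiction
    qed
    then show ?thesis by (rule covered_intro[OF frame_chart_12 d n])
  next
    case False
    have "frame_minor 4 1 3 u' v' w' \<noteq> 0"
      using n False by (simp add: frame_minor_def alt_wedge normal_frame_def frame_simps)
    then show ?thesis by (rule covered_413[OF d])
  qed
qed

text \<open>A nonzero entry 2 or 3 of \<open>u\<close> settles the case in one chart. If both
  vanish, a nonzero entry 0 or 4 leaves three possible minors, because the hyperplane equations then
  determine the remaining coordinate; otherwise only entry 1 survives.\<close>

lemma all_covered:
  assumes "C \<in> double_lines quintic_del_pezzo"
  shows "covered C"
proof -
  obtain u v w x l where data: "double_line_data C u v w x l"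
    using quintic_double_line_cases[OF assms] unfolding double_line_data_def by metis
  have "covered C" if u: "u $ 2 = 0" "u $ 3 = 0" "u $ 0 \<noteq> 0"
  proof -
    have "\<exists>\<beta>\<in>{1, 2, 4}. \<exists>\<gamma>\<in>{1, 2, 4}. frame_minor 0 \<beta> \<gamma> u v w \<noteq> 0"
      by (rule frame_minor_exists[OF data u(3)]) (use u in \<open>auto simp: om1_def om2_def forall_5\<close>)
    then have "frame_minor 0 1 2 u v w \<noteq> 0 \<or> frame_minor 0 1 4 u v w \<noteq> 0 \<or> frame_minor 0 2 4 u v w \<noteq> 0"
      using frame_minor_swap[of 0 2 1 u v w] frame_minor_swap[of 0 4 1 u v w] frame_minor_swap[of 0 4 2 u v w]
      by (auto simp: frame_minor_def)
    then show ?thesis using covered_012[OF data] covered_014[OF data] covered_024[OF data u(1,2)] by blast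
  qed
  moreover have "covered C" if u: "u $ 2 = 0" "u $ 3 = 0" "u $ 4 \<noteq> 0"
  proof -
    have "\<exists>\<beta>\<in>{1, 3, 0}. \<exists>\<gamma>\<in>{1, 3, 0}. frame_minor 4 \<beta> \<gamma> u v w \<noteq> 0"
      by (rule frame_minor_exists[OF data u(3)]) (use u in \<open>auto simp: om1_def om2_def forall_5\<close>)
    then have "frame_minor 4 1 3 u v w \<noteq> 0 \<or> frame_minor 4 1 0 u v w \<noteq> 0 \<or> frame_minor 4 3 0 u v w \<noteq> 0"
      using frame_minor_swap[of 4 3 1 u v w] frame_minor_swap[of 4 0 1 u v w] frame_minor_swap[of 4 0 3 u v w]
      by (auto simp: frame_minor_def)
    then show ?thesis using covered_413[OF data] covered_410[OF data] covered_430[OF data u(1,2)] by blast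
  qed
  moreover have "\<exists>i. u $ i \<noteq> 0"
  proof (rule ccontr)
    assume "\<not> ?thesis"
    then have "alt (wedge u v) i j = 0" for i j by (simp add: alt_wedge)
    then have "wedge u v = (\<lambda>_. 0)" by (intro alt_eqI) (simp, simp add: alt_def)
    then have "1 * wedge u v k + 0 * wedge u w k + 0 * direction u v w x l k = 0" for k by simp
    moreover have "independent3 (wedge u v) (wedge u w) (direction u v w x l)"
      using data by (simp add: double_line_data_def nondegenerate_def)
    ultimately show False using independent3D(1) by (metis zero_neq_one)
  qed
  moreover have "covered C" if "u $ 2 \<noteq> 0"
    using range_base[OF frame_chart_7 data that] frame_chart_7 unfolding covered_def by blast
  ultimately show ?thesis
    using covered_u3[OF data] covered_u1[OF data] unfolding exists_5 by blast
qed

theorem theorem1p1: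
  shows "\<forall>\<^sub>F m in sequentially.
     smooth_subvariety m (Hilb quintic_del_pezzo 2) (double_lines quintic_del_pezzo) \<and>
     krull_dim (subtopology (zariski_topology m (Hilb quintic_del_pezzo 2))
                  (double_lines quintic_del_pezzo)) = 4"
  using eventually_ge_at_top[of 2]
proof eventually_elim
  case (elim m)
  let ?\<A> = "{(\<rho>, \<beta>, \<gamma>, \<sigma>, \<tau>, U, V, W, X, L). frame_chart \<rho> \<beta> \<gamma> \<sigma> \<tau> U V W X L}"
  let ?B = "\<lambda>(\<rho>, \<beta>, \<gamma>, \<sigma>, \<tau>, U, V, W, X, L).
    double_line_basis (plucker_pair \<rho> \<beta>) (plucker_pair \<rho> \<gamma>) (plucker_pair \<sigma> \<tau>) m"
  let ?\<phi> = "\<lambda>(\<rho>, \<beta>, \<gamma>, \<sigma>, \<tau>, U, V, W, X, L). frame_chart.\<phi> U V W X L"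
  obtain U V W X L where base: "frame_chart 2 0 3 0 3 U V W X L" using frame_chart_7 by blast
  interpret affine_atlas m "Hilb quintic_del_pezzo 2" "double_lines quintic_del_pezzo" ?\<A> ?B ?\<phi> "(2, 0, 3, 0, 3, U, V, W, X, L)"
  proof
    show "closedin (zariski_topology m (Hilb quintic_del_pezzo 2)) (double_lines quintic_del_pezzo)"
      by (rule double_lines_closed[OF elim])
    show "double_lines quintic_del_pezzo \<subseteq> Hilb quintic_del_pezzo 2" by (auto simp: double_lines_def)
    show "double_lines quintic_del_pezzo \<subseteq> (\<Union>a\<in>?\<A>. range (?\<phi> a))"
    proof
      fix C assume "C \<in> double_lines quintic_del_pezzo"
      from all_covered[OF this] obtain \<rho> \<beta> \<gamma> \<sigma> \<tau> U V W X L where "frame_chart \<rho> \<beta> \<gamma> \<sigma> \<tau> U V W X L"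
        "C \<in> range (frame_chart.\<phi> U V W X L)" unfolding covered_def by blast
      then show "C \<in> (\<Union>a\<in>?\<A>. range (?\<phi> a))"
        by (intro UN_I[of "(\<rho>, \<beta>, \<gamma>, \<sigma>, \<tau>, U, V, W, X, L)"]) simp_all
    qed
    show "(2, 0, 3, 0, 3, U, V, W, X, L) \<in> ?\<A>" using base by simp
    fix I assume "I \<in> Hilb quintic_del_pezzo 2"
    then show "mpoly_vs.subspace I" by (rule Hilb_subspace)
  next
    fix a assume "a \<in> ?\<A>"
    then obtain \<rho> \<beta> \<gamma> \<sigma> \<tau> U' V' W' X' L' where a: "a = (\<rho>, \<beta>, \<gamma>, \<sigma>, \<tau>, U', V', W', X', L')"
      and "frame_chart \<rho> \<beta> \<gamma> \<sigma> \<tau> U' V' W' X' L'" by auto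
    then interpret c: frame_chart \<rho> \<beta> \<gamma> \<sigma> \<tau> U' V' W' X' L' by simp
    show "?B a \<subseteq> monomials m" unfolding a by (simp add: double_line_basis_monomials)
    show "double_lines quintic_del_pezzo \<inter> chart m (?B a) = range (?\<phi> a)" unfolding a using c.image[OF elim] by simp
    show "polyfun (\<lambda>z. chart_coord m (?B a) (?\<phi> a z) k)" for k unfolding a using c.coordinates by simp
    show "\<exists>h. \<forall>z n. eval_poly (h n) (chart_coord m (?B a) (?\<phi> a z)) = z n" unfolding a using c.inverse[OF elim] by simp
    \<comment> \<open>\<open>meets_base\<close> supplies a parameter with
      \<open>u $ 2 \<noteq> 0\<close>, and the base chart contains every such double line.\<close>
    show "\<exists>z. ?\<phi> a z \<in> range (?\<phi> (2, 0, 3, 0, 3, U, V, W, X, L))"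
      unfolding a prod.case using range_base[OF base c.\<phi>_data] c.meets_base by blast
  qed
  show ?case using smooth krull_dim_eq by (simp add: numeral_eq_enat)
qed

end
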